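(* Let $l\ge 2$, let $(X_k,A_k,\mu_k)$, $k=1,\dots,l$, be measure spaces with non-trivial sigma-finite separable measures, let $\vec p=(p_1,\dots,p_l)$ with $1\le p_k<\infty$ for every $k$, and put $\overline p=\max(p_1,\dots,p_l)$. Suppose $\overline p\ge 2$. Let $\xi=\xi(\vec x)=\xi(\vec x,\omega)$, $\vec x\in \prod_{k=1}^l X_k$, $\omega\in\Omega$, be a centered jointly measurable real-valued random field, and let $\xi_1,\xi_2,\dots$ be independent copies of $\xi$. If the function $$\vec x\mapsto \left[\mathbf E|\xi(\vec x)|^{\overline p}\right]^{1/\overline p}$$ belongs to the mixed Lebesgue space $L_{\vec p}$ (that is, its norm $|\cdot|_{\vec p}$ is finite), then the sequence $\{\xi_k\}$ satisfies the Central Limit Theorem in the space $L_{\vec p}$.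
   Context: All random objects are defined on a probability space $(\Omega,F,\mathbf P)$ with expectation $\mathbf E$. A sigma-finite measure $\mu_k$ on $(X_k,A_k)$ is called separable if the sets in $A_k$ of finite measure form a separable (pseudo)metric space for the distance $\rho_k(D_1,D_2)=\mu_k(D_1\setminus D_2)+\mu_k(D_2\setminus D_1)$. The mixed (anisotropic) Lebesgue space $L_{\vec p}$ consists of the (classes of) measurable functions $f:\prod_{k=1}^l X_k\to\mathbb R$ with finite norm $$|f|_{\vec p}=\left(\int_{X_l}\mu_l(dx_l)\left(\int_{X_{l-1}}\mu_{l-1}(dx_{l-1})\cdots\left(\int_{X_1}|f(\vec x)|^{p_1}\mu_1(dx_1)\right)^{p_2/p_1}\cdots\right)^{p_l/p_{l-1}}\right)^{1/p_l},$$ the innermost integration being over $X_1$ with exponent $p_1$ and the outermost over $X_l$ with exponent $p_l$. Under the separability assumption it is a separable Banach space. The field $\xi$ is centered: $\mathbf E\,\xi(\vec x)=0$ for almost every $\vec x$ (equivalently here, $\mathbf E(\xi,b)=0$ for all $b$ in the dual of $L_{\vec p}$). The $\xi_k$ are jointly measurable fields, regarded as independent identically distributed random elements of $L_{\vec p}$. Central Limit Theorem in a separable Banach space $B$: for centered i.i.d. $B$-valued random elements $\xi_k$ with $(Rb,b):=\mathbf E(\xi_1,b)^2<\infty$ for all $b\in B^*$, put $S(n)=n^{-1/2}\sum_{j=1}^n\xi_j$. The sequence $\{\xi_k\}$ satisfies the CLT in $B$ if there is a Gaussian random element $S$ taking values in $B$ with probability one, with mean $0$ and covariance operator $R$, i.e.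 $\mathbf E e^{i(S,b)}=e^{-\frac12(Rb,b)}$ for all $b\in B^*$, and the distributions of $S(n)$ converge weakly in $B$ to the distribution of $S$ as $n\to\infty$. *)

theory Defs
  imports "HOL-Probability.Probability"
begin

section \<open>Separable measures\<close>

definition finite_measure_sets :: "'a measure \<Rightarrow> 'a set set" where
  "finite_measure_sets M = {A \<in> sets M. emeasure M A < \<infinity>}"

definition separable_measure :: "'a measure \<Rightarrow> bool" where
  "separable_measure M \<longleftrightarrow>
     (\<exists>D. countable D \<and> D \<subseteq> finite_measure_sets M \<and>
        (\<forall>A \<in> finite_measure_sets M. \<forall>e>0. \<exists>B\<in>D. emeasure M (A - B) + emeasure M (B - A) < e))"

section \<open>Mixed Lebesgue spaces\<close>

text \<open>Only used with \<open>a > 0\<close>, where \<open>0\<close> is sent to \<open>0\<close> and \<open>\<infinity>\<close> to \<open>\<infinity>\<close>.\<close>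

definition ennreal_powr :: "ennreal \<Rightarrow> real \<Rightarrow> ennreal" where
  "ennreal_powr x a = (if x = \<infinity> then \<infinity> else ennreal (enn2real x powr a))"

text \<open>
  The factors are \<open>M 1, \<dots>, M l\<close>, and points of the product are functions extensional on \<open>{1..l}\<close>.
  \<open>mixed_iter M p k g x\<close> is the \<open>k\<close>-fold iterated integral over coordinates \<open>1, \<dots>, k\<close>
  (coordinate \<open>1\<close> innermost), before the last root \<open>1 / p k\<close> is taken; it depends on \<open>x\<close> only
  through the coordinates other than \<open>1, \<dots>, k\<close>.
\<close>

primrec mixed_iter ::
  "(nat \<Rightarrow> 'a measure) \<Rightarrow> (nat \<Rightarrow> real) \<Rightarrow> nat \<Rightarrow> ((nat \<Rightarrow> 'a) \<Rightarrow> ennreal) \<Rightarrow> (nat \<Rightarrow> 'a) \<Rightarrow> ennreal"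
where
  "mixed_iter M p 0 g x = g x"
| "mixed_iter M p (Suc k) g x =
     (\<integral>\<^sup>+ y. ennreal_powr (mixed_iter M p k g (x(Suc k := y)))
                  (if k = 0 then p 1 else p (Suc k) / p k) \<partial>M (Suc k))"

definition mixed_norm ::
  "(nat \<Rightarrow> 'a measure) \<Rightarrow> (nat \<Rightarrow> real) \<Rightarrow> nat \<Rightarrow> ((nat \<Rightarrow> 'a) \<Rightarrow> ennreal) \<Rightarrow> ennreal" where
  "mixed_norm M p l g = ennreal_powr (mixed_iter M p l g (\<lambda>_. undefined)) (1 / p l)"

text \<open>
  The mixed Lebesgue space is represented by the functions themselves, with a seminorm, rather than
  by classes modulo almost everywhere equality. Open sets and continuous linear functionals of the
  seminormed space are invariant under that equality, so they are those of the quotient.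
\<close>

definition mixed_Lp ::
  "(nat \<Rightarrow> 'a measure) \<Rightarrow> (nat \<Rightarrow> real) \<Rightarrow> nat \<Rightarrow> ((nat \<Rightarrow> 'a) \<Rightarrow> real) set" where
  "mixed_Lp M p l =
     {f \<in> borel_measurable (PiM {1..l} M). mixed_norm M p l (\<lambda>x. ennreal \<bar>f x\<bar>) < \<infinity>}"

definition mixed_Lp_norm ::
  "(nat \<Rightarrow> 'a measure) \<Rightarrow> (nat \<Rightarrow> real) \<Rightarrow> nat \<Rightarrow> ((nat \<Rightarrow> 'a) \<Rightarrow> real) \<Rightarrow> real" where
  "mixed_Lp_norm M p l f = enn2real (mixed_norm M p l (\<lambda>x. ennreal \<bar>f x\<bar>))"

section \<open>Random elements of a seminormed space of functions\<close>

text \<open>\<open>V\<close> is a vector space of real functions under pointwise operations, \<open>N\<close> a seminorm on it.\<close>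

definition seminorm_topology :: "('b \<Rightarrow> real) set \<Rightarrow> (('b \<Rightarrow> real) \<Rightarrow> real) \<Rightarrow> ('b \<Rightarrow> real) topology" where
  "seminorm_topology V N =
     topology (\<lambda>U. U \<subseteq> V \<and> (\<forall>f\<in>U. \<exists>e>0. \<forall>g\<in>V. N (\<lambda>x. g x - f x) < e \<longrightarrow> g \<in> U))"

lemma openin_seminorm_topology:
  "openin (seminorm_topology V N) U \<longleftrightarrow>
     U \<subseteq> V \<and> (\<forall>f\<in>U. \<exists>e>0. \<forall>g\<in>V. N (\<lambda>x. g x - f x) < e \<longrightarrow> g \<in> U)"
proof -
  let ?L = "\<lambda>U. U \<subseteq> V \<and> (\<forall>f\<in>U. \<exists>e>0. \<forall>g\<in>V. N (\<lambda>x. g x - f x) < e \<longrightarrow> g \<in> U)"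
  have "?L (S \<inter> T)" if S: "?L S" and T: "?L T" for S T
  proof (intro conjI ballI)
    show "S \<inter> T \<subseteq> V" using S by blast
    fix f assume f: "f \<in> S \<inter> T"
    obtain d where d: "d > 0" "\<forall>g\<in>V. N (\<lambda>x. g x - f x) < d \<longrightarrow> g \<in> S" using S f by blast
    obtain e where e: "e > 0" "\<forall>g\<in>V. N (\<lambda>x. g x - f x) < e \<longrightarrow> g \<in> T" using T f by blast
    show "\<exists>e>0. \<forall>g\<in>V. N (\<lambda>x. g x - f x) < e \<longrightarrow> g \<in> S \<inter> T"
      using d e by (intro exI[of _ "min d e"]) auto
  qed
  moreover have "?L (\<Union>K)" if K: "\<forall>S\<in>K. ?L S" for K
  proof (intro conjI ballI)
    show "\<Union>K \<subseteq> V" using K by blast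
    fix f assume "f \<in> \<Union>K"
    then obtain S where S: "S \<in> K" "f \<in> S" by blast
    then obtain e where "e > 0" "\<forall>g\<in>V. N (\<lambda>x. g x - f x) < e \<longrightarrow> g \<in> S" using K by blast
    then show "\<exists>e>0. \<forall>g\<in>V. N (\<lambda>x. g x - f x) < e \<longrightarrow> g \<in> \<Union>K" using S by blast
  qed
  ultimately have "istopology ?L"
    unfolding istopology_def by blast
  then show ?thesis
    by (simp add: seminorm_topology_def topology_inverse')
qed

lemma topspace_seminorm_topology: "topspace (seminorm_topology V N) = V"
proof -
  have "openin (seminorm_topology V N) V"
    unfolding openin_seminorm_topology by (auto intro: exI[of _ 1])
  then show ?thesis
    by (metis openin_seminorm_topology openin_subset openin_topspace subset_antisym)
qed

definition seminorm_borel :: "('b \<Rightarrow> real) set \<Rightarrow> (('b \<Rightarrow> real) \<Rightarrow> real) \<Rightarrow> ('b \<Rightarrow> real) measure" where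
  "seminorm_borel V N = sigma V {U. openin (seminorm_topology V N) U}"

definition dual_space ::
  "('b \<Rightarrow> real) set \<Rightarrow> (('b \<Rightarrow> real) \<Rightarrow> real) \<Rightarrow> (('b \<Rightarrow> real) \<Rightarrow> real) set" where
  "dual_space V N = {b.
     (\<forall>f\<in>V. \<forall>g\<in>V. b (\<lambda>x. f x + g x) = b f + b g) \<and>
     (\<forall>c. \<forall>f\<in>V. b (\<lambda>x. c * f x) = c * b f) \<and>
     (\<exists>C. \<forall>f\<in>V. \<bar>b f\<bar> \<le> C * N f)}"

text \<open>The arguments \<open>\<nu> n\<close> and \<open>\<nu>'\<close> are Borel probability measures on \<open>(V, N)\<close>.\<close>

definition converges_weakly ::
  "('b \<Rightarrow> real) set \<Rightarrow> (('b \<Rightarrow> real) \<Rightarrow> real) \<Rightarrow>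
   (nat \<Rightarrow> ('b \<Rightarrow> real) measure) \<Rightarrow> ('b \<Rightarrow> real) measure \<Rightarrow> bool" where
  "converges_weakly V N \<nu> \<nu>' \<longleftrightarrow>
     (\<forall>\<phi>. continuous_map (seminorm_topology V N) euclideanreal \<phi> \<and> bounded (\<phi> ` V) \<longrightarrow>
        (\<lambda>n. \<integral>f. \<phi> f \<partial>\<nu> n) \<longlonglongrightarrow> (\<integral>f. \<phi> f \<partial>\<nu>'))"

definition independent_copies ::
  "'w measure \<Rightarrow> 'v measure \<Rightarrow> ('w \<Rightarrow> 'v) \<Rightarrow> (nat \<Rightarrow> 'w \<Rightarrow> 'v) \<Rightarrow> bool" where
  "independent_copies P B X Y \<longleftrightarrow>
     prob_space.indep_vars P (\<lambda>_. B) Y UNIV \<and> (\<forall>k. distr P B (Y k) = distr P B X)"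

text \<open>Sequences are indexed from \<open>0\<close>: the first random element is \<open>Y 0\<close>.\<close>

definition normalized_sum :: "(nat \<Rightarrow> 'w \<Rightarrow> 'b \<Rightarrow> real) \<Rightarrow> nat \<Rightarrow> 'w \<Rightarrow> 'b \<Rightarrow> real" where
  "normalized_sum Y n \<omega> = (\<lambda>x. (\<Sum>j<n. Y j \<omega> x) / sqrt (real n))"

definition satisfies_CLT ::
  "'w measure \<Rightarrow> ('b \<Rightarrow> real) set \<Rightarrow> (('b \<Rightarrow> real) \<Rightarrow> real) \<Rightarrow> (nat \<Rightarrow> 'w \<Rightarrow> 'b \<Rightarrow> real) \<Rightarrow> bool" where
  "satisfies_CLT P V N Y \<longleftrightarrow>
     independent_copies P (seminorm_borel V N) (Y 0) Y \<and>
     (\<forall>b \<in> dual_space V N.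
        integrable P (\<lambda>\<omega>. b (Y 0 \<omega>)) \<and> (\<integral>\<omega>. b (Y 0 \<omega>) \<partial>P) = 0 \<and>
        integrable P (\<lambda>\<omega>. (b (Y 0 \<omega>))\<^sup>2)) \<and>
     (\<exists>S \<in> measurable P (seminorm_borel V N).
        (\<forall>b \<in> dual_space V N.
           (CLINT \<omega>|P. exp (\<i> * complex_of_real (b (S \<omega>)))) =
             complex_of_real (exp (- (\<integral>\<omega>. (b (Y 0 \<omega>))\<^sup>2 \<partial>P) / 2))) \<and>
        converges_weakly V N
          (\<lambda>n. distr P (seminorm_borel V N) (normalized_sum Y n))
          (distr P (seminorm_borel V N) S))"

section \<open>Random fields as random elements of a mixed Lebesgue space\<close>

definition jointly_measurable_field ::
  "'w measure \<Rightarrow> (nat \<Rightarrow> 'a measure) \<Rightarrow> nat \<Rightarrow> ('w \<Rightarrow> (nat \<Rightarrow> 'a) \<Rightarrow> real) \<Rightarrow> bool" where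
  "jointly_measurable_field P M l \<xi> \<longleftrightarrow>
     (\<lambda>(\<omega>, x). \<xi> \<omega> x) \<in> borel_measurable (P \<Otimes>\<^sub>M PiM {1..l} M)"

definition centered_field ::
  "'w measure \<Rightarrow> (nat \<Rightarrow> 'a measure) \<Rightarrow> nat \<Rightarrow> ('w \<Rightarrow> (nat \<Rightarrow> 'a) \<Rightarrow> real) \<Rightarrow> bool" where
  "centered_field P M l \<xi> \<longleftrightarrow>
     (AE x in PiM {1..l} M. integrable P (\<lambda>\<omega>. \<xi> \<omega> x) \<and> (\<integral>\<omega>. \<xi> \<omega> x \<partial>P) = 0)"

text \<open>
  The paths of a field are in the space only almost surely. To get a genuine map into the space,
  the remaining paths are replaced by \<open>0\<close>.
\<close>

definition Lp_element ::
  "(nat \<Rightarrow> 'a measure) \<Rightarrow> (nat \<Rightarrow> real) \<Rightarrow> nat \<Rightarrow> ('w \<Rightarrow> (nat \<Rightarrow> 'a) \<Rightarrow> real) \<Rightarrow>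
   'w \<Rightarrow> (nat \<Rightarrow> 'a) \<Rightarrow> real" where
  "Lp_element M p l \<xi> \<omega> = (if \<xi> \<omega> \<in> mixed_Lp M p l then \<xi> \<omega> else (\<lambda>_. 0))"

end

theory Submission
  imports Defs
begin

text \<open>
  Let \<open>q\<close> be the maximal exponent. By Minkowski's inequality the \<open>L\<^sub>q(\<Omega>)\<close>-norm of the mixed norm of a
  random field is at most the mixed norm of the pointwise \<open>L\<^sub>q(\<Omega>)\<close>-norms, which is finite for \<open>\<xi>\<close>. In
  the latter norm the field is a limit of finite-rank centered fields \<open>\<Sum>j. e j (\<xi>) * g j (x)\<close>. For
  fixed \<open>x\<close> the normalized sums of \<open>n\<close> independent centered copies have \<open>L\<^sub>q\<close>-norm at most a constant
  times that of a single summand, because \<open>q \<ge> 2\<close>, and the same holds for Gaussian variables of the same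
  variance. Thus the approximation is uniform in \<open>n\<close> and carries over to the Gaussian limit.
  For the finite-rank fields the assertion is the central limit theorem in finite dimension, and
  bounded Lipschitz functions suffice to test weak convergence.
\<close>

text \<open>Two obstacles shape the details. Borel sets of the seminormed space cannot tell apart
  functions that agree almost everywhere, and the copies agree with \<open>\<xi>\<close> only in law
  on these sets. Statements at a fixed point \<open>x\<close> are therefore made about the common
  law \<open>\<nu>\<close> on the space, together with a jointly measurable version
  \<open>\<Phi>\<close> of evaluation. Moreover the limit has to be exhibited as a random element;
  no compactness argument provides it. Gaussian coefficients \<open>W j\<close> with the covariances
  of the \<open>e j\<close> are chosen once for all levels of approximation, so that the finite-rank
  Gaussian fields form a Cauchy sequence and converge in norm. That the limit is Gaussian with the
  right covariance is read off at the end: cosine and sine of a functional are admissible test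
  functions, and the scalar central limit theorem identifies their limits. The estimates keep the
  L_q norm over the probability space inside and the mixed norm outside, because in this order the
  probabilistic work is done at one point \<open>x\<close> at a time; Minkowski's inequality is the
  way out of this order.\<close>

lemma ennreal_powr_ennreal [simp]: "0 \<le> x \<Longrightarrow> ennreal_powr (ennreal x) a = ennreal (x powr a)"
  by (simp add: ennreal_powr_def)

lemma ennreal_powr_0 [simp]: "ennreal_powr 0 a = 0"
  by (simp add: ennreal_powr_def)

lemma ennreal_powr_top [simp]: "ennreal_powr \<top> a = \<top>"
  by (simp add: ennreal_powr_def)

lemma ennreal_powr_1 [simp]: "ennreal_powr x 1 = x"
  by (cases x rule: ennreal_cases) auto

lemma ennreal_powr_eq_0_iff [simp]: "ennreal_powr x a = 0 \<longleftrightarrow> x = 0"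
  by (cases x rule: ennreal_cases) (auto simp: ennreal_eq_0_iff)

lemma ennreal_powr_eq_top_iff [simp]: "ennreal_powr x a = \<top> \<longleftrightarrow> x = \<top>"
  by (cases x rule: ennreal_cases) auto

lemma ennreal_powr_less_top_iff [simp]: "ennreal_powr x a < \<top> \<longleftrightarrow> x < \<top>"
  by (metis ennreal_powr_eq_top_iff less_top)

lemma ennreal_powr_mono: "0 \<le> a \<Longrightarrow> x \<le> y \<Longrightarrow> ennreal_powr x a \<le> ennreal_powr y a"
  by (cases x rule: ennreal_cases; cases y rule: ennreal_cases)
     (auto simp: powr_mono2 ennreal_leI top_unique)

lemma ennreal_powr_powr: "ennreal_powr (ennreal_powr x a) b = ennreal_powr x (a * b)"
  by (cases x rule: ennreal_cases) (auto simp: powr_powr)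

lemma ennreal_powr_mult: "ennreal_powr (x * y) a = ennreal_powr x a * ennreal_powr y a"
proof (cases x rule: ennreal_cases)
  case (real r)
  show ?thesis
  proof (cases y rule: ennreal_cases)
    case s: (real s)
    then show ?thesis using real
      by (simp add: ennreal_mult[symmetric] powr_mult)
  next
    case top
    then show ?thesis using real by (auto simp: ennreal_mult_top powr_eq_0_iff)
  qed
next
  case top
  then show ?thesis
    by (cases "y = 0") (auto simp: ennreal_top_mult)
qed

lemma ennreal_powr_add: "ennreal_powr x (a + b) = ennreal_powr x a * ennreal_powr x b"
  by (cases x rule: ennreal_cases) (auto simp: powr_add ennreal_mult ennreal_top_mult)

text \<open>For \<open>a > 0\<close> the power is an order isomorphism with inverse the power
  \<open>1 / a\<close>, hence compatible with suprema. This carries monotone convergence over to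
  \<open>Lnorm\<close>.\<close>

lemma ennreal_powr_SUP:
  assumes "0 < a" "I \<noteq> {}"
  shows "ennreal_powr (SUP i\<in>I. f i) a = (SUP i\<in>I. ennreal_powr (f i) a)"
proof (rule antisym)
  let ?u = "SUP i\<in>I. ennreal_powr (f i) a"
  have "f i \<le> ennreal_powr ?u (1 / a)" if "i \<in> I" for i
  proof -
    have "ennreal_powr (ennreal_powr (f i) a) (1 / a) \<le> ennreal_powr ?u (1 / a)"
      using assms that by (intro ennreal_powr_mono) (auto intro: SUP_upper)
    then show ?thesis using assms by (simp add: ennreal_powr_powr)
  qed
  then have "(SUP i\<in>I. f i) \<le> ennreal_powr ?u (1 / a)" by (intro SUP_least)
  then have "ennreal_powr (SUP i\<in>I. f i) a \<le> ennreal_powr (ennreal_powr ?u (1 / a)) a"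
    using assms by (intro ennreal_powr_mono) auto
  then show "ennreal_powr (SUP i\<in>I. f i) a \<le> ?u" using assms by (simp add: ennreal_powr_powr)
next
  show "(SUP i\<in>I. ennreal_powr (f i) a) \<le> ennreal_powr (SUP i\<in>I. f i) a"
    using assms by (intro SUP_least ennreal_powr_mono) (auto intro: SUP_upper)
qed

text \<open>A monotone map with open range is continuous, and the power \<open>1 / a\<close> shows
  that the range is everything.\<close>

lemma continuous_on_ennreal_powr:
  assumes "0 < a" shows "continuous_on UNIV (\<lambda>x. ennreal_powr x a)"
proof (rule continuous_onI_mono)
  have "range (\<lambda>x. ennreal_powr x a) = UNIV"
  proof (rule surjI)
    show "ennreal_powr (ennreal_powr x (1 / a)) a = x" for x
      using assms by (simp add: ennreal_powr_powr)
  qed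
  then show "open (range (\<lambda>x. ennreal_powr x a))" by simp
qed (use assms in \<open>auto intro: ennreal_powr_mono\<close>)

lemma tendsto_ennreal_powr:
  assumes "0 < a" "(f \<longlongrightarrow> c) F"
  shows "((\<lambda>x. ennreal_powr (f x) a) \<longlongrightarrow> ennreal_powr c a) F"
  using continuous_on_tendsto_compose[OF continuous_on_ennreal_powr[OF assms(1)] assms(2)] by auto

lemma measurable_ennreal_powr [measurable]:
  assumes "f \<in> borel_measurable M"
  shows "(\<lambda>x. ennreal_powr (f x) a) \<in> borel_measurable M"
  using assms unfolding ennreal_powr_def by measurable

section \<open>Lebesgue norms of nonnegative extended functions\<close>

text \<open>Values in \<open>ennreal\<close> keep all inequalities free of integrability conditions.
  Iterating this one-variable norm gives the mixed norm.\<close>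

definition Lnorm :: "'a measure \<Rightarrow> real \<Rightarrow> ('a \<Rightarrow> ennreal) \<Rightarrow> ennreal" where
  "Lnorm M r f = ennreal_powr (\<integral>\<^sup>+ y. ennreal_powr (f y) r \<partial>M) (1 / r)"

lemma ennreal_powr_Lnorm: "0 < r \<Longrightarrow> ennreal_powr (Lnorm M r f) r = (\<integral>\<^sup>+ y. ennreal_powr (f y) r \<partial>M)"
  by (simp add: Lnorm_def ennreal_powr_powr)

lemma Lnorm_1: "Lnorm M 1 f = (\<integral>\<^sup>+ y. f y \<partial>M)"
  by (simp add: Lnorm_def)

lemma Lnorm_mono_AE: "0 < r \<Longrightarrow> AE y in M. f y \<le> g y \<Longrightarrow> Lnorm M r f \<le> Lnorm M r g"
  unfolding Lnorm_def
  by (intro ennreal_powr_mono nn_integral_mono_AE) (auto elim!: eventually_mono intro: ennreal_powr_mono)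

lemma Lnorm_mono: "0 < r \<Longrightarrow> (\<And>y. y \<in> space M \<Longrightarrow> f y \<le> g y) \<Longrightarrow> Lnorm M r f \<le> Lnorm M r g"
  by (rule Lnorm_mono_AE) auto

lemma Lnorm_cong_AE: "AE y in M. f y = g y \<Longrightarrow> Lnorm M r f = Lnorm M r g"
  unfolding Lnorm_def by (auto intro!: arg_cong2[where f = ennreal_powr] nn_integral_cong_AE)

lemma Lnorm_cong: "(\<And>y. y \<in> space M \<Longrightarrow> f y = g y) \<Longrightarrow> Lnorm M r f = Lnorm M r g"
  by (rule Lnorm_cong_AE) auto

lemma Lnorm_eq_0_iff:
  assumes [measurable]: "f \<in> borel_measurable M"
  shows "Lnorm M r f = 0 \<longleftrightarrow> (AE y in M. f y = 0)"
  unfolding Lnorm_def by (simp add: nn_integral_0_iff_AE)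

lemma Lnorm_cmult:
  assumes "0 < r" and [measurable]: "f \<in> borel_measurable M"
  shows "Lnorm M r (\<lambda>y. c * f y) = c * Lnorm M r f"
  using assms by (simp add: Lnorm_def ennreal_powr_mult nn_integral_cmult ennreal_powr_powr)

lemma Lnorm_indicator:
  assumes "0 < r" "A \<in> sets M"
  shows "Lnorm M r (indicator A) = ennreal_powr (emeasure M A) (1 / r)"
proof -
  have "ennreal_powr (indicator A y) r = (indicator A y :: ennreal)" for y
    by (auto simp: indicator_def ennreal_powr_def)
  then show ?thesis using assms by (simp add: Lnorm_def)
qed

lemma Lnorm_finite_AE:
  assumes "0 < r" and [measurable]: "f \<in> borel_measurable M" and "Lnorm M r f < \<top>"
  shows "AE y in M. f y < \<top>"
proof -
  have "AE y in M. ennreal_powr (f y) r \<noteq> \<infinity>"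
    using assms(3) unfolding Lnorm_def by (intro nn_integral_PInf_AE) auto
  then show ?thesis by (auto simp: less_top)
qed

lemma Lnorm_SUP:
  assumes "0 < r" and [measurable]: "\<And>n. f n \<in> borel_measurable M" and "incseq f"
  shows "Lnorm M r (\<lambda>y. SUP n. f n y) = (SUP n. Lnorm M r (f n))"
proof -
  have inc: "incseq (\<lambda>n y. ennreal_powr (f n y) r)"
    using assms by (auto simp: incseq_def le_fun_def intro: ennreal_powr_mono)
  show ?thesis
    using assms by (simp add: Lnorm_def ennreal_powr_SUP nn_integral_monotone_convergence_SUP[OF inc])
qed

lemma Lnorm_dominated_convergence:
  assumes r: "0 < r"
    and [measurable]: "\<And>n. u n \<in> borel_measurable M" "w \<in> borel_measurable M"
    and bound: "\<And>n. AE y in M. u n y \<le> w y"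
    and w: "Lnorm M r w < \<top>"
    and lim: "AE y in M. (\<lambda>n. u n y) \<longlonglongrightarrow> 0"
  shows "(\<lambda>n. Lnorm M r (u n)) \<longlonglongrightarrow> 0"
proof -
  have "(\<lambda>n. \<integral>\<^sup>+ y. ennreal_powr (u n y) r \<partial>M) \<longlonglongrightarrow> (\<integral>\<^sup>+ y. 0 \<partial>M)"
  proof (rule nn_integral_dominated_convergence[where w = "\<lambda>y. ennreal_powr (w y) r"])
    show "AE y in M. ennreal_powr (u n y) r \<le> ennreal_powr (w y) r" for n
      using bound[of n] by eventually_elim (use r in \<open>auto intro: ennreal_powr_mono\<close>)
    show "(\<integral>\<^sup>+ y. ennreal_powr (w y) r \<partial>M) < \<infinity>" using w by (simp add: Lnorm_def)
    show "AE y in M. (\<lambda>n. ennreal_powr (u n y) r) \<longlonglongrightarrow> 0"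
      using lim by eventually_elim (use tendsto_ennreal_powr[OF r, of _ 0] in auto)
  qed auto
  from tendsto_ennreal_powr[OF _ this, of "1 / r"] r show ?thesis by (simp add: Lnorm_def)
qed

section \<open>The inequalities of Young, Hoelder and Minkowski\<close>

lemma Young_ennreal:
  assumes "1 < r" "1 < s" "1 / r + 1 / s = 1"
  shows "x * y \<le> ennreal (1 / r) * ennreal_powr x r + ennreal (1 / s) * ennreal_powr y s"
proof (cases x rule: ennreal_cases)
  case a: (real a)
  show ?thesis
  proof (cases y rule: ennreal_cases)
    case b: (real b)
    have "a * b \<le> a powr r / r + b powr s / s"
      using Youngs_inequality[of r s a b] assms a b by auto
    then show ?thesis using a b assms
      by (simp add: ennreal_mult[symmetric] ennreal_plus[symmetric] ennreal_leI del: ennreal_plus)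
  next
    case top
    then show ?thesis using assms by (auto simp: ennreal_mult_top)
  qed
next
  case top
  then show ?thesis using assms by (auto simp: ennreal_mult_top)
qed

text \<open>Both functions are scaled to norm \<open>1\<close> and Young's inequality is integrated.
  The norms \<open>0\<close> and \<open>\<top>\<close>, which cannot be scaled, are split off
  beforehand.\<close>

lemma Holder_nn_integral:
  assumes "1 < r" "1 < s" "1 / r + 1 / s = 1"
    and [measurable]: "f \<in> borel_measurable M" "g \<in> borel_measurable M"
  shows "(\<integral>\<^sup>+ y. f y * g y \<partial>M) \<le> Lnorm M r f * Lnorm M s g"
proof -
  consider "Lnorm M r f = 0 \<or> Lnorm M s g = 0"
    | "Lnorm M r f \<noteq> 0" "Lnorm M s g \<noteq> 0" "Lnorm M r f = \<top> \<or> Lnorm M s g = \<top>"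
    | a b where "Lnorm M r f = ennreal a" "Lnorm M s g = ennreal b" "0 < a" "0 < b"
    by (cases "Lnorm M r f" rule: ennreal_cases; cases "Lnorm M s g" rule: ennreal_cases)
       (auto simp: less_le)
  then show ?thesis
  proof cases
    case 1
    then have "AE y in M. f y * g y = 0"
    proof
      assume "Lnorm M r f = 0"
      then have "AE y in M. f y = 0" by (simp add: Lnorm_eq_0_iff)
      then show ?thesis by eventually_elim auto
    next
      assume "Lnorm M s g = 0"
      then have "AE y in M. g y = 0" by (simp add: Lnorm_eq_0_iff)
      then show ?thesis by eventually_elim auto
    qed
    then have "(\<integral>\<^sup>+ y. f y * g y \<partial>M) = (\<integral>\<^sup>+ y. 0 \<partial>M)" by (intro nn_integral_cong_AE)
    then show ?thesis by simp
  next
    case 2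
    then show ?thesis by (auto simp: ennreal_mult_top ennreal_top_mult)
  next
    case 3
    let ?f = "\<lambda>y. ennreal (1 / a) * f y" and ?g = "\<lambda>y. ennreal (1 / b) * g y"
    have nf: "Lnorm M r ?f = 1" and ng: "Lnorm M s ?g = 1"
      using 3 assms by (simp_all add: Lnorm_cmult ennreal_mult[symmetric])
    have If: "(\<integral>\<^sup>+ y. ennreal_powr (?f y) r \<partial>M) = 1"
      using nf ennreal_powr_Lnorm[of r M ?f] assms by (simp add: ennreal_powr_def)
    have Ig: "(\<integral>\<^sup>+ y. ennreal_powr (?g y) s \<partial>M) = 1"
      using ng ennreal_powr_Lnorm[of s M ?g] assms by (simp add: ennreal_powr_def)
    have *: "ennreal a * ennreal (1 / a) = 1" "ennreal b * ennreal (1 / b) = 1"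
      using 3 by (simp_all add: ennreal_mult[symmetric])
    have "f y * g y = ennreal a * ennreal b * (?f y * ?g y)" for y
    proof -
      have "ennreal a * ennreal b * (?f y * ?g y) =
        (ennreal a * ennreal (1 / a)) * (ennreal b * ennreal (1 / b)) * (f y * g y)"
        by (simp only: ac_simps)
      then show ?thesis by (simp only: * mult_1)
    qed
    then have "(\<integral>\<^sup>+ y. f y * g y \<partial>M) = ennreal a * ennreal b * (\<integral>\<^sup>+ y. ?f y * ?g y \<partial>M)"
      by (simp add: nn_integral_cmult)
    also have "(\<integral>\<^sup>+ y. ?f y * ?g y \<partial>M) \<le>
        (\<integral>\<^sup>+ y. ennreal (1 / r) * ennreal_powr (?f y) r + ennreal (1 / s) * ennreal_powr (?g y) s \<partial>M)"
      by (intro nn_integral_mono Young_ennreal assms)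
    also have "\<dots> = ennreal (1 / r) * (\<integral>\<^sup>+ y. ennreal_powr (?f y) r \<partial>M)
        + ennreal (1 / s) * (\<integral>\<^sup>+ y. ennreal_powr (?g y) s \<partial>M)"
      by (subst nn_integral_add) (auto simp: nn_integral_cmult)
    also have "\<dots> = 1"
      unfolding If Ig using assms by (simp add: ennreal_plus[symmetric] del: ennreal_plus)
    finally show ?thesis using 3 by (simp add: mult_left_mono)
  qed
qed

text \<open>Convexity of the power \<open>r\<close> at
  \<open>x + y = t (x / t) + (1 - t) (y / (1 - t))\<close>. The free weight \<open>t\<close> allows
  Minkowski's inequality to be obtained by optimizing \<open>t\<close> after integration.\<close>

lemma powr_sum_le:
  fixes x y t r :: real
  assumes "0 \<le> x" "0 \<le> y" "0 < t" "t < 1" "1 \<le> r"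
  shows "(x + y) powr r \<le> t powr (1 - r) * x powr r + (1 - t) powr (1 - r) * y powr r"
proof -
  have ge1: "1 \<le> t powr (1 - r)" "1 \<le> (1 - t) powr (1 - r)"
    using assms powr_mono'[of "1 - r" 0 t] powr_mono'[of "1 - r" 0 "1 - t"] by auto
  consider "x = 0" | "y = 0" | "0 < x" "0 < y" using assms by linarith
  then show ?thesis
  proof cases
    case 1
    then show ?thesis using mult_right_mono[OF ge1(2), of "y powr r"] by simp
  next
    case 2
    then show ?thesis using mult_right_mono[OF ge1(1), of "x powr r"] by simp
  next
    case 3
    have "(t *\<^sub>R (x / t) + (1 - t) *\<^sub>R (y / (1 - t))) powr r \<le>
        t * (x / t) powr r + (1 - t) * (y / (1 - t)) powr r"
      using assms 3 convex_onD[OF powr_convex[of r], of "1 - t" "x / t" "y / (1 - t)"] by auto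
    also have "t * (x / t) powr r = t powr (1 - r) * x powr r"
      using assms 3 by (simp add: powr_divide powr_diff)
    also have "(1 - t) * (y / (1 - t)) powr r = (1 - t) powr (1 - r) * y powr r"
      using assms 3 by (simp add: powr_divide powr_diff)
    finally show ?thesis using assms by simp
  qed
qed

lemma ennreal_powr_sum_le:
  assumes "0 < t" "t < 1" "1 \<le> r"
  shows "ennreal_powr (x + y) r \<le>
    ennreal (t powr (1 - r)) * ennreal_powr x r + ennreal ((1 - t) powr (1 - r)) * ennreal_powr y r"
proof (cases "x = \<top> \<or> y = \<top>")
  case True
  then show ?thesis using assms by (auto simp: ennreal_mult_top)
next
  case False
  then obtain a b where "x = ennreal a" "y = ennreal b" "0 \<le> a" "0 \<le> b"
    by (metis ennreal_cases)
  then show ?thesis using powr_sum_le[of a b t r] assms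
    by (simp add: ennreal_mult[symmetric] ennreal_plus[symmetric] ennreal_leI del: ennreal_plus)
qed

lemma Lnorm_triangle:
  assumes r: "1 \<le> r" and [measurable]: "f \<in> borel_measurable M" "g \<in> borel_measurable M"
  shows "Lnorm M r (\<lambda>y. f y + g y) \<le> Lnorm M r f + Lnorm M r g"
proof -
  consider "Lnorm M r f = 0" | "Lnorm M r g = 0" | "Lnorm M r f = \<top> \<or> Lnorm M r g = \<top>"
    | a b where "Lnorm M r f = ennreal a" "Lnorm M r g = ennreal b" "0 < a" "0 < b"
    by (cases "Lnorm M r f" rule: ennreal_cases; cases "Lnorm M r g" rule: ennreal_cases)
       (auto simp: less_le)
  then show ?thesis
  proof cases
    case 1
    then have "AE y in M. f y = 0" by (simp add: Lnorm_eq_0_iff)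
    then have "Lnorm M r (\<lambda>y. f y + g y) = Lnorm M r g"
      by (intro Lnorm_cong_AE) auto
    then show ?thesis by simp
  next
    case 2
    then have "AE y in M. g y = 0" by (simp add: Lnorm_eq_0_iff)
    then have "Lnorm M r (\<lambda>y. f y + g y) = Lnorm M r f"
      by (intro Lnorm_cong_AE) auto
    then show ?thesis by simp
  next
    case 3
    then show ?thesis by auto
  next
    case 4
    \<comment> \<open>The minimizing weight: with it the integrated bound collapses to
      \<open>(a + b) powr r\<close>.\<close>
    define t where "t = a / (a + b)"
    have t: "0 < t" "t < 1" "1 - t = b / (a + b)" using 4 by (auto simp: t_def field_simps)
    have If: "(\<integral>\<^sup>+ y. ennreal_powr (f y) r \<partial>M) = ennreal (a powr r)"
      using 4 ennreal_powr_Lnorm[of r M f] r by simp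
    have Ig: "(\<integral>\<^sup>+ y. ennreal_powr (g y) r \<partial>M) = ennreal (b powr r)"
      using 4 ennreal_powr_Lnorm[of r M g] r by simp
    have "(\<integral>\<^sup>+ y. ennreal_powr (f y + g y) r \<partial>M) \<le>
        (\<integral>\<^sup>+ y. ennreal (t powr (1 - r)) * ennreal_powr (f y) r +
          ennreal ((1 - t) powr (1 - r)) * ennreal_powr (g y) r \<partial>M)"
      by (intro nn_integral_mono ennreal_powr_sum_le t r)
    also have "\<dots> = ennreal (t powr (1 - r)) * ennreal (a powr r) +
          ennreal ((1 - t) powr (1 - r)) * ennreal (b powr r)"
      by (subst nn_integral_add) (auto simp: nn_integral_cmult If Ig)
    also have "\<dots> = ennreal (t powr (1 - r) * a powr r + (1 - t) powr (1 - r) * b powr r)"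
      by (simp add: ennreal_mult[symmetric] ennreal_plus[symmetric] del: ennreal_plus)
    also have "t powr (1 - r) * a powr r + (1 - t) powr (1 - r) * b powr r = (a + b) powr r"
    proof -
      have "t powr (1 - r) * a powr r = a * (a + b) powr (r - 1)"
        using 4 powr_add[of a "1 - r" r] powr_minus_divide[of "a + b" "1 - r"]
        unfolding t_def by (simp add: powr_divide)
      moreover have "(1 - t) powr (1 - r) * b powr r = b * (a + b) powr (r - 1)"
        using 4 powr_add[of b "1 - r" r] powr_minus_divide[of "a + b" "1 - r"]
        unfolding t(3) by (simp add: powr_divide)
      moreover have "(a + b) * (a + b) powr (r - 1) = (a + b) powr r"
        using 4 by (simp add: powr_diff)
      ultimately show ?thesis by (simp add: algebra_simps)
    qed
    finally have "Lnorm M r (\<lambda>y. f y + g y) \<le> ennreal_powr (ennreal ((a + b) powr r)) (1 / r)"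
      unfolding Lnorm_def using r by (intro ennreal_powr_mono) auto
    then show ?thesis using 4 r by (simp add: powr_powr)
  qed
qed

lemma Lnorm_sum:
  assumes "1 \<le> r" "\<And>i. f i \<in> borel_measurable M" "finite I"
  shows "Lnorm M r (\<lambda>y. \<Sum>i\<in>I. f i y) \<le> (\<Sum>i\<in>I. Lnorm M r (f i))"
  using assms(3)
proof induction
  case empty
  then show ?case using assms by (simp add: Lnorm_def)
next
  case (insert i I)
  have "Lnorm M r (\<lambda>y. f i y + (\<Sum>i\<in>I. f i y)) \<le> Lnorm M r (f i) + Lnorm M r (\<lambda>y. \<Sum>i\<in>I. f i y)"
    using assms by (intro Lnorm_triangle) auto
  with insert show ?case by (simp add: add_left_mono order_trans)
qed

lemma Lnorm_suminf:
  assumes r: "1 \<le> r" and [measurable]: "\<And>n. f n \<in> borel_measurable M"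
  shows "Lnorm M r (\<lambda>y. \<Sum>n. f n y) \<le> (\<Sum>n. Lnorm M r (f n))"
proof -
  have "Lnorm M r (\<lambda>y. \<Sum>n. f n y) = Lnorm M r (\<lambda>y. SUP n. \<Sum>i<n. f i y)"
    by (simp add: suminf_eq_SUP)
  also have "\<dots> = (SUP n. Lnorm M r (\<lambda>y. \<Sum>i<n. f i y))"
    using r by (intro Lnorm_SUP) (auto simp: incseq_def le_fun_def intro!: sum_mono2)
  also have "\<dots> \<le> (SUP n. \<Sum>i<n. Lnorm M r (f i))"
    by (intro SUP_mono) (use Lnorm_sum[of r f M] r in auto)
  finally show ?thesis by (simp add: suminf_eq_SUP)
qed

text \<open>Minkowski's integral inequality. The inner integral \<open>G\<close> is truncated at
  level \<open>n\<close>; since \<open>Q\<close> is finite, the truncation has a finite norm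
  \<open>A\<close>. Fubini and Hoelder give that \<open>A powr s\<close> is at most the right-hand
  side times \<open>A powr (s - 1)\<close>, and this factor may be cancelled because it is finite.
  Monotone convergence removes the truncation.\<close>

lemma Lnorm_nn_integral_swap:
  assumes s: "1 \<le> s" and "finite_measure Q" "sigma_finite_measure M"
    and H [measurable]: "(\<lambda>(\<omega>, y). H \<omega> y) \<in> borel_measurable (Q \<Otimes>\<^sub>M M)"
  shows "Lnorm Q s (\<lambda>\<omega>. \<integral>\<^sup>+ y. H \<omega> y \<partial>M) \<le> (\<integral>\<^sup>+ y. Lnorm Q s (\<lambda>\<omega>. H \<omega> y) \<partial>M)"
proof -
  interpret Q: finite_measure Q by fact
  interpret M: sigma_finite_measure M by fact
  interpret QM: pair_sigma_finite Q M ..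
  define G where "G \<omega> = (\<integral>\<^sup>+ y. H \<omega> y \<partial>M)" for \<omega>
  have G [measurable]: "G \<in> borel_measurable Q" unfolding G_def by measurable
  have Hm: "(\<lambda>\<omega>. H \<omega> y) \<in> borel_measurable Q" if "y \<in> space M" for y
    using that by measurable
  let ?B = "\<integral>\<^sup>+ y. Lnorm Q s (\<lambda>\<omega>. H \<omega> y) \<partial>M"
  show ?thesis
  proof (cases "s = 1")
    case True
    then show ?thesis
      using QM.Fubini'[of H] by (simp add: Lnorm_1)
  next
    case False
    with s have s: "1 < s" by simp
    define s' where "s' = s / (s - 1)"
    have s': "1 < s'" "1 / s + 1 / s' = 1" "(s - 1) * s' = s"
      using s by (auto simp: s'_def field_simps)
    define T where "T n \<omega> = min (G \<omega>) (of_nat n)" for n \<omega>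
    have T [measurable]: "T n \<in> borel_measurable Q" for n unfolding T_def by measurable
    have bound: "Lnorm Q s (T n) \<le> ?B" for n
    proof -
      define A where "A = Lnorm Q s (T n)"
      have As: "ennreal_powr A s = (\<integral>\<^sup>+ \<omega>. ennreal_powr (T n \<omega>) s \<partial>Q)"
        using s by (simp add: A_def ennreal_powr_Lnorm)
      have "ennreal_powr A s \<le> (\<integral>\<^sup>+ \<omega>. ennreal_powr (of_nat n) s \<partial>Q)"
        unfolding As using s by (intro nn_integral_mono ennreal_powr_mono) (auto simp: T_def)
      also have "\<dots> < \<top>"
        by (simp add: less_top[symmetric] ennreal_mult_eq_top_iff)
      finally have fin: "A < \<top>" by simp
      have "ennreal_powr A s \<le> (\<integral>\<^sup>+ \<omega>. G \<omega> * ennreal_powr (T n \<omega>) (s - 1) \<partial>Q)"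
        unfolding As
      proof (intro nn_integral_mono)
        fix \<omega>
        have "ennreal_powr (T n \<omega>) s = T n \<omega> * ennreal_powr (T n \<omega>) (s - 1)"
          using ennreal_powr_add[of "T n \<omega>" 1 "s - 1"] by simp
        then show "ennreal_powr (T n \<omega>) s \<le> G \<omega> * ennreal_powr (T n \<omega>) (s - 1)"
          by (simp add: T_def mult_right_mono)
      qed
      also have "\<dots> = (\<integral>\<^sup>+ \<omega>. (\<integral>\<^sup>+ y. H \<omega> y * ennreal_powr (T n \<omega>) (s - 1) \<partial>M) \<partial>Q)"
        unfolding G_def by (intro nn_integral_cong nn_integral_multc[symmetric]) auto
      also have "\<dots> = (\<integral>\<^sup>+ y. (\<integral>\<^sup>+ \<omega>. H \<omega> y * ennreal_powr (T n \<omega>) (s - 1) \<partial>Q) \<partial>M)"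
        by (intro QM.Fubini'[symmetric]) measurable
      also have "\<dots> \<le> (\<integral>\<^sup>+ y. Lnorm Q s (\<lambda>\<omega>. H \<omega> y) * Lnorm Q s' (\<lambda>\<omega>. ennreal_powr (T n \<omega>) (s - 1)) \<partial>M)"
        using Hm by (intro nn_integral_mono Holder_nn_integral s s') auto
      also have "Lnorm Q s' (\<lambda>\<omega>. ennreal_powr (T n \<omega>) (s - 1)) = ennreal_powr A (s - 1)"
      proof -
        have "1 / s' = (s - 1) * (1 / s)" using s by (simp add: s'_def)
        then have "Lnorm Q s' (\<lambda>\<omega>. ennreal_powr (T n \<omega>) (s - 1)) =
            ennreal_powr (ennreal_powr A s) ((s - 1) * (1 / s))"
          unfolding Lnorm_def As using s'(3) by (simp add: ennreal_powr_powr)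
        then show ?thesis using s by (simp add: ennreal_powr_powr)
      qed
      also have "(\<integral>\<^sup>+ y. Lnorm Q s (\<lambda>\<omega>. H \<omega> y) * ennreal_powr A (s - 1) \<partial>M) = ?B * ennreal_powr A (s - 1)"
        unfolding Lnorm_def by (intro nn_integral_multc) measurable
      finally have le: "A * ennreal_powr A (s - 1) \<le> ?B * ennreal_powr A (s - 1)"
        using ennreal_powr_add[of A 1 "s - 1"] by simp
      show ?thesis
      proof (cases "A = 0")
        case True then show ?thesis by (simp add: A_def)
      next
        case False
        then have "ennreal_powr A (s - 1) \<noteq> 0" "ennreal_powr A (s - 1) \<noteq> \<top>"
          using fin by auto
        then obtain c where c: "ennreal_powr A (s - 1) = ennreal c" "0 < c"
          by (metis ennreal_0 ennreal_cases less_le)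
        have "ennreal c * A \<le> ennreal c * ?B" using le c by (simp add: mult.commute)
        then show ?thesis using c ennreal_mult_le_mult_iff[of "ennreal c" A ?B] by (simp add: A_def)
      qed
    qed
    have "(SUP n. T n \<omega>) = G \<omega>" for \<omega>
    proof -
      have "(SUP n. T n \<omega>) = min (G \<omega>) (SUP n. of_nat n)"
        unfolding T_def by (simp add: inf_min[symmetric] inf_SUP)
      then show ?thesis by (simp add: ennreal_SUP_of_nat_eq_top)
    qed
    then have "Lnorm Q s G = Lnorm Q s (\<lambda>\<omega>. SUP n. T n \<omega>)" by simp
    also have "\<dots> = (SUP n. Lnorm Q s (T n))"
      using s by (intro Lnorm_SUP)
        (auto simp: T_def incseq_def le_fun_def min_def of_nat_mono intro: order_trans)
    also have "\<dots> \<le> ?B" using bound by (intro SUP_least)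
    finally show ?thesis by (simp add: G_def[abs_def])
  qed
qed

text \<open>The integral inequality is applied to the \<open>r\<close>-th power of \<open>h\<close>
  with exponent \<open>s = q / r\<close>. The order of the exponents matters:
  \<open>r \<le> q\<close> is what makes \<open>s \<ge> 1\<close>.\<close>

theorem Minkowski_Lnorm_swap:
  assumes "0 < r" "r \<le> q" "finite_measure Q" "sigma_finite_measure M"
    and h [measurable]: "(\<lambda>(\<omega>, y). h \<omega> y) \<in> borel_measurable (Q \<Otimes>\<^sub>M M)"
  shows "Lnorm Q q (\<lambda>\<omega>. Lnorm M r (\<lambda>y. h \<omega> y)) \<le> Lnorm M r (\<lambda>y. Lnorm Q q (\<lambda>\<omega>. h \<omega> y))"
proof -
  define s where "s = q / r"
  have s: "1 \<le> s" "r * s = q" using assms by (auto simp: s_def)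
  let ?H = "\<lambda>\<omega> y. ennreal_powr (h \<omega> y) r"
  have "Lnorm Q q (\<lambda>\<omega>. Lnorm M r (\<lambda>y. h \<omega> y)) = ennreal_powr (Lnorm Q s (\<lambda>\<omega>. \<integral>\<^sup>+ y. ?H \<omega> y \<partial>M)) (1 / r)"
    using assms unfolding Lnorm_def s_def by (simp add: ennreal_powr_powr)
  also have "\<dots> \<le> ennreal_powr (\<integral>\<^sup>+ y. Lnorm Q s (\<lambda>\<omega>. ?H \<omega> y) \<partial>M) (1 / r)"
    using assms s by (intro ennreal_powr_mono Lnorm_nn_integral_swap) auto
  also have "(\<integral>\<^sup>+ y. Lnorm Q s (\<lambda>\<omega>. ?H \<omega> y) \<partial>M) =
      (\<integral>\<^sup>+ y. ennreal_powr (Lnorm Q q (\<lambda>\<omega>. h \<omega> y)) r \<partial>M)"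
    using assms unfolding Lnorm_def s_def by (simp add: ennreal_powr_powr)
  finally show ?thesis by (simp add: Lnorm_def)
qed

lemma (in prob_space) nn_integral_le_Lnorm:
  assumes r: "1 \<le> r" and [measurable]: "f \<in> borel_measurable M"
  shows "(\<integral>\<^sup>+ y. f y \<partial>M) \<le> Lnorm M r f"
proof (cases "r = 1")
  case True
  then show ?thesis by (simp add: Lnorm_1)
next
  case False
  with r have "(\<integral>\<^sup>+ y. f y * 1 \<partial>M) \<le> Lnorm M r f * Lnorm M (r / (r - 1)) (\<lambda>y. 1)"
    by (intro Holder_nn_integral) (auto simp: field_simps)
  also have "Lnorm M (r / (r - 1)) (\<lambda>y. 1) = 1"
    by (simp add: Lnorm_def emeasure_space_1 ennreal_powr_def)
  finally show ?thesis by simp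
qed

section \<open>Function norms with dominated convergence\<close>

text \<open>The mixed norm on the product and the combined norm of random fields are both instances,
  so completeness and density are proved once for both. Countable subadditivity is the source of
  completeness, dominated convergence the source of density.\<close>

locale function_norm =
  fixes X :: "'x measure" and N :: "('x \<Rightarrow> ennreal) \<Rightarrow> ennreal"
  assumes N_mono: "\<lbrakk>f \<in> borel_measurable X; g \<in> borel_measurable X; \<And>x. x \<in> space X \<Longrightarrow> f x \<le> g x\<rbrakk> \<Longrightarrow> N f \<le> N g"
    and N_cmult: "f \<in> borel_measurable X \<Longrightarrow> N (\<lambda>x. c * f x) = c * N f"
    and N_suminf: "(\<And>n. F n \<in> borel_measurable X) \<Longrightarrow> N (\<lambda>x. \<Sum>n. F n x) \<le> (\<Sum>n. N (F n))"
    and N_eq_0_iff: "f \<in> borel_measurable X \<Longrightarrow> N f = 0 \<longleftrightarrow> (AE x in X. f x = 0)"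
    and N_dominated: "\<lbrakk>\<And>n. u n \<in> borel_measurable X; w \<in> borel_measurable X;
        \<And>n x. x \<in> space X \<Longrightarrow> u n x \<le> w x; N w < \<top>; \<And>x. x \<in> space X \<Longrightarrow> (\<lambda>n. u n x) \<longlonglongrightarrow> 0\<rbrakk>
        \<Longrightarrow> (\<lambda>n. N (u n)) \<longlonglongrightarrow> 0"
begin

lemma N_0 [simp]: "N (\<lambda>x. 0) = 0"
  by (simp add: N_eq_0_iff)

lemma N_add:
  assumes [measurable]: "f \<in> borel_measurable X" "g \<in> borel_measurable X"
  shows "N (\<lambda>x. f x + g x) \<le> N f + N g"
proof -
  define F where "F n = (if n = 0 then f else if n = 1 then g else (\<lambda>x. 0))" for n :: nat
  have [measurable]: "F n \<in> borel_measurable X" for n unfolding F_def by auto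
  have "(\<Sum>n. F n x) = f x + g x" for x
    by (subst suminf_finite[of "{0, 1}"]) (auto simp: F_def)
  moreover have "(\<Sum>n. N (F n)) = N f + N g"
    by (subst suminf_finite[of "{0, 1}"]) (auto simp: F_def)
  ultimately show ?thesis using N_suminf[of F] by simp
qed

lemma N_mono_AE:
  assumes [measurable]: "f \<in> borel_measurable X" "g \<in> borel_measurable X"
    and le: "AE x in X. f x \<le> g x"
  shows "N f \<le> N g"
proof -
  \<comment> \<open>The part of \<open>f\<close> on the exceptional null set has norm
    \<open>0\<close>, and adding it to \<open>g\<close> restores an inequality at every point, as
    \<open>N_mono\<close> asks for.\<close>
  define h where "h x = (if f x \<le> g x then 0 else f x)" for x
  have [measurable]: "h \<in> borel_measurable X" unfolding h_def by measurable
  have "AE x in X. h x = 0" using le by eventually_elim (simp add: h_def)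
  then have "N h = 0" by (simp add: N_eq_0_iff)
  moreover have "N f \<le> N (\<lambda>x. g x + h x)" by (rule N_mono) (auto simp: h_def)
  ultimately show ?thesis using N_add[of g h] by simp
qed

lemma N_cong_AE:
  assumes "f \<in> borel_measurable X" "g \<in> borel_measurable X" "AE x in X. f x = g x"
  shows "N f = N g"
  using assms by (intro antisym N_mono_AE) auto

lemma N_finite_AE:
  assumes [measurable]: "f \<in> borel_measurable X" and fin: "N f < \<top>"
  shows "AE x in X. f x < \<top>"
proof -
  let ?i = "indicator {x \<in> space X. f x = \<top>} :: 'x \<Rightarrow> ennreal"
  \<comment> \<open>Homogeneity with the infinite factor \<open>\<top>\<close>: the product can be
    finite only if the norm of the indicator is \<open>0\<close>.\<close>
  have "N (\<lambda>x. \<top> * ?i x) \<le> N f" by (rule N_mono) (auto simp: indicator_def)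
  then have "\<top> * N ?i < \<top>" using fin by (subst N_cmult[symmetric]) auto
  then have "N ?i = 0" by (auto simp: ennreal_top_mult split: if_splits)
  then have "AE x in X. ?i x = 0" by (simp add: N_eq_0_iff)
  then show ?thesis using AE_space by eventually_elim (auto simp: indicator_def less_top split: if_splits)
qed

lemma N_abs_triangle:
  fixes f g h :: "'x \<Rightarrow> real"
  assumes [measurable]: "f \<in> borel_measurable X" "g \<in> borel_measurable X" "h \<in> borel_measurable X"
  shows "N (\<lambda>x. ennreal \<bar>f x - h x\<bar>) \<le> N (\<lambda>x. ennreal \<bar>f x - g x\<bar>) + N (\<lambda>x. ennreal \<bar>g x - h x\<bar>)"
proof -
  have "N (\<lambda>x. ennreal \<bar>f x - h x\<bar>) \<le> N (\<lambda>x. ennreal \<bar>f x - g x\<bar> + ennreal \<bar>g x - h x\<bar>)"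
    by (rule N_mono) (auto simp: ennreal_plus[symmetric] simp del: ennreal_plus intro!: ennreal_leI)
  also have "\<dots> \<le> N (\<lambda>x. ennreal \<bar>f x - g x\<bar>) + N (\<lambda>x. ennreal \<bar>g x - h x\<bar>)"
    by (rule N_add) auto
  finally show ?thesis .
qed

lemma N_abs_add:
  fixes f g :: "'x \<Rightarrow> real"
  assumes [measurable]: "f \<in> borel_measurable X" "g \<in> borel_measurable X"
  shows "N (\<lambda>x. ennreal \<bar>f x + g x\<bar>) \<le> N (\<lambda>x. ennreal \<bar>f x\<bar>) + N (\<lambda>x. ennreal \<bar>g x\<bar>)"
  using N_abs_triangle[of f "\<lambda>x. 0" "\<lambda>x. - g x"] by simp

lemma N_abs_cmult:
  fixes f :: "'x \<Rightarrow> real"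
  assumes [measurable]: "f \<in> borel_measurable X"
  shows "N (\<lambda>x. ennreal \<bar>c * f x\<bar>) = ennreal \<bar>c\<bar> * N (\<lambda>x. ennreal \<bar>f x\<bar>)"
  by (simp add: abs_mult ennreal_mult N_cmult)

text \<open>A monotone class argument: simple functions with support in some \<open>E n\<close> are dense. The closure
  property of \<open>W\<close> is an assumption, so that \<open>W\<close> can be the closure of any countable or finite-rank family.\<close>

lemma density:
  fixes W :: "('x \<Rightarrow> real) set"
  assumes W_add: "\<And>f g. f \<in> W \<Longrightarrow> g \<in> W \<Longrightarrow> (\<lambda>x. f x + g x) \<in> W"
    and W_scale: "\<And>f c. f \<in> W \<Longrightarrow> (\<lambda>x. c * f x) \<in> W"
    and W_closed: "\<And>f. f \<in> borel_measurable X \<Longrightarrow>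
      (\<And>e::real. 0 < e \<Longrightarrow> \<exists>g\<in>W. g \<in> borel_measurable X \<and> N (\<lambda>x. ennreal \<bar>f x - g x\<bar>) < ennreal e) \<Longrightarrow> f \<in> W"
    and G: "Int_stable G" "G \<subseteq> Pow (space X)" "sets X = sigma_sets (space X) G"
    and E: "\<And>n. E n \<in> sets X" "incseq E" "(\<Union>n. E n) = space X" "\<And>n. N (indicator (E n)) < \<top>"
    and W_E: "\<And>n. indicator (E n) \<in> W"
    and W_G: "\<And>A n. A \<in> G \<Longrightarrow> indicator (A \<inter> E n) \<in> W"
    and f [measurable]: "f \<in> borel_measurable X" and fin: "N (\<lambda>x. ennreal \<bar>f x\<bar>) < \<top>"
  shows "f \<in> W"
proof -
  note E(1)[measurable]
  have W_0: "(\<lambda>x. 0) \<in> W" using W_scale[OF W_E[of 0], of 0] by simp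
  have W_sum: "(\<lambda>x. \<Sum>i\<in>I. h i x) \<in> W" if "finite I" "\<And>i. i \<in> I \<Longrightarrow> h i \<in> W" for h and I :: "'i set"
    using that by induction (auto intro: W_0 W_add)
  have W_lim: "h \<in> W" if [measurable]: "h \<in> borel_measurable X" "\<And>k::nat. g k \<in> borel_measurable X"
    and g: "\<And>k. g k \<in> W" and lim: "(\<lambda>k. N (\<lambda>x. ennreal \<bar>h x - g k x\<bar>)) \<longlonglongrightarrow> 0" for h g
  proof (rule W_closed)
    fix e :: real assume "0 < e"
    with order_tendstoD(2)[OF lim, of "ennreal e"] obtain k where "N (\<lambda>x. ennreal \<bar>h x - g k x\<bar>) < ennreal e"
      by (auto simp: eventually_sequentially)
    with g show "\<exists>g\<in>W. g \<in> borel_measurable X \<and> N (\<lambda>x. ennreal \<bar>h x - g x\<bar>) < ennreal e"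
      by (intro bexI[of _ "g k"]) auto
  qed simp
  have ind: "indicator (A \<inter> E n) \<in> W" if "A \<in> sets X" for A n
    using G(1,2) that[unfolded G(3)]
  proof (induction rule: sigma_sets_induct_disjoint)
    case (basic A) then show ?case by (rule W_G)
  next
    case empty then show ?case using W_0 by simp
  next
    case (compl A)
    have "indicator ((space X - A) \<inter> E n) = (\<lambda>x. indicator (E n) x + (-1) * indicator (A \<inter> E n) x :: real)"
      using sets.sets_into_space[OF E(1)[of n]] by (auto simp: indicator_def fun_eq_iff)
    then show ?case using W_add[OF W_E W_scale[OF compl(2)], of n "-1"] by simp
  next
    case (union A)
    have [measurable]: "A i \<in> sets X" for i using union(2) G(3) by auto
    \<comment> \<open>By disjointness the remainder after \<open>k\<close> summands is the indicator
      of a tail union. It vanishes pointwise for large \<open>k\<close> and stays below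
      \<open>indicator (E n)\<close>, so dominated convergence applies.\<close>
    have eq: "\<bar>indicator ((\<Union>i. A i) \<inter> E n) x - (\<Sum>i<k. indicator (A i \<inter> E n) x)\<bar> =
          (indicator ((\<Union>i\<in>{k..}. A i) \<inter> E n) x :: real)" for x k
      proof (cases "\<exists>i. x \<in> A i \<inter> E n")
        case True
        then obtain i where i: "x \<in> A i" "x \<in> E n" by auto
        then have iff: "x \<in> A j \<longleftrightarrow> j = i" for j using union(1) by (auto simp: disjoint_family_on_def)
        have "(\<Sum>j<k. indicator (A j \<inter> E n) x) = (\<Sum>j<k. if j = i then 1 else 0 :: real)"
          using i iff by (intro sum.cong) (auto simp: indicator_def)
        then show ?thesis using i iff by (auto simp: indicator_def)
      next
        case False
        then have "indicator (A j \<inter> E n) x = (0::real)" for j by (auto simp: indicator_def)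
        then show ?thesis using False by (auto simp: indicator_def)
      qed
    have "(\<lambda>k. N (\<lambda>x. ennreal \<bar>indicator ((\<Union>i. A i) \<inter> E n) x - (\<Sum>i<k. indicator (A i \<inter> E n) x)\<bar>)) \<longlonglongrightarrow> 0"
        unfolding eq
      proof (rule N_dominated[where w = "indicator (E n)"])
        fix x
        show "(\<lambda>k. ennreal (indicator ((\<Union>i\<in>{k..}. A i) \<inter> E n) x)) \<longlonglongrightarrow> 0"
        proof (cases "\<exists>i. x \<in> A i")
          case True
          then obtain i where i: "x \<in> A i" by auto
          then have iff: "x \<in> A j \<longleftrightarrow> j = i" for j using union(1) by (auto simp: disjoint_family_on_def)
          have "\<forall>\<^sub>F k in sequentially. ennreal (indicator ((\<Union>i\<in>{k..}. A i) \<inter> E n) x) = 0"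
            using iff by (intro eventually_sequentiallyI[of "Suc i"]) (auto simp: indicator_def)
          then show ?thesis by (rule tendsto_eventually)
        next
          case False then show ?thesis by (auto simp: indicator_def)
        qed
      qed (use E in \<open>auto simp: indicator_def\<close>)
    then show ?case
      by (rule W_lim[rotated 3]) (use union in \<open>auto intro: W_sum\<close>)
  qed
  obtain s where s: "\<And>k. simple_function X (s k)" "\<And>x. x \<in> space X \<Longrightarrow> (\<lambda>k. s k x) \<longlonglongrightarrow> f x"
    "\<And>k x. x \<in> space X \<Longrightarrow> dist (s k x) 0 \<le> 2 * dist (f x) 0"
    using borel_measurable_implies_sequence_metric[OF f, of 0] by metis
  have [measurable]: "s k \<in> borel_measurable X" for k using s(1) by (rule borel_measurable_simple_function)
  \<comment> \<open>The simple function \<open>s k\<close> cut down to \<open>E k\<close>, which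
    makes it a finite combination of indicators of sets \<open>A \<inter> E k\<close>.\<close>
  define g where "g k x = (\<Sum>y\<in>s k ` space X. y * indicator ((s k -` {y} \<inter> space X) \<inter> E k) x)" for k x
  have fin_s: "finite (s k ` space X)" for k using s(1) by (simp add: simple_function_def)
  have g_eq: "g k x = s k x * indicator (E k) x" if "x \<in> space X" for k x
  proof -
    have "g k x = (\<Sum>y\<in>s k ` space X. if y = s k x then y * indicator (E k) x else 0)"
      unfolding g_def using that by (intro sum.cong) (auto simp: indicator_def)
    then show ?thesis using that fin_s by simp
  qed
  have meas: "s k -` {y} \<inter> space X \<in> sets X" for k y by measurable
  have g_meas [measurable]: "g k \<in> borel_measurable X" for k
    unfolding g_def[abs_def] using meas by measurable
  show ?thesis
  proof (rule W_lim[OF f])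
    show "g k \<in> W" for k
      unfolding g_def[abs_def] by (intro W_sum W_scale ind fin_s meas)
    \<comment> \<open>The dominating factor \<open>3\<close> is \<open>1 + 2\<close>: the
      approximating simple functions satisfy
      \<open>\<bar>s k x\<bar> \<le> 2 * \<bar>f x\<bar>\<close>.\<close>
    show "(\<lambda>k. N (\<lambda>x. ennreal \<bar>f x - g k x\<bar>)) \<longlonglongrightarrow> 0"
    proof (rule N_dominated[where w = "\<lambda>x. 3 * ennreal \<bar>f x\<bar>"])
      show "N (\<lambda>x. 3 * ennreal \<bar>f x\<bar>) < \<top>" using fin by (simp add: N_cmult ennreal_mult_less_top)
      fix x assume x: "x \<in> space X"
      show "ennreal \<bar>f x - g k x\<bar> \<le> 3 * ennreal \<bar>f x\<bar>" for k
      proof -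
        have "\<bar>f x - g k x\<bar> \<le> 3 * \<bar>f x\<bar>" using s(3)[OF x, of k] x by (auto simp: g_eq indicator_def)
        then have "ennreal \<bar>f x - g k x\<bar> \<le> ennreal (3 * \<bar>f x\<bar>)" by (rule ennreal_leI)
        then show ?thesis by (simp add: ennreal_mult)
      qed
      obtain n0 where n0: "x \<in> E n0" using x E(3) by auto
      have "\<forall>\<^sub>F k in sequentially. s k x = g k x"
        using n0 E(2) x by (intro eventually_sequentiallyI[of n0])
          (auto simp: g_eq indicator_def incseq_def dest!: subsetD)
      with s(2)[OF x] have "(\<lambda>k. g k x) \<longlonglongrightarrow> f x" by (rule Lim_transform_eventually)
      then have "(\<lambda>k. \<bar>f x - g k x\<bar>) \<longlonglongrightarrow> \<bar>f x - f x\<bar>" by (intro tendsto_intros)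
      then show "(\<lambda>k. ennreal \<bar>f x - g k x\<bar>) \<longlonglongrightarrow> 0" using tendsto_ennrealI by force
    qed auto
  qed auto
qed

end

text \<open>Random fields become functions on the product \<open>Q \<Otimes>\<^sub>M X\<close>, and
  their norm inherits each axiom from the corresponding property of \<open>Lnorm\<close> at fixed
  \<open>x\<close>. Null sets match by Fubini.\<close>

lemma function_norm_pair:
  assumes "function_norm X N" "sigma_finite_measure X" "prob_space Q" and q: "1 \<le> q"
  shows "function_norm (Q \<Otimes>\<^sub>M X) (\<lambda>F. N (\<lambda>x. Lnorm Q q (\<lambda>\<omega>. F (\<omega>, x))))"
proof -
  interpret function_norm X N by fact
  interpret X: sigma_finite_measure X by fact
  interpret Q: prob_space Q by fact
  interpret QX: pair_sigma_finite Q X ..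
  have q0: "0 < q" using q by simp
  have L [measurable]: "(\<lambda>x. Lnorm Q q (\<lambda>\<omega>. f (\<omega>, x))) \<in> borel_measurable X"
    if [measurable]: "f \<in> borel_measurable (Q \<Otimes>\<^sub>M X)" for f
    unfolding Lnorm_def by measurable
  show ?thesis
  proof
    fix f g :: "'b \<times> 'a \<Rightarrow> ennreal"
    assume [measurable]: "f \<in> borel_measurable (Q \<Otimes>\<^sub>M X)" "g \<in> borel_measurable (Q \<Otimes>\<^sub>M X)"
      and le: "\<And>x. x \<in> space (Q \<Otimes>\<^sub>M X) \<Longrightarrow> f x \<le> g x"
    show "N (\<lambda>x. Lnorm Q q (\<lambda>\<omega>. f (\<omega>, x))) \<le> N (\<lambda>x. Lnorm Q q (\<lambda>\<omega>. g (\<omega>, x)))"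
      using le q0 by (intro N_mono Lnorm_mono L) (auto simp: space_pair_measure)
  next
    fix f :: "'b \<times> 'a \<Rightarrow> ennreal" and c
    assume [measurable]: "f \<in> borel_measurable (Q \<Otimes>\<^sub>M X)"
    have "N (\<lambda>x. Lnorm Q q (\<lambda>\<omega>. c * f (\<omega>, x))) = N (\<lambda>x. c * Lnorm Q q (\<lambda>\<omega>. f (\<omega>, x)))"
      using q0 L[of "\<lambda>z. c * f z"] by (intro N_cong_AE) (auto simp: Lnorm_cmult)
    then show "N (\<lambda>x. Lnorm Q q (\<lambda>\<omega>. c * f (\<omega>, x))) = c * N (\<lambda>x. Lnorm Q q (\<lambda>\<omega>. f (\<omega>, x)))"
      by (simp add: N_cmult)
  next
    fix F :: "nat \<Rightarrow> 'b \<times> 'a \<Rightarrow> ennreal"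
    assume [measurable]: "\<And>n. F n \<in> borel_measurable (Q \<Otimes>\<^sub>M X)"
    have "N (\<lambda>x. Lnorm Q q (\<lambda>\<omega>. \<Sum>n. F n (\<omega>, x))) \<le> N (\<lambda>x. \<Sum>n. Lnorm Q q (\<lambda>\<omega>. F n (\<omega>, x)))"
      using q L[of "\<lambda>z. \<Sum>n. F n z"] by (intro N_mono Lnorm_suminf) auto
    also have "\<dots> \<le> (\<Sum>n. N (\<lambda>x. Lnorm Q q (\<lambda>\<omega>. F n (\<omega>, x))))" by (intro N_suminf) auto
    finally show "N (\<lambda>x. Lnorm Q q (\<lambda>\<omega>. \<Sum>n. F n (\<omega>, x))) \<le> (\<Sum>n. N (\<lambda>x. Lnorm Q q (\<lambda>\<omega>. F n (\<omega>, x))))" .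
  next
    fix f :: "'b \<times> 'a \<Rightarrow> ennreal"
    assume [measurable]: "f \<in> borel_measurable (Q \<Otimes>\<^sub>M X)"
    have "N (\<lambda>x. Lnorm Q q (\<lambda>\<omega>. f (\<omega>, x))) = 0 \<longleftrightarrow> (AE x in X. Lnorm Q q (\<lambda>\<omega>. f (\<omega>, x)) = 0)"
      by (intro N_eq_0_iff) auto
    also have "\<dots> \<longleftrightarrow> (AE x in X. AE \<omega> in Q. f (\<omega>, x) = 0)"
      by (intro AE_cong) (simp add: Lnorm_eq_0_iff)
    also have "\<dots> \<longleftrightarrow> (AE \<omega> in Q. AE x in X. f (\<omega>, x) = 0)"
      by (rule QX.AE_commute[symmetric]) measurable
    also have "\<dots> \<longleftrightarrow> (AE z in Q \<Otimes>\<^sub>M X. f z = 0)"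
      using QX.AE_pair_iff[of "\<lambda>\<omega> x. f (\<omega>, x) = 0"] by simp
    finally show "N (\<lambda>x. Lnorm Q q (\<lambda>\<omega>. f (\<omega>, x))) = 0 \<longleftrightarrow> (AE z in Q \<Otimes>\<^sub>M X. f z = 0)" .
  next
    fix u :: "nat \<Rightarrow> 'b \<times> 'a \<Rightarrow> ennreal" and w
    assume [measurable]: "\<And>n. u n \<in> borel_measurable (Q \<Otimes>\<^sub>M X)" "w \<in> borel_measurable (Q \<Otimes>\<^sub>M X)"
      and le: "\<And>n z. z \<in> space (Q \<Otimes>\<^sub>M X) \<Longrightarrow> u n z \<le> w z"
      and fin: "N (\<lambda>x. Lnorm Q q (\<lambda>\<omega>. w (\<omega>, x))) < \<top>"
      and lim: "\<And>z. z \<in> space (Q \<Otimes>\<^sub>M X) \<Longrightarrow> (\<lambda>n. u n z) \<longlonglongrightarrow> 0"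
    let ?w = "\<lambda>x. Lnorm Q q (\<lambda>\<omega>. w (\<omega>, x))"
    \<comment> \<open>The norm of \<open>w\<close> over \<open>Q\<close> is finite only for almost
      every \<open>x\<close>. At the other points the sequence is replaced by \<open>0\<close>,
      since \<open>N_dominated\<close> asks for convergence everywhere.\<close>
    let ?u = "\<lambda>n x. if ?w x < \<top> then Lnorm Q q (\<lambda>\<omega>. u n (\<omega>, x)) else 0"
    have ae: "AE x in X. ?w x < \<top>" using fin by (intro N_finite_AE) auto
    have le': "Lnorm Q q (\<lambda>\<omega>. u n (\<omega>, x)) \<le> ?w x" if "x \<in> space X" for n x
      using le that q0 by (intro Lnorm_mono) (auto simp: space_pair_measure)
    have "(\<lambda>n. N (?u n)) \<longlonglongrightarrow> 0"
    proof (rule N_dominated[where w = ?w])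
      fix x assume x: "x \<in> space X"
      show "(\<lambda>n. ?u n x) \<longlonglongrightarrow> 0"
      proof (cases "?w x < \<top>")
        case True
        have "(\<lambda>n. Lnorm Q q (\<lambda>\<omega>. u n (\<omega>, x))) \<longlonglongrightarrow> 0"
          by (rule Lnorm_dominated_convergence[OF q0, where w = "\<lambda>\<omega>. w (\<omega>, x)"])
             (use x le lim True in \<open>auto simp: space_pair_measure\<close>)
        then show ?thesis using True by simp
      qed simp
    qed (use fin le' in auto)
    moreover have "N (?u n) = N (\<lambda>x. Lnorm Q q (\<lambda>\<omega>. u n (\<omega>, x)))" for n
      using ae by (intro N_cong_AE) auto
    ultimately show "(\<lambda>n. N (\<lambda>x. Lnorm Q q (\<lambda>\<omega>. u n (\<omega>, x)))) \<longlonglongrightarrow> 0" by simp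
  qed
qed

section \<open>Mixed norms as iterated Lebesgue norms\<close>

text \<open>The root is taken at every level, so each level is a genuine norm and facts about
  \<open>Lnorm\<close> lift by induction on the number of coordinates. In \<open>mixed_iter\<close>
  this root is merged into the next exponent.\<close>

primrec mnorm ::
  "(nat \<Rightarrow> 'a measure) \<Rightarrow> (nat \<Rightarrow> real) \<Rightarrow> nat \<Rightarrow> ((nat \<Rightarrow> 'a) \<Rightarrow> ennreal) \<Rightarrow> (nat \<Rightarrow> 'a) \<Rightarrow> ennreal"
where
  "mnorm M p 0 g x = g x"
| "mnorm M p (Suc k) g x = Lnorm (M (Suc k)) (p (Suc k)) (\<lambda>y. mnorm M p k g (x(Suc k := y)))"

text \<open>The locale \<open>product_sigma_finite\<close> speaks about all indices. Those outside
  \<open>I\<close> are filled with the measure on the empty space, which does not affect products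
  over \<open>I\<close>.\<close>

lemma product_sigma_finite_on:
  assumes "\<And>i. i \<in> I \<Longrightarrow> sigma_finite_measure (M i)"
  obtains M' where "product_sigma_finite M'" "\<And>i. i \<in> I \<Longrightarrow> M' i = M i"
proof
  let ?M' = "\<lambda>i. if i \<in> I then M i else count_space {}"
  show "product_sigma_finite ?M'"
    using assms by (auto simp: product_sigma_finite_def intro: sigma_finite_measure_count_space_finite)
qed auto

lemma sigma_finite_PiM:
  assumes "finite I" "\<And>i. i \<in> I \<Longrightarrow> sigma_finite_measure (M i)"
  shows "sigma_finite_measure (PiM I M)"
proof -
  obtain M' where M': "product_sigma_finite M'" "\<And>i. i \<in> I \<Longrightarrow> M' i = M i"
    using product_sigma_finite_on[of I M] assms by blast
  interpret product_sigma_finite M' by fact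
  interpret finite_product_sigma_finite M' I by standard fact
  have "PiM I M = PiM I M'" using M' by (intro PiM_cong) auto
  then show ?thesis using sigma_finite_measure_axioms by simp
qed

lemma nn_integral_PiM_insert:
  assumes "finite I" "i \<notin> I" "\<And>j. j \<in> insert i I \<Longrightarrow> sigma_finite_measure (M j)"
    and "f \<in> borel_measurable (PiM (insert i I) M)"
  shows "integral\<^sup>N (PiM (insert i I) M) f = (\<integral>\<^sup>+ x. (\<integral>\<^sup>+ y. f (x(i := y)) \<partial>M i) \<partial>PiM I M)"
proof -
  obtain M' where M': "product_sigma_finite M'" "\<And>j. j \<in> insert i I \<Longrightarrow> M' j = M j"
    using product_sigma_finite_on[of "insert i I" M] assms by blast
  interpret product_sigma_finite M' by fact
  have "PiM (insert i I) M = PiM (insert i I) M'" "PiM I M = PiM I M'"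
    using M' by (intro PiM_cong; auto)+
  with product_nn_integral_insert[of I i f] assms M' show ?thesis by simp
qed

locale mixed_space =
  fixes M :: "nat \<Rightarrow> 'a measure" and p :: "nat \<Rightarrow> real" and l :: nat
  assumes l_pos: "1 \<le> l"
    and sigma_finite_M: "\<And>k. k \<in> {1..l} \<Longrightarrow> sigma_finite_measure (M k)"
    and p_ge_1: "\<And>k. k \<in> {1..l} \<Longrightarrow> 1 \<le> p k"
begin

abbreviation X :: "(nat \<Rightarrow> 'a) measure" where "X \<equiv> PiM {1..l} M"
abbreviation N :: "((nat \<Rightarrow> 'a) \<Rightarrow> ennreal) \<Rightarrow> ennreal" where "N \<equiv> mixed_norm M p l"

lemma mixed_iter_eq_mnorm:
  "1 \<le> k \<Longrightarrow> k \<le> l \<Longrightarrow> mixed_iter M p k g x = ennreal_powr (mnorm M p k g x) (p k)"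
proof (induction k arbitrary: x)
  case (Suc k)
  have p: "0 < p (Suc k)" using p_ge_1[of "Suc k"] Suc by auto
  show ?case
  proof (cases "k = 0")
    case True
    then show ?thesis using p by (simp add: ennreal_powr_Lnorm)
  next
    case False
    then have "0 < p k" using p_ge_1[of k] Suc by auto
    with False p Suc show ?thesis by (simp add: ennreal_powr_Lnorm ennreal_powr_powr)
  qed
qed simp

lemma N_eq_mnorm: "N g = mnorm M p l g (\<lambda>_. undefined)"
  using mixed_iter_eq_mnorm[of l g] l_pos p_ge_1[of l]
  by (simp add: mixed_norm_def ennreal_powr_powr)

lemma sigma_finite_X: "sigma_finite_measure X"
  by (rule sigma_finite_PiM) (auto intro: sigma_finite_M)

lemma interval_insert: "Suc k \<le> l \<Longrightarrow> {Suc k..l} = insert (Suc k) {Suc (Suc k)..l}"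
  by auto

lemma upd_in_space:
  "\<lbrakk>Suc k \<le> l; x \<in> space (PiM {Suc (Suc k)..l} M); y \<in> space (M (Suc k))\<rbrakk> \<Longrightarrow> x(Suc k := y) \<in> space (PiM {Suc k..l} M)"
  by (auto simp: space_PiM PiE_def Pi_def extensional_def)

lemma measurable_upd:
  "\<lbrakk>Suc k \<le> l; x \<in> space (PiM {Suc (Suc k)..l} M)\<rbrakk> \<Longrightarrow> (\<lambda>y. x(Suc k := y)) \<in> measurable (M (Suc k)) (PiM {Suc k..l} M)"
  by (rule measurable_fun_upd[where J = "{Suc (Suc k)..l}"]) auto

text \<open>The parameter \<open>\<omega>\<close> is carried through the induction so that norms of
  random fields are measurable in \<open>\<omega>\<close>; a one-point parameter space gives the
  deterministic case. After \<open>k\<close> integrations only the coordinates from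
  \<open>Suc k\<close> on remain.\<close>

lemma measurable_mnorm_param:
  assumes g: "(\<lambda>(\<omega>, x). g \<omega> x) \<in> borel_measurable (Q \<Otimes>\<^sub>M X)" and "k \<le> l"
  shows "(\<lambda>(\<omega>, x). mnorm M p k (g \<omega>) x) \<in> borel_measurable (Q \<Otimes>\<^sub>M PiM {Suc k..l} M)"
  using \<open>k \<le> l\<close>
proof (induction k)
  case 0
  then show ?case using g by simp
next
  case (Suc k)
  interpret Mk: sigma_finite_measure "M (Suc k)" using sigma_finite_M Suc by auto
  let ?J = "{Suc (Suc k)..l}"
  have [measurable]: "(\<lambda>(\<omega>, x). mnorm M p k (g \<omega>) x) \<in> borel_measurable (Q \<Otimes>\<^sub>M PiM {Suc k..l} M)"
    using Suc by simp
  have [measurable]: "(\<lambda>z. (snd (fst z))(Suc k := snd z)) \<in>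
      measurable ((Q \<Otimes>\<^sub>M PiM ?J M) \<Otimes>\<^sub>M M (Suc k)) (PiM {Suc k..l} M)"
    using Suc by (intro measurable_fun_upd[where J = ?J]) auto
  have "(\<lambda>z. (fst (fst z), (snd (fst z))(Suc k := snd z))) \<in>
      measurable ((Q \<Otimes>\<^sub>M PiM ?J M) \<Otimes>\<^sub>M M (Suc k)) (Q \<Otimes>\<^sub>M PiM {Suc k..l} M)"
    by measurable
  from measurable_compose[OF this Suc(1)] Suc(2)
  have [measurable]: "(\<lambda>(z, y). mnorm M p k (g (fst z)) ((snd z)(Suc k := y))) \<in>
      borel_measurable ((Q \<Otimes>\<^sub>M PiM ?J M) \<Otimes>\<^sub>M M (Suc k))"
    by (simp add: split_beta')
  have "(\<lambda>z. mnorm M p (Suc k) (g (fst z)) (snd z)) \<in> borel_measurable (Q \<Otimes>\<^sub>M PiM ?J M)"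
    unfolding mnorm.simps Lnorm_def by measurable
  then show ?case by (simp add: split_beta')
qed

lemma measurable_N_param [measurable (raw)]:
  assumes "(\<lambda>(\<omega>, x). g \<omega> x) \<in> borel_measurable (Q \<Otimes>\<^sub>M X)"
  shows "(\<lambda>\<omega>. N (g \<omega>)) \<in> borel_measurable Q"
proof -
  have "(\<lambda>\<omega>. (\<omega>, \<lambda>_. undefined)) \<in> measurable Q (Q \<Otimes>\<^sub>M PiM {Suc l..l} M)"
    by (intro measurable_Pair measurable_const) (auto simp: space_PiM)
  from measurable_compose[OF this measurable_mnorm_param[OF assms order_refl]]
  show ?thesis by (simp add: N_eq_mnorm)
qed

lemma measurable_mnorm:
  assumes [measurable]: "g \<in> borel_measurable X" and "k \<le> l"
  shows "mnorm M p k g \<in> borel_measurable (PiM {Suc k..l} M)"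
proof -
  have "(\<lambda>(\<omega>::unit, x). mnorm M p k g x) \<in> borel_measurable (count_space UNIV \<Otimes>\<^sub>M PiM {Suc k..l} M)"
    by (rule measurable_mnorm_param[OF _ assms(2)]) measurable
  from measurable_compose[OF _ this, of "\<lambda>x. ((), x)" "PiM {Suc k..l} M"] show ?thesis by simp
qed

lemma measurable_mnorm_section:
  assumes "g \<in> borel_measurable X" "Suc k \<le> l" "x \<in> space (PiM {Suc (Suc k)..l} M)"
  shows "(\<lambda>y. mnorm M p k g (x(Suc k := y))) \<in> borel_measurable (M (Suc k))"
  using measurable_compose[OF measurable_upd[OF assms(2,3)] measurable_mnorm[OF assms(1), of k]] assms by simp

lemma mnorm_mono:
  assumes "k \<le> l" "x \<in> space (PiM {Suc k..l} M)" "\<And>x. x \<in> space X \<Longrightarrow> f x \<le> g x"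
  shows "mnorm M p k f x \<le> mnorm M p k g x"
  using assms(1,2)
proof (induction k arbitrary: x)
  case (Suc k)
  have "0 < p (Suc k)" using p_ge_1[of "Suc k"] Suc by auto
  then show ?case using Suc upd_in_space[OF Suc(2)] by (auto intro!: Lnorm_mono)
qed (use assms in auto)

lemma mnorm_cmult:
  assumes [measurable]: "f \<in> borel_measurable X" and "k \<le> l" "x \<in> space (PiM {Suc k..l} M)"
  shows "mnorm M p k (\<lambda>x. c * f x) x = c * mnorm M p k f x"
  using assms(2,3)
proof (induction k arbitrary: x)
  case (Suc k)
  have p: "0 < p (Suc k)" using p_ge_1[of "Suc k"] Suc by auto
  have "mnorm M p (Suc k) (\<lambda>x. c * f x) x =
      Lnorm (M (Suc k)) (p (Suc k)) (\<lambda>y. c * mnorm M p k f (x(Suc k := y)))"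
    using Suc upd_in_space[OF Suc(2,3)] by (simp cong: Lnorm_cong)
  then show ?case using p measurable_mnorm_section[OF assms(1) Suc(2,3)] by (simp add: Lnorm_cmult)
qed simp

lemma mnorm_suminf:
  assumes [measurable]: "\<And>n. f n \<in> borel_measurable X" and "k \<le> l" "x \<in> space (PiM {Suc k..l} M)"
  shows "mnorm M p k (\<lambda>x. \<Sum>n. f n x) x \<le> (\<Sum>n. mnorm M p k (f n) x)"
  using assms(2,3)
proof (induction k arbitrary: x)
  case (Suc k)
  have p: "1 \<le> p (Suc k)" using p_ge_1[of "Suc k"] Suc by auto
  have "mnorm M p (Suc k) (\<lambda>x. \<Sum>n. f n x) x \<le>
      Lnorm (M (Suc k)) (p (Suc k)) (\<lambda>y. \<Sum>n. mnorm M p k (f n) (x(Suc k := y)))"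
    unfolding mnorm.simps using Suc upd_in_space[OF Suc(2,3)] p by (intro Lnorm_mono) auto
  also have "\<dots> \<le> (\<Sum>n. mnorm M p (Suc k) (f n) x)"
    using p measurable_mnorm_section[OF assms(1) Suc(2,3)] by (simp add: Lnorm_suminf)
  finally show ?case .
qed simp

lemma mnorm_dominated:
  assumes [measurable]: "\<And>n. u n \<in> borel_measurable X" "w \<in> borel_measurable X"
    and le: "\<And>n x. x \<in> space X \<Longrightarrow> u n x \<le> w x" and lim: "\<And>x. x \<in> space X \<Longrightarrow> (\<lambda>n. u n x) \<longlonglongrightarrow> 0"
    and "k \<le> l" "x \<in> space (PiM {Suc k..l} M)" "mnorm M p k w x < \<top>"
  shows "(\<lambda>n. mnorm M p k (u n) x) \<longlonglongrightarrow> 0"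
  using assms(5-)
proof (induction k arbitrary: x)
  case 0
  then show ?case using lim by simp
next
  case (Suc k)
  have p: "0 < p (Suc k)" using p_ge_1[of "Suc k"] Suc by auto
  note sec [measurable] = measurable_mnorm_section[OF _ Suc(2,3)]
  show ?case unfolding mnorm.simps
  proof (rule Lnorm_dominated_convergence[OF p, where w = "\<lambda>y. mnorm M p k w (x(Suc k := y))"])
    have fin: "AE y in M (Suc k). mnorm M p k w (x(Suc k := y)) < \<top>"
      using Suc(4) p by (intro Lnorm_finite_AE[where r = "p (Suc k)"]) auto
    show "AE y in M (Suc k). (\<lambda>n. mnorm M p k (u n) (x(Suc k := y))) \<longlonglongrightarrow> 0"
      using fin AE_space by eventually_elim (use Suc upd_in_space[OF Suc(2,3)] in auto)
    show "AE y in M (Suc k). mnorm M p k (u n) (x(Suc k := y)) \<le> mnorm M p k w (x(Suc k := y))" for n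
      using AE_space by eventually_elim (use Suc upd_in_space[OF Suc(2,3)] le in \<open>auto intro!: mnorm_mono\<close>)
  qed (use Suc in auto)
qed

text \<open>Tonelli, one coordinate per induction step. It connects mixed norms with the product
  measure, whose null sets have to be recognized.\<close>

lemma nn_integral_X_eq_mnorm:
  assumes "\<And>k. k \<in> {1..l} \<Longrightarrow> p k = 1" and [measurable]: "g \<in> borel_measurable X" and "k \<le> l"
  shows "(\<integral>\<^sup>+ x. g x \<partial>X) = (\<integral>\<^sup>+ x. mnorm M p k g x \<partial>PiM {Suc k..l} M)"
  using \<open>k \<le> l\<close>
proof (induction k)
  case (Suc k)
  have "(\<integral>\<^sup>+ x. g x \<partial>X) = (\<integral>\<^sup>+ x. mnorm M p k g x \<partial>PiM {Suc k..l} M)" using Suc by simp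
  also have "\<dots> = (\<integral>\<^sup>+ x. (\<integral>\<^sup>+ y. mnorm M p k g (x(Suc k := y)) \<partial>M (Suc k)) \<partial>PiM {Suc (Suc k)..l} M)"
    unfolding interval_insert[OF Suc(2)]
    using measurable_mnorm[of g k] assms(2) Suc(2) unfolding interval_insert[OF Suc(2)]
    by (intro nn_integral_PiM_insert) (auto intro: sigma_finite_M)
  finally show ?case using assms(1)[of "Suc k"] Suc by (simp add: Lnorm_1)
qed (simp add: mnorm.simps(1)[abs_def])

lemma N_1_eq:
  assumes "\<And>k. k \<in> {1..l} \<Longrightarrow> p k = 1" and "g \<in> borel_measurable X"
  shows "N g = (\<integral>\<^sup>+ x. g x \<partial>X)"
proof -
  have "(\<integral>\<^sup>+ x. mnorm M p l g x \<partial>PiM {Suc l..l} M) = (\<integral>\<^sup>+ x. mnorm M p l g (\<lambda>_. undefined) \<partial>PiM {Suc l..l} M)"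
    by (rule nn_integral_cong) (auto simp: space_PiM)
  then show ?thesis
    using nn_integral_X_eq_mnorm[OF assms order_refl] by (simp add: N_eq_mnorm space_PiM_empty)
qed

text \<open>An \<open>Lnorm\<close> vanishes exactly for functions that vanish almost everywhere,
  whatever the exponent. Comparison with all exponents equal to \<open>1\<close> then identifies the
  functions of mixed norm \<open>0\<close> as the null functions of the product measure.\<close>

lemma mnorm_eq_0_iff:
  assumes "mixed_space M p' l" and [measurable]: "g \<in> borel_measurable X" and "k \<le> l" "x \<in> space (PiM {Suc k..l} M)"
  shows "mnorm M p k g x = 0 \<longleftrightarrow> mnorm M p' k g x = 0"
  using assms(3,4)
proof (induction k arbitrary: x)
  case (Suc k)
  interpret m': mixed_space M p' l by fact
  have "mnorm M p (Suc k) g x = 0 \<longleftrightarrow> (AE y in M (Suc k). mnorm M p k g (x(Suc k := y)) = 0)"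
    using measurable_mnorm_section[OF assms(2) Suc(2,3)] by (simp add: Lnorm_eq_0_iff)
  also have "\<dots> \<longleftrightarrow> (AE y in M (Suc k). mnorm M p' k g (x(Suc k := y)) = 0)"
    using Suc upd_in_space[OF Suc(2,3)] by (intro AE_cong) auto
  also have "\<dots> \<longleftrightarrow> mnorm M p' (Suc k) g x = 0"
    using m'.measurable_mnorm_section[OF assms(2) Suc(2,3)] by (simp add: Lnorm_eq_0_iff)
  finally show ?case .
qed simp

lemma undefined_in_space: "(\<lambda>_. undefined) \<in> space (PiM {Suc l..l} M)"
  by (simp add: space_PiM)

lemma function_norm_N: "function_norm X N"
proof (rule function_norm.intro)
  fix f :: "(nat \<Rightarrow> 'a) \<Rightarrow> ennreal" assume f [measurable]: "f \<in> borel_measurable X"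
  interpret m1: mixed_space M "\<lambda>_. 1" l
    by (rule mixed_space.intro[OF l_pos sigma_finite_M]) auto
  have "N f = 0 \<longleftrightarrow> mixed_norm M (\<lambda>_. 1) l f = 0"
    unfolding N_eq_mnorm m1.N_eq_mnorm
    by (rule mnorm_eq_0_iff[OF m1.mixed_space_axioms f order_refl undefined_in_space])
  then show "N f = 0 \<longleftrightarrow> (AE x in X. f x = 0)"
    using m1.N_1_eq[OF refl f] nn_integral_0_iff_AE[OF f] by simp
next
  fix u :: "nat \<Rightarrow> (nat \<Rightarrow> 'a) \<Rightarrow> ennreal" and w
  assume "\<And>n. u n \<in> borel_measurable X" "w \<in> borel_measurable X" "\<And>n x. x \<in> space X \<Longrightarrow> u n x \<le> w x"
    "N w < \<top>" "\<And>x. x \<in> space X \<Longrightarrow> (\<lambda>n. u n x) \<longlonglongrightarrow> 0"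
  then show "(\<lambda>n. N (u n)) \<longlonglongrightarrow> 0"
    unfolding N_eq_mnorm by (intro mnorm_dominated[OF _ _ _ _ order_refl undefined_in_space]) auto
next
  fix F :: "nat \<Rightarrow> (nat \<Rightarrow> 'a) \<Rightarrow> ennreal"
  assume "\<And>n. F n \<in> borel_measurable X"
  then show "N (\<lambda>x. \<Sum>n. F n x) \<le> (\<Sum>n. N (F n))"
    unfolding N_eq_mnorm by (rule mnorm_suminf[OF _ order_refl undefined_in_space])
next
  fix f :: "(nat \<Rightarrow> 'a) \<Rightarrow> ennreal" and c
  assume "f \<in> borel_measurable X"
  then show "N (\<lambda>x. c * f x) = c * N f"
    unfolding N_eq_mnorm by (rule mnorm_cmult[OF _ order_refl undefined_in_space])
next
  fix f g :: "(nat \<Rightarrow> 'a) \<Rightarrow> ennreal"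
  assume "\<And>x. x \<in> space X \<Longrightarrow> f x \<le> g x"
  then show "N f \<le> N g"
    unfolding N_eq_mnorm by (rule mnorm_mono[OF order_refl undefined_in_space])
qed

sublocale function_norm X N by (rule function_norm_N)

text \<open>By induction the norm over \<open>Q\<close> is moved inwards past one coordinate after
  another with \<open>Minkowski_Lnorm_swap\<close>; every swap requires the exponent of that
  coordinate to be at most \<open>q\<close>.\<close>

theorem N_Minkowski:
  assumes q: "\<And>k. k \<in> {1..l} \<Longrightarrow> p k \<le> q" and Q: "finite_measure Q"
    and g [measurable]: "(\<lambda>(\<omega>, x). g \<omega> x) \<in> borel_measurable (Q \<Otimes>\<^sub>M X)"
  shows "Lnorm Q q (\<lambda>\<omega>. N (g \<omega>)) \<le> N (\<lambda>x. Lnorm Q q (\<lambda>\<omega>. g \<omega> x))"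
proof -
  have "Lnorm Q q (\<lambda>\<omega>. mnorm M p k (g \<omega>) x) \<le> mnorm M p k (\<lambda>x. Lnorm Q q (\<lambda>\<omega>. g \<omega> x)) x"
    if "k \<le> l" "x \<in> space (PiM {Suc k..l} M)" for k x
    using that
  proof (induction k arbitrary: x)
    case (Suc k)
    have p: "0 < p (Suc k)" "p (Suc k) \<le> q" using p_ge_1[of "Suc k"] q[of "Suc k"] Suc by auto
    have m: "(\<lambda>(\<omega>, y). mnorm M p k (g \<omega>) (x(Suc k := y))) \<in> borel_measurable (Q \<Otimes>\<^sub>M M (Suc k))"
    proof -
      have [measurable]: "(\<lambda>z. x(Suc k := snd z)) \<in> measurable (Q \<Otimes>\<^sub>M M (Suc k)) (PiM {Suc k..l} M)"
        using measurable_compose[OF measurable_snd measurable_upd[OF Suc(2,3)]] .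
      have "(\<lambda>z. (fst z, x(Suc k := snd z))) \<in> measurable (Q \<Otimes>\<^sub>M M (Suc k)) (Q \<Otimes>\<^sub>M PiM {Suc k..l} M)"
        by measurable
      from measurable_compose[OF this measurable_mnorm_param[OF g, of k]] Suc(2)
      show ?thesis by (simp add: split_beta')
    qed
    have "Lnorm Q q (\<lambda>\<omega>. mnorm M p (Suc k) (g \<omega>) x) \<le>
        Lnorm (M (Suc k)) (p (Suc k)) (\<lambda>y. Lnorm Q q (\<lambda>\<omega>. mnorm M p k (g \<omega>) (x(Suc k := y))))"
      unfolding mnorm.simps using sigma_finite_M Suc p Q m by (intro Minkowski_Lnorm_swap) auto
    also have "\<dots> \<le> mnorm M p (Suc k) (\<lambda>x. Lnorm Q q (\<lambda>\<omega>. g \<omega> x)) x"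
      unfolding mnorm.simps using Suc p upd_in_space[OF Suc(2,3)] by (intro Lnorm_mono) auto
    finally show ?case .
  qed simp
  from this[OF order_refl undefined_in_space] show ?thesis by (simp add: N_eq_mnorm)
qed

text \<open>The indicator of a rectangle is a product. Each integration turns one factor into a
  power of a measure, while the factors of the coordinates not yet integrated act as
  constants.\<close>

lemma N_rectangle:
  assumes A: "\<And>i. i \<in> {1..l} \<Longrightarrow> A i \<in> sets (M i)"
  shows "N (indicator (PiE {1..l} A)) = (\<Prod>i\<in>{1..l}. ennreal_powr (emeasure (M i) (A i)) (1 / p i))"
proof -
  have "mnorm M p k (indicator (PiE {1..l} A)) x =
      (\<Prod>i\<in>{1..k}. ennreal_powr (emeasure (M i) (A i)) (1 / p i)) * (\<Prod>i\<in>{Suc k..l}. indicator (A i) (x i))"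
    if "k \<le> l" "x \<in> space (PiM {Suc k..l} M)" for k x
    using that
  proof (induction k arbitrary: x)
    case 0
    then have "x \<in> extensional {1..l}" by (auto simp: space_PiM PiE_def)
    then show ?case by (auto simp: indicator_def PiE_def Pi_def prod_zero_iff)
  next
    case (Suc k)
    let ?c = "(\<Prod>i\<in>{1..k}. ennreal_powr (emeasure (M i) (A i)) (1 / p i))"
      and ?d = "(\<Prod>i\<in>{Suc (Suc k)..l}. indicator (A i) (x i)) :: ennreal"
    have p: "0 < p (Suc k)" using p_ge_1[of "Suc k"] Suc by auto
    have Ak: "A (Suc k) \<in> sets (M (Suc k))" using A[of "Suc k"] Suc by auto
    have "mnorm M p (Suc k) (indicator (PiE {1..l} A)) x =
        Lnorm (M (Suc k)) (p (Suc k)) (\<lambda>y. ?c * ?d * indicator (A (Suc k)) y)"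
      unfolding mnorm.simps
    proof (rule Lnorm_cong)
      fix y assume y: "y \<in> space (M (Suc k))"
      have "(\<Prod>i\<in>{Suc k..l}. indicator (A i) ((x(Suc k := y)) i)) = ?d * (indicator (A (Suc k)) y :: ennreal)"
          unfolding interval_insert[OF Suc(2)] by (auto simp: mult.commute intro!: arg_cong2[where f = times] prod.cong)
      then show "mnorm M p k (indicator (PiE {1..l} A)) (x(Suc k := y)) = ?c * ?d * indicator (A (Suc k)) y"
        using Suc upd_in_space[OF Suc(2,3) y] by (simp add: mult.assoc)
    qed
    also have "\<dots> = ?c * ?d * ennreal_powr (emeasure (M (Suc k)) (A (Suc k))) (1 / p (Suc k))"
      using p Ak by (simp add: Lnorm_cmult Lnorm_indicator)
    finally show ?case by (simp add: mult_ac)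
  qed
  from this[OF order_refl undefined_in_space] show ?thesis by (simp add: N_eq_mnorm)
qed

end

declare One_nat_def [simp del]

section \<open>Almost everywhere limits and completeness in a function norm\<close>

context function_norm
begin

text \<open>Countable subadditivity bounds the norm of the series of distances. This series is
  therefore finite almost everywhere, and its terms tend to \<open>0\<close> there.\<close>

lemma AE_tendsto_of_summable_N:
  fixes u :: "nat \<Rightarrow> 'x \<Rightarrow> real"
  assumes [measurable]: "\<And>n. u n \<in> borel_measurable X" "f \<in> borel_measurable X"
    and fin: "(\<Sum>n. N (\<lambda>x. ennreal \<bar>u n x - f x\<bar>)) < \<top>"
  shows "AE x in X. (\<lambda>n. u n x) \<longlonglongrightarrow> f x"
proof -
  have "N (\<lambda>x. \<Sum>n. ennreal \<bar>u n x - f x\<bar>) \<le> (\<Sum>n. N (\<lambda>x. ennreal \<bar>u n x - f x\<bar>))"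
    by (rule N_suminf) measurable
  with fin have "AE x in X. (\<Sum>n. ennreal \<bar>u n x - f x\<bar>) < \<top>"
    by (intro N_finite_AE) auto
  then show ?thesis
  proof eventually_elim
    case (elim x)
    then have "summable (\<lambda>n. \<bar>u n x - f x\<bar>)" by (intro summable_suminf_not_top) auto
    then have "(\<lambda>n. \<bar>u n x - f x\<bar>) \<longlonglongrightarrow> 0" by (rule summable_LIMSEQ_zero)
    then show ?case by (simp add: tendsto_rabs_zero_iff LIM_zero_iff)
  qed
qed

text \<open>The Riesz-Fischer argument: where the series of increments converges absolutely, the
  sequence telescopes to a limit, and the tail of the series bounds the distance to it. The limit of
  the Gaussian fields is obtained from this.\<close>

lemma N_complete:
  fixes u :: "nat \<Rightarrow> 'x \<Rightarrow> real"
  assumes [measurable]: "\<And>n. u n \<in> borel_measurable X"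
    and fin: "(\<Sum>n. N (\<lambda>x. ennreal \<bar>u (Suc n) x - u n x\<bar>)) < \<top>"
  obtains S where "S \<in> borel_measurable X"
    "\<And>m. N (\<lambda>x. ennreal \<bar>S x - u m x\<bar>) \<le> (\<Sum>n. N (\<lambda>x. ennreal \<bar>u (Suc (n + m)) x - u (n + m) x\<bar>))"
proof
  \<comment> \<open>Where the sequence diverges, \<open>lim\<close> has an unspecified value; such
    points lie in the null set on which the series of increments is infinite.\<close>
  define S where "S x = lim (\<lambda>n. u n x)" for x
  show S [measurable]: "S \<in> borel_measurable X"
    unfolding S_def[abs_def] by (rule borel_measurable_lim_metric) simp
  have "N (\<lambda>x. \<Sum>n. ennreal \<bar>u (Suc n) x - u n x\<bar>) \<le> (\<Sum>n. N (\<lambda>x. ennreal \<bar>u (Suc n) x - u n x\<bar>))"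
    by (rule N_suminf) measurable
  with fin have ae: "AE x in X. (\<Sum>n. ennreal \<bar>u (Suc n) x - u n x\<bar>) < \<top>"
    by (intro N_finite_AE) auto
  fix m
  have "AE x in X. ennreal \<bar>S x - u m x\<bar> \<le> (\<Sum>n. ennreal \<bar>u (Suc (n + m)) x - u (n + m) x\<bar>)"
    using ae
  proof eventually_elim
    case (elim x)
    let ?d = "\<lambda>n. u (Suc n) x - u n x"
    have abs: "summable (\<lambda>n. \<bar>?d n\<bar>)" using elim by (intro summable_suminf_not_top) auto
    then have absm: "summable (\<lambda>n. \<bar>?d (n + m)\<bar>)" by (subst summable_iff_shift)
    have "(\<lambda>n. \<Sum>i<n. ?d (i + m)) = (\<lambda>n. u (n + m) x - u m x)"
      using sum_lessThan_telescope[of "\<lambda>i. u (i + m) x"] by simp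
    then have "(\<lambda>n. u (n + m) x - u m x) \<longlonglongrightarrow> (\<Sum>n. ?d (n + m))"
      using summable_LIMSEQ[OF summable_rabs_cancel[OF absm]] by simp
    then have "(\<lambda>n. (u (n + m) x - u m x) + u m x) \<longlonglongrightarrow> (\<Sum>n. ?d (n + m)) + u m x"
      by (intro tendsto_intros)
    then have "(\<lambda>n. u n x) \<longlonglongrightarrow> (\<Sum>n. ?d (n + m)) + u m x"
      using LIMSEQ_offset[of "\<lambda>n. u n x" m] by simp
    then have "S x = (\<Sum>n. ?d (n + m)) + u m x" unfolding S_def by (rule limI)
    then have "\<bar>S x - u m x\<bar> \<le> (\<Sum>n. \<bar>?d (n + m)\<bar>)" using summable_rabs[OF absm] by simp
    then have "ennreal \<bar>S x - u m x\<bar> \<le> ennreal (\<Sum>n. \<bar>?d (n + m)\<bar>)" by (rule ennreal_leI)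
    also have "\<dots> = (\<Sum>n. ennreal \<bar>?d (n + m)\<bar>)" by (rule suminf_ennreal2[symmetric]) (use absm in auto)
    finally show ?case .
  qed
  then have "N (\<lambda>x. ennreal \<bar>S x - u m x\<bar>) \<le> N (\<lambda>x. \<Sum>n. ennreal \<bar>u (Suc (n + m)) x - u (n + m) x\<bar>)"
    by (intro N_mono_AE) auto
  also have "\<dots> \<le> (\<Sum>n. N (\<lambda>x. ennreal \<bar>u (Suc (n + m)) x - u (n + m) x\<bar>))"
    by (rule N_suminf) measurable
  finally show "N (\<lambda>x. ennreal \<bar>S x - u m x\<bar>) \<le> (\<Sum>n. N (\<lambda>x. ennreal \<bar>u (Suc (n + m)) x - u (n + m) x\<bar>))" .
qed

end

section \<open>The mixed Lebesgue space as a measurable space\<close>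

context mixed_space
begin

abbreviation V :: "((nat \<Rightarrow> 'a) \<Rightarrow> real) set" where "V \<equiv> mixed_Lp M p l"
abbreviation nn :: "((nat \<Rightarrow> 'a) \<Rightarrow> real) \<Rightarrow> real" where "nn \<equiv> mixed_Lp_norm M p l"
abbreviation BV :: "((nat \<Rightarrow> 'a) \<Rightarrow> real) measure" where "BV \<equiv> seminorm_borel V nn"

lemma V_iff: "f \<in> V \<longleftrightarrow> f \<in> borel_measurable X \<and> N (\<lambda>x. ennreal \<bar>f x\<bar>) < \<top>"
  by (simp add: mixed_Lp_def)

lemma V_measurable: "f \<in> V \<Longrightarrow> f \<in> borel_measurable X" by (simp add: V_iff)

lemma ennreal_nn: "f \<in> V \<Longrightarrow> ennreal (nn f) = N (\<lambda>x. ennreal \<bar>f x\<bar>)"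
  by (simp add: V_iff mixed_Lp_norm_def)

lemma nn_nonneg [simp]: "0 \<le> nn f" by (simp add: mixed_Lp_norm_def)

lemma V_0 [simp]: "(\<lambda>x. 0) \<in> V" by (simp add: V_iff)

lemma V_add: "f \<in> V \<Longrightarrow> g \<in> V \<Longrightarrow> (\<lambda>x. f x + g x) \<in> V"
  using N_abs_add[of f g] by (auto simp: V_iff intro: le_less_trans)

lemma V_scale: "f \<in> V \<Longrightarrow> (\<lambda>x. c * f x) \<in> V"
  using N_abs_cmult[of f c] by (auto simp: V_iff ennreal_mult_less_top)

lemma V_diff: "f \<in> V \<Longrightarrow> g \<in> V \<Longrightarrow> (\<lambda>x. f x - g x) \<in> V"
  using V_add[of f "\<lambda>x. -1 * g x"] V_scale[of g "-1"] by simp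

lemma V_sum: "(\<And>i. i \<in> I \<Longrightarrow> f i \<in> V) \<Longrightarrow> (\<lambda>x. \<Sum>i\<in>I. f i x) \<in> V"
  by (induction I rule: infinite_finite_induct) (auto intro: V_add)

lemma nn_add: "f \<in> V \<Longrightarrow> g \<in> V \<Longrightarrow> nn (\<lambda>x. f x + g x) \<le> nn f + nn g"
  using N_abs_add[of f g] V_add[of f g]
  by (simp add: V_measurable ennreal_nn[symmetric] ennreal_plus[symmetric] del: ennreal_plus)

lemma nn_triangle: "f \<in> V \<Longrightarrow> g \<in> V \<Longrightarrow> h \<in> V \<Longrightarrow> nn (\<lambda>x. f x - h x) \<le> nn (\<lambda>x. f x - g x) + nn (\<lambda>x. g x - h x)"
  using nn_add[of "\<lambda>x. f x - g x" "\<lambda>x. g x - h x"] by (simp add: V_diff)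

lemma nn_cmult: "f \<in> V \<Longrightarrow> nn (\<lambda>x. c * f x) = \<bar>c\<bar> * nn f"
  by (simp add: mixed_Lp_norm_def N_abs_cmult V_measurable enn2real_mult)

lemma nn_commute: "nn (\<lambda>x. f x - g x) = nn (\<lambda>x. g x - f x)"
  by (simp add: mixed_Lp_norm_def abs_minus_commute)

lemma nn_diff_eq_0:
  assumes "f \<in> borel_measurable X" "g \<in> borel_measurable X" "AE x in X. f x = g x"
  shows "nn (\<lambda>x. f x - g x) = 0"
proof -
  have "N (\<lambda>x. ennreal \<bar>f x - g x\<bar>) = 0"
    using assms(3) by (subst N_eq_0_iff) (use assms in \<open>auto elim: eventually_mono\<close>)
  then show ?thesis by (simp add: mixed_Lp_norm_def)
qed

lemma V_cong_AE:
  assumes "f \<in> V" "g \<in> borel_measurable X" "AE x in X. f x = g x"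
  shows "g \<in> V"
proof -
  have "N (\<lambda>x. ennreal \<bar>f x\<bar>) = N (\<lambda>x. ennreal \<bar>g x\<bar>)"
    using assms V_measurable[OF assms(1)] by (intro N_cong_AE) (auto elim: eventually_mono)
  then show ?thesis using assms by (simp add: V_iff)
qed

lemma space_BV: "space BV = V"
proof -
  have "{U. openin (seminorm_topology V nn) U} \<subseteq> Pow V" by (auto simp: openin_seminorm_topology)
  then show ?thesis by (simp add: seminorm_borel_def)
qed

lemma sets_BV: "sets BV = sigma_sets V {U. openin (seminorm_topology V nn) U}"
proof -
  have "{U. openin (seminorm_topology V nn) U} \<subseteq> Pow V" by (auto simp: openin_seminorm_topology)
  then show ?thesis by (simp add: seminorm_borel_def)
qed

lemma open_in_BV: "openin (seminorm_topology V nn) U \<Longrightarrow> U \<in> sets BV"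
  by (auto simp: sets_BV)

lemma openin_ball:
  assumes f: "f \<in> V" shows "openin (seminorm_topology V nn) {g \<in> V. nn (\<lambda>x. g x - f x) < r}"
  unfolding openin_seminorm_topology
proof (intro conjI ballI)
  fix g assume g: "g \<in> {g \<in> V. nn (\<lambda>x. g x - f x) < r}"
  show "\<exists>e>0. \<forall>h\<in>V. nn (\<lambda>x. h x - g x) < e \<longrightarrow> h \<in> {g \<in> V. nn (\<lambda>x. g x - f x) < r}"
  proof (intro exI[of _ "r - nn (\<lambda>x. g x - f x)"] conjI ballI impI)
    fix h assume "h \<in> V" "nn (\<lambda>x. h x - g x) < r - nn (\<lambda>x. g x - f x)"
    then show "h \<in> {g \<in> V. nn (\<lambda>x. g x - f x) < r}" using nn_triangle[of h g f] f g by auto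
  qed (use g in auto)
qed auto

lemma measurable_nn_diff [measurable]: "f \<in> V \<Longrightarrow> (\<lambda>g. nn (\<lambda>x. g x - f x)) \<in> borel_measurable BV"
  by (rule borel_measurableI_less) (simp add: space_BV open_in_BV openin_ball)

lemma continuous_map_measurable:
  assumes "continuous_map (seminorm_topology V nn) euclideanreal \<phi>"
  shows "\<phi> \<in> borel_measurable BV"
proof (rule borel_measurableI)
  fix S :: "real set" assume "open S"
  then have "openin (seminorm_topology V nn) {x \<in> V. \<phi> x \<in> S}"
    using assms by (auto simp: continuous_map topspace_seminorm_topology)
  moreover have "\<phi> -` S \<inter> space BV = {x \<in> V. \<phi> x \<in> S}" by (auto simp: space_BV)
  ultimately show "\<phi> -` S \<inter> space BV \<in> sets BV" by (simp add: open_in_BV)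
qed

lemma continuous_map_iff:
  "continuous_map (seminorm_topology V nn) euclideanreal \<phi> \<longleftrightarrow>
    (\<forall>f\<in>V. \<forall>e>0. \<exists>d>0. \<forall>g\<in>V. nn (\<lambda>x. g x - f x) < d \<longrightarrow> \<bar>\<phi> g - \<phi> f\<bar> < e)" (is "?l \<longleftrightarrow> ?r")
proof
  assume l: ?l
  show ?r
  proof (intro ballI allI impI)
    fix f and e :: real assume f: "f \<in> V" "0 < e"
    have "openin (seminorm_topology V nn) {x \<in> V. \<phi> x \<in> ball (\<phi> f) e}"
      using l by (auto simp: continuous_map topspace_seminorm_topology)
    with f obtain d where "0 < d" "\<forall>g\<in>V. nn (\<lambda>x. g x - f x) < d \<longrightarrow> g \<in> {x \<in> V. \<phi> x \<in> ball (\<phi> f) e}"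
      unfolding openin_seminorm_topology by auto
    then show "\<exists>d>0. \<forall>g\<in>V. nn (\<lambda>x. g x - f x) < d \<longrightarrow> \<bar>\<phi> g - \<phi> f\<bar> < e"
      by (intro exI[of _ d]) (auto simp: dist_real_def abs_minus_commute)
  qed
next
  assume r: ?r
  show ?l unfolding continuous_map topspace_seminorm_topology
  proof (intro conjI allI impI)
    fix U :: "real set" assume "openin euclideanreal U"
    then have U: "open U" by simp
    show "openin (seminorm_topology V nn) {x \<in> V. \<phi> x \<in> U}"
      unfolding openin_seminorm_topology
    proof (intro conjI ballI)
      fix f assume f: "f \<in> {x \<in> V. \<phi> x \<in> U}"
      then obtain e where e: "0 < e" "ball (\<phi> f) e \<subseteq> U" using U open_contains_ball by blast
      obtain d where d: "0 < d" "\<forall>g\<in>V. nn (\<lambda>x. g x - f x) < d \<longrightarrow> \<bar>\<phi> g - \<phi> f\<bar> < e"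
        using r f e by blast
      have "\<phi> g \<in> ball (\<phi> f) e" if "g \<in> V" "nn (\<lambda>x. g x - f x) < d" for g
        using d that by (auto simp: dist_real_def abs_minus_commute)
      then show "\<exists>e>0. \<forall>g\<in>V. nn (\<lambda>x. g x - f x) < e \<longrightarrow> g \<in> {x \<in> V. \<phi> x \<in> U}"
        using d(1) e(2) by blast
    qed auto
  qed simp
qed

lemma rectangle_sets: "(\<And>i. i \<in> {1..l} \<Longrightarrow> A i \<in> sets (M i)) \<Longrightarrow> PiE {1..l} A \<in> sets X"
  by (intro sets_PiM_I_finite) auto

lemma ennreal_prod_less_top:
  fixes f :: "'i \<Rightarrow> ennreal"
  shows "(\<And>i. i \<in> I \<Longrightarrow> f i < \<top>) \<Longrightarrow> (\<Prod>i\<in>I. f i) < \<top>"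
  by (induction I rule: infinite_finite_induct) (auto simp: ennreal_mult_less_top)

lemma rectangle_in_V:
  assumes "\<And>i. i \<in> {1..l} \<Longrightarrow> A i \<in> finite_measure_sets (M i)"
  shows "indicator (PiE {1..l} A) \<in> V"
proof -
  have "N (\<lambda>x. ennreal \<bar>indicator (PiE {1..l} A) x\<bar>) = N (indicator (PiE {1..l} A))"
    by (intro arg_cong[where f = N]) (auto simp: indicator_def)
  also have "\<dots> < \<top>"
    using assms by (subst N_rectangle) (auto simp: finite_measure_sets_def intro!: ennreal_prod_less_top)
  finally have fin: "N (\<lambda>x. ennreal \<bar>indicator (PiE {1..l} A) x\<bar>) < \<top>" .
  have "PiE {1..l} A \<in> sets X" using assms by (intro rectangle_sets) (auto simp: finite_measure_sets_def)
  then show ?thesis unfolding V_iff using fin by (intro conjI borel_measurable_indicator)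
qed

text \<open>These are the sets \<open>E n\<close> required by \<open>density\<close>. Rectangles
  with sides of finite measure are chosen because \<open>N_rectangle\<close> shows that their norms
  are finite.\<close>

lemma rectangle_exhaustion:
  obtains E :: "nat \<Rightarrow> nat \<Rightarrow> 'a set" where
    "\<And>i n. i \<in> {1..l} \<Longrightarrow> E i n \<in> finite_measure_sets (M i)"
    "\<And>n. PiE {1..l} (\<lambda>i. E i n) \<in> sets X" "incseq (\<lambda>n. PiE {1..l} (\<lambda>i. E i n))"
    "(\<Union>n. PiE {1..l} (\<lambda>i. E i n)) = space X" "\<And>n. N (indicator (PiE {1..l} (\<lambda>i. E i n))) < \<top>"
proof -
  have "\<forall>i\<in>{1..l}. \<exists>E. range E \<subseteq> sets (M i) \<and> (\<Union>n. E n) = space (M i) \<and> (\<forall>n. emeasure (M i) (E n) \<noteq> \<infinity>) \<and> incseq E"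
    using sigma_finite_M sigma_finite_measure.sigma_finite_incseq by metis
  then obtain E :: "nat \<Rightarrow> nat \<Rightarrow> 'a set" where
    E: "\<And>i. i \<in> {1..l} \<Longrightarrow> range (E i) \<subseteq> sets (M i)" "\<And>i. i \<in> {1..l} \<Longrightarrow> (\<Union>n. E i n) = space (M i)"
      "\<And>i n. i \<in> {1..l} \<Longrightarrow> emeasure (M i) (E i n) \<noteq> \<infinity>" "\<And>i. i \<in> {1..l} \<Longrightarrow> incseq (E i)"
    by metis
  have fin_E: "E i n \<in> finite_measure_sets (M i)" if "i \<in> {1..l}" for i n
    using E(1,3)[OF that] by (auto simp: finite_measure_sets_def less_top)
  let ?E = "\<lambda>n. PiE {1..l} (\<lambda>i. E i n)"
  show thesis
  proof (rule that[of E])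
    show "E i n \<in> finite_measure_sets (M i)" if "i \<in> {1..l}" for i n using that by (rule fin_E)
    show "?E n \<in> sets X" for n using E(1) by (intro rectangle_sets) auto
    show "incseq ?E" using E(4) by (auto simp: incseq_def PiE_def Pi_def) (metis atLeastAtMost_iff subsetD)
    show "(\<Union>n. ?E n) = space X"
    proof (intro equalityI subsetI)
      fix x assume "x \<in> (\<Union>n. ?E n)"
      then show "x \<in> space X" using E(2) by (fastforce simp: space_PiM PiE_def Pi_def)
    next
      fix x assume x: "x \<in> space X"
      have "\<exists>n. x i \<in> E i n" if i: "i \<in> {1..l}" for i
      proof -
        have "x i \<in> (\<Union>n. E i n)" unfolding E(2)[OF i] using x i by (auto simp: space_PiM PiE_def Pi_def)
        then show ?thesis by blast
      qed
      then obtain n where n: "\<And>i. i \<in> {1..l} \<Longrightarrow> x i \<in> E i (n i)" by metis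
      \<comment> \<open>Finitely many coordinates have a largest index, and the sides increase with
        the index.\<close>
      let ?n = "Max (n ` {1..l})"
      have "x i \<in> E i ?n" if i: "i \<in> {1..l}" for i
        using n[OF i] E(4)[OF i] i Max_ge[of "n ` {1..l}" "n i"] unfolding incseq_def by (meson finite_imageI finite_atLeastAtMost imageI subsetD)
      then have "x \<in> ?E ?n" using x by (auto simp: space_PiM PiE_def)
      then show "x \<in> (\<Union>n. ?E n)" by blast
    qed
    show "N (indicator (?E n)) < \<top>" for n
    proof (subst N_rectangle)
      show "E i n \<in> sets (M i)" if "i \<in> {1..l}" for i using E(1)[OF that] by auto
      show "(\<Prod>i\<in>{1..l}. ennreal_powr (emeasure (M i) (E i n)) (1 / p i)) < \<top>"
        using E(3) by (intro ennreal_prod_less_top) (simp add: less_top[symmetric])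
    qed
  qed
qed

end

section \<open>Separability and measurable maps into the space\<close>

locale separable_mixed_space = mixed_space +
  assumes separable_M: "\<And>k. k \<in> {1..l} \<Longrightarrow> separable_measure (M k)"
begin

text \<open>The countable dense set consists of rational combinations of rectangles with sides from
  the countable dense families \<open>C k\<close>. Its closure \<open>W\<close> in \<open>V\<close>
  is shown to be linear, closed and to contain all rectangles with sides of finite measure; then
  \<open>density\<close> makes \<open>W\<close> everything.\<close>

theorem V_separable: "\<exists>D. countable D \<and> D \<subseteq> V \<and> (\<forall>f\<in>V. \<forall>e>0. \<exists>g\<in>D. nn (\<lambda>x. f x - g x) < e)"
proof -
  have "\<forall>k\<in>{1..l}. \<exists>C. countable C \<and> C \<subseteq> finite_measure_sets (M k) \<and>
        (\<forall>A \<in> finite_measure_sets (M k). \<forall>e>0. \<exists>B\<in>C. emeasure (M k) (A - B) + emeasure (M k) (B - A) < e)"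
    using separable_M unfolding separable_measure_def by auto
  then obtain C where C: "\<And>k. k \<in> {1..l} \<Longrightarrow> countable (C k)" "\<And>k. k \<in> {1..l} \<Longrightarrow> C k \<subseteq> finite_measure_sets (M k)"
      "\<And>k A e. k \<in> {1..l} \<Longrightarrow> A \<in> finite_measure_sets (M k) \<Longrightarrow> e > 0 \<Longrightarrow>
        \<exists>B\<in>C k. emeasure (M k) (A - B) + emeasure (M k) (B - A) < e"
    by metis
  \<comment> \<open>Combinations are coded by lists, so countability follows from that of lists over
    a countable set and addition becomes concatenation.\<close>
  define comb :: "(real \<times> (nat \<Rightarrow> 'a set)) list \<Rightarrow> (nat \<Rightarrow> 'a) \<Rightarrow> real"
    where "comb L x = (\<Sum>(c, A)\<leftarrow>L. c * indicator (PiE {1..l} A) x)" for L x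
  define D where "D = comb ` lists (\<rat> \<times> PiE {1..l} C)"
  have "countable (PiE {1..l} C)" using C(1) by (intro countable_PiE) auto
  then have cD: "countable D" unfolding D_def
    by (intro countable_image countable_lists countable_SIGMA) (auto simp: countable_rat)
  have comb_V: "comb L \<in> V" if "L \<in> lists (UNIV \<times> PiE {1..l} C)" for L
    using that
  proof (induction L)
    case Nil then show ?case by (simp add: comb_def[abs_def])
  next
    case (Cons a L)
    have "indicator (PiE {1..l} (snd a)) \<in> V"
      using Cons C(2) by (intro rectangle_in_V) (fastforce simp: PiE_def Pi_def dest: subsetD)
    then have "(\<lambda>x. fst a * indicator (PiE {1..l} (snd a)) x + comb L x) \<in> V"
      using Cons by (intro V_add V_scale) auto
    then show ?case by (simp add: comb_def[abs_def] split_beta')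
  qed
  have DV: "D \<subseteq> V"
  proof
    fix f assume "f \<in> D"
    then obtain L where L: "L \<in> lists (\<rat> \<times> PiE {1..l} C)" "f = comb L" unfolding D_def by auto
    have "lists (\<rat> \<times> PiE {1..l} C) \<subseteq> lists (UNIV \<times> PiE {1..l} C)" by (intro lists_mono) auto
    from comb_V[OF subsetD[OF this L(1)]] show "f \<in> V" unfolding L(2) .
  qed
  define W where "W = {f \<in> V. \<forall>e>0. \<exists>g\<in>D. nn (\<lambda>x. f x - g x) < e}"
  have W_D: "\<exists>g\<in>D. nn (\<lambda>x. f x - g x) < e" if "f \<in> W" "0 < e" for f e
    using that unfolding W_def by auto
  have D_add: "(\<lambda>x. f x + g x) \<in> D" if "f \<in> D" "g \<in> D" for f g
  proof -
    from that obtain K L where "K \<in> lists (\<rat> \<times> PiE {1..l} C)" "L \<in> lists (\<rat> \<times> PiE {1..l} C)" "f = comb K" "g = comb L"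
      unfolding D_def by auto
    then show ?thesis unfolding D_def
      by (intro image_eqI[of _ _ "K @ L"]) (auto simp: comb_def[abs_def] fun_eq_iff)
  qed
  have D_scale: "(\<lambda>x. c * f x) \<in> D" if f: "f \<in> D" "c \<in> \<rat>" for f c
  proof -
    from f obtain L where L: "L \<in> lists (\<rat> \<times> PiE {1..l} C)" "f = comb L" unfolding D_def by auto
    have "(\<lambda>x. c * comb L x) = comb (map (\<lambda>a. (c * fst a, snd a)) L)"
      by (simp add: comb_def[abs_def] fun_eq_iff sum_list_const_mult[symmetric] o_def split_beta' mult.assoc)
    moreover have "map (\<lambda>a. (c * fst a, snd a)) L \<in> lists (\<rat> \<times> PiE {1..l} C)"
    proof -
      have "(c * fst a, snd a) \<in> \<rat> \<times> PiE {1..l} C" if "a \<in> set L" for a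
      proof -
        have "a \<in> \<rat> \<times> PiE {1..l} C" using L(1) that by (metis in_listsD)
        then show ?thesis using f(2) by (simp add: mem_Times_iff Rats_mult)
      qed
      then show ?thesis by (auto simp: in_lists_conv_set simp del: mem_Sigma_iff)
    qed
    ultimately show ?thesis unfolding D_def L(2) by auto
  qed
  have W_add: "(\<lambda>x. f x + g x) \<in> W" if fg: "f \<in> W" "g \<in> W" for f g
    unfolding W_def
  proof (intro CollectI conjI allI impI)
    show "(\<lambda>x. f x + g x) \<in> V" using fg by (auto simp: W_def intro: V_add)
    fix e :: real assume e: "0 < e"
    obtain f' where f': "f' \<in> D" "nn (\<lambda>x. f x - f' x) < e/2" using W_D[OF fg(1), of "e/2"] e by auto
    obtain g' where g': "g' \<in> D" "nn (\<lambda>x. g x - g' x) < e/2" using W_D[OF fg(2), of "e/2"] e by auto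
    note D = f'(1) g'(1) and lt = f'(2) g'(2)
    have "nn (\<lambda>x. (f x - f' x) + (g x - g' x)) \<le> nn (\<lambda>x. f x - f' x) + nn (\<lambda>x. g x - g' x)"
      using fg D DV by (intro nn_add V_diff) (auto simp: W_def)
    then have "nn (\<lambda>x. (f x + g x) - (f' x + g' x)) < e" using lt by (simp add: algebra_simps)
    then show "\<exists>h\<in>D. nn (\<lambda>x. (f x + g x) - h x) < e" using D_add[OF D] by (intro bexI[of _ "\<lambda>x. f' x + g' x"])
  qed
  have W_scale: "(\<lambda>x. c * f x) \<in> W" if f: "f \<in> W" for f c
    unfolding W_def
  proof (intro CollectI conjI allI impI)
    have fV: "f \<in> V" using f by (auto simp: W_def)
    then show "(\<lambda>x. c * f x) \<in> V" by (rule V_scale)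
    fix e :: real assume e: "0 < e"
    obtain g where g: "g \<in> D" "nn (\<lambda>x. f x - g x) < e / (2 * (\<bar>c\<bar> + 1))"
      using W_D[OF f, of "e / (2 * (\<bar>c\<bar> + 1))"] e by (auto simp: add_nonneg_pos)
    have gV: "g \<in> V" using g DV by auto
    \<comment> \<open>The error is split as \<open>c (f - g) + (c - r) g\<close> with a rational
      \<open>r\<close> near \<open>c\<close>. The \<open>1\<close> added in both denominators covers
      \<open>c = 0\<close> and \<open>nn g = 0\<close>.\<close>
    define d where "d = e / (2 * (nn g + 1))"
    have "0 < d" using e nn_nonneg[of g] by (simp add: d_def add_nonneg_pos)
    then obtain r where r: "r \<in> \<rat>" "c < r" "r < c + d" using Rats_dense_in_real[of c "c + d"] by auto
    have "nn (\<lambda>x. c * (f x - g x) + (c - r) * g x) \<le> nn (\<lambda>x. c * (f x - g x)) + nn (\<lambda>x. (c - r) * g x)"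
      using fV gV by (intro nn_add V_scale V_diff)
    also have "\<dots> = \<bar>c\<bar> * nn (\<lambda>x. f x - g x) + \<bar>c - r\<bar> * nn g"
      using fV gV nn_cmult[of "\<lambda>x. f x - g x" c] nn_cmult[of g "c - r"] by (simp add: V_diff)
    also have "\<dots> < e"
    proof -
      have "\<bar>c\<bar> * nn (\<lambda>x. f x - g x) \<le> \<bar>c\<bar> * (e / (2 * (\<bar>c\<bar> + 1)))"
        using g by (intro mult_left_mono) auto
      also have "\<dots> < e / 2" using e by (simp add: field_simps add_pos_nonneg)
      finally have 1: "\<bar>c\<bar> * nn (\<lambda>x. f x - g x) < e / 2" .
      have "\<bar>c - r\<bar> * nn g \<le> d * nn g" using r by (intro mult_right_mono) auto
      also have "\<dots> \<le> d * (nn g + 1)" using \<open>0 < d\<close> by (intro mult_left_mono) auto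
      also have "\<dots> = e / 2"
      proof -
        have *: "e / (2 * s) * s = e / 2" if "s \<noteq> 0" for s :: real using that by simp
        have "nn g + 1 \<noteq> 0" using nn_nonneg[of g] by linarith
        from *[OF this] show ?thesis unfolding d_def .
      qed
      finally show ?thesis using 1 by simp
    qed
    finally have "nn (\<lambda>x. c * f x - r * g x) < e" by (simp add: algebra_simps)
    then show "\<exists>h\<in>D. nn (\<lambda>x. c * f x - h x) < e" using D_scale[OF g(1) r(1)] by (intro bexI[of _ "\<lambda>x. r * g x"])
  qed
  have W_closed': "f \<in> W" if f: "f \<in> V" "\<And>e. 0 < e \<Longrightarrow> \<exists>g\<in>W. nn (\<lambda>x. f x - g x) < e" for f
    unfolding W_def
  proof (intro CollectI conjI allI impI)
    fix e :: real assume e: "0 < e"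
    obtain g where g: "g \<in> W" "nn (\<lambda>x. f x - g x) < e / 2" using f(2)[of "e / 2"] e by auto
    obtain h where h: "h \<in> D" "nn (\<lambda>x. g x - h x) < e / 2" using W_D[OF g(1), of "e / 2"] e by auto
    have "nn (\<lambda>x. f x - h x) \<le> nn (\<lambda>x. f x - g x) + nn (\<lambda>x. g x - h x)"
      using f g h DV by (intro nn_triangle) (auto simp: W_def)
    then show "\<exists>h\<in>D. nn (\<lambda>x. f x - h x) < e" using g h by (intro bexI[of _ h]) auto
  qed (rule f)
  \<comment> \<open>The sides are exchanged for members of the families \<open>C i\<close> one at a
    time. The induction runs over the number \<open>l - k\<close> of sides that are still arbitrary;
    when none is left the rectangle is in \<open>D\<close>.\<close>
  have W_rect: "indicator (PiE {1..l} A) \<in> W"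
    if "k \<le> l" "\<And>i. i \<in> {1..l} \<Longrightarrow> A i \<in> finite_measure_sets (M i)" "\<And>i. i \<in> {1..k} \<Longrightarrow> A i \<in> C i" for k A
    using that
  proof (induction "l - k" arbitrary: k A)
    case 0
    then have "k = l" by simp
    let ?A = "restrict A {1..l}"
    have "PiE {1..l} A = PiE {1..l} ?A" by (intro PiE_cong) auto
    then have "indicator (PiE {1..l} A) = comb [(1, ?A)]" by (simp add: comb_def[abs_def] fun_eq_iff)
    moreover have "comb [(1, ?A)] \<in> D" unfolding D_def using 0 \<open>k = l\<close> by (intro imageI) auto
    ultimately have *: "indicator (PiE {1..l} A) \<in> D" by simp
    moreover have "nn (\<lambda>x. indicator (PiE {1..l} A) x - indicator (PiE {1..l} A) x) < e" if "0 < e" for e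
      using that by (simp add: mixed_Lp_norm_def)
    ultimately show ?case using DV unfolding W_def by blast
  next
    case (Suc n k A)
    let ?j = "Suc k"
    have j: "?j \<in> {1..l}" using Suc(2,3) by auto
    have fin_A: "A i \<in> finite_measure_sets (M i)" if "i \<in> {1..l}" for i using Suc(4) that .
    show ?case
    proof (rule W_closed')
      show "indicator (PiE {1..l} A) \<in> V" using fin_A by (rule rectangle_in_V)
      fix e :: real assume e: "0 < e"
      have "(\<Prod>i\<in>{1..l} - {?j}. ennreal_powr (emeasure (M i) (A i)) (1 / p i)) < \<top>"
        using fin_A by (auto simp: finite_measure_sets_def intro!: ennreal_prod_less_top)
      then obtain c where c: "(\<Prod>i\<in>{1..l} - {?j}. ennreal_powr (emeasure (M i) (A i)) (1 / p i)) = ennreal c" "0 \<le> c"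
        by (cases "\<Prod>i\<in>{1..l} - {?j}. ennreal_powr (emeasure (M i) (A i)) (1 / p i)" rule: ennreal_cases) auto
      have pj: "0 < p ?j" using p_ge_1[OF j] by simp
      \<comment> \<open>Chosen so that the root \<open>1 / p ?j\<close> of \<open>d\<close>, times
        the norm \<open>c\<close> contributed by the other sides, is \<open>e * c / (c + 1)\<close>,
        which is below \<open>e\<close>.\<close>
      define d where "d = (e / (c + 1)) powr p ?j"
      have d: "0 < d" using e c by (auto simp: d_def)
      obtain B where B: "B \<in> C ?j" "emeasure (M ?j) (A ?j - B) + emeasure (M ?j) (B - A ?j) < ennreal d"
        using C(3)[OF j fin_A[OF j], of "ennreal d"] d by auto
      have Bs: "B \<in> finite_measure_sets (M ?j)" using B C(2)[OF j] by auto
      \<comment> \<open>Two rectangles differing in one side have as symmetric difference the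
        rectangle \<open>?S\<close> over the symmetric difference of these sides, so
        \<open>N_rectangle\<close> computes their distance.\<close>
      let ?B = "A(?j := B)" and ?S = "A(?j := (A ?j - B) \<union> (B - A ?j))"
      have meas: "A ?j \<in> sets (M ?j)" "B \<in> sets (M ?j)" using Bs fin_A[OF j] by (auto simp: finite_measure_sets_def)
      have "indicator (PiE {1..l} ?B) \<in> W"
        using Suc j Bs B by (intro Suc(1)[of ?j]) (auto simp: le_Suc_eq)
      moreover have "nn (\<lambda>x. indicator (PiE {1..l} A) x - indicator (PiE {1..l} ?B) x) < e"
      proof -
        have PiE_upd: "x \<in> PiE {1..l} (A(?j := S)) \<longleftrightarrow> x \<in> PiE ({1..l} - {?j}) A \<union> PiE {1..l} (A(?j := UNIV)) \<and>
            x \<in> extensional {1..l} \<and> (\<forall>i\<in>{1..l} - {?j}. x i \<in> A i) \<and> x ?j \<in> S" for x S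
          using j by (auto simp: PiE_def Pi_def)
        have "ennreal \<bar>indicator (PiE {1..l} A) x - indicator (PiE {1..l} ?B) x\<bar> = indicator (PiE {1..l} ?S) x" for x
          using PiE_upd[of x "A ?j"] PiE_upd[of x B] PiE_upd[of x "(A ?j - B) \<union> (B - A ?j)"]
          by (auto simp: indicator_def)
        then have "N (\<lambda>x. ennreal \<bar>indicator (PiE {1..l} A) x - indicator (PiE {1..l} ?B) x\<bar>) =
            N (indicator (PiE {1..l} ?S))" by presburger
        also have "\<dots> = (\<Prod>i\<in>{1..l}. ennreal_powr (emeasure (M i) (?S i)) (1 / p i))"
          using fin_A meas by (intro N_rectangle) (auto simp: finite_measure_sets_def)
        also have "\<dots> = ennreal_powr (emeasure (M ?j) ((A ?j - B) \<union> (B - A ?j))) (1 / p ?j) * ennreal c"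
          using j by (subst prod.remove[of _ ?j]) (auto simp: c(1)[symmetric] intro!: arg_cong2[where f = times] prod.cong)
        also have "\<dots> \<le> ennreal_powr (ennreal d) (1 / p ?j) * ennreal c"
        proof (intro mult_right_mono ennreal_powr_mono)
          have "emeasure (M ?j) ((A ?j - B) \<union> (B - A ?j)) \<le> emeasure (M ?j) (A ?j - B) + emeasure (M ?j) (B - A ?j)"
            using meas by (intro emeasure_subadditive) auto
          then show "emeasure (M ?j) ((A ?j - B) \<union> (B - A ?j)) \<le> ennreal d" using B(2) by simp
        qed (use pj in auto)
        also have "ennreal_powr (ennreal d) (1 / p ?j) = ennreal (e / (c + 1))"
          using pj e c d by (simp add: d_def powr_powr)
        also have "ennreal (e / (c + 1)) * ennreal c = ennreal (e / (c + 1) * c)"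
          using e c(2) by (subst ennreal_mult) auto
        finally have le: "N (\<lambda>x. ennreal \<bar>indicator (PiE {1..l} A) x - indicator (PiE {1..l} ?B) x\<bar>) \<le> ennreal (e / (c + 1) * c)" .
        have "nn (\<lambda>x. indicator (PiE {1..l} A) x - indicator (PiE {1..l} ?B) x) \<le> e / (c + 1) * c"
          unfolding mixed_Lp_norm_def by (rule enn2real_leI[rotated, OF le]) (use e c in simp)
        also have "\<dots> < e" using e c by (simp add: field_simps)
        finally show ?thesis .
      qed
      ultimately show "\<exists>g\<in>W. nn (\<lambda>x. indicator (PiE {1..l} A) x - g x) < e" by blast
    qed
  qed
  obtain E where fin_E: "\<And>i n. i \<in> {1..l} \<Longrightarrow> E i n \<in> finite_measure_sets (M i)"
    and E: "\<And>n. PiE {1..l} (\<lambda>i. E i n) \<in> sets X" "incseq (\<lambda>n. PiE {1..l} (\<lambda>i. E i n))"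
      "(\<Union>n. PiE {1..l} (\<lambda>i. E i n)) = space X" "\<And>n. N (indicator (PiE {1..l} (\<lambda>i. E i n))) < \<top>"
    using rectangle_exhaustion by blast
  let ?E = "\<lambda>n. PiE {1..l} (\<lambda>i. E i n)"
  have "f \<in> W" if f: "f \<in> V" for f
  proof (rule density[where G = "prod_algebra {1..l} M" and E = ?E])
    show "(\<lambda>x. f x + g x) \<in> W" if "f \<in> W" "g \<in> W" for f g using that by (rule W_add)
    show "(\<lambda>x. c * f x) \<in> W" if "f \<in> W" for f c using that by (rule W_scale)
    show "f \<in> W" if f [measurable]: "f \<in> borel_measurable X"
      and ap: "\<And>e::real. 0 < e \<Longrightarrow> \<exists>g\<in>W. g \<in> borel_measurable X \<and> N (\<lambda>x. ennreal \<bar>f x - g x\<bar>) < ennreal e" for f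
    proof -
      \<comment> \<open>One approximation at distance below \<open>1\<close> already shows that
        \<open>f\<close> has finite norm.\<close>
      obtain g where g: "g \<in> W" "N (\<lambda>x. ennreal \<bar>f x - g x\<bar>) < ennreal 1" using ap[of 1] by auto
      have gV: "g \<in> V" using g by (auto simp: W_def)
      have "(\<lambda>x. f x - g x) \<in> V" using g(2) V_measurable[OF gV] by (auto simp: V_iff intro: less_trans)
      from V_add[OF this gV] have fV: "f \<in> V" by simp
      show ?thesis
      proof (rule W_closed'[OF fV])
        fix e :: real assume e: "0 < e"
        obtain h where h: "h \<in> W" "N (\<lambda>x. ennreal \<bar>f x - h x\<bar>) < ennreal e" using ap[OF e] by auto
        have "ennreal (nn (\<lambda>x. f x - h x)) < ennreal e"
          using h fV by (subst ennreal_nn) (auto simp: W_def intro: V_diff)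
        then show "\<exists>g\<in>W. nn (\<lambda>x. f x - g x) < e" using h by (intro bexI[of _ h]) (auto simp: ennreal_less_iff)
      qed
    qed
    show "Int_stable (prod_algebra {1..l} M)" by (rule Int_stable_prod_algebra)
    show "prod_algebra {1..l} M \<subseteq> Pow (space X)"
      using prod_algebra_sets_into_space[of "{1..l}" M] by (simp add: space_PiM)
    show "sets X = sigma_sets (space X) (prod_algebra {1..l} M)" by (simp add: sets_PiM space_PiM)
    show "?E n \<in> sets X" "incseq ?E" "(\<Union>n. ?E n) = space X" "N (indicator (?E n)) < \<top>" for n by (rule E)+
    show "indicator (?E n) \<in> W" for n using fin_E by (intro W_rect[of 0]) auto
    show "indicator (A \<inter> ?E n) \<in> W" if A: "A \<in> prod_algebra {1..l} M" for A n
    proof -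
      obtain F where F: "A = PiE {1..l} F" "\<And>i. i \<in> {1..l} \<Longrightarrow> F i \<in> sets (M i)"
        using A unfolding prod_algebra_eq_finite[OF finite_atLeastAtMost] by (blast dest: Pi_mem)
      have "indicator (PiE {1..l} (\<lambda>i. F i \<inter> E i n)) \<in> W"
      proof (rule W_rect[of 0])
        fix i assume i: "i \<in> {1..l}"
        have "emeasure (M i) (F i \<inter> E i n) \<le> emeasure (M i) (E i n)"
          using fin_E[OF i] by (intro emeasure_mono) (auto simp: finite_measure_sets_def)
        also have "\<dots> < \<infinity>" using fin_E[OF i] by (simp add: finite_measure_sets_def)
        finally show "F i \<inter> E i n \<in> finite_measure_sets (M i)"
          using fin_E[OF i] F(2)[OF i] by (auto simp: finite_measure_sets_def)
      qed auto
      then show ?thesis by (simp add: F(1) PiE_Int)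
    qed
    show "f \<in> borel_measurable X" "N (\<lambda>x. ennreal \<bar>f x\<bar>) < \<top>" using f by (auto simp: V_iff)
  qed
  then show ?thesis using cD DV unfolding W_def by blast
qed

text \<open>Here separability is used: an open set is a countable union of balls with centers in
  \<open>D\<close> and rational radii, and the preimage of a ball is measurable because the distance
  of \<open>F \<omega>\<close> to its center is a measurable function of
  \<open>\<omega>\<close>.\<close>

lemma measurable_into_BV:
  assumes V: "\<And>\<omega>. \<omega> \<in> space Q \<Longrightarrow> F \<omega> \<in> V"
    and F [measurable]: "(\<lambda>(\<omega>, x). F \<omega> x) \<in> borel_measurable (Q \<Otimes>\<^sub>M X)"
  shows "F \<in> measurable Q BV"
  unfolding seminorm_borel_def
proof (rule measurable_measure_of)
  show "{U. openin (seminorm_topology V nn) U} \<subseteq> Pow V" by (auto simp: openin_seminorm_topology)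
  show "F \<in> space Q \<rightarrow> V" using V by auto
  fix U assume U: "U \<in> {U. openin (seminorm_topology V nn) U}"
  obtain D where D: "countable D" "D \<subseteq> V" "\<And>f e. f \<in> V \<Longrightarrow> 0 < e \<Longrightarrow> \<exists>g\<in>D. nn (\<lambda>x. f x - g x) < e"
    using V_separable by metis
  let ?I = "{(d, r). d \<in> D \<and> r \<in> \<rat> \<and> {g \<in> V. nn (\<lambda>x. g x - d x) < r} \<subseteq> U}"
  have "?I \<subseteq> D \<times> \<rat>" by auto
  then have I: "countable ?I" using D(1) countable_rat by (meson countable_SIGMA countable_subset)
  have "U = (\<Union>(d, r)\<in>?I. {g \<in> V. nn (\<lambda>x. g x - d x) < r})"
  proof (intro equalityI subsetI)
    fix f assume f: "f \<in> U"
    with U have fV: "f \<in> V" by (auto simp: openin_seminorm_topology)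
    obtain e where e: "0 < e" "\<And>g. g \<in> V \<Longrightarrow> nn (\<lambda>x. g x - f x) < e \<Longrightarrow> g \<in> U"
      using U f by (auto simp: openin_seminorm_topology)
    obtain r where r: "r \<in> \<rat>" "0 < r" "r < e / 2" using Rats_dense_in_real[of 0 "e / 2"] e by auto
    obtain d where d: "d \<in> D" "nn (\<lambda>x. f x - d x) < r" using D(3)[OF fV r(2)] by auto
    have "g \<in> U" if g: "g \<in> V" "nn (\<lambda>x. g x - d x) < r" for g
    proof (rule e(2)[OF g(1)])
      have "nn (\<lambda>x. g x - f x) \<le> nn (\<lambda>x. g x - d x) + nn (\<lambda>x. d x - f x)"
        using g fV d D(2) by (intro nn_triangle) auto
      then show "nn (\<lambda>x. g x - f x) < e" using g d r by (simp add: nn_commute[of d f])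
    qed
    then show "f \<in> (\<Union>(d, r)\<in>?I. {g \<in> V. nn (\<lambda>x. g x - d x) < r})" using d r fV by auto
  qed auto
  then have "F -` U \<inter> space Q = (\<Union>(d, r)\<in>?I. {\<omega> \<in> space Q. nn (\<lambda>x. F \<omega> x - d x) < r})"
    using V by fastforce
  also have "\<dots> \<in> sets Q"
  proof (rule sets.countable_UN'[OF I], safe)
    fix d r assume "d \<in> D"
    then have [measurable]: "d \<in> borel_measurable X" using D(2) by (auto simp: V_iff)
    have [measurable]: "(\<lambda>z. F (fst z) (snd z)) \<in> borel_measurable (Q \<Otimes>\<^sub>M X)" using F by (simp add: split_beta')
    have "(\<lambda>(\<omega>, x). ennreal \<bar>F \<omega> x - d x\<bar>) \<in> borel_measurable (Q \<Otimes>\<^sub>M X)"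
      unfolding split_beta' by measurable
    from measurable_N_param[OF this] have [measurable]: "(\<lambda>\<omega>. nn (\<lambda>x. F \<omega> x - d x)) \<in> borel_measurable Q"
      unfolding mixed_Lp_norm_def by measurable
    show "{\<omega> \<in> space Q. nn (\<lambda>x. F \<omega> x - d x) < r} \<in> sets Q" by measurable
  qed
  finally show "F -` U \<inter> space Q \<in> sets Q" .
qed

text \<open>Evaluation \<open>(v, x) \<mapsto> v x\<close> need not be jointly measurable, since it is sensitive to changes of
  \<open>v\<close> on null sets. A limit of nearest points in a countable dense set is a version of it that is.\<close>

theorem jointly_measurable_version:
  obtains \<Phi> :: "((nat \<Rightarrow> 'a) \<Rightarrow> real) \<Rightarrow> (nat \<Rightarrow> 'a) \<Rightarrow> real"
  where "(\<lambda>(v, x). \<Phi> v x) \<in> borel_measurable (BV \<Otimes>\<^sub>M X)" "\<And>v. v \<in> V \<Longrightarrow> AE x in X. \<Phi> v x = v x"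
proof -
  obtain D where D: "countable D" "D \<subseteq> V" "\<And>f e. f \<in> V \<Longrightarrow> 0 < e \<Longrightarrow> \<exists>g\<in>D. nn (\<lambda>x. f x - g x) < e"
    using V_separable by metis
  have "D \<noteq> {}" using D(3)[of "\<lambda>x. 0" 1] by auto
  then obtain d where d: "D = range (d :: nat \<Rightarrow> _)" using D(1) by (metis range_from_nat_into)
  have dV: "d i \<in> V" for i using d D(2) by auto
  then have [measurable]: "d i \<in> borel_measurable X" for i by (auto simp: V_iff)
  \<comment> \<open>Taking the least admissible index makes the choice measurable in
    \<open>v\<close>. The radii \<open>(1/2) ^ j\<close> are summable, so the chosen points converge
    to \<open>v\<close> almost everywhere and not merely in norm.\<close>
  define ind where "ind j v = (LEAST i. nn (\<lambda>x. v x - d i x) < (1/2) ^ j)" for j v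
  have ind: "nn (\<lambda>x. v x - d (ind j v) x) < (1/2) ^ j" if "v \<in> V" for v j
  proof -
    have "\<exists>i. nn (\<lambda>x. v x - d i x) < (1/2) ^ j" using D(3)[OF that, of "(1/2) ^ j"] d by auto
    then show ?thesis unfolding ind_def by (rule LeastI_ex)
  qed
  have ind_meas [measurable]: "ind j \<in> measurable BV (count_space UNIV)" for j
    unfolding ind_def[abs_def] using dV by measurable
  define u where "u j v x = d (ind j v) x" for j v x
  have u_meas [measurable]: "(\<lambda>z. u j (fst z) (snd z)) \<in> borel_measurable (BV \<Otimes>\<^sub>M X)" for j
    unfolding u_def
    by (rule measurable_compose_countable[where f = "\<lambda>i z. d i (snd z)" and g = "\<lambda>z. ind j (fst z)"]) measurable
  let ?P = "\<lambda>v x. lim (\<lambda>j. u j v x)"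
  have "(\<lambda>z. ?P (fst z) (snd z)) \<in> borel_measurable (BV \<Otimes>\<^sub>M X)"
    by (rule borel_measurable_lim_metric) measurable
  then have P_meas: "(\<lambda>(v, x). ?P v x) \<in> borel_measurable (BV \<Otimes>\<^sub>M X)" by (simp add: split_beta')
  have "AE x in X. ?P v x = v x" if v: "v \<in> V" for v
  proof -
  have uV: "u j v \<in> V" for j using dV by (simp add: u_def[abs_def])
  have "(\<Sum>j. N (\<lambda>x. ennreal \<bar>u j v x - v x\<bar>)) \<le> (\<Sum>j. ennreal ((1/2) ^ j))"
  proof (rule suminf_le)
    fix j
    have "N (\<lambda>x. ennreal \<bar>u j v x - v x\<bar>) = ennreal (nn (\<lambda>x. u j v x - v x))"
      using uV v by (simp add: ennreal_nn V_diff)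
    also have "\<dots> \<le> ennreal ((1/2) ^ j)"
      using ind[OF v, of j] by (subst nn_commute) (auto simp: u_def intro: ennreal_leI)
    finally show "N (\<lambda>x. ennreal \<bar>u j v x - v x\<bar>) \<le> ennreal ((1/2) ^ j)" .
  qed auto
  also have "\<dots> = ennreal (\<Sum>j. (1/2) ^ j)" by (intro suminf_ennreal2) auto
  finally have "(\<Sum>j. N (\<lambda>x. ennreal \<bar>u j v x - v x\<bar>)) < \<top>" by (simp add: le_less_trans)
  then have "AE x in X. (\<lambda>j. u j v x) \<longlonglongrightarrow> v x"
    by (intro AE_tendsto_of_summable_N) (use uV v in \<open>auto simp: V_iff\<close>)
  then show "AE x in X. ?P v x = v x" by eventually_elim (rule limI)
  qed
  with P_meas show thesis by (rule that)
qed

end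

section \<open>A moment bound for sums of independent centered variables\<close>

text \<open>For \<open>x = - y\<close> with \<open>y > 0\<close>, the product
  \<open>(1 - y + y^2) (1 + y) = 1 + y^3\<close> is at least \<open>1\<close>, and
  \<open>1 + y \<le> exp y\<close>.\<close>

lemma exp_le_quadratic:
  fixes x :: real
  assumes "\<bar>x\<bar> \<le> 1"
  shows "exp x \<le> 1 + x + x\<^sup>2"
proof (cases "0 \<le> x")
  case True
  then show ?thesis using assms by (intro exp_bound) auto
next
  case False
  define y where "y = - x"
  have y: "0 < y" using False by (simp add: y_def)
  have "1 \<le> (1 - y + y\<^sup>2) * (1 + y)" using y by (simp add: algebra_simps power2_eq_square)
  also have "\<dots> \<le> (1 - y + y\<^sup>2) * exp y"
  proof (rule mult_left_mono)
    show "0 \<le> 1 - y + y\<^sup>2" using y assms by (simp add: y_def)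
  qed (rule exp_ge_add_one_self)
  finally have "exp (- y) \<le> 1 - y + y\<^sup>2" by (simp add: exp_minus field_simps)
  then show ?thesis by (simp add: y_def)
qed

text \<open>Dividing by \<open>a\<close> leaves one variable \<open>t = b / a\<close>. For
  \<open>\<bar>q t\<bar> \<le> 1\<close> the bound comes from \<open>1 + t \<le> exp t\<close> and
  \<open>exp_le_quadratic\<close>, which produces the constant \<open>q^2\<close>; for larger
  \<open>t\<close> one has \<open>\<bar>1 + t\<bar> \<le> (q + 1) \<bar>t\<bar>\<close>, which
  produces \<open>(q + 1) powr q\<close>. Keeping the exact linear term is the point, since it will
  have mean \<open>0\<close>.\<close>

lemma abs_powr_add_le:
  fixes a b q :: real
  assumes q: "2 \<le> q"
  shows "\<bar>a + b\<bar> powr q \<le> \<bar>a\<bar> powr q + q * (\<bar>a\<bar> powr (q - 2) * a) * b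
    + ((q + 1) powr q + q\<^sup>2) * (\<bar>a\<bar> powr (q - 2) * b\<^sup>2 + \<bar>b\<bar> powr q)"
proof (cases "a = 0")
  case True
  have "1 \<le> (q + 1) powr q" using q by (intro ge_one_powr_ge_zero) auto
  then have "1 * \<bar>b\<bar> powr q \<le> ((q + 1) powr q + q\<^sup>2) * \<bar>b\<bar> powr q"
    by (intro mult_right_mono add_increasing2) auto
  then show ?thesis using True by simp
next
  case False
  define t where "t = b / a"
  define C where "C = (q + 1) powr q + q\<^sup>2"
  have b: "b = t * a" using False by (simp add: t_def)
  have main: "\<bar>1 + t\<bar> powr q \<le> 1 + q * t + C * (t\<^sup>2 + \<bar>t\<bar> powr q)"
  proof (cases "\<bar>q * t\<bar> \<le> 1")
    case True
    have "\<bar>t\<bar> \<le> 1 / q" using True q by (simp add: abs_mult field_simps)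
    also have "\<dots> \<le> 1 / 2" using q by (simp add: field_simps)
    finally have t: "0 < 1 + t" by (auto simp: abs_le_iff)
    have "\<bar>1 + t\<bar> powr q \<le> (exp t) powr q"
      using t q by (intro powr_mono2) auto
    also have "\<dots> = exp (q * t)" by (simp add: exp_powr_real mult.commute)
    also have "\<dots> \<le> 1 + q * t + (q * t)\<^sup>2" using True by (rule exp_le_quadratic)
    also have "\<dots> \<le> 1 + q * t + C * (t\<^sup>2 + \<bar>t\<bar> powr q)"
    proof -
      have "q\<^sup>2 * t\<^sup>2 \<le> C * (t\<^sup>2 + \<bar>t\<bar> powr q)" unfolding C_def
        by (intro mult_mono) auto
      then show ?thesis by (simp add: power_mult_distrib)
    qed
    finally show ?thesis .
  next
    case False
    then have qt: "1 \<le> q * \<bar>t\<bar>" using q by (simp add: abs_mult)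
    have "\<bar>1 + t\<bar> \<le> (q + 1) * \<bar>t\<bar>" using qt by (simp add: algebra_simps)
    then have "\<bar>1 + t\<bar> powr q \<le> ((q + 1) * \<bar>t\<bar>) powr q" using q by (intro powr_mono2) auto
    also have "\<dots> = (q + 1) powr q * \<bar>t\<bar> powr q" using q by (simp add: powr_mult)
    finally have 1: "\<bar>1 + t\<bar> powr q \<le> (q + 1) powr q * \<bar>t\<bar> powr q" .
    have "q * \<bar>t\<bar> * 1 \<le> q * \<bar>t\<bar> * (q * \<bar>t\<bar>)" using qt q by (intro mult_left_mono) auto
    then have "q * \<bar>t\<bar> \<le> q\<^sup>2 * t\<^sup>2" by (simp add: power2_eq_square mult_ac)
    moreover have "- (q * \<bar>t\<bar>) \<le> q * t" using q by (simp add: abs_if mult_le_0_iff)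
    ultimately have "0 \<le> 1 + q * t + q\<^sup>2 * t\<^sup>2" by linarith
    moreover have "0 \<le> (q + 1) powr q * t\<^sup>2" "0 \<le> q\<^sup>2 * \<bar>t\<bar> powr q" by auto
    moreover have "C * (t\<^sup>2 + \<bar>t\<bar> powr q) = (q + 1) powr q * t\<^sup>2 + (q + 1) powr q * \<bar>t\<bar> powr q + q\<^sup>2 * t\<^sup>2 + q\<^sup>2 * \<bar>t\<bar> powr q"
      by (simp add: C_def algebra_simps)
    ultimately show ?thesis using 1 by linarith
  qed
  have pa: "\<bar>a\<bar> powr q = \<bar>a\<bar> powr (q - 2) * a\<^sup>2"
    using False by (simp add: powr_diff)
  have "\<bar>a + b\<bar> powr q = \<bar>a\<bar> powr q * \<bar>1 + t\<bar> powr q"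
  proof -
    have "\<bar>a + b\<bar> = \<bar>a\<bar> * \<bar>1 + t\<bar>" by (simp add: b abs_mult[symmetric] algebra_simps)
    then show ?thesis by (simp add: powr_mult)
  qed
  also have "\<dots> \<le> \<bar>a\<bar> powr q * (1 + q * t + C * (t\<^sup>2 + \<bar>t\<bar> powr q))"
    using main by (intro mult_left_mono) auto
  also have "\<dots> = \<bar>a\<bar> powr q + q * (\<bar>a\<bar> powr (q - 2) * a) * b + C * (\<bar>a\<bar> powr (q - 2) * b\<^sup>2 + \<bar>b\<bar> powr q)"
  proof -
    have "\<bar>b\<bar> powr q = \<bar>a\<bar> powr q * \<bar>t\<bar> powr q" by (simp add: b abs_mult powr_mult)
    moreover have "\<bar>a\<bar> powr (q - 2) * b\<^sup>2 = \<bar>a\<bar> powr q * t\<^sup>2" by (simp add: pa b power_mult_distrib)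
    moreover have "\<bar>a\<bar> powr (q - 2) * a * b = \<bar>a\<bar> powr q * t" by (simp add: pa b power2_eq_square)
    ultimately show ?thesis by (simp add: algebra_simps)
  qed
  finally show ?thesis unfolding C_def .
qed

text \<open>The weight \<open>1 + 1 / (2 n)\<close> is what \<open>(n + 1) powr (q / 2)\<close> can absorb in the induction for
  \<open>moment_bound_sum\<close>; the term linear in \<open>b\<close> vanishes in expectation.\<close>

lemma abs_powr_add_le_weighted:
  fixes q :: real
  assumes q: "2 \<le> q"
  obtains D :: real where "0 \<le> D"
    "\<And>a b n. 1 \<le> n \<Longrightarrow> \<bar>a + b\<bar> powr q \<le> (1 + 1 / (2 * real n)) * \<bar>a\<bar> powr q
      + q * (\<bar>a\<bar> powr (q - 2) * a) * b + D * real n powr (q / 2 - 1) * \<bar>b\<bar> powr q"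
proof -
  define C where "C = (q + 1) powr q + q\<^sup>2"
  have C: "0 < C" using q by (simp add: C_def add_nonneg_pos)
  define D where "D = C * ((2 * C) powr (q / 2 - 1) + 1)"
  have D: "0 \<le> D" using C by (simp add: D_def)
  have "\<bar>a + b\<bar> powr q \<le> (1 + 1 / (2 * real n)) * \<bar>a\<bar> powr q
      + q * (\<bar>a\<bar> powr (q - 2) * a) * b + D * real n powr (q / 2 - 1) * \<bar>b\<bar> powr q" if n: "1 \<le> n" for a b and n :: nat
  proof -
    have n1: "1 \<le> real n powr (q / 2 - 1)" using n q by (intro ge_one_powr_ge_zero) auto
    have "C * (\<bar>a\<bar> powr (q - 2) * b\<^sup>2) \<le> 1 / (2 * real n) * \<bar>a\<bar> powr q
        + C * (2 * C) powr (q / 2 - 1) * real n powr (q / 2 - 1) * \<bar>b\<bar> powr q"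
    \<comment> \<open>If \<open>a\<close> dominates, \<open>C b^2 \<le> a^2 / (2 n)\<close> and the
      mixed term is absorbed by the weight \<open>1 / (2 n)\<close>. Otherwise
      \<open>\<bar>a\<bar> powr (q - 2)\<close> is bounded through \<open>b\<close>, which creates
      the factor \<open>real n powr (q / 2 - 1)\<close> and the power of \<open>2 C\<close> in
      \<open>D\<close>.\<close>
    proof (cases "2 * real n * C * b\<^sup>2 \<le> a\<^sup>2")
      case True
      have "C * b\<^sup>2 \<le> a\<^sup>2 / (2 * real n)" using True n by (simp add: field_simps)
      then have "\<bar>a\<bar> powr (q - 2) * (C * b\<^sup>2) \<le> \<bar>a\<bar> powr (q - 2) * (a\<^sup>2 / (2 * real n))"
        by (rule mult_left_mono) auto
      also have "\<dots> = 1 / (2 * real n) * \<bar>a\<bar> powr q" by (cases "a = 0") (auto simp: powr_diff)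
      finally show ?thesis using C by (simp add: mult_ac add_increasing2)
    next
      case False
      have "\<bar>a\<bar> powr (q - 2) \<le> (2 * real n * C * b\<^sup>2) powr (q / 2 - 1)"
      proof -
        have "\<bar>a\<bar> powr (q - 2) = (a\<^sup>2) powr (q / 2 - 1)"
        proof (cases "a = 0")
          case False
          then have "(a\<^sup>2) powr (q / 2 - 1) = (\<bar>a\<bar> powr 2) powr (q / 2 - 1)" by simp
          then show ?thesis unfolding powr_powr by (simp add: algebra_simps)
        qed simp
        also have "\<dots> \<le> (2 * real n * C * b\<^sup>2) powr (q / 2 - 1)"
          using False q by (intro powr_mono2) auto
        finally show ?thesis .
      qed
      then have "C * (\<bar>a\<bar> powr (q - 2) * b\<^sup>2) \<le> C * ((2 * real n * C * b\<^sup>2) powr (q / 2 - 1) * b\<^sup>2)"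
        using C by (intro mult_left_mono mult_right_mono) auto
      also have "(2 * real n * C * b\<^sup>2) powr (q / 2 - 1) * b\<^sup>2 =
          (2 * C) powr (q / 2 - 1) * real n powr (q / 2 - 1) * \<bar>b\<bar> powr q"
      proof (cases "b = 0")
        case False
        have "(b\<^sup>2) powr (q / 2 - 1) * b\<^sup>2 = \<bar>b\<bar> powr q"
        proof -
          have "(b\<^sup>2) powr (q / 2 - 1) = (\<bar>b\<bar> powr 2) powr (q / 2 - 1)" using False by simp
          also have "\<dots> = \<bar>b\<bar> powr (q - 2)" unfolding powr_powr by (simp add: algebra_simps)
          finally show ?thesis using False by (simp add: powr_diff)
        qed
        then show ?thesis using C by (simp add: powr_mult mult_ac)
      qed simp
      finally show ?thesis by (simp add: mult_ac add_increasing)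
    qed
    moreover have "C * \<bar>b\<bar> powr q \<le> C * real n powr (q / 2 - 1) * \<bar>b\<bar> powr q"
      using n1 C by (intro mult_right_mono) auto
    ultimately show ?thesis
      using abs_powr_add_le[OF q, of a b] unfolding C_def[symmetric] D_def by (simp add: algebra_simps)
  qed
  with D show thesis by (rule that)
qed

text \<open>The left side equals \<open>real n powr (q / 2 - 1) * real (Suc n)\<close>, and the
  exponent \<open>q / 2 - 1\<close> is nonnegative because \<open>q \<ge> 2\<close>.\<close>

lemma powr_add_one_ge:
  fixes q :: real
  assumes "2 \<le> q" "1 \<le> n"
  shows "real n powr (q / 2) + real n powr (q / 2 - 1) \<le> real (Suc n) powr (q / 2)"
proof -
  have n: "0 < real n" using assms by simp
  have "real n powr (q / 2) + real n powr (q / 2 - 1) = real n powr (q / 2 - 1) * real (Suc n)"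
    using n powr_add[of "real n" "q / 2 - 1" 1] by (simp add: algebra_simps)
  also have "\<dots> \<le> real (Suc n) powr (q / 2 - 1) * real (Suc n)"
    using assms by (intro mult_right_mono powr_mono2) auto
  also have "\<dots> = real (Suc n) powr (q / 2)" by (simp add: powr_diff)
  finally show ?thesis .
qed

context prob_space
begin

lemma integrable_powr_le:
  fixes X :: "'a \<Rightarrow> real"
  assumes [measurable]: "X \<in> borel_measurable M" and "integrable M (\<lambda>\<omega>. \<bar>X \<omega>\<bar> powr q)" "0 \<le> r" "r \<le> q"
  shows "integrable M (\<lambda>\<omega>. \<bar>X \<omega>\<bar> powr r)"
proof (rule Bochner_Integration.integrable_bound)
  show "integrable M (\<lambda>\<omega>. 1 + \<bar>X \<omega>\<bar> powr q)" using assms by simp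
  have "x powr r \<le> 1 + x powr q" if "0 \<le> x" for x :: real
  proof (cases "1 \<le> x")
    case True
    then have "x powr r \<le> x powr q" using assms by (intro powr_mono) auto
    then show ?thesis by simp
  next
    case False
    then have "x powr r \<le> 1" using that assms by (intro powr_le1) auto
    then show ?thesis by (simp add: add_increasing2)
  qed
  then show "AE \<omega> in M. norm (\<bar>X \<omega>\<bar> powr r) \<le> norm (1 + \<bar>X \<omega>\<bar> powr q)"
    by (intro always_eventually allI) (auto simp: abs_of_nonneg add_nonneg_nonneg)
qed simp

text \<open>The growth \<open>n powr (q / 2)\<close> is what the division by \<open>sqrt n\<close>
  can compensate. The proof is an induction on \<open>n\<close> with
  \<open>abs_powr_add_le_weighted\<close> at the partial sum and the next variable, which are
  independent. The constant \<open>K\<close> is fixed before the variables, so that later it serves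
  all points of a random field simultaneously.\<close>

theorem moment_bound_sum:
  fixes q :: real
  assumes q: "2 \<le> q"
  obtains K :: real where "1 \<le> K"
    "\<And>X :: nat \<Rightarrow> 'a \<Rightarrow> real. \<And>m n. \<lbrakk>indep_vars (\<lambda>_. borel) X UNIV; \<And>i. integrable M (\<lambda>\<omega>. \<bar>X i \<omega>\<bar> powr q);
        \<And>i. expectation (\<lambda>\<omega>. \<bar>X i \<omega>\<bar> powr q) \<le> m; \<And>i. expectation (X i) = 0\<rbrakk> \<Longrightarrow>
      integrable M (\<lambda>\<omega>. \<bar>\<Sum>i<n. X i \<omega>\<bar> powr q) \<and>
      expectation (\<lambda>\<omega>. \<bar>\<Sum>i<n. X i \<omega>\<bar> powr q) \<le> K * real n powr (q / 2) * m"
proof -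
  obtain D :: real where D: "0 \<le> D"
    "\<And>a b n. 1 \<le> n \<Longrightarrow> \<bar>a + b\<bar> powr q \<le> (1 + 1 / (2 * real n)) * \<bar>a\<bar> powr q
      + q * (\<bar>a\<bar> powr (q - 2) * a) * b + D * real n powr (q / 2 - 1) * \<bar>b\<bar> powr q"
    using abs_powr_add_le_weighted[OF q] by blast
  \<comment> \<open>In the induction step the weight \<open>1 / (2 n)\<close> and the
    \<open>D\<close>-term each contribute at most
    \<open>K / 2 * real n powr (q / 2 - 1) * m\<close>, the second because
    \<open>2 * D \<le> K\<close>. The bound \<open>1 \<le> K\<close> settles a single
    summand.\<close>
  define K where "K = max 1 (2 * D)"
  have main: "integrable M (\<lambda>\<omega>. \<bar>\<Sum>i<n. X i \<omega>\<bar> powr q) \<and>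
      expectation (\<lambda>\<omega>. \<bar>\<Sum>i<n. X i \<omega>\<bar> powr q) \<le> K * real n powr (q / 2) * m"
    if ind: "indep_vars (\<lambda>_. borel) X UNIV" and int: "\<And>i. integrable M (\<lambda>\<omega>. \<bar>X i \<omega>\<bar> powr q)"
      and m: "\<And>i. expectation (\<lambda>\<omega>. \<bar>X i \<omega>\<bar> powr q) \<le> m" and mean: "\<And>i. expectation (X i) = 0"
    for X :: "nat \<Rightarrow> 'a \<Rightarrow> real" and m n
  proof (induction n)
    case 0
    then show ?case using q by simp
  next
    case (Suc n)
    have [measurable]: "X i \<in> borel_measurable M" for i using ind by (simp add: indep_vars_def2)
    have m0: "0 \<le> m" using m[of 0] by (rule order_trans[rotated]) (simp add: integral_nonneg_AE)
    show ?case
    proof (cases "n = 0")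
      case True
      have "1 * m \<le> K * m" using m0 by (intro mult_right_mono) (auto simp: K_def)
      then show ?thesis using True int m[of 0] by simp
    next
      case False
      then have n: "1 \<le> n" by simp
      define S where "S \<omega> = (\<Sum>i<n. X i \<omega>)" for \<omega>
      have [measurable]: "S \<in> borel_measurable M" unfolding S_def[abs_def] by measurable
      have Sint: "integrable M (\<lambda>\<omega>. \<bar>S \<omega>\<bar> powr q)"
        and Sle: "expectation (\<lambda>\<omega>. \<bar>S \<omega>\<bar> powr q) \<le> K * real n powr (q / 2) * m"
        using Suc by (simp_all add: S_def)
      have Xint: "integrable M (X n)"
      proof -
        have "integrable M (\<lambda>\<omega>. \<bar>X n \<omega>\<bar> powr 1)" using q by (intro integrable_powr_le[OF _ int]) auto
        then show ?thesis by (simp add: integrable_abs_iff)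
      qed
      let ?T = "\<lambda>\<omega>. \<bar>S \<omega>\<bar> powr (q - 2) * S \<omega>"
      have Tint: "integrable M ?T"
      proof -
        have "integrable M (\<lambda>\<omega>. \<bar>S \<omega>\<bar> powr (q - 1))" using q by (intro integrable_powr_le[OF _ Sint]) auto
        then show ?thesis
        proof (rule Bochner_Integration.integrable_bound)
          have "\<bar>s\<bar> powr (q - 2) * \<bar>s\<bar> = \<bar>s\<bar> powr (q - 1)" for s :: real
            using powr_add[of "\<bar>s\<bar>" "q - 2" 1] by simp
          then show "AE \<omega> in M. norm (?T \<omega>) \<le> norm (\<bar>S \<omega>\<bar> powr (q - 1))" by (simp add: abs_mult)
        qed simp
      qed
      have "indep_var borel (X n) borel S"
        unfolding S_def[abs_def]
        by (rule indep_vars_sum) (auto intro: indep_vars_subset[OF ind])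
      then have "indep_var borel ((\<lambda>x. x) \<circ> X n) borel ((\<lambda>s. \<bar>s\<bar> powr (q - 2) * s) \<circ> S)"
        by (rule indep_var_compose) auto
      then have ind2: "indep_var borel (X n) borel ?T" by (simp add: o_def)
      have XTint: "integrable M (\<lambda>\<omega>. X n \<omega> * ?T \<omega>)"
        using ind2 Xint Tint by (rule indep_var_integrable)
      have XT0: "expectation (\<lambda>\<omega>. X n \<omega> * ?T \<omega>) = 0"
        using indep_var_lebesgue_integral[OF ind2 Xint Tint] mean by simp
      let ?B = "\<lambda>\<omega>. (1 + 1 / (2 * real n)) * \<bar>S \<omega>\<bar> powr q + q * (X n \<omega> * ?T \<omega>)
        + D * real n powr (q / 2 - 1) * \<bar>X n \<omega>\<bar> powr q"
      have Bint: "integrable M ?B" using Sint XTint int[of n] by simp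
      have le: "\<bar>S \<omega> + X n \<omega>\<bar> powr q \<le> ?B \<omega>" for \<omega>
        using D(2)[OF n, of "S \<omega>" "X n \<omega>"] by (simp add: mult_ac)
      have int': "integrable M (\<lambda>\<omega>. \<bar>S \<omega> + X n \<omega>\<bar> powr q)"
        by (rule Bochner_Integration.integrable_bound[OF Bint]) (use le in \<open>auto intro: order_trans[OF _ abs_ge_self]\<close>)
      have "expectation (\<lambda>\<omega>. \<bar>S \<omega> + X n \<omega>\<bar> powr q) \<le> expectation ?B"
        using int' Bint le by (intro integral_mono)
      also have "\<dots> = (1 + 1 / (2 * real n)) * expectation (\<lambda>\<omega>. \<bar>S \<omega>\<bar> powr q)
        + D * real n powr (q / 2 - 1) * expectation (\<lambda>\<omega>. \<bar>X n \<omega>\<bar> powr q)"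
        using Sint XTint int[of n] XT0 by simp
      also have "\<dots> \<le> (1 + 1 / (2 * real n)) * (K * real n powr (q / 2) * m) + K / 2 * real n powr (q / 2 - 1) * m"
        using Sle m[of n] D(1) m0 by (intro add_mono mult_left_mono mult_mono) (auto simp: K_def)
      also have "\<dots> = K * (real n powr (q / 2) + real n powr (q / 2 - 1)) * m"
      proof -
        have "real n powr (q / 2) = real n * real n powr (q / 2 - 1)"
          using n powr_add[of "real n" "q / 2 - 1" 1] by (simp add: mult.commute)
        then show ?thesis using n by (simp add: distrib_left distrib_right)
      qed
      also have "\<dots> \<le> K * real (Suc n) powr (q / 2) * m"
        using powr_add_one_ge[OF q n] m0 by (intro mult_right_mono mult_left_mono) (auto simp: K_def)
      finally show ?thesis using int' by (simp add: S_def)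
    qed
  qed
  show thesis
  proof (rule that[of K])
    show "1 \<le> K" by (simp add: K_def)
  qed (rule main)
qed

section \<open>Weak convergence from characteristic functions\<close>

text \<open>The standardized central limit theorem with its characteristic functions evaluated at
  \<open>sqrt v\<close>, which undoes the standardization. Variance \<open>0\<close> is treated
  apart, since then all variables vanish almost surely.\<close>

theorem CLT_iexp:
  fixes X :: "nat \<Rightarrow> 'a \<Rightarrow> real"
  assumes ind: "indep_vars (\<lambda>_. borel) X UNIV" and id: "\<And>n. distr M borel (X n) = distr M borel (X 0)"
    and sq: "integrable M (\<lambda>\<omega>. (X 0 \<omega>)\<^sup>2)" and mean: "expectation (X 0) = 0"
  shows "(\<lambda>n. CLINT \<omega>|M. iexp ((\<Sum>i<n. X i \<omega>) / sqrt (real n))) \<longlonglongrightarrow>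
    complex_of_real (exp (- expectation (\<lambda>\<omega>. (X 0 \<omega>)\<^sup>2) / 2))"
proof -
  have [measurable]: "X i \<in> borel_measurable M" for i using ind by (simp add: indep_vars_def2)
  define v where "v = expectation (\<lambda>\<omega>. (X 0 \<omega>)\<^sup>2)"
  have sq': "integrable M (\<lambda>\<omega>. (X n \<omega>)\<^sup>2)" for n
  proof -
    have "integrable (distr M borel (X n)) (\<lambda>x. x\<^sup>2)" unfolding id[of n] using sq by (simp add: integrable_distr_eq)
    then show ?thesis by (simp add: integrable_distr_eq)
  qed
  have v': "expectation (\<lambda>\<omega>. (X n \<omega>)\<^sup>2) = v" for n
  proof -
    have "expectation (\<lambda>\<omega>. (X n \<omega>)\<^sup>2) = (\<integral>x. x\<^sup>2 \<partial>distr M borel (X n))" by (simp add: integral_distr)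
    also have "\<dots> = v" unfolding id[of n] v_def by (simp add: integral_distr)
    finally show ?thesis .
  qed
  have mean': "expectation (X n) = 0" for n
  proof -
    have "expectation (X n) = (\<integral>x. x \<partial>distr M borel (X n))" by (simp add: integral_distr)
    also have "\<dots> = 0" unfolding id[of n] using mean by (simp add: integral_distr)
    finally show ?thesis .
  qed
  have v0: "0 \<le> v" unfolding v_def by simp
  show ?thesis
  proof (cases "v = 0")
    case True
    have "AE \<omega> in M. X n \<omega> = 0" for n
      using v'[of n] sq'[of n] True by (simp add: integral_nonneg_eq_0_iff_AE)
    then have ae: "AE \<omega> in M. \<forall>n. X n \<omega> = 0" by (simp add: AE_all_countable)
    have "(CLINT \<omega>|M. iexp ((\<Sum>i<n. X i \<omega>) / sqrt (real n))) = (CLINT \<omega>|M. 1)" for n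
      using ae by (intro integral_cong_AE) (auto elim!: eventually_mono)
    then show ?thesis using True by (simp add: v_def prob_space)
  next
    case False
    with v0 have v: "0 < v" by simp
    have "weak_conv_m (\<lambda>n. distr M borel (\<lambda>\<omega>. (\<Sum>i<n. X i \<omega>) / sqrt (real n * (sqrt v)\<^sup>2))) std_normal_distribution"
      by (rule central_limit_theorem_zero_mean[OF ind mean' _ sq' _ id]) (use v v' mean' in auto)
    then have "(\<lambda>n. char (distr M borel (\<lambda>\<omega>. (\<Sum>i<n. X i \<omega>) / sqrt (real n * (sqrt v)\<^sup>2))) (sqrt v))
        \<longlonglongrightarrow> char std_normal_distribution (sqrt v)"
      by (intro levy_continuity1) (auto intro!: real_dist_normal_dist real_distribution_distr)
    moreover have "char (distr M borel (\<lambda>\<omega>. (\<Sum>i<n. X i \<omega>) / sqrt (real n * (sqrt v)\<^sup>2))) (sqrt v) =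
        (CLINT \<omega>|M. iexp ((\<Sum>i<n. X i \<omega>) / sqrt (real n)))" for n
      using v unfolding char_def by (subst integral_distr) (auto simp: real_sqrt_mult)
    ultimately show ?thesis using v by (simp add: char_std_normal_distribution v_def)
  qed
qed

end

section \<open>Trigonometric polynomials, the test functions governed by characteristic
  functions\<close>

inductive_set trig_poly :: "nat \<Rightarrow> ((nat \<Rightarrow> real) \<Rightarrow> complex) set" for d where
  monomial: "(\<lambda>t. c * iexp (\<Sum>j<d. a j * t j)) \<in> trig_poly d"
| add: "f \<in> trig_poly d \<Longrightarrow> g \<in> trig_poly d \<Longrightarrow> (\<lambda>t. f t + g t) \<in> trig_poly d"

text \<open>Frequencies add under multiplication. Closure under products is what makes the
  trigonometric polynomials a ring to which the Stone-Weierstrass theorem applies.\<close>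

lemma trig_poly_monomial_mult:
  assumes "f \<in> trig_poly d"
  shows "(\<lambda>t. c * iexp (\<Sum>j<d. a j * t j) * f t) \<in> trig_poly d"
  using assms
proof induction
  case (monomial c' a')
  have "(\<lambda>t. c * iexp (\<Sum>j<d. a j * t j) * (c' * iexp (\<Sum>j<d. a' j * t j))) =
      (\<lambda>t. (c * c') * iexp (\<Sum>j<d. (a j + a' j) * t j))"
    by (simp add: fun_eq_iff distrib_right sum.distrib exp_add distrib_left mult_ac)
  then show ?case using trig_poly.monomial by metis
next
  case (add f g)
  from trig_poly.add[OF add(3,4)] show ?case by (simp add: distrib_left)
qed

lemma trig_poly_mult:
  assumes "f \<in> trig_poly d" "g \<in> trig_poly d"
  shows "(\<lambda>t. f t * g t) \<in> trig_poly d"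
  using assms(1)
proof induction
  case (monomial c a)
  then show ?case by (rule trig_poly_monomial_mult[OF assms(2)])
next
  case (add f f')
  from trig_poly.add[OF add(3,4)] show ?case by (simp add: distrib_right)
qed

lemma trig_poly_const: "(\<lambda>t. c) \<in> trig_poly d"
  using trig_poly.monomial[of c "\<lambda>_. 0" d] by simp

text \<open>These functions are the coordinates after the arcsine substitution; they separate the
  points of the cube.\<close>

lemma trig_poly_sin:
  assumes "j < d" shows "(\<lambda>t. complex_of_real (sin (r * t j))) \<in> trig_poly d"
proof -
  have "(\<Sum>k<d. (if k = j then s else 0) * t k) = s * t j" for s and t :: "nat \<Rightarrow> real"
    using assms by (simp add: if_distrib[of "\<lambda>x. x * _"] cong: if_cong)
  then have 1: "(\<lambda>t. c * iexp (s * t j)) \<in> trig_poly d" for c and s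
    using trig_poly.monomial[of c "\<lambda>k. if k = j then s else 0" d] by simp
  have "complex_of_real (sin x) = 1 / (2 * \<i>) * iexp x + (- 1 / (2 * \<i>)) * iexp (- x)" for x
    by (simp add: sin_of_real[symmetric] sin_exp_eq field_simps)
  then show ?thesis
    using trig_poly.add[OF 1[of "1 / (2 * \<i>)" r] 1[of "- 1 / (2 * \<i>)" "- r"]] by simp
qed

context prob_space
begin

lemma trig_poly_tendsto:
  fixes T :: "nat \<Rightarrow> nat \<Rightarrow> 'a \<Rightarrow> real" and W :: "nat \<Rightarrow> 'a \<Rightarrow> real"
  assumes [measurable]: "\<And>n j. T n j \<in> borel_measurable M" "\<And>j. W j \<in> borel_measurable M"
    and char: "\<And>a :: nat \<Rightarrow> real. (\<lambda>n. CLINT \<omega>|M. iexp (\<Sum>j<d. a j * T n j \<omega>)) \<longlonglongrightarrow> (CLINT \<omega>|M. iexp (\<Sum>j<d. a j * W j \<omega>))"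
    and h: "h \<in> trig_poly d"
  shows "(\<lambda>n. CLINT \<omega>|M. h (\<lambda>j. T n j \<omega>)) \<longlonglongrightarrow> (CLINT \<omega>|M. h (\<lambda>j. W j \<omega>)) \<and>
    (\<forall>n. integrable M (\<lambda>\<omega>. h (\<lambda>j. T n j \<omega>))) \<and> integrable M (\<lambda>\<omega>. h (\<lambda>j. W j \<omega>))"
  using h
proof induction
  case (monomial c a)
  have int: "integrable M (\<lambda>\<omega>. iexp (\<Sum>j<d. a j * Z j \<omega>))" if [measurable]: "\<And>j. Z j \<in> borel_measurable M" for Z
    by (rule integrable_const_bound[where B = 1]) auto
  have "(\<lambda>n. c * (CLINT \<omega>|M. iexp (\<Sum>j<d. a j * T n j \<omega>))) \<longlonglongrightarrow> c * (CLINT \<omega>|M. iexp (\<Sum>j<d. a j * W j \<omega>))"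
    by (intro tendsto_intros char)
  then show ?case using int[of "T _"] int[of W] by simp
next
  case (add f g)
  have "(\<lambda>n. (CLINT \<omega>|M. f (\<lambda>j. T n j \<omega>)) + (CLINT \<omega>|M. g (\<lambda>j. T n j \<omega>))) \<longlonglongrightarrow>
      (CLINT \<omega>|M. f (\<lambda>j. W j \<omega>)) + (CLINT \<omega>|M. g (\<lambda>j. W j \<omega>))"
    using add by (intro tendsto_add) auto
  with add show ?case by simp
qed

text \<open>After the substitution \<open>t j = L * arcsin (u j)\<close> the Stone--Weierstrass theorem on the cube
  gives a trigonometric polynomial in \<open>t\<close> that is uniformly bounded on the whole space and close
  to the given function for \<open>\<bar>t j\<bar> \<le> L\<close>.\<close>

lemma trig_poly_approx:
  fixes \<psi> :: "(nat \<Rightarrow> real) \<Rightarrow> real"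
  assumes \<psi>: "continuous_on UNIV \<psi>" and K: "\<And>t. \<bar>\<psi> t\<bar> \<le> K" and e: "0 < e" and L: "0 < L"
  obtains h :: "(nat \<Rightarrow> real) \<Rightarrow> real" where "(\<lambda>t. complex_of_real (h t)) \<in> trig_poly d"
    "\<And>t. (\<And>j. d \<le> j \<Longrightarrow> t j = 0) \<Longrightarrow> \<bar>h t\<bar> \<le> K + e"
    "\<And>t. (\<And>j. d \<le> j \<Longrightarrow> t j = 0) \<Longrightarrow> (\<And>j. j < d \<Longrightarrow> \<bar>t j\<bar> \<le> L) \<Longrightarrow> \<bar>h t - \<psi> t\<bar> < e"
proof -
  \<comment> \<open>The cube of dimension \<open>d\<close>, embedded into sequences by the value
    \<open>0\<close> in all later coordinates; in this form it is a compact product set.\<close>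
  define S :: "(nat \<Rightarrow> real) set" where "S = PiE UNIV (\<lambda>j. if j < d then {-1..1} else {0})"
  \<comment> \<open>Functions on the cube whose pullback under
    \<open>t \<mapsto> sin (t / L)\<close> in each coordinate is a trigonometric polynomial.\<close>
  define R where "R = {g. continuous_on S g \<and> (\<lambda>t. complex_of_real (g (\<lambda>j. sin (1 / L * t j)))) \<in> trig_poly d}"
  have "compactin (product_topology (\<lambda>_. euclideanreal) UNIV) S"
    unfolding S_def compactin_PiE by auto
  then have cS: "compact S" by (simp add: euclidean_product_topology)
  have proj: "continuous_on S (\<lambda>u. u j)" for j by (rule continuous_on_subset[OF continuous_on_product_coordinates]) auto
  interpret function_ring_on R S
  proof
    show "compact S" by fact
    show "continuous_on S f" if "f \<in> R" for f using that by (simp add: R_def)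
    show "(\<lambda>x. f x + g x) \<in> R" if "f \<in> R" "g \<in> R" for f g
      using that trig_poly.add by (force simp: R_def intro: continuous_on_add)
    show "(\<lambda>x. f x * g x) \<in> R" if "f \<in> R" "g \<in> R" for f g
      using that trig_poly_mult by (force simp: R_def intro: continuous_on_mult)
    show "(\<lambda>_. c) \<in> R" for c by (simp add: R_def trig_poly_const)
    fix x y assume xy: "x \<in> S" "y \<in> S" "x \<noteq> y"
    then obtain j where j: "x j \<noteq> y j" by (auto simp: fun_eq_iff)
    have "j < d"
    proof (rule ccontr)
      assume "\<not> j < d"
      then have "x j = 0" "y j = 0" using xy by (auto simp: S_def PiE_def Pi_def dest!: spec[of _ j])
      with j show False by simp
    qed
    then have "(\<lambda>u. u j) \<in> R" using trig_poly_sin[of j d "1 / L"] proj by (simp add: R_def)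
    then show "\<exists>f\<in>R. f x \<noteq> f y" using j by (intro bexI[of _ "\<lambda>u. u j"])
  qed
  let ?chi = "\<lambda>u. \<psi> (\<lambda>j. if j < d then L * arcsin (u j) else 0)"
  have "continuous_on S ?chi"
  proof (rule continuous_on_compose2[OF \<psi>])
    show "continuous_on S (\<lambda>u j. if j < d then L * arcsin (u j) else 0)"
    proof (rule continuous_on_coordinatewise_then_product)
      fix j
      show "continuous_on S (\<lambda>u. if j < d then L * arcsin (u j) else 0)"
      proof (cases "j < d")
        case True
        have "continuous_on S (\<lambda>u. arcsin (u j))"
          by (rule continuous_on_arcsin[OF proj]) (use True in \<open>auto simp: S_def PiE_def Pi_def dest!: spec[of _ j]\<close>)
        then show ?thesis using True by (auto intro: continuous_on_mult_left)
      qed simp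
    qed
  qed auto
  from Stone_Weierstrass_basic[OF this e] obtain g where g: "g \<in> R" "\<And>u. u \<in> S \<Longrightarrow> \<bar>?chi u - g u\<bar> < e" by auto
  let ?h = "\<lambda>t. g (\<lambda>j. sin (1 / L * t j))"
  have inS: "(\<lambda>j. sin (1 / L * t j)) \<in> S" if "\<And>j. d \<le> j \<Longrightarrow> t j = 0" for t
    using that by (auto simp: S_def PiE_def Pi_def)
  show thesis
  proof (rule that[of ?h])
    show "(\<lambda>t. complex_of_real (?h t)) \<in> trig_poly d" using g(1) by (simp add: R_def)
    fix t :: "nat \<Rightarrow> real" assume t: "\<And>j. d \<le> j \<Longrightarrow> t j = 0"
    show "\<bar>?h t\<bar> \<le> K + e"
      using g(2)[OF inS, of t] t K[of "\<lambda>j. if j < d then L * arcsin (sin (1 / L * t j)) else 0"] by (smt (verit))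
    assume le: "\<And>j. j < d \<Longrightarrow> \<bar>t j\<bar> \<le> L"
    have "(\<lambda>j. if j < d then L * arcsin (sin (1 / L * t j)) else 0) = t"
    proof
      fix j
      show "(if j < d then L * arcsin (sin (1 / L * t j)) else 0) = t j"
      proof (cases "j < d")
        case True
        have "\<bar>1 / L * t j\<bar> \<le> 1" using le[OF True] L by (simp add: abs_mult)
        then have "- (pi / 2) \<le> 1 / L * t j" "1 / L * t j \<le> pi / 2" using pi_ge_two unfolding abs_le_iff by linarith+
        then have "arcsin (sin (1 / L * t j)) = 1 / L * t j" by (rule arcsin_sin)
        then show ?thesis using True L by simp
      qed (use t in auto)
    qed
    then show "\<bar>?h t - \<psi> t\<bar> < e" using g(2)[OF inS, of t] t by (simp add: abs_minus_commute)
  qed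
qed

text \<open>Convergence for trigonometric polynomials is immediate by linearity. A trigonometric
  polynomial close to \<open>\<psi>\<close> on a cube and bounded outside it has nearly the same
  expectations as \<open>\<psi>\<close>, uniformly in \<open>n\<close>, because tightness makes the
  outside improbable. Vectors of dimension \<open>d\<close> are sequences vanishing from index
  \<open>d\<close> on.\<close>

theorem weak_convergence_of_char:
  fixes T :: "nat \<Rightarrow> nat \<Rightarrow> 'a \<Rightarrow> real" and W :: "nat \<Rightarrow> 'a \<Rightarrow> real" and \<psi> :: "(nat \<Rightarrow> real) \<Rightarrow> real"
  assumes T [measurable]: "\<And>n j. T n j \<in> borel_measurable M" and W [measurable]: "\<And>j. W j \<in> borel_measurable M"
    and char: "\<And>a :: nat \<Rightarrow> real. (\<lambda>n. CLINT \<omega>|M. iexp (\<Sum>j<d. a j * T n j \<omega>)) \<longlonglongrightarrow> (CLINT \<omega>|M. iexp (\<Sum>j<d. a j * W j \<omega>))"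
    and tight: "\<And>e. 0 < e \<Longrightarrow> \<exists>L>0. (\<forall>n. prob {\<omega> \<in> space M. \<exists>j<d. L < \<bar>T n j \<omega>\<bar>} \<le> e) \<and> prob {\<omega> \<in> space M. \<exists>j<d. L < \<bar>W j \<omega>\<bar>} \<le> e"
    and zero: "\<And>n j \<omega>. d \<le> j \<Longrightarrow> T n j \<omega> = 0" "\<And>j \<omega>. d \<le> j \<Longrightarrow> W j \<omega> = 0"
    and \<psi>: "continuous_on UNIV \<psi>" and K: "\<And>t. \<bar>\<psi> t\<bar> \<le> K"
  shows "(\<lambda>n. expectation (\<lambda>\<omega>. \<psi> (\<lambda>j. T n j \<omega>))) \<longlonglongrightarrow> expectation (\<lambda>\<omega>. \<psi> (\<lambda>j. W j \<omega>))"
proof (rule LIMSEQ_I)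
  fix r :: real assume r: "0 < r"
  have K0: "0 \<le> K" using K[of undefined] by simp
  have [measurable]: "\<psi> \<in> borel_measurable borel" using \<psi> by (rule borel_measurable_continuous_onI)
  \<comment> \<open>Three errors, each bounded by \<open>e * (2 * K + 2)\<close>, have to add up to
    less than \<open>r\<close>: one for the limit and two for replacing \<open>\<psi>\<close> by
    \<open>h\<close>.\<close>
  define e where "e = r / (6 * (2 * K + 2) + 1)"
  have e: "0 < e" using r K0 by (simp add: e_def add_nonneg_pos)
  define e' where "e' = min e 1"
  have e': "0 < e'" "e' \<le> 1" "e' \<le> e" using e by (auto simp: e'_def)
  obtain L where L: "0 < L" "\<And>n. prob {\<omega> \<in> space M. \<exists>j<d. L < \<bar>T n j \<omega>\<bar>} \<le> e'" "prob {\<omega> \<in> space M. \<exists>j<d. L < \<bar>W j \<omega>\<bar>} \<le> e'"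
    using tight[OF e'(1)] by blast
  obtain h where h: "(\<lambda>t. complex_of_real (h t)) \<in> trig_poly d"
    "\<And>t. (\<And>j. d \<le> j \<Longrightarrow> t j = 0) \<Longrightarrow> \<bar>h t\<bar> \<le> K + e'"
    "\<And>t. (\<And>j. d \<le> j \<Longrightarrow> t j = 0) \<Longrightarrow> (\<And>j. j < d \<Longrightarrow> \<bar>t j\<bar> \<le> L) \<Longrightarrow> \<bar>h t - \<psi> t\<bar> < e'"
    using trig_poly_approx[OF \<psi> K e'(1) L(1), of d] by blast
  have lim: "(\<lambda>n. CLINT \<omega>|M. complex_of_real (h (\<lambda>j. T n j \<omega>))) \<longlonglongrightarrow> (CLINT \<omega>|M. complex_of_real (h (\<lambda>j. W j \<omega>)))"
    and int: "\<And>n. integrable M (\<lambda>\<omega>. complex_of_real (h (\<lambda>j. T n j \<omega>)))" "integrable M (\<lambda>\<omega>. complex_of_real (h (\<lambda>j. W j \<omega>)))"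
    using trig_poly_tendsto[OF T W char h(1)] by auto
  have lim': "(\<lambda>n. expectation (\<lambda>\<omega>. h (\<lambda>j. T n j \<omega>))) \<longlonglongrightarrow> expectation (\<lambda>\<omega>. h (\<lambda>j. W j \<omega>))"
    using tendsto_Re[OF lim] by simp
  have approx: "\<bar>expectation (\<lambda>\<omega>. h (\<lambda>j. Z j \<omega>)) - expectation (\<lambda>\<omega>. \<psi> (\<lambda>j. Z j \<omega>))\<bar> \<le> e * (2 * K + 2)"
    if Z [measurable]: "\<And>j. Z j \<in> borel_measurable M" and zero: "\<And>j \<omega>. d \<le> j \<Longrightarrow> Z j \<omega> = 0"
      and pr: "prob {\<omega> \<in> space M. \<exists>j<d. L < \<bar>Z j \<omega>\<bar>} \<le> e'"
      and int: "integrable M (\<lambda>\<omega>. complex_of_real (h (\<lambda>j. Z j \<omega>)))" for Z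
  proof -
    define A where "A = {\<omega> \<in> space M. \<exists>j<d. L < \<bar>Z j \<omega>\<bar>}"
    have [measurable]: "A \<in> sets M" unfolding A_def by measurable
    have [measurable]: "(\<lambda>\<omega> j. Z j \<omega>) \<in> borel_measurable M" by (rule measurable_coordinatewise_then_product) simp
    have hi: "integrable M (\<lambda>\<omega>. h (\<lambda>j. Z j \<omega>))" using integrable_Re[OF int] by simp
    have \<psi>i: "integrable M (\<lambda>\<omega>. \<psi> (\<lambda>j. Z j \<omega>))" by (rule integrable_const_bound[where B = K]) (use K in auto)
    have "\<bar>h (\<lambda>j. Z j \<omega>) - \<psi> (\<lambda>j. Z j \<omega>)\<bar> \<le> e' + (2 * K + 1) * indicator A \<omega>" if "\<omega> \<in> space M" for \<omega>
    proof (cases "\<omega> \<in> A")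
      case True
      have "\<bar>h (\<lambda>j. Z j \<omega>)\<bar> \<le> K + e'" by (rule h(2)) (simp add: zero)
      then show ?thesis using True that K[of "\<lambda>j. Z j \<omega>"] e' by auto
    next
      case False
      have "\<bar>h (\<lambda>j. Z j \<omega>) - \<psi> (\<lambda>j. Z j \<omega>)\<bar> < e'"
      proof (rule h(3))
        show "\<bar>Z j \<omega>\<bar> \<le> L" if "j < d" for j using False \<open>\<omega> \<in> space M\<close> that unfolding A_def by fastforce
      qed (rule zero)
      then show ?thesis using False by simp
    qed
    moreover have Ai: "integrable M (\<lambda>\<omega>. indicator A \<omega> :: real)"
      by (rule integrable_const_bound[where B = 1]) (auto simp: indicator_def)
    ultimately have "expectation (\<lambda>\<omega>. \<bar>h (\<lambda>j. Z j \<omega>) - \<psi> (\<lambda>j. Z j \<omega>)\<bar>) \<le> expectation (\<lambda>\<omega>. e' + (2 * K + 1) * indicator A \<omega>)"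
      using hi \<psi>i by (intro integral_mono Bochner_Integration.integrable_add integrable_mult_right integrable_abs Bochner_Integration.integrable_diff) simp_all
    also have "\<dots> = e' + (2 * K + 1) * prob A"
      using Ai by (subst Bochner_Integration.integral_add) (simp_all add: prob_space)
    also have "\<dots> \<le> e' + (2 * K + 1) * e'" using pr[folded A_def] K0 by (intro add_left_mono mult_left_mono) auto
    also have "\<dots> = e' * (2 * K + 2)" by (simp add: algebra_simps)
    also have "\<dots> \<le> e * (2 * K + 2)" using e' K0 by (intro mult_right_mono) auto
    finally have "expectation (\<lambda>\<omega>. \<bar>h (\<lambda>j. Z j \<omega>) - \<psi> (\<lambda>j. Z j \<omega>)\<bar>) \<le> e * (2 * K + 2)" .
    moreover have "\<bar>expectation (\<lambda>\<omega>. h (\<lambda>j. Z j \<omega>) - \<psi> (\<lambda>j. Z j \<omega>))\<bar> \<le> expectation (\<lambda>\<omega>. \<bar>h (\<lambda>j. Z j \<omega>) - \<psi> (\<lambda>j. Z j \<omega>)\<bar>)"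
      by (rule integral_abs_bound)
    ultimately show ?thesis using hi \<psi>i by simp
  qed
  have small: "3 * (e * (2 * K + 2)) < r"
  proof -
    have "0 < 6 * (2 * K + 2) + 1" using K0 by simp
    then have "e * (6 * (2 * K + 2) + 1) = r" by (simp add: e_def)
    then have "6 * (e * (2 * K + 2)) + e = r" by (simp add: algebra_simps)
    moreover have "0 \<le> e * (2 * K + 2)" using e K0 by simp
    ultimately show ?thesis using e by linarith
  qed
  obtain n0 where n0: "\<And>n. n0 \<le> n \<Longrightarrow> \<bar>expectation (\<lambda>\<omega>. h (\<lambda>j. T n j \<omega>)) - expectation (\<lambda>\<omega>. h (\<lambda>j. W j \<omega>))\<bar> < e * (2 * K + 2)"
    using LIMSEQ_D[OF lim', of "e * (2 * K + 2)"] e K0 by (auto simp: real_norm_def)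
  show "\<exists>n0. \<forall>n\<ge>n0. norm (expectation (\<lambda>\<omega>. \<psi> (\<lambda>j. T n j \<omega>)) - expectation (\<lambda>\<omega>. \<psi> (\<lambda>j. W j \<omega>))) < r"
  proof (intro exI allI impI)
    fix n assume "n0 \<le> n"
    then show "norm (expectation (\<lambda>\<omega>. \<psi> (\<lambda>j. T n j \<omega>)) - expectation (\<lambda>\<omega>. \<psi> (\<lambda>j. W j \<omega>))) < r"
      using n0[of n] approx[OF T zero(1) L(2) int(1), of n] approx[OF W zero(2) L(3) int(2)] small
      unfolding real_norm_def by linarith
  qed
qed

end

section \<open>A Gaussian family with prescribed covariance\<close>

text \<open>The Gaussian limit has to be found on the given probability space, which carries no other
  randomness than the random elements \<open>Y k\<close>. Independent events of equal nontrivial probability give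
  random variables without atoms by ternary expansion, and the quantile transform then gives
  independent standard normal variables.\<close>

lemma ternary_expansion_unique:
  fixes a b :: "nat \<Rightarrow> real"
  assumes a: "\<And>j. a j \<in> {0, 1}" and b: "\<And>j. b j \<in> {0, 1}"
    and eq: "(\<Sum>j. a j * (1/3) ^ j) = (\<Sum>j. b j * (1/3) ^ j)"
  shows "a = b"
proof (rule ccontr)
  assume "a \<noteq> b"
  then obtain j0 where "a j0 \<noteq> b j0" by auto
  \<comment> \<open>At the first differing digit the two series differ by \<open>(1/3) ^ m\<close>,
    while all later digits together contribute at most half of that. With base two both would be
    equal and uniqueness would fail.\<close>
  define m where "m = (LEAST j. a j \<noteq> b j)"
  have m: "a m \<noteq> b m" unfolding m_def using \<open>a j0 \<noteq> b j0\<close> by (rule LeastI)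
  have less: "a j = b j" if "j < m" for j using not_less_Least that unfolding m_def by blast
  let ?c = "\<lambda>j. a j - b j"
  have c1: "\<bar>?c j\<bar> \<le> 1" for j using a[of j] b[of j] by auto
  have geo: "summable (\<lambda>j. (1/3 :: real) ^ j)" by (rule summable_geometric) simp
  have sa: "summable (\<lambda>j. a j * (1/3) ^ j)" "summable (\<lambda>j. b j * (1/3) ^ j)"
  proof -
    show "summable (\<lambda>j. a j * (1/3) ^ j)"
    proof (rule summable_comparison_test'[OF geo, of 0])
      show "norm (a j * (1/3) ^ j) \<le> (1/3) ^ j" for j using a[of j] by auto
    qed
    show "summable (\<lambda>j. b j * (1/3) ^ j)"
    proof (rule summable_comparison_test'[OF geo, of 0])
      show "norm (b j * (1/3) ^ j) \<le> (1/3) ^ j" for j using b[of j] by auto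
    qed
  qed
  have sc: "summable (\<lambda>j. ?c j * (1/3) ^ j)" using summable_diff[OF sa] by (simp add: left_diff_distrib)
  have "(\<Sum>j. ?c j * (1/3) ^ j) = 0" using suminf_diff[OF sa] eq by (simp add: left_diff_distrib)
  moreover have "(\<Sum>j. ?c j * (1/3) ^ j) = (\<Sum>j. ?c (j + Suc m) * (1/3) ^ (j + Suc m)) + (\<Sum>j<Suc m. ?c j * (1/3) ^ j)"
    using sc by (rule suminf_split_initial_segment)
  moreover have "(\<Sum>j<Suc m. ?c j * (1/3) ^ j) = ?c m * (1/3) ^ m" using less by simp
  ultimately have "\<bar>?c m * (1/3) ^ m\<bar> = \<bar>\<Sum>j. ?c (j + Suc m) * (1/3) ^ (j + Suc m)\<bar>" by linarith
  also have "\<dots> \<le> (\<Sum>j. (1/3) ^ (j + Suc m))"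
  proof -
    have g: "summable (\<lambda>j. (1/3 :: real) ^ (j + Suc m))" using geo by (subst summable_iff_shift)
    have le: "\<bar>?c (j + Suc m) * (1/3) ^ (j + Suc m)\<bar> \<le> (1/3) ^ (j + Suc m)" for j
      using c1[of "j + Suc m"] by (simp add: abs_mult mult_left_le_one_le)
    have s: "summable (\<lambda>j. \<bar>?c (j + Suc m) * (1/3) ^ (j + Suc m)\<bar>)"
      by (rule summable_comparison_test'[OF g, of 0]) (use le in simp)
    show ?thesis using summable_rabs[OF s] suminf_le[OF le s g] by linarith
  qed
  also have "\<dots> = (1/3) ^ Suc m * (\<Sum>j. (1/3) ^ j)"
    using suminf_mult[OF geo, of "(1/3) ^ Suc m"] by (simp add: power_add mult.commute)
  also have "\<dots> = (1/3) ^ m / 2" using suminf_geometric[of "1/3 :: real"] by simp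
  finally have "\<bar>?c m\<bar> * (1/3) ^ m \<le> (1/3) ^ m / 2" by (simp add: abs_mult)
  moreover have "\<bar>?c m\<bar> = 1" using m a[of m] b[of m] by auto
  ultimately show False by simp
qed

text \<open>Without atoms the distribution function of \<open>\<nu>\<close> is continuous, attains
  every value strictly between \<open>0\<close> and \<open>1\<close>, and is itself uniformly
  distributed under \<open>\<nu>\<close>. Composing it with the generalized inverse of the
  distribution function of \<open>\<mu>\<close> produces the law \<open>\<mu>\<close>.\<close>

lemma exists_transport:
  assumes "real_distribution \<nu>" "real_distribution \<mu>" and atomless: "\<And>x. measure \<nu> {x} = 0"
  shows "\<exists>h \<in> borel_measurable borel. distr \<nu> borel h = \<mu>"
proof -
  interpret \<nu>: real_distribution \<nu> by fact
  interpret \<nu>: cdf_distribution \<nu> ..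
  interpret \<mu>: real_distribution \<mu> by fact
  interpret \<mu>: cdf_distribution \<mu> ..
  let ?F = "cdf \<nu>"
  have cont: "isCont ?F x" for x using atomless by (simp add: \<nu>.isCont_cdf)
  have F_bounds: "0 \<le> ?F x" "?F x \<le> 1" for x by (auto simp: \<nu>.cdf_nonneg \<nu>.cdf_bounded_prob)
  have F_mono: "x \<le> y \<Longrightarrow> ?F x \<le> ?F y" for x y by (rule \<nu>.cdf_nondecreasing)
  have ivt: "\<exists>t. ?F t = u" if u: "0 < u" "u < 1" for u
  proof -
    obtain a where a: "?F a < u"
      using order_tendstoD(2)[OF \<nu>.cdf_lim_at_bot u(1)] by (metis eventually_at_bot_linorder order_refl)
    obtain b where b: "u < ?F b"
      using order_tendstoD(1)[OF \<nu>.cdf_lim_at_top_prob u(2)] by (metis eventually_at_top_linorder order_refl)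
    have "a \<le> b" using a b F_mono[of b a] by linarith
    then show ?thesis using IVT'[of ?F a u b] a b cont by (auto simp: continuous_at_imp_continuous_on)
  qed
  have F_meas [measurable]: "?F \<in> borel_measurable borel" by (rule \<nu>.measurable_C)
  have F_set: "{x. ?F x \<le> u} \<in> sets \<nu>" for u
  proof -
    have "{x \<in> space borel. ?F x \<le> u} \<in> sets borel" by measurable
    then show ?thesis by simp
  qed
  \<comment> \<open>The level \<open>u = 0\<close> need not be attained by the distribution
    function, so the bound is obtained from attained levels \<open>w > u\<close>.\<close>
  have upper: "measure \<nu> {x. ?F x \<le> u} \<le> u" if u: "0 \<le> u" "u < 1" for u
  proof (rule dense_ge_bounded[OF u(2)])
    fix w assume w: "u < w" "w < 1"
    obtain t where t: "?F t = w" using ivt[of w] w u by auto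
    have "{x. ?F x \<le> u} \<subseteq> {..t}"
    proof
      fix x assume "x \<in> {x. ?F x \<le> u}"
      then have "?F x < ?F t" using w t by simp
      then show "x \<in> {..t}" using F_mono[of t x] by (cases "x \<le> t") auto
    qed
    then have "measure \<nu> {x. ?F x \<le> u} \<le> measure \<nu> {..t}" by (intro \<nu>.finite_measure_mono) auto
    then show "measure \<nu> {x. ?F x \<le> u} \<le> w" using t by (simp add: cdf_def)
  qed
  have unif: "measure \<nu> {x. ?F x \<le> u} = u" if u: "0 \<le> u" "u \<le> 1" for u
  proof -
    consider "u = 0" | "u = 1" | "0 < u" "u < 1" using u by linarith
    then show ?thesis
    proof cases
      case 1
      then show ?thesis using upper[of 0] measure_nonneg[of \<nu> "{x. ?F x \<le> 0}"] by simp
    next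
      case 2
      then have "{x. ?F x \<le> u} = UNIV" using F_bounds by auto
      then show ?thesis using 2 \<nu>.prob_space by simp
    next
      case 3
      obtain t where t: "?F t = u" using ivt[OF 3] by auto
      have "{..t} \<subseteq> {x. ?F x \<le> u}" using F_mono t by auto
      then have "measure \<nu> {..t} \<le> measure \<nu> {x. ?F x \<le> u}" using F_set by (intro \<nu>.finite_measure_mono)
      then show ?thesis using upper[of u] 3 t by (simp add: cdf_def)
    qed
  qed
  have ae0: "AE x in \<nu>. 0 < ?F x"
  proof -
    have "{x \<in> space \<nu>. \<not> 0 < ?F x} = {x. ?F x \<le> 0}" by auto
    then show ?thesis using unif[of 0] F_set[of 0] by (intro AE_I[of _ _ "{x. ?F x \<le> 0}"]) (auto simp: \<nu>.emeasure_eq_measure)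
  qed
  have ae1: "AE x in \<nu>. ?F x < 1"
  proof -
    have S: "{x. ?F x < 1} \<in> sets \<nu>"
    proof -
      have "{x \<in> space borel. ?F x < 1} \<in> sets borel" by measurable
      then show ?thesis by simp
    qed
    have "1 \<le> measure \<nu> {x. ?F x < 1}"
    proof (rule dense_le_bounded[of 0])
      fix w :: real assume w: "0 < w" "w < 1"
      have "measure \<nu> {x. ?F x \<le> w} \<le> measure \<nu> {x. ?F x < 1}"
        using w S by (intro \<nu>.finite_measure_mono) auto
      then show "w \<le> measure \<nu> {x. ?F x < 1}" using unif[of w] w by simp
    qed simp
    then have "\<nu>.prob {x. ?F x < 1} = 1" using \<nu>.prob_le_1 by (intro antisym)
    then show ?thesis using \<nu>.AE_prob_1[of "{x. ?F x < 1}"] by simp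
  qed
  let ?I = "\<lambda>u. Inf {x. u \<le> cdf \<mu> x}"
  \<comment> \<open>The quantile function is used only on the open unit interval, where the
    distribution function of \<open>\<nu>\<close> lies almost surely; the value \<open>0\<close>
    elsewhere is a default.\<close>
  define g where "g u = (if u \<in> {0<..<1} then ?I u else 0)" for u :: real
  have [measurable]: "g \<in> borel_measurable borel"
    unfolding g_def[abs_def] using \<mu>.measurable_CI by (subst measurable_restrict_space_iff[symmetric]) auto
  define h where "h x = g (?F x)" for x
  have h [measurable]: "h \<in> borel_measurable borel" unfolding h_def[abs_def] by measurable
  have "distr \<nu> borel h = \<mu>"
  proof (rule cdf_unique)
    show "real_distribution (distr \<nu> borel h)" by (rule \<nu>.real_distribution_distr) simp
    show "real_distribution \<mu>" by fact
    show "cdf (distr \<nu> borel h) = cdf \<mu>"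
    proof
      fix z
      have "cdf (distr \<nu> borel h) z = measure \<nu> {x. h x \<le> z}"
        unfolding cdf_def by (subst measure_distr) (auto intro: arg_cong[where f = "measure \<nu>"])
      also have "\<dots> = measure \<nu> {x. ?F x \<le> cdf \<mu> z}"
      proof (rule \<nu>.finite_measure_eq_AE)
        show "AE x in \<nu>. (x \<in> {x. h x \<le> z}) = (x \<in> {x. ?F x \<le> cdf \<mu> z})"
          using ae0 ae1
        proof eventually_elim
          case (elim x)
          then show ?case using \<mu>.pseudoinverse[of "?F x" z] by (simp add: h_def g_def)
        qed
        have "{x \<in> space borel. h x \<le> z} \<in> sets borel" by measurable
        then show "{x. h x \<le> z} \<in> sets \<nu>" by simp
      qed (rule F_set)
      also have "\<dots> = cdf \<mu> z" by (intro unif \<mu>.cdf_nonneg \<mu>.cdf_bounded_prob)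
      finally show "cdf (distr \<nu> borel h) z = cdf \<mu> z" .
    qed
  qed
  then show ?thesis using h by blast
qed

context prob_space
begin

text \<open>A pairing function splits the given sequence into infinitely many disjoint blocks, whose
  expansions \<open>X i\<close> are independent. By uniqueness of expansions the event
  \<open>X i = a\<close> prescribes all digits, so its probability is at most \<open>c ^ n\<close>
  for every \<open>n\<close>, where \<open>c < 1\<close> is the larger of the two digit
  probabilities. Hence there are no atoms.\<close>

lemma iid_normals:
  fixes \<epsilon> :: "nat \<Rightarrow> 'a \<Rightarrow> real"
  assumes ind: "indep_vars (\<lambda>_. borel) \<epsilon> UNIV" and val: "\<And>k \<omega>. \<epsilon> k \<omega> \<in> {0, 1}"
    and r: "0 < r" "r < 1" "\<And>k. prob {\<omega> \<in> space M. \<epsilon> k \<omega> = 1} = r"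
  obtains Z :: "nat \<Rightarrow> 'a \<Rightarrow> real" where "indep_vars (\<lambda>_. borel) Z UNIV"
    "\<And>i. distr M borel (Z i) = std_normal_distribution"
proof -
  have \<epsilon> [measurable]: "\<epsilon> k \<in> borel_measurable M" for k using ind by (simp add: indep_vars_def2)
  define K where "K i = range (\<lambda>j. prod_encode (i, j))" for i
  define X where "X i \<omega> = (\<Sum>j. \<epsilon> (prod_encode (i, j)) \<omega> * (1/3) ^ j)" for i \<omega>
  have [measurable]: "X i \<in> borel_measurable M" for i unfolding X_def[abs_def] by measurable
  have "indep_vars (\<lambda>i. PiM (K i) (\<lambda>_. borel)) (\<lambda>i \<omega>. restrict (\<lambda>k. \<epsilon> k \<omega>) (K i)) UNIV"
    by (rule indep_vars_restrict[OF ind]) (auto simp: K_def disjoint_family_on_def)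
  then have "indep_vars (\<lambda>_. borel) (\<lambda>i \<omega>. (\<lambda>f. \<Sum>j. f (prod_encode (i, j)) * (1/3) ^ j) (restrict (\<lambda>k. \<epsilon> k \<omega>) (K i))) UNIV"
  proof (rule indep_vars_compose2[where Y = "\<lambda>i f. \<Sum>j. f (prod_encode (i, j)) * (1/3 :: real) ^ j"])
    fix i
    have [measurable]: "(\<lambda>f :: nat \<Rightarrow> real. f (prod_encode (i, j))) \<in> measurable (PiM (K i) (\<lambda>_. borel)) borel" for j
      by (rule measurable_component_singleton) (auto simp: K_def)
    show "(\<lambda>f :: nat \<Rightarrow> real. \<Sum>j. f (prod_encode (i, j)) * (1/3) ^ j) \<in> measurable (PiM (K i) (\<lambda>_. borel)) borel"
      by measurable
  qed
  moreover have "(\<lambda>i \<omega>. (\<lambda>f. \<Sum>j. f (prod_encode (i, j)) * (1/3) ^ j) (restrict (\<lambda>k. \<epsilon> k \<omega>) (K i))) = X"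
    by (intro ext) (simp add: X_def K_def)
  ultimately have indX: "indep_vars (\<lambda>_. borel) X UNIV" by simp
  define c where "c = max r (1 - r)"
  have c: "0 \<le> c" "c < 1" using r by (auto simp: c_def)
  have pr: "prob {\<omega> \<in> space M. \<epsilon> k \<omega> = b} \<le> c" for k b
  proof -
    consider "b = 1" | "b = 0" | "b \<noteq> 0" "b \<noteq> 1" by auto
    then show ?thesis
    proof cases
      case 1 then show ?thesis using r by (simp add: c_def)
    next
      case 2
      have "{\<omega> \<in> space M. \<epsilon> k \<omega> = b} = {\<omega> \<in> space M. \<not> \<epsilon> k \<omega> = 1}" using 2 val[of k] by auto
      then have "prob {\<omega> \<in> space M. \<epsilon> k \<omega> = b} = 1 - r" using r(3)[of k] by (simp add: prob_neg)
      then show ?thesis by (simp add: c_def)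
    next
      case 3
      then have empty: "{\<omega> \<in> space M. \<epsilon> k \<omega> = b} = {}" using val[of k] by auto
      show ?thesis unfolding empty using c by simp
    qed
  qed
  have atomless: "prob {\<omega> \<in> space M. X i \<omega> = a} = 0" for i a
  proof (cases "\<exists>\<omega>\<in>space M. X i \<omega> = a")
    case False
    then have empty: "{\<omega> \<in> space M. X i \<omega> = a} = {}" by blast
    show ?thesis unfolding empty by simp
  next
    case True
    then obtain \<omega>0 where \<omega>0: "\<omega>0 \<in> space M" "X i \<omega>0 = a" by auto
    have le: "prob {\<omega> \<in> space M. X i \<omega> = a} \<le> c ^ n" for n
    proof (cases "n = 0")
      case False
      let ?J = "(\<lambda>j. prod_encode (i, j)) ` {..<n}"
      have "{\<omega> \<in> space M. X i \<omega> = a} \<subseteq> (\<Inter>k\<in>?J. \<epsilon> k -` {\<epsilon> k \<omega>0} \<inter> space M)"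
      proof
        fix \<omega> assume w: "\<omega> \<in> {\<omega> \<in> space M. X i \<omega> = a}"
        have "(\<lambda>j. \<epsilon> (prod_encode (i, j)) \<omega>) = (\<lambda>j. \<epsilon> (prod_encode (i, j)) \<omega>0)"
          by (rule ternary_expansion_unique[OF val val]) (use w \<omega>0 in \<open>simp add: X_def\<close>)
        then show "\<omega> \<in> (\<Inter>k\<in>?J. \<epsilon> k -` {\<epsilon> k \<omega>0} \<inter> space M)" using w by (auto simp: fun_eq_iff)
      qed
      then have "prob {\<omega> \<in> space M. X i \<omega> = a} \<le> prob (\<Inter>k\<in>?J. \<epsilon> k -` {\<epsilon> k \<omega>0} \<inter> space M)"
        using False by (intro finite_measure_mono sets.finite_INT) auto
      also have "\<dots> = (\<Prod>k\<in>?J. prob (\<epsilon> k -` {\<epsilon> k \<omega>0} \<inter> space M))"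
        using False by (intro indep_varsD[OF ind]) auto
      also have "\<dots> \<le> (\<Prod>k\<in>?J. c)"
      proof (intro prod_mono conjI)
        fix k
        have "\<epsilon> k -` {\<epsilon> k \<omega>0} \<inter> space M = {\<omega> \<in> space M. \<epsilon> k \<omega> = \<epsilon> k \<omega>0}" by auto
        then show "prob (\<epsilon> k -` {\<epsilon> k \<omega>0} \<inter> space M) \<le> c" using pr by simp
      qed auto
      also have "\<dots> = c ^ n" by (simp add: card_image inj_on_def)
      finally show ?thesis .
    qed simp
    have "(\<lambda>n. c ^ n) \<longlonglongrightarrow> 0" using c by (intro LIMSEQ_realpow_zero)
    then have "prob {\<omega> \<in> space M. X i \<omega> = a} \<le> 0" using le by (intro LIMSEQ_le_const) auto
    then show ?thesis by (simp add: measure_le_0_iff)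
  qed
  have "\<exists>h \<in> borel_measurable borel. distr (distr M borel (X i)) borel h = std_normal_distribution" for i
  proof (rule exists_transport)
    show "real_distribution (distr M borel (X i))" by (rule real_distribution_distr) simp
    show "real_distribution std_normal_distribution" by (rule real_dist_normal_dist)
    fix x
    have "X i -` {x} \<inter> space M = {\<omega> \<in> space M. X i \<omega> = x}" by auto
    then show "measure (distr M borel (X i)) {x} = 0" using atomless by (simp add: measure_distr)
  qed
  then obtain h where h: "\<And>i. h i \<in> borel_measurable borel" "\<And>i. distr (distr M borel (X i)) borel (h i) = std_normal_distribution"
    by metis
  show thesis
  proof (rule that[of "\<lambda>i \<omega>. h i (X i \<omega>)"])
    show "indep_vars (\<lambda>_. borel) (\<lambda>i \<omega>. h i (X i \<omega>)) UNIV" by (rule indep_vars_compose2[OF indX]) (rule h)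
    show "distr M borel (\<lambda>\<omega>. h i (X i \<omega>)) = std_normal_distribution" for i
      using h(2)[of i] h(1)[of i] by (simp add: distr_distr o_def)
  qed
qed

end

section \<open>Orthogonalization of bounded functions and the resulting Gaussian variables\<close>

definition bounded_measurable :: "'a measure \<Rightarrow> ('a \<Rightarrow> real) set" where
  "bounded_measurable M = {f \<in> borel_measurable M. \<exists>C. \<forall>x. \<bar>f x\<bar> \<le> C}"

lemma bounded_measurable_measurable [measurable_dest]: "f \<in> bounded_measurable M \<Longrightarrow> f \<in> borel_measurable M"
  by (simp add: bounded_measurable_def)

lemma bounded_measurable_cmult: "f \<in> bounded_measurable M \<Longrightarrow> (\<lambda>x. c * f x) \<in> bounded_measurable M"
  unfolding bounded_measurable_def by (auto simp: abs_mult intro!: exI[of _ "\<bar>c\<bar> * _"] mult_left_mono)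

lemma bounded_measurable_add:
  assumes "f \<in> bounded_measurable M" "g \<in> bounded_measurable M"
  shows "(\<lambda>x. f x + g x) \<in> bounded_measurable M"
proof -
  obtain C D where "\<And>x. \<bar>f x\<bar> \<le> C" "\<And>x. \<bar>g x\<bar> \<le> D" using assms by (auto simp: bounded_measurable_def)
  then have "\<bar>f x + g x\<bar> \<le> C + D" for x by (rule order_trans[OF abs_triangle_ineq add_mono])
  then show ?thesis using assms by (auto simp: bounded_measurable_def)
qed

lemma bounded_measurable_mult:
  assumes "f \<in> bounded_measurable M" "g \<in> bounded_measurable M"
  shows "(\<lambda>x. f x * g x) \<in> bounded_measurable M"
proof -
  obtain C D where C: "\<And>x. \<bar>f x\<bar> \<le> C" "\<And>x. \<bar>g x\<bar> \<le> D" using assms by (auto simp: bounded_measurable_def)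
  have "\<bar>f x * g x\<bar> \<le> C * D" for x
    unfolding abs_mult using C(1)[of x] C(2)[of x] by (intro mult_mono) auto
  then show ?thesis using assms by (auto simp: bounded_measurable_def)
qed

lemma bounded_measurable_const: "(\<lambda>x. c) \<in> bounded_measurable M"
  by (auto simp: bounded_measurable_def)

lemma bounded_measurable_sum:
  "(\<And>i. i \<in> I \<Longrightarrow> f i \<in> bounded_measurable M) \<Longrightarrow> (\<lambda>x. \<Sum>i\<in>I. f i x) \<in> bounded_measurable M"
  by (induction I rule: infinite_finite_induct) (auto intro: bounded_measurable_add bounded_measurable_const)

text \<open>If the residual has norm \<open>0\<close>, division by zero yields the function
  \<open>0\<close>. Thus linearly dependent families need no selection, and the family obtained is
  orthonormal up to zero members.\<close>

fun gram_schmidt :: "'a measure \<Rightarrow> (nat \<Rightarrow> 'a \<Rightarrow> real) \<Rightarrow> nat \<Rightarrow> 'a \<Rightarrow> real" where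
  "gram_schmidt M e n =
    (let r = (\<lambda>v. e n v - (\<Sum>i<n. (\<integral>w. e n w * gram_schmidt M e i w \<partial>M) * gram_schmidt M e i v))
     in (\<lambda>v. r v / sqrt (\<integral>w. (r w)\<^sup>2 \<partial>M)))"

declare gram_schmidt.simps [simp del]

context prob_space
begin

lemma bounded_measurable_integrable [simp]:
  assumes "f \<in> bounded_measurable M" shows "integrable M f"
proof -
  obtain C where "\<And>x. \<bar>f x\<bar> \<le> C" using assms by (auto simp: bounded_measurable_def)
  then show ?thesis using assms by (intro integrable_const_bound[where B = C]) (auto simp: bounded_measurable_def)
qed

text \<open>The residual \<open>r n\<close> acts in inner products like the component of
  \<open>e n\<close> along \<open>h n\<close>; in the degenerate case \<open>r n\<close> vanishes
  almost everywhere and both sides are \<open>0\<close>. Hence each \<open>e n\<close> expands in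
  \<open>h 0, ..., h n\<close>, and the last claim is the resulting Parseval identity for computing
  covariances.\<close>

lemma gram_schmidt_expansion:
  fixes e :: "nat \<Rightarrow> 'a \<Rightarrow> real"
  assumes e: "\<And>n. e n \<in> bounded_measurable M"
  defines "h \<equiv> gram_schmidt M e"
  shows "h n \<in> bounded_measurable M"
    and "j < i \<Longrightarrow> (\<integral>v. e j v * h i v \<partial>M) = 0"
    and "g \<in> bounded_measurable M \<Longrightarrow> (\<integral>v. e n v * g v \<partial>M) = (\<Sum>i\<le>n. (\<integral>v. e n v * h i v \<partial>M) * (\<integral>v. h i v * g v \<partial>M))"
proof -
  define ip where "ip f g = (\<integral>v. f v * g v \<partial>M)" for f g :: "'a \<Rightarrow> real"
  define r where "r n v = e n v - (\<Sum>i<n. ip (e n) (h i) * h i v)" for n v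
  define s where "s n = sqrt (ip (r n) (r n))" for n
  have h_eq: "h n = (\<lambda>v. 1 / s n * r n v)" for n
    unfolding h_def by (subst gram_schmidt.simps) (simp add: h_def[symmetric] r_def[abs_def] s_def ip_def Let_def power2_eq_square)
  have r_bm': "r n \<in> bounded_measurable M" if "\<And>i. i < n \<Longrightarrow> h i \<in> bounded_measurable M" for n
  proof -
    have "(\<lambda>v. e n v + (\<Sum>i<n. (- ip (e n) (h i)) * h i v)) \<in> bounded_measurable M"
      using that by (intro bounded_measurable_add e bounded_measurable_sum bounded_measurable_cmult) auto
    then show ?thesis by (simp add: r_def[abs_def] sum_negf)
  qed
  have h_bm: "h n \<in> bounded_measurable M" for n
  proof (induction n rule: less_induct)
    case (less n)
    then show ?case unfolding h_eq[of n] by (intro bounded_measurable_cmult r_bm')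
  qed
  then show "h n \<in> bounded_measurable M" .
  have r_bm: "r n \<in> bounded_measurable M" for n using h_bm by (rule r_bm')
  note bm = e h_bm r_bm
  have ip_commute: "ip f g = ip g f" for f g by (simp add: ip_def mult.commute)
  have ip_e: "ip (e n) g = (\<Sum>i<n. ip (e n) (h i) * ip (h i) g) + ip (r n) g" if g: "g \<in> bounded_measurable M" for n g
  proof -
    have "ip (e n) g = (\<integral>v. (\<Sum>i<n. ip (e n) (h i) * (h i v * g v)) + r n v * g v \<partial>M)"
      unfolding ip_def[of "e n" g] by (intro Bochner_Integration.integral_cong refl)
        (simp add: r_def algebra_simps sum_distrib_left sum_distrib_right)
    also have "\<dots> = (\<Sum>i<n. ip (e n) (h i) * ip (h i) g) + ip (r n) g"
    proof -
      have "integrable M (\<lambda>v. h i v * g v)" for i using h_bm g by (intro bounded_measurable_integrable bounded_measurable_mult)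
      moreover have "integrable M (\<lambda>v. r n v * g v)" using r_bm g by (intro bounded_measurable_integrable bounded_measurable_mult)
      ultimately show ?thesis unfolding ip_def[of "h _" g] ip_def[of "r _" g] by simp
    qed
    finally show ?thesis .
  qed
  have ip_h: "ip (h n) g = 1 / s n * ip (r n) g" for n g
    unfolding ip_def h_eq[of n] by (simp add: mult.assoc)
  have ip_rr: "0 \<le> ip (r n) (r n)" for n unfolding ip_def by (simp add: integral_nonneg_AE)
  have s0: "h n = (\<lambda>v. 0)" if "s n = 0" for n unfolding h_eq[of n] by (simp add: that)
  have s2: "s n * s n = ip (r n) (r n)" for n using ip_rr by (simp add: s_def)
  have ip_r0: "ip (r n) g = 0" if "s n = 0" for n g
  proof -
    have "(\<integral>v. r n v * r n v \<partial>M) = 0" using s2[of n] that by (simp add: ip_def)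
    moreover have "integrable M (\<lambda>v. r n v * r n v)"
      by (intro bounded_measurable_integrable bounded_measurable_mult r_bm)
    ultimately have "AE v in M. r n v * r n v = 0" by (simp add: integral_nonneg_eq_0_iff_AE)
    then have "AE v in M. r n v * g v = 0" by eventually_elim simp
    then show ?thesis unfolding ip_def by (rule integral_eq_zero_AE)
  qed
  have ip_hh: "ip (h n) (h n) = 1" if "s n \<noteq> 0" for n
  proof -
    have "ip (h n) (h n) = 1 / s n * (1 / s n * ip (r n) (r n))"
      by (simp only: ip_h[of n "h n"] ip_commute[of "r n" "h n"] ip_h[of n "r n"])
    also have "\<dots> = 1 / s n * (1 / s n * (s n * s n))" unfolding s2 ..
    also have "\<dots> = 1" using that by simp
    finally show ?thesis .
  qed
  have orth: "ip (h n) (h i) = 0" if "i < n" for i n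
    using that
  proof (induction n arbitrary: i rule: less_induct)
    case (less n)
    have "ip (e n) (h i) = (\<Sum>k<n. ip (e n) (h k) * ip (h k) (h i)) + ip (r n) (h i)" by (rule ip_e[OF h_bm])
    also have "(\<Sum>k<n. ip (e n) (h k) * ip (h k) (h i)) = (\<Sum>k<n. if k = i then ip (e n) (h i) * ip (h i) (h i) else 0)"
    proof (intro sum.cong refl)
      fix k assume k: "k \<in> {..<n}"
      show "ip (e n) (h k) * ip (h k) (h i) = (if k = i then ip (e n) (h i) * ip (h i) (h i) else 0)"
      proof (cases k i rule: linorder_cases)
        case less': less
        then have "ip (h i) (h k) = 0" using less.IH[of i k] \<open>i < n\<close> by simp
        then show ?thesis using less' by (simp add: ip_commute)
      next
        case greater
        then have "ip (h k) (h i) = 0" using less.IH[of k i] k by simp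
        then show ?thesis using greater by simp
      qed simp
    qed
    also have "\<dots> = ip (e n) (h i) * ip (h i) (h i)" using less.prems by simp
    also have "\<dots> = ip (e n) (h i)"
    proof (cases "s i = 0")
      case True
      then have "ip (e n) (h i) = 0" using s0[of i] by (simp add: ip_def)
      then show ?thesis by simp
    qed (simp add: ip_hh)
    finally have "ip (r n) (h i) = 0" by simp
    then show ?case by (simp add: ip_h)
  qed
  have ip_rg: "ip (r n) g = ip (e n) (h n) * ip (h n) g" if g: "g \<in> bounded_measurable M" for n g
  proof (cases "s n = 0")
    case True
    then show ?thesis using ip_r0[of n g] s0[of n] by (simp add: ip_def)
  next
    case False
    have "ip (e n) (h n) = ip (r n) (h n)"
      using ip_e[OF h_bm, of n n] orth by (simp add: ip_commute[of _ "h n"])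
    also have "\<dots> = 1 / s n * ip (r n) (r n)" by (simp only: ip_commute[of "r n" "h n"] ip_h)
    also have "\<dots> = 1 / s n * (s n * s n)" unfolding s2 ..
    also have "\<dots> = s n" using False by simp
    finally show ?thesis using False by (simp add: ip_h)
  qed
  have exp: "ip (e n) g = (\<Sum>i\<le>n. ip (e n) (h i) * ip (h i) g)" if "g \<in> bounded_measurable M" for n g
    using ip_e[OF that, of n] ip_rg[OF that, of n] by (simp add: lessThan_Suc_atMost[symmetric])
  then show "g \<in> bounded_measurable M \<Longrightarrow> (\<integral>v. e n v * g v \<partial>M) = (\<Sum>i\<le>n. (\<integral>v. e n v * h i v \<partial>M) * (\<integral>v. h i v * g v \<partial>M))"
    unfolding ip_def .
  have "ip (e j) (h i) = 0" if "j < i"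
  proof -
    have "ip (e j) (h i) = (\<Sum>k\<le>j. ip (e j) (h k) * ip (h k) (h i))" by (rule exp[OF h_bm])
    also have "\<dots> = 0" using that orth by (intro sum.neutral) (simp add: ip_commute[of _ "h i"])
    finally show ?thesis .
  qed
  then show "j < i \<Longrightarrow> (\<integral>v. e j v * h i v \<partial>M) = 0" unfolding ip_def .
qed

text \<open>\<open>W j\<close> has the coordinates of \<open>e j\<close> in the orthonormal system
  as coefficients on independent normals. For a combination \<open>g\<close> of the
  \<open>e j\<close> the coefficients are its inner products \<open>a i\<close> with
  \<open>h i\<close>, and the expansion identity gives that the sum of their squares is the integral
  of \<open>g\<close> squared.\<close>

lemma gaussian_family_of_normals:
  fixes Z :: "nat \<Rightarrow> 'a \<Rightarrow> real" and e :: "nat \<Rightarrow> 'v \<Rightarrow> real"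
  assumes Z: "indep_vars (\<lambda>_. borel) Z UNIV" "\<And>i. distr M borel (Z i) = std_normal_distribution"
    and "prob_space \<nu>" and e: "\<And>n. e n \<in> bounded_measurable \<nu>"
  obtains W :: "nat \<Rightarrow> 'a \<Rightarrow> real" where "\<And>j. W j \<in> borel_measurable M"
    "\<And>d c. (CLINT \<omega>|M. iexp (\<Sum>j<d. c j * W j \<omega>)) = complex_of_real (exp (- (\<integral>v. (\<Sum>j<d. c j * e j v)\<^sup>2 \<partial>\<nu>) / 2))"
proof -
  interpret \<nu>: prob_space \<nu> by fact
  have [measurable]: "Z i \<in> borel_measurable M" for i using Z(1) by (simp add: indep_vars_def2)
  define h where "h = gram_schmidt \<nu> e"
  have h: "h n \<in> bounded_measurable \<nu>" for n unfolding h_def using e by (rule \<nu>.gram_schmidt_expansion)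
  define b where "b j i = (\<integral>v. e j v * h i v \<partial>\<nu>)" for j i
  have b0: "b j i = 0" if "j < i" for j i unfolding b_def h_def using e that by (rule \<nu>.gram_schmidt_expansion)
  define W where "W j \<omega> = (\<Sum>i\<le>j. b j i * Z i \<omega>)" for j \<omega>
  have "(CLINT \<omega>|M. iexp (\<Sum>j<d. c j * W j \<omega>)) = complex_of_real (exp (- (\<integral>v. (\<Sum>j<d. c j * e j v)\<^sup>2 \<partial>\<nu>) / 2))" for d c
  proof -
    define g where "g v = (\<Sum>j<d. c j * e j v)" for v
    have g: "g \<in> bounded_measurable \<nu>" unfolding g_def[abs_def] by (intro bounded_measurable_sum bounded_measurable_cmult e)
    define a where "a i = (\<Sum>j<d. c j * b j i)" for i
    \<comment> \<open>The coefficients are triangular, so all sums may run over the same range and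
      be interchanged.\<close>
    have ext: "(\<Sum>i\<le>j. b j i * x i) = (\<Sum>i<d. b j i * x i)" if "j < d" for j x
      using that b0 by (intro sum.mono_neutral_left) auto
    have a_eq: "a i = (\<integral>v. g v * h i v \<partial>\<nu>)" for i
      unfolding a_def b_def g_def using e h
      by (simp add: sum_distrib_right Bochner_Integration.integral_sum mult.assoc bounded_measurable_mult bounded_measurable_cmult)
    have "(\<Sum>j<d. c j * W j \<omega>) = (\<Sum>i<d. a i * Z i \<omega>)" for \<omega>
    proof -
      have "(\<Sum>j<d. c j * W j \<omega>) = (\<Sum>j<d. \<Sum>i<d. c j * b j i * Z i \<omega>)"
        by (intro sum.cong refl) (simp add: W_def ext sum_distrib_left mult.assoc)
      also have "\<dots> = (\<Sum>i<d. \<Sum>j<d. c j * b j i * Z i \<omega>)" by (rule sum.swap)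
      finally show ?thesis by (simp add: a_def sum_distrib_right)
    qed
    then have "(CLINT \<omega>|M. iexp (\<Sum>j<d. c j * W j \<omega>)) = char (distr M borel (\<lambda>\<omega>. \<Sum>i<d. a i * Z i \<omega>)) 1"
      by (simp add: char_def integral_distr)
    also have "\<dots> = (\<Prod>i<d. char (distr M borel (\<lambda>\<omega>. a i * Z i \<omega>)) 1)"
    proof (rule char_distr_sum)
      have "indep_vars (\<lambda>_. borel) (\<lambda>i \<omega>. a i * Z i \<omega>) UNIV" by (rule indep_vars_compose2[OF Z(1)]) simp
      then show "indep_vars (\<lambda>_. borel) (\<lambda>i \<omega>. a i * Z i \<omega>) {..<d}" by (rule indep_vars_subset) simp
    qed
    also have "\<dots> = (\<Prod>i<d. complex_of_real (exp (- (a i)\<^sup>2 / 2)))"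
    proof (intro prod.cong refl)
      fix i
      have "char (distr M borel (\<lambda>\<omega>. a i * Z i \<omega>)) 1 = char (distr M borel (Z i)) (a i)"
        by (simp add: char_def integral_distr)
      then show "char (distr M borel (\<lambda>\<omega>. a i * Z i \<omega>)) 1 = complex_of_real (exp (- (a i)\<^sup>2 / 2))"
        by (simp add: Z(2) char_std_normal_distribution)
    qed
    also have "\<dots> = complex_of_real (exp (- (\<Sum>i<d. (a i)\<^sup>2) / 2))"
      by (simp add: exp_sum[symmetric] sum_negf sum_divide_distrib of_real_prod[symmetric] del: of_real_prod)
    also have "(\<Sum>i<d. (a i)\<^sup>2) = (\<integral>v. (g v)\<^sup>2 \<partial>\<nu>)"
    proof -
      have "(\<integral>v. (g v)\<^sup>2 \<partial>\<nu>) = (\<integral>v. (\<Sum>j<d. c j * (e j v * g v)) \<partial>\<nu>)"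
        by (intro Bochner_Integration.integral_cong refl)
           (simp add: g_def power2_eq_square sum_distrib_right mult.assoc)
      also have "\<dots> = (\<Sum>j<d. c j * (\<integral>v. e j v * g v \<partial>\<nu>))"
        using e g by (simp add: Bochner_Integration.integral_sum bounded_measurable_mult)
      also have "\<dots> = (\<Sum>j<d. c j * (\<Sum>i<d. b j i * a i))"
      proof (intro sum.cong refl)
        fix j assume j: "j \<in> {..<d}"
        have "(\<integral>v. e j v * g v \<partial>\<nu>) = (\<Sum>i\<le>j. b j i * (\<integral>v. h i v * g v \<partial>\<nu>))"
          unfolding b_def h_def by (rule \<nu>.gram_schmidt_expansion(3)[OF e g])
        also have "\<dots> = (\<Sum>i<d. b j i * (\<integral>v. h i v * g v \<partial>\<nu>))" using j by (intro ext) simp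
        also have "\<dots> = (\<Sum>i<d. b j i * a i)" by (simp only: a_eq mult.commute[of "g _"])
        finally show "c j * (\<integral>v. e j v * g v \<partial>\<nu>) = c j * (\<Sum>i<d. b j i * a i)" by simp
      qed
      also have "\<dots> = (\<Sum>j<d. \<Sum>i<d. c j * b j i * a i)" by (simp add: sum_distrib_left mult.assoc)
      also have "\<dots> = (\<Sum>i<d. \<Sum>j<d. c j * b j i * a i)" by (rule sum.swap)
      also have "\<dots> = (\<Sum>i<d. (a i)\<^sup>2)" by (simp add: a_def sum_distrib_right power2_eq_square)
      finally show ?thesis ..
    qed
    finally show ?thesis by (simp add: g_def)
  qed
  then show thesis by (intro that[of W]) (auto simp: W_def[abs_def])
qed

text \<open>If some event has \<open>\<nu>\<close>-probability strictly between \<open>0\<close> and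
  \<open>1\<close>, its occurrences along the \<open>Y k\<close> are independent trials, and
  \<open>iid_normals\<close> applies. Otherwise \<open>\<nu>\<close> takes only the values
  \<open>0\<close> and \<open>1\<close> on events, every centered \<open>e n\<close> vanishes almost
  everywhere, and the zero family has the required characteristic functions.\<close>

theorem gaussian_family:
  fixes Y :: "nat \<Rightarrow> 'a \<Rightarrow> 'v" and e :: "nat \<Rightarrow> 'v \<Rightarrow> real"
  assumes Y: "indep_vars (\<lambda>_. B) Y UNIV" and \<nu>: "\<And>k. distr M B (Y k) = \<nu>"
    and e: "\<And>n. e n \<in> bounded_measurable \<nu>" and mean: "\<And>n. (\<integral>v. e n v \<partial>\<nu>) = 0"
  obtains W :: "nat \<Rightarrow> 'a \<Rightarrow> real" where "\<And>j. W j \<in> borel_measurable M"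
    "\<And>d c. (CLINT \<omega>|M. iexp (\<Sum>j<d. c j * W j \<omega>)) = complex_of_real (exp (- (\<integral>v. (\<Sum>j<d. c j * e j v)\<^sup>2 \<partial>\<nu>) / 2))"
proof -
  have Ym [measurable]: "Y k \<in> measurable M B" for k using Y by (simp add: indep_vars_def2)
  have "prob_space (distr M B (Y 0))" by (rule prob_space_distr) simp
  then have p\<nu>: "prob_space \<nu>" by (simp add: \<nu>)
  interpret \<nu>: prob_space \<nu> by fact
  have sets_\<nu>: "sets \<nu> = sets B" using \<nu>[of 0] by auto
  show thesis
  proof (cases "\<exists>A\<in>sets B. 0 < measure \<nu> A \<and> measure \<nu> A < 1")
    case True
    then obtain A where A [measurable]: "A \<in> sets B" and A01: "0 < measure \<nu> A" "measure \<nu> A < 1" by auto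
    have ind: "indep_vars (\<lambda>_. borel) (\<lambda>k \<omega>. indicator A (Y k \<omega>) :: real) UNIV"
      by (rule indep_vars_compose2[OF Y]) simp
    have prA: "prob {\<omega> \<in> space M. indicator A (Y k \<omega>) = (1::real)} = measure \<nu> A" for k
    proof -
      have "{\<omega> \<in> space M. indicator A (Y k \<omega>) = (1::real)} = Y k -` A \<inter> space M" by (auto simp: indicator_def)
      then show ?thesis unfolding \<nu>[of k, symmetric] by (simp add: measure_distr)
    qed
    obtain Z :: "nat \<Rightarrow> 'a \<Rightarrow> real" where Z: "indep_vars (\<lambda>_. borel) Z UNIV" "\<And>i. distr M borel (Z i) = std_normal_distribution"
      by (rule iid_normals[OF ind _ A01 prA]) (auto simp: indicator_def)
    show thesis by (rule gaussian_family_of_normals[OF Z p\<nu> e]) (rule that)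
  next
    case False
    have null: "AE v in \<nu>. e n v = 0" for n
    proof -
      have [measurable]: "e n \<in> borel_measurable \<nu>" using e by (simp add: bounded_measurable_def)
      \<comment> \<open>For a measure with values \<open>0\<close> and \<open>1\<close> the event
        \<open>0 < f\<close> is null or almost sure; this excludes the second case by the mean. Used
        for \<open>e n\<close> and for its negative.\<close>
      have pos: "measure \<nu> {v \<in> space \<nu>. 0 < f v} \<noteq> 1"
        if [measurable]: "f \<in> borel_measurable \<nu>" and f: "integrable \<nu> f" "(\<integral>v. f v \<partial>\<nu>) = 0" for f :: "'v \<Rightarrow> real"
      proof
        assume "measure \<nu> {v \<in> space \<nu>. 0 < f v} = 1"
        then have ae: "AE v in \<nu>. 0 < f v" by (subst (asm) \<nu>.prob_Collect_eq_1) auto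
        then have "AE v in \<nu>. 0 \<le> f v" by eventually_elim simp
        then have "AE v in \<nu>. f v = 0"
          using f integral_nonneg_eq_0_iff_AE[OF f(1)] by simp
        with ae have "AE v in \<nu>. False" by eventually_elim simp
        then show False by simp
      qed
      have dich: "measure \<nu> {v \<in> space \<nu>. 0 < f v} = 0" if [measurable]: "f \<in> borel_measurable \<nu>"
        and f: "integrable \<nu> f" "(\<integral>v. f v \<partial>\<nu>) = 0" for f :: "'v \<Rightarrow> real"
      proof -
        have "{v \<in> space \<nu>. 0 < f v} \<in> sets B" unfolding sets_\<nu>[symmetric] by measurable
        then show ?thesis using False pos[OF that] \<nu>.prob_le_1[of "{v \<in> space \<nu>. 0 < f v}"]
            measure_nonneg[of \<nu> "{v \<in> space \<nu>. 0 < f v}"] by (auto simp: less_le)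
      qed
      have "AE v in \<nu>. \<not> 0 < e n v"
        using dich[of "e n"] e mean by (subst \<nu>.prob_Collect_eq_0[symmetric]) auto
      moreover have "AE v in \<nu>. \<not> 0 < - e n v"
        using dich[of "\<lambda>v. - e n v"] e mean by (subst \<nu>.prob_Collect_eq_0[symmetric]) auto
      ultimately show ?thesis by eventually_elim simp
    qed
    then have ae: "AE v in \<nu>. \<forall>n. e n v = 0" by (simp add: AE_all_countable)
    have "(\<integral>v. (\<Sum>j<d. c j * e j v)\<^sup>2 \<partial>\<nu>) = 0" for c d
      by (rule integral_eq_zero_AE) (use ae in \<open>auto elim!: eventually_mono\<close>)
    then show thesis by (intro that[of "\<lambda>_ _. 0"]) (auto simp: prob_space)
  qed
qed

section \<open>Norm estimates for Gaussian variables, centering and normalized sums\<close>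

lemma Lnorm_mono_exponent:
  assumes "0 < r" "r \<le> q" and [measurable]: "f \<in> borel_measurable M"
  shows "Lnorm M r f \<le> Lnorm M q f"
proof -
  have "(\<integral>\<^sup>+ y. ennreal_powr (f y) r \<partial>M) \<le> Lnorm M (q / r) (\<lambda>y. ennreal_powr (f y) r)"
    using assms by (intro nn_integral_le_Lnorm) auto
  then have "Lnorm M r f \<le> ennreal_powr (Lnorm M (q / r) (\<lambda>y. ennreal_powr (f y) r)) (1 / r)"
    unfolding Lnorm_def[of M r] using assms by (intro ennreal_powr_mono) auto
  also have "\<dots> = Lnorm M q f" using assms by (simp add: Lnorm_def ennreal_powr_powr)
  finally show ?thesis .
qed

end

text \<open>The power \<open>q\<close> is dominated by \<open>1\<close> plus an even integer power,
  whose moment exists. This norm is the constant in all comparisons with Gaussian variables.\<close>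

lemma std_normal_abs_moment_finite:
  assumes "0 < q"
  shows "Lnorm std_normal_distribution q (\<lambda>x. ennreal \<bar>x\<bar>) < \<top>"
proof -
  interpret real_distribution std_normal_distribution by (rule real_dist_normal_dist)
  define k where "k = nat \<lceil>q\<rceil>"
  have k: "q \<le> real (2 * k)" using assms by (simp add: k_def) linarith
  have "(\<integral>\<^sup>+ x. ennreal_powr (ennreal \<bar>x\<bar>) q \<partial>std_normal_distribution) \<le> (\<integral>\<^sup>+ x. ennreal (1 + x ^ (2 * k)) \<partial>std_normal_distribution)"
  proof (intro nn_integral_mono)
    fix x :: real
    have "\<bar>x\<bar> powr q \<le> 1 + x ^ (2 * k)"
    proof (cases "1 \<le> \<bar>x\<bar>")
      case True
      then have "\<bar>x\<bar> powr q \<le> \<bar>x\<bar> powr real (2 * k)" using k by (intro powr_mono) auto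
      also have "\<dots> = \<bar>x\<bar> ^ (2 * k)" using True by (intro powr_realpow) auto
      finally show ?thesis by (simp add: power_even_abs)
    next
      case False
      then have "\<bar>x\<bar> powr q \<le> 1" using assms by (intro powr_le1) auto
      then show ?thesis by (simp add: add_increasing2)
    qed
    then show "ennreal_powr (ennreal \<bar>x\<bar>) q \<le> ennreal (1 + x ^ (2 * k))" by (simp add: ennreal_leI del: ennreal_plus)
  qed
  also have "\<dots> = ennreal (\<integral>x. 1 + x ^ (2 * k) \<partial>std_normal_distribution)"
    using integrable_std_normal_distribution_moment[of "2 * k"] by (intro nn_integral_eq_integral) auto
  finally show ?thesis unfolding Lnorm_def by (simp add: le_less_trans)
qed

text \<open>The characteristic function identifies the law as that of \<open>\<sigma>\<close> times
  a standard normal variable, so every moment is controlled by the variance alone.\<close>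

lemma (in prob_space) gaussian_Lnorm:
  fixes G :: "'a \<Rightarrow> real"
  assumes [measurable]: "G \<in> borel_measurable M" and "0 \<le> \<sigma>" "0 < q"
    and char: "\<And>t. (CLINT \<omega>|M. iexp (t * G \<omega>)) = complex_of_real (exp (- (t * \<sigma>)\<^sup>2 / 2))"
  shows "Lnorm M q (\<lambda>\<omega>. ennreal \<bar>G \<omega>\<bar>) = ennreal \<sigma> * Lnorm std_normal_distribution q (\<lambda>x. ennreal \<bar>x\<bar>)"
proof -
  interpret N: real_distribution std_normal_distribution by (rule real_dist_normal_dist)
  let ?N = "distr std_normal_distribution borel (\<lambda>x. \<sigma> * x)"
  have eq: "distr M borel G = ?N"
  proof (rule Levy_uniqueness)
    show "real_distribution (distr M borel G)" by (rule real_distribution_distr) simp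
    show "real_distribution ?N" by (rule N.real_distribution_distr) simp
    show "char (distr M borel G) = char ?N"
    proof
      fix t
      have "char ?N t = char std_normal_distribution (t * \<sigma>)"
        unfolding char_def by (subst integral_distr) (auto simp: mult.assoc)
      moreover have "char (distr M borel G) t = (CLINT \<omega>|M. iexp (t * G \<omega>))"
        unfolding char_def by (subst integral_distr) auto
      ultimately show "char (distr M borel G) t = char ?N t"
        by (simp only: char char_std_normal_distribution)
    qed
  qed
  have "Lnorm M q (\<lambda>\<omega>. ennreal \<bar>G \<omega>\<bar>) = Lnorm (distr M borel G) q (\<lambda>x. ennreal \<bar>x\<bar>)"
    unfolding Lnorm_def by (subst nn_integral_distr) auto
  also have "\<dots> = Lnorm std_normal_distribution q (\<lambda>x. ennreal \<bar>\<sigma> * x\<bar>)"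
    unfolding eq Lnorm_def by (subst nn_integral_distr) auto
  also have "\<dots> = Lnorm std_normal_distribution q (\<lambda>x. ennreal \<sigma> * ennreal \<bar>x\<bar>)"
    using assms by (simp add: abs_mult ennreal_mult)
  also have "\<dots> = ennreal \<sigma> * Lnorm std_normal_distribution q (\<lambda>x. ennreal \<bar>x\<bar>)"
    using assms by (intro Lnorm_cmult) auto
  finally show ?thesis .
qed

lemma ennreal_add_less_of_half:
  assumes "x < ennreal (e / 2)" "y < ennreal (e / 2)" shows "x + y < ennreal e"
proof -
  obtain a b where "x = ennreal a" "y = ennreal b" "0 \<le> a" "0 \<le> b"
    using assms by (metis ennreal_cases ennreal_less_top less_asym')
  then show ?thesis using assms
    by (simp add: ennreal_less_iff ennreal_plus[symmetric] del: ennreal_plus)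
qed

text \<open>\<open>density\<close> applied to the closure \<open>W\<close> of a linear family
  \<open>S\<close>. The axioms of a function norm make this closure linear and closed.\<close>

lemma (in function_norm) density_span:
  fixes S :: "('x \<Rightarrow> real) set"
  assumes S_meas: "S \<subseteq> borel_measurable X"
    and S_add: "\<And>f g. f \<in> S \<Longrightarrow> g \<in> S \<Longrightarrow> (\<lambda>x. f x + g x) \<in> S"
    and S_scale: "\<And>f c. f \<in> S \<Longrightarrow> (\<lambda>x. c * f x) \<in> S"
    and G: "Int_stable G" "G \<subseteq> Pow (space X)" "sets X = sigma_sets (space X) G"
    and E: "\<And>n. E n \<in> sets X" "incseq E" "(\<Union>n. E n) = space X" "\<And>n. N (indicator (E n)) < \<top>"
    and S_E: "\<And>n. indicator (E n) \<in> S"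
    and S_G: "\<And>A n. A \<in> G \<Longrightarrow> indicator (A \<inter> E n) \<in> S"
    and f: "f \<in> borel_measurable X" "N (\<lambda>x. ennreal \<bar>f x\<bar>) < \<top>" and e: "0 < e"
  shows "\<exists>g\<in>S. N (\<lambda>x. ennreal \<bar>f x - g x\<bar>) < ennreal e"
proof -
  define W where "W = {f \<in> borel_measurable X. \<forall>e::real>0. \<exists>g\<in>S. N (\<lambda>x. ennreal \<bar>f x - g x\<bar>) < ennreal e}"
  have S_W: "S \<subseteq> W"
  proof
    fix f assume "f \<in> S"
    moreover have "N (\<lambda>x. ennreal \<bar>f x - f x\<bar>) < ennreal e" if "0 < e" for e using that by simp
    ultimately show "f \<in> W" using S_meas unfolding W_def by blast
  qed
  have W_D: "\<exists>g\<in>S. N (\<lambda>x. ennreal \<bar>f x - g x\<bar>) < ennreal e" if "f \<in> W" "0 < e" for f e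
    using that unfolding W_def by blast
  have W_meas: "f \<in> borel_measurable X" if "f \<in> W" for f using that unfolding W_def by blast
  have "f \<in> W"
  proof (rule density[OF _ _ _ G E _ _ f])
    show "indicator (E n) \<in> W" for n using S_E S_W by blast
    show "indicator (A \<inter> E n) \<in> W" if "A \<in> G" for A n using S_G[OF that] S_W by blast
  next
    fix f g assume fg: "f \<in> W" "g \<in> W"
    note W_meas[OF fg(1), measurable] W_meas[OF fg(2), measurable]
    show "(\<lambda>x. f x + g x) \<in> W" unfolding W_def
    proof (intro CollectI conjI allI impI)
      fix e :: real assume "0 < e"
      then obtain f' g' where D: "f' \<in> S" "g' \<in> S" "N (\<lambda>x. ennreal \<bar>f x - f' x\<bar>) < ennreal (e/2)" "N (\<lambda>x. ennreal \<bar>g x - g' x\<bar>) < ennreal (e/2)"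
        using W_D[OF fg(1), of "e/2"] W_D[OF fg(2), of "e/2"] by auto
      have [measurable]: "f' \<in> borel_measurable X" "g' \<in> borel_measurable X" using D S_meas by auto
      have "N (\<lambda>x. ennreal \<bar>(f x - f' x) + (g x - g' x)\<bar>) \<le> N (\<lambda>x. ennreal \<bar>f x - f' x\<bar>) + N (\<lambda>x. ennreal \<bar>g x - g' x\<bar>)"
        by (rule N_abs_add) measurable
      also have "\<dots> < ennreal e" using D by (intro ennreal_add_less_of_half)
      finally show "\<exists>h\<in>S. N (\<lambda>x. ennreal \<bar>(f x + g x) - h x\<bar>) < ennreal e"
        using S_add[OF D(1,2)] by (intro bexI[of _ "\<lambda>x. f' x + g' x"]) (simp_all add: algebra_simps)
    qed measurable
  next
    fix f and c :: real assume f: "f \<in> W"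
    note W_meas[OF f, measurable]
    show "(\<lambda>x. c * f x) \<in> W" unfolding W_def
    proof (intro CollectI conjI allI impI)
      fix e :: real assume e: "0 < e"
      define d where "d = e / (\<bar>c\<bar> + 1)"
      have d: "0 < d" using e by (simp add: d_def add_nonneg_pos)
      obtain g where g: "g \<in> S" "N (\<lambda>x. ennreal \<bar>f x - g x\<bar>) < ennreal d" using W_D[OF f d] by auto
      have [measurable]: "g \<in> borel_measurable X" using g S_meas by auto
      have "N (\<lambda>x. ennreal \<bar>c * (f x - g x)\<bar>) \<le> ennreal \<bar>c\<bar> * ennreal d"
        using g by (subst N_abs_cmult) (auto intro: mult_left_mono)
      also have "\<dots> = ennreal (\<bar>c\<bar> * d)" using d by (simp add: ennreal_mult)
      also have "\<dots> < ennreal e"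
      proof -
        have "\<bar>c\<bar> * d < (\<bar>c\<bar> + 1) * d" using d by (simp add: algebra_simps)
        also have "\<dots> = e" using add_nonneg_pos[of "\<bar>c\<bar>" 1] by (simp add: d_def)
        finally show ?thesis using d by (simp add: ennreal_less_iff)
      qed
      finally show "\<exists>h\<in>S. N (\<lambda>x. ennreal \<bar>c * f x - h x\<bar>) < ennreal e"
        using S_scale[OF g(1), of c] by (intro bexI[of _ "\<lambda>x. c * g x"]) (simp_all add: right_diff_distrib)
    qed measurable
  next
    fix f assume f [measurable]: "f \<in> borel_measurable X"
      and ap: "\<And>e::real. 0 < e \<Longrightarrow> \<exists>g\<in>W. g \<in> borel_measurable X \<and> N (\<lambda>x. ennreal \<bar>f x - g x\<bar>) < ennreal e"
    show "f \<in> W" unfolding W_def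
    proof (intro CollectI conjI allI impI)
      fix e :: real assume "0 < e"
      then obtain g where g: "g \<in> W" "N (\<lambda>x. ennreal \<bar>f x - g x\<bar>) < ennreal (e/2)" using ap[of "e/2"] by auto
      obtain h where h: "h \<in> S" "N (\<lambda>x. ennreal \<bar>g x - h x\<bar>) < ennreal (e/2)" using W_D[OF g(1), of "e/2"] \<open>0 < e\<close> by auto
      have [measurable]: "h \<in> borel_measurable X" "g \<in> borel_measurable X" using h S_meas W_meas[OF g(1)] by auto
      have "N (\<lambda>x. ennreal \<bar>f x - h x\<bar>) \<le> N (\<lambda>x. ennreal \<bar>f x - g x\<bar>) + N (\<lambda>x. ennreal \<bar>g x - h x\<bar>)"
        by (rule N_abs_triangle) measurable
      also have "\<dots> < ennreal e" using g h by (intro ennreal_add_less_of_half)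
      finally show "\<exists>h\<in>S. N (\<lambda>x. ennreal \<bar>f x - h x\<bar>) < ennreal e" using h by blast
    qed simp
  qed
  then show ?thesis using e by (rule W_D)
qed

text \<open>The mean is bounded by the first absolute moment and hence by the L_q norm, so centering
  an approximation costs at most a factor \<open>2\<close>.\<close>

lemma (in prob_space) Lnorm_centered_le:
  fixes D :: "'a \<Rightarrow> real"
  assumes q: "1 \<le> q" and [measurable]: "D \<in> borel_measurable M" and fin: "Lnorm M q (\<lambda>\<omega>. ennreal \<bar>D \<omega>\<bar>) < \<top>"
  shows "integrable M D"
    and "Lnorm M q (\<lambda>\<omega>. ennreal \<bar>D \<omega> - expectation D\<bar>) \<le> 2 * Lnorm M q (\<lambda>\<omega>. ennreal \<bar>D \<omega>\<bar>)"
proof -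
  have le: "(\<integral>\<^sup>+ \<omega>. ennreal \<bar>D \<omega>\<bar> \<partial>M) \<le> Lnorm M q (\<lambda>\<omega>. ennreal \<bar>D \<omega>\<bar>)" by (rule nn_integral_le_Lnorm[OF q]) measurable
  then show int: "integrable M D" using fin by (intro integrableI_bounded) (auto intro: le_less_trans)
  have "ennreal \<bar>expectation D\<bar> \<le> ennreal (expectation (\<lambda>\<omega>. \<bar>D \<omega>\<bar>))" by (intro ennreal_leI integral_abs_bound)
  also have "\<dots> = (\<integral>\<^sup>+ \<omega>. ennreal \<bar>D \<omega>\<bar> \<partial>M)" using int by (intro nn_integral_eq_integral[symmetric]) auto
  finally have mean: "ennreal \<bar>expectation D\<bar> \<le> Lnorm M q (\<lambda>\<omega>. ennreal \<bar>D \<omega>\<bar>)" using le by (rule order_trans)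
  have "Lnorm M q (\<lambda>\<omega>. ennreal \<bar>D \<omega> - expectation D\<bar>) \<le> Lnorm M q (\<lambda>\<omega>. ennreal \<bar>D \<omega>\<bar> + ennreal \<bar>expectation D\<bar>)"
    using q by (intro Lnorm_mono) (auto simp: ennreal_plus[symmetric] simp del: ennreal_plus intro!: ennreal_leI)
  also have "\<dots> \<le> Lnorm M q (\<lambda>\<omega>. ennreal \<bar>D \<omega>\<bar>) + Lnorm M q (\<lambda>\<omega>. ennreal \<bar>expectation D\<bar>)"
    using q by (intro Lnorm_triangle) auto
  also have "Lnorm M q (\<lambda>\<omega>. ennreal \<bar>expectation D\<bar>) = ennreal \<bar>expectation D\<bar>"
    using q by (simp add: Lnorm_def emeasure_space_1 powr_powr)
  also have "Lnorm M q (\<lambda>\<omega>. ennreal \<bar>D \<omega>\<bar>) + \<dots> \<le> 2 * Lnorm M q (\<lambda>\<omega>. ennreal \<bar>D \<omega>\<bar>)"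
    using mean by (simp add: mult_2 add_left_mono)
  finally show "Lnorm M q (\<lambda>\<omega>. ennreal \<bar>D \<omega> - expectation D\<bar>) \<le> 2 * Lnorm M q (\<lambda>\<omega>. ennreal \<bar>D \<omega>\<bar>)" .
qed

lemma (in prob_space) Lnorm_eq_integral:
  fixes X :: "'a \<Rightarrow> real"
  assumes "0 < q" "integrable M (\<lambda>\<omega>. \<bar>X \<omega>\<bar> powr q)"
  shows "Lnorm M q (\<lambda>\<omega>. ennreal \<bar>X \<omega>\<bar>) = ennreal (expectation (\<lambda>\<omega>. \<bar>X \<omega>\<bar> powr q) powr (1 / q))"
proof -
  have "(\<integral>\<^sup>+ \<omega>. ennreal (\<bar>X \<omega>\<bar> powr q) \<partial>M) = ennreal (expectation (\<lambda>\<omega>. \<bar>X \<omega>\<bar> powr q))"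
    using assms by (intro nn_integral_eq_integral) auto
  then show ?thesis by (simp add: Lnorm_def integral_nonneg_AE)
qed

lemma (in prob_space) integrable_powr_of_Lnorm:
  fixes X :: "'a \<Rightarrow> real"
  assumes "0 < q" and [measurable]: "X \<in> borel_measurable M" and "Lnorm M q (\<lambda>\<omega>. ennreal \<bar>X \<omega>\<bar>) < \<top>"
  shows "integrable M (\<lambda>\<omega>. \<bar>X \<omega>\<bar> powr q)"
  using assms by (intro integrableI_bounded) (auto simp: Lnorm_def)

text \<open>The factor \<open>real n powr (q / 2)\<close> of \<open>moment_bound_sum\<close> cancels
  against the \<open>q\<close>-th power of \<open>sqrt (real n)\<close>. As \<open>K\<close> depends
  neither on \<open>H\<close> nor on \<open>n\<close>, the bound holds with one constant for all
  sections of a random field and all sample sizes.\<close>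

lemma (in prob_space) normalized_sum_Lnorm_bound:
  assumes q: "2 \<le> q"
  obtains K :: real where "1 \<le> K"
    "\<And>(Y :: nat \<Rightarrow> 'a \<Rightarrow> 'v) B \<nu> H n. \<lbrakk>indep_vars (\<lambda>_. B) Y UNIV; \<And>k. distr M B (Y k) = \<nu>; H \<in> borel_measurable B;
        Lnorm \<nu> q (\<lambda>v. ennreal \<bar>H v\<bar>) < \<top>; (\<integral>v. H v \<partial>\<nu>) = (0::real)\<rbrakk> \<Longrightarrow>
      Lnorm M q (\<lambda>\<omega>. ennreal \<bar>(\<Sum>k<n. H (Y k \<omega>)) / sqrt (real n)\<bar>) \<le> ennreal K * Lnorm \<nu> q (\<lambda>v. ennreal \<bar>H v\<bar>)"
proof -
  obtain K0 :: real where K0: "1 \<le> K0"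
    "\<And>X :: nat \<Rightarrow> 'a \<Rightarrow> real. \<And>m n. \<lbrakk>indep_vars (\<lambda>_. borel) X UNIV; \<And>i. integrable M (\<lambda>\<omega>. \<bar>X i \<omega>\<bar> powr q);
        \<And>i. expectation (\<lambda>\<omega>. \<bar>X i \<omega>\<bar> powr q) \<le> m; \<And>i. expectation (X i) = 0\<rbrakk> \<Longrightarrow>
      integrable M (\<lambda>\<omega>. \<bar>\<Sum>i<n. X i \<omega>\<bar> powr q) \<and>
      expectation (\<lambda>\<omega>. \<bar>\<Sum>i<n. X i \<omega>\<bar> powr q) \<le> K0 * real n powr (q / 2) * m"
    using moment_bound_sum[OF q] by blast
  show thesis
  proof (rule that[of "K0 powr (1 / q)"])
    show "1 \<le> K0 powr (1 / q)" using K0 q by (intro ge_one_powr_ge_zero) auto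
    fix Y :: "nat \<Rightarrow> 'a \<Rightarrow> 'v" and B \<nu> H n
    assume Y: "indep_vars (\<lambda>_. B) Y UNIV" and \<nu>: "\<And>k. distr M B (Y k) = \<nu>" and H [measurable]: "H \<in> borel_measurable B"
      and fin: "Lnorm \<nu> q (\<lambda>v. ennreal \<bar>H v\<bar>) < \<top>" and mean: "(\<integral>v. H v \<partial>\<nu>) = (0::real)"
    have [measurable]: "Y k \<in> measurable M B" for k using Y by (simp add: indep_vars_def2)
    have "prob_space (distr M B (Y 0))" by (rule prob_space_distr) simp
    then interpret \<nu>: prob_space \<nu> by (simp add: \<nu>)
    have [measurable_cong]: "sets \<nu> = sets B" using \<nu>[of 0] by auto
    define m where "m = (\<integral>v. \<bar>H v\<bar> powr q \<partial>\<nu>)"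
    have m0: "0 \<le> m" by (simp add: m_def integral_nonneg_AE)
    have Hint: "integrable \<nu> (\<lambda>v. \<bar>H v\<bar> powr q)" using q fin by (intro \<nu>.integrable_powr_of_Lnorm) auto
    have LH: "Lnorm \<nu> q (\<lambda>v. ennreal \<bar>H v\<bar>) = ennreal (m powr (1 / q))"
      using q Hint by (simp add: \<nu>.Lnorm_eq_integral m_def)
    show "Lnorm M q (\<lambda>\<omega>. ennreal \<bar>(\<Sum>k<n. H (Y k \<omega>)) / sqrt (real n)\<bar>) \<le> ennreal (K0 powr (1 / q)) * Lnorm \<nu> q (\<lambda>v. ennreal \<bar>H v\<bar>)"
    proof (cases "n = 0")
      case True
      then show ?thesis by (simp add: Lnorm_def)
    next
      case False
      have ind: "indep_vars (\<lambda>_. borel) (\<lambda>k \<omega>. H (Y k \<omega>)) UNIV" by (rule indep_vars_compose2[OF Y]) simp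
      have i1: "integrable M (\<lambda>\<omega>. \<bar>H (Y k \<omega>)\<bar> powr q)" for k
        using Hint unfolding \<nu>[of k, symmetric] by (subst (asm) integrable_distr_eq) auto
      have i2: "expectation (\<lambda>\<omega>. \<bar>H (Y k \<omega>)\<bar> powr q) = m" for k
        unfolding m_def \<nu>[of k, symmetric] by (subst integral_distr) auto
      have i3: "expectation (\<lambda>\<omega>. H (Y k \<omega>)) = 0" for k
        using mean unfolding \<nu>[of k, symmetric] by (subst (asm) integral_distr) auto
      have S: "integrable M (\<lambda>\<omega>. \<bar>\<Sum>k<n. H (Y k \<omega>)\<bar> powr q)"
        "expectation (\<lambda>\<omega>. \<bar>\<Sum>k<n. H (Y k \<omega>)\<bar> powr q) \<le> K0 * real n powr (q / 2) * m"
        using K0(2)[OF ind i1 _ i3, of m n] i2 by auto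
      have sn: "sqrt (real n) powr q = real n powr (q / 2)"
        using False by (simp add: powr_half_sqrt[symmetric] powr_powr)
      have "\<bar>x / sqrt (real n)\<bar> powr q = \<bar>x\<bar> powr q / real n powr (q / 2)" for x
        using sn by (simp add: abs_divide powr_divide)
      then have S': "integrable M (\<lambda>\<omega>. \<bar>(\<Sum>k<n. H (Y k \<omega>)) / sqrt (real n)\<bar> powr q)"
        "expectation (\<lambda>\<omega>. \<bar>(\<Sum>k<n. H (Y k \<omega>)) / sqrt (real n)\<bar> powr q) \<le> K0 * m"
        using S False by (simp_all add: divide_le_eq mult_ac)
      have "Lnorm M q (\<lambda>\<omega>. ennreal \<bar>(\<Sum>k<n. H (Y k \<omega>)) / sqrt (real n)\<bar>) \<le> ennreal ((K0 * m) powr (1 / q))"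
        using S' q by (subst Lnorm_eq_integral) (auto intro!: ennreal_leI powr_mono2 integral_nonneg_AE)
      also have "\<dots> = ennreal (K0 powr (1 / q)) * ennreal (m powr (1 / q))"
        using K0 m0 by (simp add: powr_mult ennreal_mult)
      finally show ?thesis by (simp add: LH)
    qed
  qed
qed

text \<open>A bounded continuous function is the increasing limit of Lipschitz functions
  (inf-convolutions), so that weak convergence need only be tested on the latter.\<close>

context mixed_space
begin

definition inf_conv :: "(((nat \<Rightarrow> 'a) \<Rightarrow> real) \<Rightarrow> real) \<Rightarrow> nat \<Rightarrow> ((nat \<Rightarrow> 'a) \<Rightarrow> real) \<Rightarrow> real" where
  "inf_conv \<phi> k f = (INF g\<in>V. \<phi> g + real k * nn (\<lambda>x. f x - g x))"

lemma inf_conv: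
  assumes K: "\<And>f. f \<in> V \<Longrightarrow> \<bar>\<phi> f\<bar> \<le> K" and f: "f \<in> V"
  shows "inf_conv \<phi> k f \<le> \<phi> f" "\<bar>inf_conv \<phi> k f\<bar> \<le> K"
    and "h \<in> V \<Longrightarrow> \<bar>inf_conv \<phi> k f - inf_conv \<phi> k h\<bar> \<le> real k * nn (\<lambda>x. f x - h x)"
    and "continuous_map (seminorm_topology V nn) euclideanreal \<phi> \<Longrightarrow> (\<lambda>k. inf_conv \<phi> k f) \<longlonglongrightarrow> \<phi> f"
proof -
  have ge: "- K \<le> \<phi> g + real k * nn (\<lambda>x. f x - g x)" if "g \<in> V" for g f k
    using K[OF that] mult_nonneg_nonneg[OF of_nat_0_le_iff nn_nonneg, of k "\<lambda>x. f x - g x"] by linarith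
  have bdd: "bdd_below ((\<lambda>g. \<phi> g + real k * nn (\<lambda>x. f x - g x)) ` V)" for f k
    using ge by (intro bdd_belowI[of _ "- K"]) auto
  have ne: "V \<noteq> {}" using f by auto
  have nn0: "nn (\<lambda>x. f x - f x) = 0" for f :: "(nat \<Rightarrow> 'a) \<Rightarrow> real" by (simp add: mixed_Lp_norm_def)
  have up: "inf_conv \<phi> k f \<le> \<phi> g + real k * nn (\<lambda>x. f x - g x)" if "g \<in> V" for f g k
    unfolding inf_conv_def by (rule cINF_lower[OF bdd that])
  show le: "inf_conv \<phi> k f \<le> \<phi> f" for k using up[OF f, of k f] nn0[of f] by simp
  have low: "- K \<le> inf_conv \<phi> k f" for f k unfolding inf_conv_def by (rule cINF_greatest[OF ne ge])
  show "\<bar>inf_conv \<phi> k f\<bar> \<le> K" using le[of k] low[of k f] K[OF f] by linarith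
  have half: "inf_conv \<phi> k f - real k * nn (\<lambda>x. f x - h x) \<le> inf_conv \<phi> k h" if "f \<in> V" "h \<in> V" for f h
    unfolding inf_conv_def[of \<phi> k h]
  proof (rule cINF_greatest[OF ne])
    fix g assume g: "g \<in> V"
    have "real k * nn (\<lambda>x. f x - g x) \<le> real k * (nn (\<lambda>x. f x - h x) + nn (\<lambda>x. h x - g x))"
      using that g by (intro mult_left_mono nn_triangle) auto
    then show "inf_conv \<phi> k f - real k * nn (\<lambda>x. f x - h x) \<le> \<phi> g + real k * nn (\<lambda>x. h x - g x)"
      using up[OF g, of k f] by (simp add: algebra_simps)
  qed
  show "\<bar>inf_conv \<phi> k f - inf_conv \<phi> k h\<bar> \<le> real k * nn (\<lambda>x. f x - h x)" if h: "h \<in> V"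
    using half[OF f h] half[OF h f] nn_commute[of f h] by (auto simp: abs_le_iff)
  show "(\<lambda>k. inf_conv \<phi> k f) \<longlonglongrightarrow> \<phi> f" if cont: "continuous_map (seminorm_topology V nn) euclideanreal \<phi>"
  proof (rule LIMSEQ_I)
    fix e :: real assume e: "0 < e"
    then obtain d where d: "0 < d" "\<And>g. g \<in> V \<Longrightarrow> nn (\<lambda>x. g x - f x) < d \<Longrightarrow> \<bar>\<phi> g - \<phi> f\<bar> < e / 2"
      using cont[unfolded continuous_map_iff] f by (meson half_gt_zero)
    \<comment> \<open>Within distance \<open>d\<close> continuity controls \<open>\<phi> g\<close>.
      Beyond it the penalty exceeds \<open>2 * K\<close>, the largest possible oscillation of
      \<open>\<phi>\<close>.\<close>
    obtain k0 :: nat where k0: "2 * K / d < real k0" using reals_Archimedean2 by blast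
    have "\<phi> f - e / 2 \<le> inf_conv \<phi> k f" if k: "k0 \<le> k" for k
      unfolding inf_conv_def
    proof (rule cINF_greatest[OF ne])
      fix g assume g: "g \<in> V"
      show "\<phi> f - e / 2 \<le> \<phi> g + real k * nn (\<lambda>x. f x - g x)"
      proof (cases "nn (\<lambda>x. f x - g x) < d")
        case True
        then have "\<bar>\<phi> g - \<phi> f\<bar> < e / 2" using d(2)[OF g] nn_commute[of f g] by simp
        moreover have "0 \<le> real k * nn (\<lambda>x. f x - g x)" by simp
        ultimately show ?thesis by linarith
      next
        case False
        have "2 * K < real k0 * d" using k0 d by (simp add: divide_less_eq)
        also have "\<dots> \<le> real k * nn (\<lambda>x. f x - g x)" using False k d by (intro mult_mono) auto
        finally show ?thesis using K[OF f] K[OF g] e by linarith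
      qed
    qed
    then have "norm (inf_conv \<phi> k f - \<phi> f) < e" if "k0 \<le> k" for k
      using le[of k] that e unfolding real_norm_def by (smt (verit) field_sum_of_halves)
    then show "\<exists>k0. \<forall>k\<ge>k0. norm (inf_conv \<phi> k f - \<phi> f) < e" by blast
  qed
qed

lemma lipschitz_continuous_map:
  assumes "\<And>f h. f \<in> V \<Longrightarrow> h \<in> V \<Longrightarrow> \<bar>\<phi> f - \<phi> h\<bar> \<le> C * nn (\<lambda>x. f x - h x)"
  shows "continuous_map (seminorm_topology V nn) euclideanreal \<phi>"
  unfolding continuous_map_iff
proof (intro ballI allI impI)
  fix f and e :: real assume f: "f \<in> V" and e: "0 < e"
  have "\<bar>\<phi> g - \<phi> f\<bar> < e" if g: "g \<in> V" "nn (\<lambda>x. g x - f x) < e / (\<bar>C\<bar> + 1)" for g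
  proof -
    have "\<bar>\<phi> g - \<phi> f\<bar> \<le> C * nn (\<lambda>x. g x - f x)" using assms f g by blast
    also have "\<dots> \<le> (\<bar>C\<bar> + 1) * nn (\<lambda>x. g x - f x)" by (intro mult_right_mono) auto
    also have "\<dots> < e" using g(2) by (simp add: pos_less_divide_eq add_nonneg_pos mult.commute)
    finally show ?thesis .
  qed
  then show "\<exists>d>0. \<forall>g\<in>V. nn (\<lambda>x. g x - f x) < d \<longrightarrow> \<bar>\<phi> g - \<phi> f\<bar> < e"
    using e by (intro exI[of _ "e / (\<bar>C\<bar> + 1)"]) (auto simp: add_nonneg_pos)
qed

text \<open>An inf-convolution lies below the function, its expectations converge by
  \<open>lip\<close>, and its limit expectation is close to that of the function by dominated
  convergence. This bounds the expectations from below in the limit; the same bound for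
  \<open>- \<phi>\<close> is the upper one.\<close>

lemma expectation_tendsto_of_lipschitz:
  assumes "prob_space Q" and Sn: "\<And>n. Sn n \<in> measurable Q BV" and S: "S \<in> measurable Q BV"
    and lip: "\<And>\<phi> C K. (\<And>f h. f \<in> V \<Longrightarrow> h \<in> V \<Longrightarrow> \<bar>\<phi> f - \<phi> h\<bar> \<le> C * nn (\<lambda>x. f x - h x)) \<Longrightarrow> (\<And>f. f \<in> V \<Longrightarrow> \<bar>\<phi> f\<bar> \<le> K) \<Longrightarrow>
      (\<lambda>n. \<integral>\<omega>. \<phi> (Sn n \<omega>) \<partial>Q) \<longlonglongrightarrow> (\<integral>\<omega>. \<phi> (S \<omega>) \<partial>Q)"
    and \<phi>: "continuous_map (seminorm_topology V nn) euclideanreal \<phi>" and K: "\<And>f. f \<in> V \<Longrightarrow> \<bar>\<phi> f\<bar> \<le> K"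
  shows "(\<lambda>n. \<integral>\<omega>. \<phi> (Sn n \<omega>) \<partial>Q) \<longlonglongrightarrow> (\<integral>\<omega>. \<phi> (S \<omega>) \<partial>Q)"
proof -
  interpret Q: prob_space Q by fact
  have SV: "S \<omega> \<in> V" "Sn n \<omega> \<in> V" if "\<omega> \<in> space Q" for \<omega> n
    using measurable_space[OF S that] measurable_space[OF Sn that] by (auto simp: space_BV)
  have low: "\<forall>\<^sub>F n in sequentially. (\<integral>\<omega>. \<psi> (S \<omega>) \<partial>Q) - e < (\<integral>\<omega>. \<psi> (Sn n \<omega>) \<partial>Q)"
    if \<psi>: "continuous_map (seminorm_topology V nn) euclideanreal \<psi>" and K: "\<And>f. f \<in> V \<Longrightarrow> \<bar>\<psi> f\<bar> \<le> K" and e: "0 < e" for \<psi> and e :: real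
  proof -
    note cm = continuous_map_measurable
    have ic_facts: "inf_conv \<psi> k f \<le> \<psi> f" "\<bar>inf_conv \<psi> k f\<bar> \<le> K" "(\<lambda>k. inf_conv \<psi> k f) \<longlonglongrightarrow> \<psi> f"
      if "f \<in> V" for k f
      by (rule inf_conv[where K = K]; fact)+
    have ic_lip: "\<bar>inf_conv \<psi> k f - inf_conv \<psi> k h\<bar> \<le> real k * nn (\<lambda>x. f x - h x)" if "f \<in> V" "h \<in> V" for k f h
      by (rule inf_conv[where K = K]; fact)
    have ic: "continuous_map (seminorm_topology V nn) euclideanreal (inf_conv \<psi> k)" for k
      using ic_lip by (rule lipschitz_continuous_map)
    have int: "integrable Q (\<lambda>\<omega>. \<rho> (Z \<omega>))" if Z: "Z \<in> measurable Q BV"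
      and \<rho>: "continuous_map (seminorm_topology V nn) euclideanreal \<rho>" "\<And>f. f \<in> V \<Longrightarrow> \<bar>\<rho> f\<bar> \<le> K" for Z \<rho>
    proof (rule Q.integrable_const_bound[where B = K])
      show "AE \<omega> in Q. norm (\<rho> (Z \<omega>)) \<le> K"
        using measurable_space[OF Z] \<rho>(2) by (intro AE_I2) (auto simp: space_BV)
      show "(\<lambda>\<omega>. \<rho> (Z \<omega>)) \<in> borel_measurable Q" by (rule measurable_compose[OF Z cm[OF \<rho>(1)]])
    qed
    have "(\<lambda>k. \<integral>\<omega>. inf_conv \<psi> k (S \<omega>) \<partial>Q) \<longlonglongrightarrow> (\<integral>\<omega>. \<psi> (S \<omega>) \<partial>Q)"
    proof (rule integral_dominated_convergence[where w = "\<lambda>_. K"])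
      show "(\<lambda>\<omega>. \<psi> (S \<omega>)) \<in> borel_measurable Q" by (rule measurable_compose[OF S cm[OF \<psi>]])
      show "(\<lambda>\<omega>. inf_conv \<psi> k (S \<omega>)) \<in> borel_measurable Q" for k by (rule measurable_compose[OF S cm[OF ic]])
      show "AE \<omega> in Q. (\<lambda>k. inf_conv \<psi> k (S \<omega>)) \<longlonglongrightarrow> \<psi> (S \<omega>)"
        using ic_facts(3) SV(1) by (intro AE_I2) auto
      show "AE \<omega> in Q. norm (inf_conv \<psi> k (S \<omega>)) \<le> K" for k
        using ic_facts(2) SV(1) by (intro AE_I2) auto
    qed simp
    from order_tendstoD(1)[OF this, of "(\<integral>\<omega>. \<psi> (S \<omega>) \<partial>Q) - e"] e
    obtain k where k: "(\<integral>\<omega>. \<psi> (S \<omega>) \<partial>Q) - e < (\<integral>\<omega>. inf_conv \<psi> k (S \<omega>) \<partial>Q)"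
      by (auto simp: eventually_sequentially)
    have "(\<lambda>n. \<integral>\<omega>. inf_conv \<psi> k (Sn n \<omega>) \<partial>Q) \<longlonglongrightarrow> (\<integral>\<omega>. inf_conv \<psi> k (S \<omega>) \<partial>Q)"
      using ic_lip ic_facts(2) by (rule lip)
    from order_tendstoD(1)[OF this k] show ?thesis
    proof eventually_elim
      case (elim n)
      have "(\<integral>\<omega>. inf_conv \<psi> k (Sn n \<omega>) \<partial>Q) \<le> (\<integral>\<omega>. \<psi> (Sn n \<omega>) \<partial>Q)"
        using ic_facts(1) SV(2)
        by (intro integral_mono int[OF Sn] ic ic_facts(2) \<psi> K) auto
      with elim show ?case by linarith
    qed
  qed
  have neg: "continuous_map (seminorm_topology V nn) euclideanreal (\<lambda>f. - \<phi> f)"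
    using \<phi> unfolding continuous_map_iff by (simp add: abs_minus_commute)
  show ?thesis
  proof (rule order_tendstoI)
    fix a assume "a < (\<integral>\<omega>. \<phi> (S \<omega>) \<partial>Q)"
    then show "\<forall>\<^sub>F n in sequentially. a < (\<integral>\<omega>. \<phi> (Sn n \<omega>) \<partial>Q)"
      using low[OF \<phi> K, of "(\<integral>\<omega>. \<phi> (S \<omega>) \<partial>Q) - a"] by simp
  next
    fix a assume "(\<integral>\<omega>. \<phi> (S \<omega>) \<partial>Q) < a"
    then show "\<forall>\<^sub>F n in sequentially. (\<integral>\<omega>. \<phi> (Sn n \<omega>) \<partial>Q) < a"
      using low[OF neg, of "a - (\<integral>\<omega>. \<phi> (S \<omega>) \<partial>Q)"] K by simp
  qed
qed

end

section \<open>Random fields\<close>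

context mixed_space
begin

text \<open>With \<open>q\<close> the maximal exponent, finiteness for \<open>\<xi>\<close> is the
  moment hypothesis of the theorem. The norm over \<open>Q\<close> stands inside, so probabilistic
  estimates can be made for each \<open>x\<close> separately.\<close>

definition field_norm :: "'v measure \<Rightarrow> real \<Rightarrow> ('v \<Rightarrow> (nat \<Rightarrow> 'a) \<Rightarrow> real) \<Rightarrow> ennreal" where
  "field_norm Q q F = N (\<lambda>x. Lnorm Q q (\<lambda>\<omega>. ennreal \<bar>F \<omega> x\<bar>))"

lemma function_norm_field:
  "prob_space Q \<Longrightarrow> 1 \<le> q \<Longrightarrow> function_norm (Q \<Otimes>\<^sub>M X) (\<lambda>F. N (\<lambda>x. Lnorm Q q (\<lambda>\<omega>. F (\<omega>, x))))"
  by (rule function_norm_pair[OF function_norm_N sigma_finite_X])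

lemma measurable_Lnorm_field:
  assumes "prob_space Q" and F [measurable]: "(\<lambda>z. F (fst z) (snd z)) \<in> borel_measurable (Q \<Otimes>\<^sub>M X)"
  shows "(\<lambda>x. Lnorm Q q (\<lambda>\<omega>. ennreal \<bar>F \<omega> x\<bar>)) \<in> borel_measurable X"
proof -
  interpret Q: prob_space Q by fact
  have [measurable]: "(\<lambda>(x, \<omega>). F \<omega> x) \<in> borel_measurable (X \<Otimes>\<^sub>M Q)"
    using measurable_compose[OF measurable_pair_swap' F] by (simp add: split_beta')
  show ?thesis unfolding Lnorm_def by measurable
qed

lemma field_norm_triangle:
  assumes "prob_space Q" "1 \<le> q" and [measurable]: "(\<lambda>z. F (fst z) (snd z)) \<in> borel_measurable (Q \<Otimes>\<^sub>M X)"
    "(\<lambda>z. G (fst z) (snd z)) \<in> borel_measurable (Q \<Otimes>\<^sub>M X)" "(\<lambda>z. H (fst z) (snd z)) \<in> borel_measurable (Q \<Otimes>\<^sub>M X)"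
  shows "field_norm Q q (\<lambda>\<omega> x. F \<omega> x - H \<omega> x) \<le> field_norm Q q (\<lambda>\<omega> x. F \<omega> x - G \<omega> x) + field_norm Q q (\<lambda>\<omega> x. G \<omega> x - H \<omega> x)"
proof -
  interpret NN: function_norm "Q \<Otimes>\<^sub>M X" "\<lambda>F. N (\<lambda>x. Lnorm Q q (\<lambda>\<omega>. F (\<omega>, x)))"
    using assms by (intro function_norm_field)
  show ?thesis
    using NN.N_abs_triangle[of "\<lambda>z. F (fst z) (snd z)" "\<lambda>z. G (fst z) (snd z)" "\<lambda>z. H (fst z) (snd z)"]
    by (simp add: field_norm_def)
qed

lemma field_norm_commute: "field_norm Q q (\<lambda>\<omega> x. F \<omega> x - G \<omega> x) = field_norm Q q (\<lambda>\<omega> x. G \<omega> x - F \<omega> x)"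
  by (simp add: field_norm_def abs_minus_commute)

lemma Lnorm_N_le_field_norm:
  assumes "prob_space Q" and "\<And>k. k \<in> {1..l} \<Longrightarrow> p k \<le> q"
    and F [measurable]: "(\<lambda>z. F (fst z) (snd z)) \<in> borel_measurable (Q \<Otimes>\<^sub>M X)"
  shows "Lnorm Q q (\<lambda>\<omega>. N (\<lambda>x. ennreal \<bar>F \<omega> x\<bar>)) \<le> field_norm Q q F"
proof -
  interpret Q: prob_space Q by fact
  show ?thesis unfolding field_norm_def
    by (rule N_Minkowski) (use assms in \<open>auto simp: split_beta' Q.finite_measure_axioms\<close>)
qed

lemma nn_integral_N_le_field_norm:
  assumes "prob_space Q" "1 \<le> q" and "\<And>k. k \<in> {1..l} \<Longrightarrow> p k \<le> q"
    and F [measurable]: "(\<lambda>z. F (fst z) (snd z)) \<in> borel_measurable (Q \<Otimes>\<^sub>M X)"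
  shows "(\<integral>\<^sup>+ \<omega>. N (\<lambda>x. ennreal \<bar>F \<omega> x\<bar>) \<partial>Q) \<le> field_norm Q q F"
proof -
  interpret Q: prob_space Q by fact
  have "(\<lambda>\<omega>. N (\<lambda>x. ennreal \<bar>F \<omega> x\<bar>)) \<in> borel_measurable Q"
    by (rule measurable_N_param) (simp add: split_beta')
  then have "(\<integral>\<^sup>+ \<omega>. N (\<lambda>x. ennreal \<bar>F \<omega> x\<bar>) \<partial>Q) \<le> Lnorm Q q (\<lambda>\<omega>. N (\<lambda>x. ennreal \<bar>F \<omega> x\<bar>))"
    using assms by (intro Q.nn_integral_le_Lnorm)
  also have "\<dots> \<le> field_norm Q q F" using assms by (intro Lnorm_N_le_field_norm)
  finally show ?thesis .
qed

text \<open>\<open>density_span\<close> on the product of \<open>Q\<close> and \<open>X\<close>,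
  with measurable rectangles as generator. The indicator of a rectangle is a product of a function
  of \<open>\<omega>\<close> and a function of \<open>x\<close>, so the span consists of finite-rank
  fields.\<close>

lemma simple_field_dense:
  assumes "prob_space Q" and q: "1 \<le> q" and F: "(\<lambda>z. F (fst z) (snd z)) \<in> borel_measurable (Q \<Otimes>\<^sub>M X)"
    and fin: "field_norm Q q F < \<top>" and e: "0 < e"
  obtains d :: nat and B f where "\<And>i. B i \<in> sets Q" "\<And>i. f i \<in> V"
    "field_norm Q q (\<lambda>\<omega> x. F \<omega> x - (\<Sum>i<d. indicator (B i) \<omega> * f i x)) < ennreal e"
proof -
  interpret Q: prob_space Q by fact
  interpret NN: function_norm "Q \<Otimes>\<^sub>M X" "\<lambda>F. N (\<lambda>x. Lnorm Q q (\<lambda>\<omega>. F (\<omega>, x)))"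
    using assms by (intro function_norm_field)
  define comb :: "('b set \<times> ((nat \<Rightarrow> 'a) \<Rightarrow> real)) list \<Rightarrow> 'b \<times> (nat \<Rightarrow> 'a) \<Rightarrow> real"
    where "comb L z = (\<Sum>(B, f)\<leftarrow>L. indicator B (fst z) * f (snd z))" for L z
  define S where "S = comb ` lists (sets Q \<times> V)"
  obtain E0 where E0: "\<And>n. PiE {1..l} (\<lambda>i. E0 i n) \<in> sets X" "incseq (\<lambda>n. PiE {1..l} (\<lambda>i. E0 i n))"
      "(\<Union>n. PiE {1..l} (\<lambda>i. E0 i n)) = space X" "\<And>n. N (indicator (PiE {1..l} (\<lambda>i. E0 i n))) < \<top>"
    by (rule rectangle_exhaustion) (rule that)
  define E where "E n = PiE {1..l} (\<lambda>i. E0 i n)" for n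
  have E: "\<And>n. E n \<in> sets X" "incseq E" "(\<Union>n. E n) = space X" "\<And>n. N (indicator (E n)) < \<top>"
    unfolding E_def[abs_def] by (rule E0)+
  have ind_V: "indicator (C \<inter> E n) \<in> V" if [measurable]: "C \<in> sets X" for C n
  proof -
    note E(1)[measurable]
    have "N (\<lambda>x. ennreal \<bar>indicator (C \<inter> E n) x\<bar>) \<le> N (indicator (E n))"
      by (rule N_mono) (auto simp: indicator_def)
    then have "N (\<lambda>x. ennreal \<bar>indicator (C \<inter> E n) x\<bar>) < \<top>" using E(4) by (rule le_less_trans)
    moreover have "indicator (C \<inter> E n) \<in> borel_measurable X" by measurable
    ultimately show ?thesis unfolding V_iff by simp
  qed
  have ind_S: "indicator (B \<times> (C \<inter> E n)) \<in> S" if "B \<in> sets Q" "C \<in> sets X" for B C n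
  proof -
    have "indicator (B \<times> (C \<inter> E n)) = comb [(B, indicator (C \<inter> E n))]"
      by (auto simp: comb_def fun_eq_iff indicator_def)
    then show ?thesis unfolding S_def using that ind_V by auto
  qed
  have "\<exists>g\<in>S. N (\<lambda>x. Lnorm Q q (\<lambda>\<omega>. ennreal \<bar>F (fst (\<omega>, x)) (snd (\<omega>, x)) - g (\<omega>, x)\<bar>)) < ennreal e"
  proof (rule NN.density_span[where G = "{a \<times> b |a b. a \<in> sets Q \<and> b \<in> sets X}" and E = "\<lambda>n. space Q \<times> E n"])
    show "S \<subseteq> borel_measurable (Q \<Otimes>\<^sub>M X)"
    proof
      fix g assume "g \<in> S"
      then obtain L where L: "L \<in> lists (sets Q \<times> V)" "g = comb L" unfolding S_def by auto
      have "comb L \<in> borel_measurable (Q \<Otimes>\<^sub>M X)" using L(1)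
      proof (induction L)
        case Nil then show ?case by (simp add: comb_def[abs_def])
      next
        case (Cons a L)
        then have [measurable]: "fst a \<in> sets Q" "snd a \<in> borel_measurable X" "comb L \<in> borel_measurable (Q \<Otimes>\<^sub>M X)"
          by (auto simp: V_measurable)
        have "comb (a # L) = (\<lambda>z. indicator (fst a) (fst z) * snd a (snd z) + comb L z)"
          by (simp add: comb_def[abs_def] split_beta')
        then show ?case by simp
      qed
      then show "g \<in> borel_measurable (Q \<Otimes>\<^sub>M X)" by (simp add: L(2))
    qed
    show "(\<lambda>x. f x + g x) \<in> S" if "f \<in> S" "g \<in> S" for f g
    proof -
      from that obtain K L where "K \<in> lists (sets Q \<times> V)" "L \<in> lists (sets Q \<times> V)" "f = comb K" "g = comb L"
        unfolding S_def by auto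
      then show ?thesis unfolding S_def
        by (intro image_eqI[of _ _ "K @ L"]) (auto simp: comb_def[abs_def] fun_eq_iff)
    qed
    show "(\<lambda>x. c * f x) \<in> S" if "f \<in> S" for f c
    proof -
      from that obtain L where L: "L \<in> lists (sets Q \<times> V)" "f = comb L" unfolding S_def by auto
      have "(\<lambda>z. c * comb L z) = comb (map (\<lambda>a. (fst a, \<lambda>x. c * snd a x)) L)"
        by (simp add: comb_def[abs_def] fun_eq_iff sum_list_const_mult[symmetric] o_def split_beta' mult_ac)
      moreover have "(fst a, \<lambda>x. c * snd a x) \<in> sets Q \<times> V" if "a \<in> set L" for a
      proof -
        have "a \<in> sets Q \<times> V" using L(1) that by (metis in_listsD)
        then show ?thesis by (simp add: mem_Times_iff V_scale)
      qed
      then have "map (\<lambda>a. (fst a, \<lambda>x. c * snd a x)) L \<in> lists (sets Q \<times> V)"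
        by (auto simp: in_lists_conv_set simp del: mem_Sigma_iff)
      ultimately show ?thesis unfolding S_def L(2) by auto
    qed
    show "Int_stable {a \<times> b |a b. a \<in> sets Q \<and> b \<in> sets X}" by (rule Int_stable_pair_measure_generator)
    show "{a \<times> b |a b. a \<in> sets Q \<and> b \<in> sets X} \<subseteq> Pow (space (Q \<Otimes>\<^sub>M X))"
      unfolding space_pair_measure by (rule pair_measure_closed)
    show "sets (Q \<Otimes>\<^sub>M X) = sigma_sets (space (Q \<Otimes>\<^sub>M X)) {a \<times> b |a b. a \<in> sets Q \<and> b \<in> sets X}"
      by (simp add: sets_pair_measure space_pair_measure)
    show "space Q \<times> E n \<in> sets (Q \<Otimes>\<^sub>M X)" for n using E(1) by simp
    show "incseq (\<lambda>n. space Q \<times> E n)" using E(2) by (auto simp: incseq_def)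
    show "(\<Union>n. space Q \<times> E n) = space (Q \<Otimes>\<^sub>M X)" using E(3) by (auto simp: space_pair_measure)
    show "N (\<lambda>x. Lnorm Q q (\<lambda>\<omega>. indicator (space Q \<times> E n) (\<omega>, x))) < \<top>" for n
    proof -
      have "Lnorm Q q (\<lambda>\<omega>. indicator (space Q \<times> E n) (\<omega>, x)) = indicator (E n) x" for x
      proof -
        have "Lnorm Q q (\<lambda>\<omega>. indicator (space Q \<times> E n) (\<omega>, x)) = Lnorm Q q (\<lambda>\<omega>. indicator (E n) x)"
          by (rule Lnorm_cong) (auto simp: indicator_def)
        also have "\<dots> = indicator (E n) x"
          using q by (auto simp: Lnorm_def indicator_def Q.emeasure_space_1 ennreal_powr_def)
        finally show ?thesis .
      qed
      then show ?thesis using E(4) by simp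
    qed
    show "indicator (space Q \<times> E n) \<in> S" for n
      using ind_S[of "space Q" "space X" n] sets.sets_into_space[OF E(1)[of n]] by (simp add: Int_absorb1)
    show "indicator (A \<inter> space Q \<times> E n) \<in> S" if A: "A \<in> {a \<times> b |a b. a \<in> sets Q \<and> b \<in> sets X}" for A n
    proof -
      obtain a b where ab: "A = a \<times> b" "a \<in> sets Q" "b \<in> sets X" using A by auto
      have "A \<inter> space Q \<times> E n = a \<times> (b \<inter> E n)" using ab sets.sets_into_space[OF ab(2)] by auto
      then show ?thesis using ind_S[OF ab(2,3)] by simp
    qed
    show "(\<lambda>z. F (fst z) (snd z)) \<in> borel_measurable (Q \<Otimes>\<^sub>M X)" by fact
    show "N (\<lambda>x. Lnorm Q q (\<lambda>\<omega>. ennreal \<bar>F (fst (\<omega>, x)) (snd (\<omega>, x))\<bar>)) < \<top>"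
      using fin by (simp add: field_norm_def)
  qed (rule e)
  then obtain L where L: "L \<in> lists (sets Q \<times> V)"
    "N (\<lambda>x. Lnorm Q q (\<lambda>\<omega>. ennreal \<bar>F \<omega> x - comb L (\<omega>, x)\<bar>)) < ennreal e"
    unfolding S_def by auto
  define B where "B i = (if i < length L then fst (L ! i) else {})" for i
  define f where "f i = (if i < length L then snd (L ! i) else (\<lambda>x. 0))" for i
  have LV: "L ! i \<in> sets Q \<times> V" if "i < length L" for i using L(1) that by (metis in_listsD nth_mem)
  have comb_eq: "comb L (\<omega>, x) = (\<Sum>i<length L. indicator (B i) \<omega> * f i x)" for \<omega> x
    unfolding comb_def sum_list_sum_nth length_map atLeast0LessThan
    by (intro sum.cong refl) (simp add: B_def f_def split_beta')
  show thesis
  proof (rule that[of B f "length L"])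
    show "B i \<in> sets Q" "f i \<in> V" for i
      using LV[of i] by (cases "i < length L"; simp add: B_def f_def mem_Times_iff)+
    show "field_norm Q q (\<lambda>\<omega> x. F \<omega> x - (\<Sum>i<length L. indicator (B i) \<omega> * f i x)) < ennreal e"
      unfolding field_norm_def comb_eq[symmetric] by (rule L(2))
  qed
qed

text \<open>Since \<open>F\<close> is centered, replacing each indicator by its deviation from its
  mean amounts to centering the error \<open>D\<close> at fixed \<open>x\<close>. By
  \<open>Lnorm_centered_le\<close> this at most doubles the error, hence the tolerance
  \<open>e / 2\<close> at the start.\<close>

lemma centered_field_dense:
  assumes "prob_space Q" and q: "1 \<le> q" and F [measurable]: "(\<lambda>z. F (fst z) (snd z)) \<in> borel_measurable (Q \<Otimes>\<^sub>M X)"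
    and fin: "field_norm Q q F < \<top>" and mean: "AE x in X. (\<integral>\<omega>. F \<omega> x \<partial>Q) = 0" and e: "0 < e"
  obtains d :: nat and B f where "\<And>i. B i \<in> sets Q" "\<And>i. f i \<in> V"
    "field_norm Q q (\<lambda>\<omega> x. F \<omega> x - (\<Sum>i<d. (indicator (B i) \<omega> - measure Q (B i)) * f i x)) < ennreal e"
proof -
  interpret Q: prob_space Q by fact
  obtain d :: nat and B f where B [measurable]: "\<And>i. B i \<in> sets Q" and f: "\<And>i. f i \<in> V"
    and less: "field_norm Q q (\<lambda>\<omega> x. F \<omega> x - (\<Sum>i<d. indicator (B i) \<omega> * f i x)) < ennreal (e / 2)"
    by (rule simple_field_dense[OF \<open>prob_space Q\<close> q F fin half_gt_zero[OF e]]) (rule that)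
  have [measurable]: "f i \<in> borel_measurable X" for i using f by (rule V_measurable)
  define D where "D \<omega> x = F \<omega> x - (\<Sum>i<d. indicator (B i) \<omega> * f i x)" for \<omega> x
  have [measurable]: "(\<lambda>z. D (fst z) (snd z)) \<in> borel_measurable (Q \<Otimes>\<^sub>M X)" unfolding D_def by measurable
  have fin_D: "field_norm Q q D < \<top>" using less unfolding D_def by (rule less_trans) simp
  have mD [measurable]: "(\<lambda>x. Lnorm Q q (\<lambda>\<omega>. ennreal \<bar>D \<omega> x\<bar>)) \<in> borel_measurable X"
    by (rule measurable_Lnorm_field) (fact, measurable)
  have mF [measurable]: "(\<lambda>x. Lnorm Q q (\<lambda>\<omega>. ennreal \<bar>F \<omega> x\<bar>)) \<in> borel_measurable X"
    by (rule measurable_Lnorm_field) (fact, measurable)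
  have "AE x in X. Lnorm Q q (\<lambda>\<omega>. ennreal \<bar>D \<omega> x\<bar>) < \<top>" "AE x in X. Lnorm Q q (\<lambda>\<omega>. ennreal \<bar>F \<omega> x\<bar>) < \<top>"
    using fin_D fin unfolding field_norm_def by (auto intro!: N_finite_AE)
  then have le: "AE x in X. Lnorm Q q (\<lambda>\<omega>. ennreal \<bar>F \<omega> x - (\<Sum>i<d. (indicator (B i) \<omega> - measure Q (B i)) * f i x)\<bar>)
      \<le> 2 * Lnorm Q q (\<lambda>\<omega>. ennreal \<bar>D \<omega> x\<bar>)"
    using mean AE_space
  proof eventually_elim
    case (elim x)
    note [measurable] = elim(4)
    have Dm: "(\<lambda>\<omega>. D \<omega> x) \<in> borel_measurable Q" and Fm: "(\<lambda>\<omega>. F \<omega> x) \<in> borel_measurable Q"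
      using measurable_compose[OF measurable_Pair2'[OF elim(4)], of "\<lambda>z. D (fst z) (snd z)"]
        measurable_compose[OF measurable_Pair2'[OF elim(4)], of "\<lambda>z. F (fst z) (snd z)"] by simp_all
    have ints: "integrable Q (\<lambda>\<omega>. F \<omega> x)" by (rule Q.Lnorm_centered_le(1)[OF q Fm elim(2)])
    have indi: "integrable Q (\<lambda>\<omega>. indicator (B i) \<omega> * f i x)" for i
      by (intro integrable_mult_left Q.integrable_const_bound[where B = 1]) (auto simp: indicator_def)
    have "Q.expectation (\<lambda>\<omega>. D \<omega> x) = Q.expectation (\<lambda>\<omega>. F \<omega> x) - Q.expectation (\<lambda>\<omega>. \<Sum>i<d. indicator (B i) \<omega> * f i x)"
      unfolding D_def by (intro Bochner_Integration.integral_diff ints Bochner_Integration.integrable_sum indi)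
    also have "Q.expectation (\<lambda>\<omega>. \<Sum>i<d. indicator (B i) \<omega> * f i x) = (\<Sum>i<d. Q.expectation (\<lambda>\<omega>. indicator (B i) \<omega> * f i x))"
      by (intro Bochner_Integration.integral_sum indi)
    also have "\<dots> = (\<Sum>i<d. measure Q (B i) * f i x)" by (intro sum.cong refl) simp
    finally have "Q.expectation (\<lambda>\<omega>. D \<omega> x) = - (\<Sum>i<d. measure Q (B i) * f i x)" using elim(3) by simp
    then have "D \<omega> x - Q.expectation (\<lambda>\<omega>. D \<omega> x) = F \<omega> x - (\<Sum>i<d. (indicator (B i) \<omega> - measure Q (B i)) * f i x)" for \<omega>
      by (simp add: D_def left_diff_distrib sum_subtractf)
    then show ?case using Q.Lnorm_centered_le(2)[OF q Dm elim(1)] by simp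
  qed
  have "field_norm Q q (\<lambda>\<omega> x. F \<omega> x - (\<Sum>i<d. (indicator (B i) \<omega> - measure Q (B i)) * f i x)) \<le>
      N (\<lambda>x. 2 * Lnorm Q q (\<lambda>\<omega>. ennreal \<bar>D \<omega> x\<bar>))"
    unfolding field_norm_def
  proof (rule N_mono_AE[OF _ _ le])
    show "(\<lambda>x. Lnorm Q q (\<lambda>\<omega>. ennreal \<bar>F \<omega> x - (\<Sum>i<d. (indicator (B i) \<omega> - measure Q (B i)) * f i x)\<bar>)) \<in> borel_measurable X"
      by (rule measurable_Lnorm_field) (fact, measurable)
  qed measurable
  also have "\<dots> = 2 * field_norm Q q D" by (simp add: N_cmult field_norm_def)
  also have "\<dots> = field_norm Q q D + field_norm Q q D" by (rule mult_2)
  also have "\<dots> < ennreal e" using less unfolding D_def[abs_def, symmetric] by (intro ennreal_add_less_of_half)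
  finally show thesis using B f by (intro that[of B f d])
qed

text \<open>A pairing function merges the centered indicators of all precisions into the single
  sequence \<open>e\<close>. At precision \<open>m\<close> only codes of pairs \<open>(m, i)\<close>
  with \<open>i < d m\<close> get a nonzero coefficient, and \<open>D m\<close> exceeds these
  codes.\<close>

lemma approximating_fields:
  assumes "prob_space Q" and q: "1 \<le> q" and F: "(\<lambda>z. F (fst z) (snd z)) \<in> borel_measurable (Q \<Otimes>\<^sub>M X)"
    and fin: "field_norm Q q F < \<top>" and mean: "AE x in X. (\<integral>\<omega>. F \<omega> x \<partial>Q) = 0"
  obtains e :: "nat \<Rightarrow> 'v \<Rightarrow> real" and D :: "nat \<Rightarrow> nat" and g :: "nat \<Rightarrow> nat \<Rightarrow> (nat \<Rightarrow> 'a) \<Rightarrow> real"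
  where "\<And>j. e j \<in> bounded_measurable Q" "\<And>j. (\<integral>\<omega>. e j \<omega> \<partial>Q) = 0" "\<And>m j. g m j \<in> V"
    "\<And>m j. D m \<le> j \<Longrightarrow> g m j = (\<lambda>x. 0)"
    "\<And>m. field_norm Q q (\<lambda>\<omega> x. F \<omega> x - (\<Sum>j<D m. e j \<omega> * g m j x)) < ennreal ((1/2) ^ m)"
proof -
  interpret Q: prob_space Q by fact
  define A where "A m d B f \<longleftrightarrow> (\<forall>i. B i \<in> sets Q) \<and> (\<forall>i. f i \<in> V) \<and>
    field_norm Q q (\<lambda>\<omega> x. F \<omega> x - (\<Sum>i<d. (indicator (B i) \<omega> - measure Q (B i)) * f i x)) < ennreal ((1/2) ^ m)"
    for m d :: nat and B :: "nat \<Rightarrow> 'v set" and f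
  have "\<exists>d B f. A m d B f" for m :: nat
  proof -
    have "(0 :: real) < (1/2) ^ m" by simp
    then obtain d :: nat and B f where *: "\<And>i. B i \<in> sets Q" "\<And>i. f i \<in> V"
      "field_norm Q q (\<lambda>\<omega> x. F \<omega> x - (\<Sum>i<d. (indicator (B i) \<omega> - measure Q (B i)) * f i x)) < ennreal ((1/2) ^ m)"
      by (rule centered_field_dense[OF assms]) (rule that)
    show ?thesis by (intro exI[of _ d] exI[of _ B] exI[of _ f]) (simp only: A_def * simp_thms)
  qed
  then obtain d B f where A: "\<And>m. A m (d m) (B m) (f m)" by metis
  have B: "B m i \<in> sets Q" and f: "f m i \<in> V"
    and less: "field_norm Q q (\<lambda>\<omega> x. F \<omega> x - (\<Sum>i<d m. (indicator (B m i) \<omega> - measure Q (B m i)) * f m i x)) < ennreal ((1/2) ^ m)" for m i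
    using A[of m] unfolding A_def by blast+
  define B' where "B' j = B (fst (prod_decode j)) (snd (prod_decode j))" for j
  have B' [measurable]: "B' j \<in> sets Q" for j by (simp add: B'_def B)
  define e where "e j \<omega> = indicator (B' j) \<omega> - measure Q (B' j)" for j \<omega>
  define g where "g m j = (if fst (prod_decode j) = m \<and> snd (prod_decode j) < d m then f m (snd (prod_decode j)) else (\<lambda>x. 0))" for m j
  let ?J = "\<lambda>m. (\<lambda>i. prod_encode (m, i)) ` {..<d m}"
  \<comment> \<open>Inserting \<open>0\<close> keeps the maximum defined when precision
    \<open>m\<close> uses no terms.\<close>
  define D where "D m = Suc (Max (insert 0 (?J m)))" for m
  have J: "?J m \<subseteq> {..<D m}" for m by (auto simp: D_def less_Suc_eq_le)
  have inJ: "j \<in> ?J m" if "fst (prod_decode j) = m" "snd (prod_decode j) < d m" for j m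
    using that by (intro image_eqI[of _ _ "snd (prod_decode j)"]) auto
  have g0: "g m j = (\<lambda>x. 0)" if "j \<notin> ?J m" for m j using inJ[of j m] that by (auto simp: g_def)
  have sum_eq: "(\<Sum>j<D m. e j \<omega> * g m j x) = (\<Sum>i<d m. (indicator (B m i) \<omega> - measure Q (B m i)) * f m i x)" for m \<omega> x
  proof -
    have "(\<Sum>j<D m. e j \<omega> * g m j x) = (\<Sum>j\<in>?J m. e j \<omega> * g m j x)"
      using J g0 by (intro sum.mono_neutral_right) auto
    also have "\<dots> = (\<Sum>i<d m. e (prod_encode (m, i)) \<omega> * g m (prod_encode (m, i)) x)"
      by (subst sum.reindex) (auto simp: inj_on_def)
    also have "\<dots> = (\<Sum>i<d m. (indicator (B m i) \<omega> - measure Q (B m i)) * f m i x)"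
      by (intro sum.cong refl) (simp add: e_def B'_def g_def)
    finally show ?thesis .
  qed
  show thesis
  proof (rule that[of e g D])
    show "e j \<in> bounded_measurable Q" for j
    proof -
      have "indicator (B' j) \<in> bounded_measurable Q" by (auto simp: bounded_measurable_def indicator_def intro!: exI[of _ 1])
      from bounded_measurable_add[OF this bounded_measurable_const[of "- measure Q (B' j)"]]
      show ?thesis by (simp add: e_def[abs_def])
    qed
    show "(\<integral>\<omega>. e j \<omega> \<partial>Q) = 0" for j
    proof -
      have "integrable Q (indicator (B' j) :: _ \<Rightarrow> real)" by (rule Q.integrable_const_bound[where B = 1]) (auto simp: indicator_def)
      then show ?thesis by (simp add: e_def Q.prob_space)
    qed
    show "g m j \<in> V" for m j using f by (simp add: g_def)
    show "g m j = (\<lambda>x. 0)" if "D m \<le> j" for m j using that J[of m] by (intro g0) auto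
    show "field_norm Q q (\<lambda>\<omega> x. F \<omega> x - (\<Sum>j<D m. e j \<omega> * g m j x)) < ennreal ((1/2) ^ m)" for m
      using less[of m] by (simp add: sum_eq)
  qed
qed

end

section \<open>Fields as measurable maps into the space\<close>

context separable_mixed_space
begin

lemma Lp_element_in_V: "Lp_element M p l F \<omega> \<in> V"
  by (simp add: Lp_element_def)

lemma measurable_Lp_element:
  assumes F [measurable]: "(\<lambda>z. F (fst z) (snd z)) \<in> borel_measurable (Q \<Otimes>\<^sub>M X)"
  shows "Lp_element M p l F \<in> measurable Q BV"
proof (rule measurable_into_BV)
  show "Lp_element M p l F \<omega> \<in> V" for \<omega> by (rule Lp_element_in_V)
  have [measurable]: "(\<lambda>\<omega>. N (\<lambda>x. ennreal \<bar>F \<omega> x\<bar>)) \<in> borel_measurable Q"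
    by (rule measurable_N_param) (simp add: split_beta')
  have eq: "Lp_element M p l F \<omega> x = (if N (\<lambda>x. ennreal \<bar>F \<omega> x\<bar>) < \<top> then F \<omega> x else 0)" if "\<omega> \<in> space Q" for \<omega> x
  proof -
    have "F \<omega> \<in> borel_measurable X"
      using measurable_compose[OF measurable_Pair1'[OF that] F] by simp
    then show ?thesis by (simp add: Lp_element_def V_iff)
  qed
  have "(\<lambda>z. if N (\<lambda>x. ennreal \<bar>F (fst z) x\<bar>) < \<top> then F (fst z) (snd z) else 0) \<in> borel_measurable (Q \<Otimes>\<^sub>M X)"
    by measurable
  then show "(\<lambda>(\<omega>, x). Lp_element M p l F \<omega> x) \<in> borel_measurable (Q \<Otimes>\<^sub>M X)"
    by (rule measurable_cong[THEN iffD1, rotated]) (auto simp: space_pair_measure eq)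
qed

text \<open>Open sets do not separate functions at distance \<open>0\<close>.\<close>

lemma measurable_BV_cong:
  assumes F: "F \<in> measurable Q BV" and G: "\<And>\<omega>. \<omega> \<in> space Q \<Longrightarrow> G \<omega> \<in> V"
    and eq: "\<And>\<omega>. \<omega> \<in> space Q \<Longrightarrow> nn (\<lambda>x. G \<omega> x - F \<omega> x) = 0"
  shows "G \<in> measurable Q BV"
  unfolding seminorm_borel_def
proof (rule measurable_measure_of)
  show "{U. openin (seminorm_topology V nn) U} \<subseteq> Pow V" by (auto simp: openin_seminorm_topology)
  show "G \<in> space Q \<rightarrow> V" using G by auto
  fix U assume U: "U \<in> {U. openin (seminorm_topology V nn) U}"
  have FV: "F \<omega> \<in> V" if "\<omega> \<in> space Q" for \<omega> using measurable_space[OF F that] by (simp add: space_BV)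
  have sat: "h \<in> U" if "g \<in> U" "h \<in> V" "nn (\<lambda>x. h x - g x) = 0" for g h
  proof -
    obtain e where "0 < e" "\<forall>h\<in>V. nn (\<lambda>x. h x - g x) < e \<longrightarrow> h \<in> U"
      using U \<open>g \<in> U\<close> unfolding openin_seminorm_topology by blast
    then show ?thesis using that by simp
  qed
  have "G \<omega> \<in> U \<longleftrightarrow> F \<omega> \<in> U" if "\<omega> \<in> space Q" for \<omega>
    using sat G[OF that] FV[OF that] eq[OF that] nn_commute[of "G \<omega>" "F \<omega>"] by auto
  then have "G -` U \<inter> space Q = F -` U \<inter> space Q" by auto
  also have "\<dots> \<in> sets Q"
  proof (rule measurable_sets[OF F])
    show "U \<in> sets BV" using U by (intro open_in_BV) simp
  qed
  finally show "G -` U \<inter> space Q \<in> sets Q" .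
qed

end

lemma (in prob_space) tight_of_Lnorm:
  fixes Z :: "'i \<Rightarrow> nat \<Rightarrow> 'a \<Rightarrow> real"
  assumes q: "1 \<le> q" and Z [measurable]: "\<And>i j. Z i j \<in> borel_measurable M"
    and le: "\<And>i j. j < d \<Longrightarrow> Lnorm M q (\<lambda>\<omega>. ennreal \<bar>Z i j \<omega>\<bar>) \<le> ennreal r" and r: "0 \<le> r" and \<epsilon>: "0 < \<epsilon>"
  shows "\<exists>L>0. \<forall>i. prob {\<omega> \<in> space M. \<exists>j<d. L < \<bar>Z i j \<omega>\<bar>} \<le> \<epsilon>"
proof -
  \<comment> \<open>Markov's inequality bounds each of the \<open>d\<close> coordinates by
    \<open>r / L\<close>, and this \<open>L\<close> makes their sum at most
    \<open>\<epsilon>\<close>. The added \<open>1\<close> keeps \<open>L\<close> positive when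
    \<open>d\<close> or \<open>r\<close> is \<open>0\<close>.\<close>
  define L where "L = (real d * r + 1) / \<epsilon>"
  have L: "0 < L" using r \<epsilon> by (simp add: L_def add_nonneg_pos)
  have one: "prob {\<omega> \<in> space M. L < \<bar>Z i j \<omega>\<bar>} \<le> r / L" if j: "j < d" for i j
  proof -
    have "emeasure M {\<omega> \<in> space M. L < \<bar>Z i j \<omega>\<bar>} \<le> emeasure M {\<omega> \<in> space M. 1 \<le> ennreal (1 / L) * ennreal \<bar>Z i j \<omega>\<bar>}"
      using L by (intro emeasure_mono) (auto simp: ennreal_mult[symmetric] ennreal_1[symmetric] simp del: ennreal_1 intro!: ennreal_leI)
    also have "\<dots> \<le> ennreal (1 / L) * (\<integral>\<^sup>+ \<omega>. ennreal \<bar>Z i j \<omega>\<bar> * indicator (space M) \<omega> \<partial>M)"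
      by (rule nn_integral_Markov_inequality) auto
    also have "(\<integral>\<^sup>+ \<omega>. ennreal \<bar>Z i j \<omega>\<bar> * indicator (space M) \<omega> \<partial>M) = (\<integral>\<^sup>+ \<omega>. ennreal \<bar>Z i j \<omega>\<bar> \<partial>M)"
      by (intro nn_integral_cong) simp
    also have "\<dots> \<le> ennreal r" using nn_integral_le_Lnorm[OF q, of "\<lambda>\<omega>. ennreal \<bar>Z i j \<omega>\<bar>"] le[OF j, of i] by auto
    finally have "emeasure M {\<omega> \<in> space M. L < \<bar>Z i j \<omega>\<bar>} \<le> ennreal (1 / L) * ennreal r" by (simp add: mult_left_mono)
    also have "\<dots> = ennreal (r / L)" using L r by (simp add: ennreal_mult[symmetric])
    finally show ?thesis using L r by (simp add: emeasure_eq_measure)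
  qed
  have "prob {\<omega> \<in> space M. \<exists>j<d. L < \<bar>Z i j \<omega>\<bar>} \<le> \<epsilon>" for i
  proof -
    have "{\<omega> \<in> space M. \<exists>j<d. L < \<bar>Z i j \<omega>\<bar>} = (\<Union>j\<in>{..<d}. {\<omega> \<in> space M. L < \<bar>Z i j \<omega>\<bar>})" by auto
    then have "prob {\<omega> \<in> space M. \<exists>j<d. L < \<bar>Z i j \<omega>\<bar>} \<le> (\<Sum>j<d. prob {\<omega> \<in> space M. L < \<bar>Z i j \<omega>\<bar>})"
      by (simp only:) (intro finite_measure_subadditive_finite; auto)
    also have "\<dots> \<le> (\<Sum>j<d. r / L)" using one by (intro sum_mono) auto
    also have "\<dots> = real d * r / L" by simp
    also have "\<dots> \<le> \<epsilon>"
    proof -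
      have "\<epsilon> * L = real d * r + 1" using \<epsilon> by (simp add: L_def)
      then show ?thesis using L by (simp add: divide_le_eq)
    qed
    finally show ?thesis .
  qed
  then show ?thesis using L by blast
qed

text \<open>\<open>n\<close> will be the distance between two random elements, and its
  \<open>nn_integral\<close> is compared by monotonicity. The factor
  \<open>\<bar>C\<bar> + 1\<close> instead of \<open>C\<close> can be divided by.\<close>

lemma integral_diff_le_of_lipschitz:
  fixes A B n :: "'b \<Rightarrow> real"
  assumes A: "integrable Q A" and B: "integrable Q B" and \<beta>: "0 \<le> \<beta>" "(\<integral>\<^sup>+ \<omega>. ennreal (n \<omega>) \<partial>Q) \<le> ennreal \<beta>"
    and le: "\<And>\<omega>. \<omega> \<in> space Q \<Longrightarrow> \<bar>A \<omega> - B \<omega>\<bar> \<le> C * n \<omega>" and n: "\<And>\<omega>. 0 \<le> n \<omega>"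
  shows "\<bar>(\<integral>\<omega>. A \<omega> \<partial>Q) - (\<integral>\<omega>. B \<omega> \<partial>Q)\<bar> \<le> (\<bar>C\<bar> + 1) * \<beta>"
proof -
  define c where "c = \<bar>C\<bar> + 1"
  have c: "0 < c" by (simp add: c_def add_nonneg_pos)
  have int: "integrable Q (\<lambda>\<omega>. \<bar>A \<omega> - B \<omega>\<bar> / c)" using A B by simp
  have "ennreal (\<integral>\<omega>. \<bar>A \<omega> - B \<omega>\<bar> / c \<partial>Q) = (\<integral>\<^sup>+ \<omega>. ennreal (\<bar>A \<omega> - B \<omega>\<bar> / c) \<partial>Q)"
    using int c by (intro nn_integral_eq_integral[symmetric]) auto
  also have "\<dots> \<le> (\<integral>\<^sup>+ \<omega>. ennreal (n \<omega>) \<partial>Q)"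
  proof (intro nn_integral_mono ennreal_leI)
    fix \<omega> assume "\<omega> \<in> space Q"
    then have "\<bar>A \<omega> - B \<omega>\<bar> \<le> C * n \<omega>" by (rule le)
    also have "\<dots> \<le> c * n \<omega>" using n[of \<omega>] by (intro mult_right_mono) (auto simp: c_def)
    finally show "\<bar>A \<omega> - B \<omega>\<bar> / c \<le> n \<omega>" using c by (simp add: divide_le_eq mult.commute)
  qed
  also have "\<dots> \<le> ennreal \<beta>" by (rule \<beta>(2))
  finally have "(\<integral>\<omega>. \<bar>A \<omega> - B \<omega>\<bar> \<partial>Q) \<le> c * \<beta>" using \<beta>(1) c by (simp add: divide_le_eq mult.commute)
  moreover have "\<bar>\<integral>\<omega>. A \<omega> - B \<omega> \<partial>Q\<bar> \<le> (\<integral>\<omega>. \<bar>A \<omega> - B \<omega>\<bar> \<partial>Q)" by (rule integral_abs_bound)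
  ultimately show ?thesis using A B by (simp add: c_def)
qed

lemma abs_cos_diff_le: "\<bar>cos x - cos y\<bar> \<le> \<bar>x - y\<bar>" for x y :: real
proof -
  have "\<bar>cos x - cos y\<bar> = 2 * \<bar>sin ((x + y) / 2)\<bar> * \<bar>sin ((y - x) / 2)\<bar>" by (simp add: cos_diff_cos abs_mult)
  also have "\<dots> \<le> 2 * 1 * \<bar>(y - x) / 2\<bar>" by (intro mult_mono abs_sin_x_le_abs_x) auto
  finally show ?thesis by simp
qed

lemma abs_sin_diff_le: "\<bar>sin x - sin y\<bar> \<le> \<bar>x - y\<bar>" for x y :: real
  using abs_cos_diff_le[of "pi / 2 - x" "pi / 2 - y"] by (simp add: cos_diff)

text \<open>Weak convergence is tested on real functionals, so a characteristic function is treated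
  as a cosine and a sine expectation.\<close>

lemma (in prob_space) iexp_integral_eq:
  assumes [measurable]: "f \<in> borel_measurable M"
  shows "(CLINT \<omega>|M. iexp (f \<omega>)) = Complex (expectation (\<lambda>\<omega>. cos (f \<omega>))) (expectation (\<lambda>\<omega>. sin (f \<omega>)))"
proof -
  have int: "integrable M (\<lambda>\<omega>. iexp (f \<omega>))" by (rule integrable_const_bound[where B = 1]) auto
  show ?thesis
    using integral_Re[OF int] integral_Im[OF int] by (simp add: complex_eq_iff Re_exp Im_exp)
qed

section \<open>The central limit theorem\<close>

text \<open>The field \<open>\<xi>\<close> has disappeared: moments and centering are stated for the
  version \<open>\<Phi>\<close> of evaluation under the common law \<open>\<nu>\<close>. Equality in
  law on \<open>BV\<close> transfers such statements to every \<open>Y k\<close>.\<close>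

locale clt_field = separable_mixed_space M p l + P: prob_space P
  for M :: "nat \<Rightarrow> 'a measure" and p l and P :: "'w measure" +
  fixes q :: real and Y :: "nat \<Rightarrow> 'w \<Rightarrow> (nat \<Rightarrow> 'a) \<Rightarrow> real"
    and \<nu> :: "((nat \<Rightarrow> 'a) \<Rightarrow> real) measure" and \<Phi> :: "((nat \<Rightarrow> 'a) \<Rightarrow> real) \<Rightarrow> (nat \<Rightarrow> 'a) \<Rightarrow> real"
  assumes q: "2 \<le> q" and p_le_q: "\<And>k. k \<in> {1..l} \<Longrightarrow> p k \<le> q"
    and Y_indep: "P.indep_vars (\<lambda>_. BV) Y UNIV" and Y_distr: "\<And>k. distr P BV (Y k) = \<nu>"
    and \<Phi>_measurable: "(\<lambda>(v, x). \<Phi> v x) \<in> borel_measurable (BV \<Otimes>\<^sub>M X)"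
    and \<Phi>_version: "\<And>v. v \<in> V \<Longrightarrow> AE x in X. \<Phi> v x = v x"
    and \<Phi>_finite: "field_norm \<nu> q \<Phi> < \<top>"
    and \<Phi>_centered: "AE x in X. (\<integral>v. \<Phi> v x \<partial>\<nu>) = 0"
begin

lemma q1: "1 \<le> q" and q0: "0 < q" using q by auto

lemma Y_measurable [measurable]: "Y k \<in> measurable P BV"
  using Y_indep by (simp add: P.indep_vars_def2)

lemma Y_in_V: "\<omega> \<in> space P \<Longrightarrow> Y k \<omega> \<in> V"
  using measurable_space[OF Y_measurable] by (simp add: space_BV)

lemma prob_space_\<nu>: "prob_space \<nu>"
  using P.prob_space_distr[OF Y_measurable[of 0]] by (simp add: Y_distr)

sublocale \<nu>: prob_space \<nu> by (rule prob_space_\<nu>)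

lemma sets_\<nu> [measurable_cong]: "sets \<nu> = sets BV"
  using Y_distr[of 0] by auto

lemma space_\<nu>: "space \<nu> = V"
  using sets_eq_imp_space_eq[OF sets_\<nu>] by (simp add: space_BV)

lemma \<Phi>_meas [measurable]: "(\<lambda>z. \<Phi> (fst z) (snd z)) \<in> borel_measurable (BV \<Otimes>\<^sub>M X)"
  using \<Phi>_measurable by (simp add: split_beta')

lemma \<Phi>_meas_\<nu> [measurable]: "(\<lambda>z. \<Phi> (fst z) (snd z)) \<in> borel_measurable (\<nu> \<Otimes>\<^sub>M X)"
  using \<Phi>_meas measurable_cong_sets[OF sets_pair_measure_cong[OF sets_\<nu> refl] refl] by blast

lemma \<Phi>_in_V: "v \<in> V \<Longrightarrow> \<Phi> v \<in> V"
proof (rule V_cong_AE)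
  assume v: "v \<in> V"
  then show "\<Phi> v \<in> borel_measurable X"
    using measurable_compose[OF measurable_Pair1'[of v BV X] \<Phi>_meas] by (simp add: space_BV)
  show "AE x in X. v x = \<Phi> v x" using \<Phi>_version[OF v] by eventually_elim simp
qed

lemma comb_in_V: "(\<And>j. f j \<in> V) \<Longrightarrow> (\<lambda>x. \<Sum>j<(d :: nat). t j * f j x) \<in> V"
  by (intro V_sum V_scale)

lemma comb_measurable:
  fixes Z :: "nat \<Rightarrow> 'v \<Rightarrow> real" and d :: nat
  assumes [measurable]: "\<And>j. Z j \<in> borel_measurable Q" and f: "\<And>j. f j \<in> V"
  shows "(\<lambda>z. \<Sum>j<d. Z j (fst z) * f j (snd z)) \<in> borel_measurable (Q \<Otimes>\<^sub>M X)"
    and "(\<lambda>\<omega> x. \<Sum>j<d. Z j \<omega> * f j x) \<in> measurable Q BV"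
proof -
  have [measurable]: "f j \<in> borel_measurable X" for j using f by (rule V_measurable)
  show m: "(\<lambda>z. \<Sum>j<d. Z j (fst z) * f j (snd z)) \<in> borel_measurable (Q \<Otimes>\<^sub>M X)" by measurable
  show "(\<lambda>\<omega> x. \<Sum>j<d. Z j \<omega> * f j x) \<in> measurable Q BV"
    by (rule measurable_into_BV) (use m f in \<open>auto simp: split_beta' intro: comb_in_V\<close>)
qed

lemma nn_comb_le: "(\<And>j. f j \<in> V) \<Longrightarrow> nn (\<lambda>x. \<Sum>j<(d :: nat). t j * f j x) \<le> (\<Sum>j<d. \<bar>t j\<bar> * nn (f j))"
proof (induction d)
  case 0
  then show ?case by (simp add: mixed_Lp_norm_def)
next
  case (Suc d)
  have "nn (\<lambda>x. (\<Sum>j<d. t j * f j x) + t d * f d x) \<le> nn (\<lambda>x. \<Sum>j<d. t j * f j x) + nn (\<lambda>x. t d * f d x)"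
    using Suc by (intro nn_add comb_in_V V_scale)
  then show ?case using Suc by (simp add: nn_cmult)
qed

lemma normalized_sum_in_V: "\<omega> \<in> space P \<Longrightarrow> normalized_sum Y n \<omega> \<in> V"
  using V_scale[OF V_sum[of "{..<n}" "\<lambda>j. Y j \<omega>"], of "1 / sqrt (real n)"] Y_in_V by (simp add: normalized_sum_def)

lemma AE_\<Phi>_Y:
  assumes "\<omega> \<in> space P"
  shows "AE x in X. normalized_sum Y n \<omega> x = (\<Sum>k<n. \<Phi> (Y k \<omega>) x) / sqrt (real n)"
proof -
  have "AE x in X. \<forall>k. \<Phi> (Y k \<omega>) x = Y k \<omega> x"
    using \<Phi>_version[OF Y_in_V[OF assms]] by (simp add: AE_all_countable)
  then show ?thesis by eventually_elim (simp add: normalized_sum_def)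
qed

lemma \<Phi>_Y_meas [measurable]: "(\<lambda>z. \<Phi> (Y k (fst z)) (snd z)) \<in> borel_measurable (P \<Otimes>\<^sub>M X)"
proof -
  have "(\<lambda>z. (Y k (fst z), snd z)) \<in> measurable (P \<Otimes>\<^sub>M X) (BV \<Otimes>\<^sub>M X)" by measurable
  from measurable_compose[OF this \<Phi>_meas] show ?thesis by simp
qed

text \<open>Measurability of each \<open>Y k\<close> into \<open>BV\<close> does not make its
  evaluation jointly measurable. The sum formed from the versions
  \<open>\<Phi> (Y k \<omega>)\<close> is jointly measurable, and for each \<open>\<omega>\<close>
  it is at distance \<open>0\<close> from the given sum, which \<open>measurable_BV_cong\<close>
  permits.\<close>

lemma normalized_sum_measurable: "normalized_sum Y n \<in> measurable P BV"
proof (rule measurable_BV_cong[where F = "\<lambda>\<omega> x. (\<Sum>k<n. \<Phi> (Y k \<omega>) x) / sqrt (real n)"])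
  have sum_V: "(\<lambda>x. (\<Sum>k<n. \<Phi> (Y k \<omega>) x) / sqrt (real n)) \<in> V" if "\<omega> \<in> space P" for \<omega>
    using V_scale[OF V_sum[of "{..<n}" "\<lambda>j. \<Phi> (Y j \<omega>)"], of "1 / sqrt (real n)"] \<Phi>_in_V[OF Y_in_V[OF that]] by simp
  show "(\<lambda>\<omega> x. (\<Sum>k<n. \<Phi> (Y k \<omega>) x) / sqrt (real n)) \<in> measurable P BV"
  proof (rule measurable_into_BV)
    have "(\<lambda>z. (\<Sum>k<n. \<Phi> (Y k (fst z)) (snd z)) / sqrt (real n)) \<in> borel_measurable (P \<Otimes>\<^sub>M X)" by measurable
    then show "(\<lambda>(\<omega>, x). (\<Sum>k<n. \<Phi> (Y k \<omega>) x) / sqrt (real n)) \<in> borel_measurable (P \<Otimes>\<^sub>M X)" by (simp add: split_beta')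
  qed (rule sum_V)
  fix \<omega> assume w: "\<omega> \<in> space P"
  show "normalized_sum Y n \<omega> \<in> V" using w by (rule normalized_sum_in_V)
  show "nn (\<lambda>x. normalized_sum Y n \<omega> x - (\<Sum>k<n. \<Phi> (Y k \<omega>) x) / sqrt (real n)) = 0"
    using w by (intro nn_diff_eq_0 V_measurable sum_V normalized_sum_in_V AE_\<Phi>_Y)
qed

text \<open>Minkowski's inequality turns the field norm into a \<open>q\<close>-th moment of the
  norm of a random element. As \<open>q \<ge> 2\<close>, every continuous functional then has finite
  variance.\<close>

lemma Lnorm_nn_finite: "Lnorm \<nu> q (\<lambda>v. ennreal (nn v)) < \<top>"
proof -
  have "Lnorm \<nu> q (\<lambda>v. ennreal (nn v)) = Lnorm \<nu> q (\<lambda>v. N (\<lambda>x. ennreal \<bar>\<Phi> v x\<bar>))"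
  proof (rule Lnorm_cong)
    fix v assume "v \<in> space \<nu>"
    then have v: "v \<in> V" by (simp add: space_\<nu>)
    have "N (\<lambda>x. ennreal \<bar>v x\<bar>) = N (\<lambda>x. ennreal \<bar>\<Phi> v x\<bar>)"
      using V_measurable[OF v] V_measurable[OF \<Phi>_in_V[OF v]] \<Phi>_version[OF v]
      by (intro N_cong_AE) (auto elim: eventually_mono)
    then show "ennreal (nn v) = N (\<lambda>x. ennreal \<bar>\<Phi> v x\<bar>)" using v by (simp add: ennreal_nn)
  qed
  also have "\<dots> \<le> field_norm \<nu> q \<Phi>" using prob_space_\<nu> p_le_q \<Phi>_meas_\<nu> by (rule Lnorm_N_le_field_norm)
  finally show ?thesis using \<Phi>_finite by (rule le_less_trans)
qed

lemma nn_measurable [measurable]: "nn \<in> borel_measurable BV"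
  using measurable_nn_diff[OF V_0] by simp

lemma dual_bound:
  assumes "b \<in> dual_space V nn"
  obtains C where "0 \<le> C" "\<And>f. f \<in> V \<Longrightarrow> \<bar>b f\<bar> \<le> C * nn f" "\<And>f h. f \<in> V \<Longrightarrow> h \<in> V \<Longrightarrow> \<bar>b f - b h\<bar> \<le> C * nn (\<lambda>x. f x - h x)"
proof -
  from assms obtain C0 where C0: "\<And>f. f \<in> V \<Longrightarrow> \<bar>b f\<bar> \<le> C0 * nn f"
    and add: "\<And>f g. f \<in> V \<Longrightarrow> g \<in> V \<Longrightarrow> b (\<lambda>x. f x + g x) = b f + b g"
    and scale: "\<And>c f. f \<in> V \<Longrightarrow> b (\<lambda>x. c * f x) = c * b f"
    unfolding dual_space_def by blast
  define C where "C = max 0 C0"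
  have C: "\<bar>b f\<bar> \<le> C * nn f" if "f \<in> V" for f
    using C0[OF that] mult_right_mono[of C0 C "nn f"] by (simp add: C_def)
  have "b (\<lambda>x. f x - h x) = b f - b h" if "f \<in> V" "h \<in> V" for f h
    using add[OF that(1) V_scale[OF that(2), of "-1"]] scale[OF that(2), of "-1"] by simp
  then have "\<bar>b f - b h\<bar> \<le> C * nn (\<lambda>x. f x - h x)" if "f \<in> V" "h \<in> V" for f h
    using C[OF V_diff[OF that]] that by simp
  then show thesis using C by (intro that[of C]) (auto simp: C_def)
qed

lemma dual_add: "b \<in> dual_space V nn \<Longrightarrow> f \<in> V \<Longrightarrow> h \<in> V \<Longrightarrow> b (\<lambda>x. f x + h x) = b f + b h"
  and dual_scale: "b \<in> dual_space V nn \<Longrightarrow> f \<in> V \<Longrightarrow> b (\<lambda>x. c * f x) = c * b f"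
  unfolding dual_space_def by blast+

lemma dual_sum:
  assumes "b \<in> dual_space V nn" "\<And>j. f j \<in> V"
  shows "b (\<lambda>x. \<Sum>j<(d :: nat). t j * f j x) = (\<Sum>j<d. t j * b (f j))"
proof (induction d)
  case 0
  show ?case using dual_scale[OF assms(1) V_0, of 0] by simp
next
  case (Suc d)
  have "b (\<lambda>x. (\<Sum>j<d. t j * f j x) + t d * f d x) = b (\<lambda>x. \<Sum>j<d. t j * f j x) + b (\<lambda>x. t d * f d x)"
    by (intro dual_add assms comb_in_V V_scale)
  also have "b (\<lambda>x. t d * f d x) = t d * b (f d)" by (intro dual_scale assms)
  finally show ?case using Suc by simp
qed

lemma dual_normalized_sum:
  assumes b: "b \<in> dual_space V nn" and w: "\<omega> \<in> space P"
  shows "b (normalized_sum Y n \<omega>) = (\<Sum>k<n. b (Y k \<omega>)) / sqrt (real n)"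
proof -
  have "normalized_sum Y n \<omega> = (\<lambda>x. \<Sum>k<n. (1 / sqrt (real n)) * Y k \<omega> x)"
    by (simp add: normalized_sum_def sum_divide_distrib)
  then show ?thesis using dual_sum[where f = "\<lambda>k. Y k \<omega>" and t = "\<lambda>_. 1 / sqrt (real n)" and d = n, OF b Y_in_V[OF w]]
    by (simp add: sum_divide_distrib)
qed

lemma dual_measurable:
  assumes "b \<in> dual_space V nn" shows "b \<in> borel_measurable BV"
proof -
  obtain C where "\<And>f h. f \<in> V \<Longrightarrow> h \<in> V \<Longrightarrow> \<bar>b f - b h\<bar> \<le> C * nn (\<lambda>x. f x - h x)"
    using dual_bound[OF assms] by metis
  then show ?thesis by (intro continuous_map_measurable lipschitz_continuous_map)
qed

lemma dual_square_integrable: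
  assumes b: "b \<in> dual_space V nn"
  shows "integrable \<nu> (\<lambda>v. (b v)\<^sup>2)"
proof -
  obtain C where C: "0 \<le> C" "\<And>f. f \<in> V \<Longrightarrow> \<bar>b f\<bar> \<le> C * nn f" using dual_bound[OF b] by metis
  note dual_measurable[OF b, measurable]
  have "Lnorm \<nu> 2 (\<lambda>v. ennreal (nn v)) \<le> Lnorm \<nu> q (\<lambda>v. ennreal (nn v))" using q by (intro \<nu>.Lnorm_mono_exponent) auto
  then have "Lnorm \<nu> 2 (\<lambda>v. ennreal \<bar>nn v\<bar>) < \<top>" using Lnorm_nn_finite by (auto intro: le_less_trans)
  then have "integrable \<nu> (\<lambda>v. \<bar>nn v\<bar> powr 2)" by (intro \<nu>.integrable_powr_of_Lnorm) auto
  then have "integrable \<nu> (\<lambda>v. C\<^sup>2 * \<bar>nn v\<bar> powr 2)" by (rule integrable_mult_right)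
  then show ?thesis
  proof (rule Bochner_Integration.integrable_bound)
    have "(b v)\<^sup>2 \<le> C\<^sup>2 * \<bar>nn v\<bar> powr 2" if v: "v \<in> V" for v
    proof -
      have "\<bar>b v\<bar>\<^sup>2 \<le> (C * nn v)\<^sup>2" using C(2)[OF v] by (intro power_mono) auto
      moreover have "\<bar>nn v\<bar> powr 2 = (nn v)\<^sup>2" by (cases "nn v = 0") auto
      ultimately show ?thesis by (simp add: power_mult_distrib)
    qed
    then show "AE v in \<nu>. norm ((b v)\<^sup>2) \<le> norm (C\<^sup>2 * \<bar>nn v\<bar> powr 2)"
      by (intro AE_I2) (auto simp: space_\<nu>)
  qed measurable
qed

end

text \<open>Finite-rank fields \<open>Z m\<close> approximating \<open>\<Phi>\<close>, with the normalized sums \<open>Sm m n\<close> of their copies and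
  the Gaussian fields \<open>G m\<close> with the same covariance as \<open>Z m\<close>. The \<open>e j\<close> are the same for all \<open>m\<close>, hence
  the \<open>G m\<close> can be compared with each other.\<close>

locale clt_approx = clt_field M p l P q Y \<nu> \<Phi>
  for M :: "nat \<Rightarrow> 'a measure" and p l and P :: "'w measure" and q Y \<nu> \<Phi> +
  fixes e :: "nat \<Rightarrow> ((nat \<Rightarrow> 'a) \<Rightarrow> real) \<Rightarrow> real" and D :: "nat \<Rightarrow> nat"
    and g :: "nat \<Rightarrow> nat \<Rightarrow> (nat \<Rightarrow> 'a) \<Rightarrow> real" and W :: "nat \<Rightarrow> 'w \<Rightarrow> real"
  assumes e_bounded: "\<And>j. e j \<in> bounded_measurable \<nu>" and e_mean: "\<And>j. (\<integral>v. e j v \<partial>\<nu>) = 0"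
    and g_V: "\<And>m j. g m j \<in> V" and g_0: "\<And>m j. D m \<le> j \<Longrightarrow> g m j = (\<lambda>x. 0)"
    and close: "\<And>m. field_norm \<nu> q (\<lambda>v x. \<Phi> v x - (\<Sum>j<D m. e j v * g m j x)) < ennreal ((1/2) ^ m)"
    and W_measurable [measurable]: "\<And>j. W j \<in> borel_measurable P"
    and W_char: "\<And>d c. (CLINT \<omega>|P. iexp (\<Sum>j<d. c j * W j \<omega>)) = complex_of_real (exp (- (\<integral>v. (\<Sum>j<d. c j * e j v)\<^sup>2 \<partial>\<nu>) / 2))"
begin

definition Z :: "nat \<Rightarrow> ((nat \<Rightarrow> 'a) \<Rightarrow> real) \<Rightarrow> (nat \<Rightarrow> 'a) \<Rightarrow> real" where
  "Z m v x = (\<Sum>j<D m. e j v * g m j x)"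

definition G :: "nat \<Rightarrow> 'w \<Rightarrow> (nat \<Rightarrow> 'a) \<Rightarrow> real" where
  "G m \<omega> x = (\<Sum>j<D m. W j \<omega> * g m j x)"

definition T :: "nat \<Rightarrow> nat \<Rightarrow> 'w \<Rightarrow> real" where
  "T n j \<omega> = (\<Sum>k<n. e j (Y k \<omega>)) / sqrt (real n)"

definition Sm :: "nat \<Rightarrow> nat \<Rightarrow> 'w \<Rightarrow> (nat \<Rightarrow> 'a) \<Rightarrow> real" where
  "Sm m n \<omega> x = (\<Sum>j<D m. T n j \<omega> * g m j x)"

lemma e_measurable [measurable]: "e j \<in> borel_measurable BV"
  using bounded_measurable_measurable[OF e_bounded[of j]] measurable_cong_sets[OF sets_\<nu> refl] by blast

lemma T_measurable [measurable]: "T n j \<in> borel_measurable P"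
  unfolding T_def[abs_def] by measurable

lemma e_comb_bounded: "(\<lambda>v. \<Sum>j<d. c j * e j v) \<in> bounded_measurable \<nu>"
  by (intro bounded_measurable_sum bounded_measurable_cmult e_bounded)

lemma sum_g_extend: "D m \<le> d \<Longrightarrow> (\<Sum>j<D m. a j * g m j x) = (\<Sum>j<d. a j * g m j x)"
  by (intro sum.mono_neutral_left) (auto simp: g_0)

text \<open>The combination of the \<open>W j\<close> is Gaussian with standard deviation
  \<open>\<sigma>\<close>, the L_2 norm under \<open>\<nu>\<close> of the corresponding combination
  of the \<open>e j\<close>. This is at most its L_q norm since \<open>q \<ge> 2\<close>.\<close>

lemma Lnorm_W_comb_le:
  "Lnorm P q (\<lambda>\<omega>. ennreal \<bar>\<Sum>j<d. c j * W j \<omega>\<bar>) \<le>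
    Lnorm std_normal_distribution q (\<lambda>x. ennreal \<bar>x\<bar>) * Lnorm \<nu> q (\<lambda>v. ennreal \<bar>\<Sum>j<d. c j * e j v\<bar>)"
proof -
  let ?f = "\<lambda>v. \<Sum>j<d. c j * e j v"
  define \<sigma> where "\<sigma> = sqrt (\<integral>v. (?f v)\<^sup>2 \<partial>\<nu>)"
  have \<sigma>2: "\<sigma>\<^sup>2 = (\<integral>v. (?f v)\<^sup>2 \<partial>\<nu>)" by (simp add: \<sigma>_def integral_nonneg_AE)
  have sq: "\<bar>x\<bar> powr 2 = x\<^sup>2" for x :: real by (cases "x = 0") auto
  have "integrable \<nu> (\<lambda>v. (?f v)\<^sup>2)"
    unfolding power2_eq_square by (intro \<nu>.bounded_measurable_integrable bounded_measurable_mult e_comb_bounded)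
  then have "Lnorm \<nu> 2 (\<lambda>v. ennreal \<bar>?f v\<bar>) = ennreal \<sigma>"
    by (subst \<nu>.Lnorm_eq_integral) (auto simp: sq \<sigma>_def powr_half_sqrt integral_nonneg_AE)
  moreover have "Lnorm \<nu> 2 (\<lambda>v. ennreal \<bar>?f v\<bar>) \<le> Lnorm \<nu> q (\<lambda>v. ennreal \<bar>?f v\<bar>)"
    using q by (intro \<nu>.Lnorm_mono_exponent) auto
  ultimately have le: "ennreal \<sigma> \<le> Lnorm \<nu> q (\<lambda>v. ennreal \<bar>?f v\<bar>)" by simp
  have "Lnorm P q (\<lambda>\<omega>. ennreal \<bar>\<Sum>j<d. c j * W j \<omega>\<bar>) = ennreal \<sigma> * Lnorm std_normal_distribution q (\<lambda>x. ennreal \<bar>x\<bar>)"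
  proof (rule P.gaussian_Lnorm)
    show "0 \<le> \<sigma>" by (simp add: \<sigma>_def integral_nonneg_AE)
    show "0 < q" by (rule q0)
    fix t
    have "(CLINT \<omega>|P. iexp (t * (\<Sum>j<d. c j * W j \<omega>))) = (CLINT \<omega>|P. iexp (\<Sum>j<d. (t * c j) * W j \<omega>))"
      by (simp add: sum_distrib_left mult.assoc)
    also have "\<dots> = complex_of_real (exp (- (\<integral>v. (\<Sum>j<d. (t * c j) * e j v)\<^sup>2 \<partial>\<nu>) / 2))" by (rule W_char)
    also have "(\<integral>v. (\<Sum>j<d. (t * c j) * e j v)\<^sup>2 \<partial>\<nu>) = (\<integral>v. t\<^sup>2 * (?f v)\<^sup>2 \<partial>\<nu>)"
      by (intro Bochner_Integration.integral_cong refl)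
         (simp only: power_mult_distrib[symmetric] sum_distrib_left mult.assoc)
    also have "\<dots> = (t * \<sigma>)\<^sup>2" by (simp add: power_mult_distrib \<sigma>2)
    finally show "(CLINT \<omega>|P. iexp (t * (\<Sum>j<d. c j * W j \<omega>))) = complex_of_real (exp (- (t * \<sigma>)\<^sup>2 / 2))" .
  qed measurable
  then show ?thesis by (simp only:) (subst mult.commute, rule mult_left_mono[OF le], simp)
qed

lemma joint_measurable [measurable]:
  "(\<lambda>z. Z m (fst z) (snd z)) \<in> borel_measurable (\<nu> \<Otimes>\<^sub>M X)"
  "(\<lambda>z. G m (fst z) (snd z)) \<in> borel_measurable (P \<Otimes>\<^sub>M X)"
  "(\<lambda>z. Sm m n (fst z) (snd z)) \<in> borel_measurable (P \<Otimes>\<^sub>M X)"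
  unfolding Z_def G_def Sm_def by (intro comb_measurable g_V; measurable)+

lemma measurable_BV_G: "G m \<in> measurable P BV" and measurable_BV_Sm: "Sm m n \<in> measurable P BV"
  unfolding G_def[abs_def] Sm_def[abs_def] by (intro comb_measurable g_V; measurable)+

lemma G_V: "G m \<omega> \<in> V" and Sm_V: "Sm m n \<omega> \<in> V" and Z_V: "Z m v \<in> V"
  unfolding G_def[abs_def] Sm_def[abs_def] Z_def[abs_def] by (intro comb_in_V g_V)+

text \<open>Both sums are extended by zero coefficients to a common length. At fixed
  \<open>x\<close> the two differences are then combinations of the \<open>W j\<close> and of the
  \<open>e j\<close> with the same coefficients, and \<open>Lnorm_W_comb_le\<close> applies
  pointwise.\<close>

lemma field_norm_G_diff:
  "field_norm P q (\<lambda>\<omega> x. G m' \<omega> x - G m \<omega> x) \<le>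
    Lnorm std_normal_distribution q (\<lambda>x. ennreal \<bar>x\<bar>) * field_norm \<nu> q (\<lambda>v x. Z m' v x - Z m v x)"
proof -
  define d where "d = max (D m) (D m')"
  have d: "D m \<le> d" "D m' \<le> d" by (auto simp: d_def)
  have Gd: "G m' \<omega> x - G m \<omega> x = (\<Sum>j<d. (g m' j x - g m j x) * W j \<omega>)" for \<omega> x
    unfolding G_def sum_g_extend[OF d(1)] sum_g_extend[OF d(2)] sum_subtractf[symmetric]
    by (intro sum.cong refl) (simp add: algebra_simps)
  have Zd: "Z m' v x - Z m v x = (\<Sum>j<d. (g m' j x - g m j x) * e j v)" for v x
    unfolding Z_def sum_g_extend[OF d(1)] sum_g_extend[OF d(2)] sum_subtractf[symmetric]
    by (intro sum.cong refl) (simp add: algebra_simps)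
  have m1: "(\<lambda>x. Lnorm P q (\<lambda>\<omega>. ennreal \<bar>G m' \<omega> x - G m \<omega> x\<bar>)) \<in> borel_measurable X"
    by (rule measurable_Lnorm_field[OF P.prob_space_axioms]) measurable
  have m2: "(\<lambda>x. Lnorm \<nu> q (\<lambda>v. ennreal \<bar>Z m' v x - Z m v x\<bar>)) \<in> borel_measurable X"
    by (rule measurable_Lnorm_field[OF prob_space_\<nu>]) measurable
  have "field_norm P q (\<lambda>\<omega> x. G m' \<omega> x - G m \<omega> x) \<le>
      N (\<lambda>x. Lnorm std_normal_distribution q (\<lambda>x. ennreal \<bar>x\<bar>) * Lnorm \<nu> q (\<lambda>v. ennreal \<bar>Z m' v x - Z m v x\<bar>))"
    unfolding field_norm_def
  proof (rule N_mono[OF m1])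
    show "(\<lambda>x. Lnorm std_normal_distribution q (\<lambda>x. ennreal \<bar>x\<bar>) * Lnorm \<nu> q (\<lambda>v. ennreal \<bar>Z m' v x - Z m v x\<bar>)) \<in> borel_measurable X"
      using m2 by measurable
    show "Lnorm P q (\<lambda>\<omega>. ennreal \<bar>G m' \<omega> x - G m \<omega> x\<bar>) \<le>
        Lnorm std_normal_distribution q (\<lambda>x. ennreal \<bar>x\<bar>) * Lnorm \<nu> q (\<lambda>v. ennreal \<bar>Z m' v x - Z m v x\<bar>)" for x
      unfolding Gd Zd by (rule Lnorm_W_comb_le)
  qed
  also have "\<dots> = Lnorm std_normal_distribution q (\<lambda>x. ennreal \<bar>x\<bar>) * field_norm \<nu> q (\<lambda>v x. Z m' v x - Z m v x)"
    unfolding field_norm_def by (rule N_cmult[OF m2])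
  finally show ?thesis .
qed

lemma field_norm_\<Phi>_Z: "field_norm \<nu> q (\<lambda>v x. \<Phi> v x - Z m v x) \<le> ennreal ((1/2) ^ m)"
  using close[of m] unfolding Z_def by (rule less_imp_le)

lemma field_norm_Z_diff: "field_norm \<nu> q (\<lambda>v x. Z (Suc m) v x - Z m v x) \<le> ennreal (2 * (1/2) ^ m)"
proof -
  have "field_norm \<nu> q (\<lambda>v x. Z (Suc m) v x - Z m v x) \<le>
      field_norm \<nu> q (\<lambda>v x. Z (Suc m) v x - \<Phi> v x) + field_norm \<nu> q (\<lambda>v x. \<Phi> v x - Z m v x)"
    by (rule field_norm_triangle[OF prob_space_\<nu> q1]) measurable
  also have "field_norm \<nu> q (\<lambda>v x. Z (Suc m) v x - \<Phi> v x) = field_norm \<nu> q (\<lambda>v x. \<Phi> v x - Z (Suc m) v x)"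
    by (rule field_norm_commute)
  also have "\<dots> + field_norm \<nu> q (\<lambda>v x. \<Phi> v x - Z m v x) \<le> ennreal ((1/2) ^ Suc m) + ennreal ((1/2) ^ m)"
    by (intro add_mono field_norm_\<Phi>_Z)
  also have "\<dots> = ennreal ((1/2) ^ Suc m + (1/2) ^ m)" by (rule ennreal_plus[symmetric]) auto
  also have "\<dots> \<le> ennreal (2 * (1/2) ^ m)" by (intro ennreal_leI) simp
  finally show ?thesis .
qed

text \<open>Successive fields \<open>G m\<close> are geometrically close in the field norm, so
  \<open>N_complete\<close> on the product of \<open>P\<close> and \<open>X\<close> gives a jointly
  measurable limit with a geometric rate. Paths outside \<open>V\<close> form a null set and are
  reset to \<open>0\<close> by \<open>Lp_element\<close>.\<close>

lemma limit_exists: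
  obtains S C where "S \<in> measurable P BV" "0 \<le> C"
    "\<And>m. (\<integral>\<^sup>+ \<omega>. ennreal (nn (\<lambda>x. S \<omega> x - G m \<omega> x)) \<partial>P) \<le> ennreal (C * (1/2) ^ m)"
proof -
  interpret NN: function_norm "P \<Otimes>\<^sub>M X" "\<lambda>F. N (\<lambda>x. Lnorm P q (\<lambda>\<omega>. F (\<omega>, x)))"
    by (rule function_norm_field[OF P.prob_space_axioms q1])
  obtain c where c: "Lnorm std_normal_distribution q (\<lambda>x. ennreal \<bar>x\<bar>) = ennreal c" "0 \<le> c"
    using std_normal_abs_moment_finite[OF q0] by (cases "Lnorm std_normal_distribution q (\<lambda>x. ennreal \<bar>x\<bar>)" rule: ennreal_cases) auto
  let ?u = "\<lambda>m z. G m (fst z) (snd z)"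
  have step: "N (\<lambda>x. Lnorm P q (\<lambda>\<omega>. ennreal \<bar>?u (Suc m) (\<omega>, x) - ?u m (\<omega>, x)\<bar>)) \<le> ennreal (2 * c * (1/2) ^ m)" for m
  proof -
    have "field_norm P q (\<lambda>\<omega> x. G (Suc m) \<omega> x - G m \<omega> x) \<le> ennreal c * field_norm \<nu> q (\<lambda>v x. Z (Suc m) v x - Z m v x)"
      using field_norm_G_diff[of "Suc m" m] unfolding c(1) .
    also have "\<dots> \<le> ennreal c * ennreal (2 * (1/2) ^ m)" by (intro mult_left_mono field_norm_Z_diff) simp
    also have "\<dots> = ennreal (c * (2 * (1/2) ^ m))" using c by (intro ennreal_mult[symmetric]) auto
    finally show ?thesis by (simp add: field_norm_def mult_ac)
  qed
  have geo: "(\<Sum>n. ennreal (2 * c * (1/2) ^ (n + m))) = ennreal (4 * c * (1/2) ^ m)" for m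
  proof -
    have s: "summable (\<lambda>n. (1/2 :: real) ^ n)" by (rule summable_geometric) simp
    have eq: "2 * c * (1/2) ^ (n + m) = (2 * c * (1/2) ^ m) * (1/2) ^ n" for n by (simp add: power_add mult_ac)
    have "(\<Sum>n. ennreal (2 * c * (1/2) ^ (n + m))) = ennreal (\<Sum>n. (2 * c * (1/2) ^ m) * (1/2) ^ n)"
      unfolding eq by (rule suminf_ennreal2) (use c s in \<open>auto intro: summable_mult\<close>)
    also have "(\<Sum>n. (2 * c * (1/2) ^ m) * (1/2) ^ n) = 4 * c * (1/2) ^ m"
      using suminf_mult[OF s, of "2 * c * (1/2) ^ m"] suminf_geometric[of "1/2 :: real"] by simp
    finally show ?thesis .
  qed
  have sum_le: "(\<Sum>n. N (\<lambda>x. Lnorm P q (\<lambda>\<omega>. ennreal \<bar>?u (Suc (n + m)) (\<omega>, x) - ?u (n + m) (\<omega>, x)\<bar>))) \<le> ennreal (4 * c * (1/2) ^ m)" for m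
    unfolding geo[symmetric] by (intro suminf_le step) auto
  have "(\<Sum>n. N (\<lambda>x. Lnorm P q (\<lambda>\<omega>. ennreal \<bar>?u (Suc n) (\<omega>, x) - ?u n (\<omega>, x)\<bar>))) < \<top>"
    using sum_le[of 0] by (simp add: le_less_trans)
  then obtain S0 where S0 [measurable]: "S0 \<in> borel_measurable (P \<Otimes>\<^sub>M X)"
    and S0_le: "\<And>m. N (\<lambda>x. Lnorm P q (\<lambda>\<omega>. ennreal \<bar>S0 (\<omega>, x) - ?u m (\<omega>, x)\<bar>)) \<le>
      (\<Sum>n. N (\<lambda>x. Lnorm P q (\<lambda>\<omega>. ennreal \<bar>?u (Suc (n + m)) (\<omega>, x) - ?u (n + m) (\<omega>, x)\<bar>)))"
    using NN.N_complete[of ?u, OF joint_measurable(2)] by blast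
  define S' where "S' \<omega> x = S0 (\<omega>, x)" for \<omega> x
  have S'_meas [measurable]: "(\<lambda>z. S' (fst z) (snd z)) \<in> borel_measurable (P \<Otimes>\<^sub>M X)" by (simp add: S'_def)
  have E_le: "(\<integral>\<^sup>+ \<omega>. N (\<lambda>x. ennreal \<bar>S' \<omega> x - G m \<omega> x\<bar>) \<partial>P) \<le> ennreal (4 * c * (1/2) ^ m)" for m
  proof -
    have "(\<integral>\<^sup>+ \<omega>. N (\<lambda>x. ennreal \<bar>S' \<omega> x - G m \<omega> x\<bar>) \<partial>P) \<le> field_norm P q (\<lambda>\<omega> x. S' \<omega> x - G m \<omega> x)"
      by (rule nn_integral_N_le_field_norm[OF P.prob_space_axioms q1 p_le_q]) measurable
    also have "\<dots> \<le> ennreal (4 * c * (1/2) ^ m)"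
      using order_trans[OF S0_le sum_le, of m] by (simp add: field_norm_def S'_def)
    finally show ?thesis .
  qed
  have sec: "S' \<omega> \<in> borel_measurable X" if "\<omega> \<in> space P" for \<omega>
    using measurable_compose[OF measurable_Pair1'[OF that] S'_meas] by simp
  have Nm [measurable]: "(\<lambda>\<omega>. N (\<lambda>x. ennreal \<bar>S' \<omega> x - G m \<omega> x\<bar>)) \<in> borel_measurable P" for m
  proof (rule measurable_N_param)
    have "(\<lambda>z. ennreal \<bar>S' (fst z) (snd z) - G m (fst z) (snd z)\<bar>) \<in> borel_measurable (P \<Otimes>\<^sub>M X)" by measurable
    then show "(\<lambda>(\<omega>, x). ennreal \<bar>S' \<omega> x - G m \<omega> x\<bar>) \<in> borel_measurable (P \<Otimes>\<^sub>M X)" by (simp add: split_beta')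
  qed
  \<comment> \<open>Finite mean distance to the field \<open>G 0\<close>, whose paths are all in
    \<open>V\<close>, puts almost every path of the limit in \<open>V\<close>.\<close>
  have "(\<integral>\<^sup>+ \<omega>. N (\<lambda>x. ennreal \<bar>S' \<omega> x - G 0 \<omega> x\<bar>) \<partial>P) \<noteq> \<infinity>" using E_le[of 0] by (auto simp: top_unique)
  then have "AE \<omega> in P. N (\<lambda>x. ennreal \<bar>S' \<omega> x - G 0 \<omega> x\<bar>) \<noteq> \<infinity>" by (intro nn_integral_PInf_AE Nm)
  then have S'_V: "AE \<omega> in P. S' \<omega> \<in> V" using AE_space
  proof eventually_elim
    case (elim \<omega>)
    have "(\<lambda>x. S' \<omega> x - G 0 \<omega> x) \<in> V"
      using elim sec[OF elim(2)] V_measurable[OF G_V[of 0 \<omega>]] by (auto simp: V_iff less_top)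
    from V_add[OF this G_V[of 0 \<omega>]] show ?case by simp
  qed
  define S where "S = Lp_element M p l S'"
  have "(\<integral>\<^sup>+ \<omega>. ennreal (nn (\<lambda>x. S \<omega> x - G m \<omega> x)) \<partial>P) \<le> ennreal (4 * c * (1/2) ^ m)" for m
  proof -
    have "(\<integral>\<^sup>+ \<omega>. ennreal (nn (\<lambda>x. S \<omega> x - G m \<omega> x)) \<partial>P) = (\<integral>\<^sup>+ \<omega>. N (\<lambda>x. ennreal \<bar>S' \<omega> x - G m \<omega> x\<bar>) \<partial>P)"
    proof (rule nn_integral_cong_AE)
      show "AE \<omega> in P. ennreal (nn (\<lambda>x. S \<omega> x - G m \<omega> x)) = N (\<lambda>x. ennreal \<bar>S' \<omega> x - G m \<omega> x\<bar>)"
        using S'_V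
      proof eventually_elim
        case (elim \<omega>)
        then have "S \<omega> = S' \<omega>" by (simp add: S_def Lp_element_def)
        then show ?case using ennreal_nn[OF V_diff[OF elim G_V[of m \<omega>]]] by simp
      qed
    qed
    then show ?thesis using E_le by simp
  qed
  moreover have "S \<in> measurable P BV" unfolding S_def by (rule measurable_Lp_element[OF S'_meas])
  ultimately show thesis using c by (intro that[of S "4 * c"]) auto
qed

text \<open>Interchanging the finite sums shows that the distance to the original sums is governed
  by a normalized sum again, that of the residuals \<open>\<Phi> - Z m\<close>.\<close>

lemma Sm_eq: "Sm m n \<omega> x = (\<Sum>k<n. Z m (Y k \<omega>) x) / sqrt (real n)"
proof -
  have "(\<Sum>k<n. Z m (Y k \<omega>) x) = (\<Sum>j<D m. (\<Sum>k<n. e j (Y k \<omega>)) * g m j x)"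
    unfolding Z_def by (subst sum.swap) (simp add: sum_distrib_right)
  then show ?thesis by (simp add: Sm_def T_def sum_divide_distrib[of _ "{..<D m}"])
qed

text \<open>At almost every \<open>x\<close> the residual \<open>H\<close> is a centered function
  under \<open>\<nu>\<close> with finite L_q norm. The moment bound therefore transfers its field
  norm to the normalized sums with a factor \<open>K\<close> that does not depend on
  \<open>n\<close> or \<open>m\<close>.\<close>

lemma partial_sums_close:
  obtains K where "0 \<le> K"
    "\<And>n m. (\<integral>\<^sup>+ \<omega>. ennreal (nn (\<lambda>x. normalized_sum Y n \<omega> x - Sm m n \<omega> x)) \<partial>P) \<le> ennreal (K * (1/2) ^ m)"
proof -
  obtain K :: real where K: "1 \<le> K"
    "\<And>(Y' :: nat \<Rightarrow> 'w \<Rightarrow> (nat \<Rightarrow> 'a) \<Rightarrow> real) B \<nu>' H n. \<lbrakk>P.indep_vars (\<lambda>_. B) Y' UNIV; \<And>k. distr P B (Y' k) = \<nu>'; H \<in> borel_measurable B;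
        Lnorm \<nu>' q (\<lambda>v. ennreal \<bar>H v\<bar>) < \<top>; (\<integral>v. H v \<partial>\<nu>') = (0::real)\<rbrakk> \<Longrightarrow>
      Lnorm P q (\<lambda>\<omega>. ennreal \<bar>(\<Sum>k<n. H (Y' k \<omega>)) / sqrt (real n)\<bar>) \<le> ennreal K * Lnorm \<nu>' q (\<lambda>v. ennreal \<bar>H v\<bar>)"
    using P.normalized_sum_Lnorm_bound[OF q, where 'v = "(nat \<Rightarrow> 'a) \<Rightarrow> real"] by blast
  have "(\<integral>\<^sup>+ \<omega>. ennreal (nn (\<lambda>x. normalized_sum Y n \<omega> x - Sm m n \<omega> x)) \<partial>P) \<le> ennreal (K * (1/2) ^ m)" for n m
  proof -
    define H where "H v x = \<Phi> v x - Z m v x" for v x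
    have H_meas [measurable]: "(\<lambda>z. H (fst z) (snd z)) \<in> borel_measurable (\<nu> \<Otimes>\<^sub>M X)" unfolding H_def by measurable
    have H_meas' [measurable]: "(\<lambda>z. H (fst z) (snd z)) \<in> borel_measurable (BV \<Otimes>\<^sub>M X)"
      using H_meas measurable_cong_sets[OF sets_pair_measure_cong[OF sets_\<nu> refl] refl] by blast
    have HY [measurable]: "(\<lambda>z. H (Y k (fst z)) (snd z)) \<in> borel_measurable (P \<Otimes>\<^sub>M X)" for k
    proof -
      have "(\<lambda>z. (Y k (fst z), snd z)) \<in> measurable (P \<Otimes>\<^sub>M X) (BV \<Otimes>\<^sub>M X)" by measurable
      from measurable_compose[OF this H_meas'] show ?thesis by simp
    qed
    let ?R = "\<lambda>\<omega> x. (\<Sum>k<n. H (Y k \<omega>) x) / sqrt (real n)"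
    have R_meas [measurable]: "(\<lambda>z. ?R (fst z) (snd z)) \<in> borel_measurable (P \<Otimes>\<^sub>M X)" by measurable
    have "(\<integral>\<^sup>+ \<omega>. ennreal (nn (\<lambda>x. normalized_sum Y n \<omega> x - Sm m n \<omega> x)) \<partial>P) = (\<integral>\<^sup>+ \<omega>. N (\<lambda>x. ennreal \<bar>?R \<omega> x\<bar>) \<partial>P)"
    proof (rule nn_integral_cong)
      fix \<omega> assume w: "\<omega> \<in> space P"
      have "N (\<lambda>x. ennreal \<bar>normalized_sum Y n \<omega> x - Sm m n \<omega> x\<bar>) = N (\<lambda>x. ennreal \<bar>?R \<omega> x\<bar>)"
      proof (rule N_cong_AE)
        show "AE x in X. ennreal \<bar>normalized_sum Y n \<omega> x - Sm m n \<omega> x\<bar> = ennreal \<bar>?R \<omega> x\<bar>"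
          using AE_\<Phi>_Y[OF w, of n] by eventually_elim (simp add: Sm_eq H_def sum_subtractf diff_divide_distrib)
        show "(\<lambda>x. ennreal \<bar>normalized_sum Y n \<omega> x - Sm m n \<omega> x\<bar>) \<in> borel_measurable X"
          using V_measurable[OF normalized_sum_in_V[OF w, of n]] V_measurable[OF Sm_V[of m n \<omega>]] by measurable
        have "?R \<omega> \<in> borel_measurable X" using measurable_compose[OF measurable_Pair1'[OF w] R_meas] by simp
        then show "(\<lambda>x. ennreal \<bar>?R \<omega> x\<bar>) \<in> borel_measurable X" by measurable
      qed
      then show "ennreal (nn (\<lambda>x. normalized_sum Y n \<omega> x - Sm m n \<omega> x)) = N (\<lambda>x. ennreal \<bar>?R \<omega> x\<bar>)"
        using ennreal_nn[OF V_diff[OF normalized_sum_in_V[OF w, of n] Sm_V[of m n \<omega>]]] by simp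
    qed
    also have "\<dots> \<le> field_norm P q ?R"
      by (rule nn_integral_N_le_field_norm[OF P.prob_space_axioms q1 p_le_q R_meas])
    also have "\<dots> \<le> N (\<lambda>x. ennreal K * Lnorm \<nu> q (\<lambda>v. ennreal \<bar>H v x\<bar>))"
      unfolding field_norm_def
    proof (rule N_mono_AE)
      show "(\<lambda>x. Lnorm P q (\<lambda>\<omega>. ennreal \<bar>?R \<omega> x\<bar>)) \<in> borel_measurable X"
        by (rule measurable_Lnorm_field[OF P.prob_space_axioms R_meas])
      have mH [measurable]: "(\<lambda>x. Lnorm \<nu> q (\<lambda>v. ennreal \<bar>H v x\<bar>)) \<in> borel_measurable X"
        by (rule measurable_Lnorm_field[OF prob_space_\<nu> H_meas])
      show "(\<lambda>x. ennreal K * Lnorm \<nu> q (\<lambda>v. ennreal \<bar>H v x\<bar>)) \<in> borel_measurable X" by measurable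
      have "AE x in X. Lnorm \<nu> q (\<lambda>v. ennreal \<bar>H v x\<bar>) < \<top>"
        using field_norm_\<Phi>_Z[of m] unfolding field_norm_def H_def[symmetric]
        by (intro N_finite_AE mH) (auto intro: le_less_trans)
      moreover have "AE x in X. Lnorm \<nu> q (\<lambda>v. ennreal \<bar>\<Phi> v x\<bar>) < \<top>"
        using \<Phi>_finite unfolding field_norm_def
        by (intro N_finite_AE measurable_Lnorm_field[OF prob_space_\<nu> \<Phi>_meas_\<nu>])
      ultimately show "AE x in X. Lnorm P q (\<lambda>\<omega>. ennreal \<bar>?R \<omega> x\<bar>) \<le> ennreal K * Lnorm \<nu> q (\<lambda>v. ennreal \<bar>H v x\<bar>)"
        using \<Phi>_centered AE_space
      proof eventually_elim
        case (elim x)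
        have \<Phi>x: "(\<lambda>v. \<Phi> v x) \<in> borel_measurable \<nu>"
          using measurable_compose[OF measurable_Pair2'[OF elim(4)] \<Phi>_meas_\<nu>] by simp
        have Hx: "(\<lambda>v. H v x) \<in> borel_measurable BV"
          using measurable_compose[OF measurable_Pair2'[OF elim(4)] H_meas'] by simp
        have \<Phi>i: "integrable \<nu> (\<lambda>v. \<Phi> v x)" by (rule \<nu>.Lnorm_centered_le(1)[OF q1 \<Phi>x elim(2)])
        have Zi: "integrable \<nu> (\<lambda>v. e j v * g m j x)" for j by (intro integrable_mult_left \<nu>.bounded_measurable_integrable e_bounded)
        have "(\<integral>v. Z m v x \<partial>\<nu>) = (\<Sum>j<D m. (\<integral>v. e j v * g m j x \<partial>\<nu>))"
          unfolding Z_def by (intro Bochner_Integration.integral_sum Zi)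
        also have "\<dots> = 0" by (simp add: e_mean)
        finally have Z0: "(\<integral>v. Z m v x \<partial>\<nu>) = 0" .
        have "integrable \<nu> (\<lambda>v. Z m v x)" unfolding Z_def by (intro Bochner_Integration.integrable_sum Zi)
        then have H0: "(\<integral>v. H v x \<partial>\<nu>) = 0" unfolding H_def using \<Phi>i Z0 elim(3) by simp
        show ?case by (rule K(2)[OF Y_indep Y_distr Hx elim(1) H0])
      qed
    qed
    also have "\<dots> = ennreal K * field_norm \<nu> q H"
      unfolding field_norm_def by (rule N_cmult[OF measurable_Lnorm_field[OF prob_space_\<nu> H_meas]])
    also have "\<dots> \<le> ennreal K * ennreal ((1/2) ^ m)"
      unfolding H_def by (intro mult_left_mono field_norm_\<Phi>_Z) simp
    also have "\<dots> = ennreal (K * (1/2) ^ m)" using K by (intro ennreal_mult[symmetric]) auto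
    finally show ?thesis .
  qed
  then show thesis using K by (intro that[of K]) auto
qed

text \<open>On the finite-dimensional range of the fields, \<open>\<phi>\<close> becomes a bounded
  continuous function \<open>\<psi>\<close> of the coefficient vector. Following Cramer and Wold,
  each linear combination of coefficients is handled by the scalar central limit theorem, and
  tightness comes from the L_q bounds.\<close>

lemma finite_dimensional_convergence:
  assumes lip: "\<And>f h. f \<in> V \<Longrightarrow> h \<in> V \<Longrightarrow> \<bar>\<phi> f - \<phi> h\<bar> \<le> C * nn (\<lambda>x. f x - h x)"
    and K: "\<And>f. f \<in> V \<Longrightarrow> \<bar>\<phi> f\<bar> \<le> K"
  shows "(\<lambda>n. P.expectation (\<lambda>\<omega>. \<phi> (Sm m n \<omega>))) \<longlonglongrightarrow> P.expectation (\<lambda>\<omega>. \<phi> (G m \<omega>))"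
proof -
  let ?d = "D m"
  \<comment> \<open>Coordinates from \<open>D m\<close> on are set to \<open>0\<close>, the form in
    which \<open>weak_convergence_of_char\<close> represents vectors.\<close>
  define T' where "T' n j \<omega> = (if j < ?d then T n j \<omega> else 0)" for n j \<omega>
  define W' where "W' j \<omega> = (if j < ?d then W j \<omega> else 0)" for j \<omega>
  have T'_m [measurable]: "T' n j \<in> borel_measurable P" for n j unfolding T'_def[abs_def] by measurable
  have W'_m [measurable]: "W' j \<in> borel_measurable P" for j unfolding W'_def[abs_def] by measurable
  define \<psi> where "\<psi> t = \<phi> (\<lambda>x. \<Sum>j<?d. t j * g m j x)" for t :: "nat \<Rightarrow> real"
  have in_V: "(\<lambda>x. \<Sum>j<?d. t j * g m j x) \<in> V" for t by (intro comb_in_V g_V)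
  have "(\<lambda>n. P.expectation (\<lambda>\<omega>. \<psi> (\<lambda>j. T' n j \<omega>))) \<longlonglongrightarrow> P.expectation (\<lambda>\<omega>. \<psi> (\<lambda>j. W' j \<omega>))"
  proof (rule P.weak_convergence_of_char[where d = ?d, OF T'_m W'_m])
    show "\<bar>\<psi> t\<bar> \<le> K" for t unfolding \<psi>_def by (rule K[OF in_V])
    show "T' n j \<omega> = 0" "W' j \<omega> = 0" if "?d \<le> j" for n j \<omega> using that by (auto simp: T'_def W'_def)
    show "continuous_on UNIV \<psi>"
    proof (rule continuous_at_imp_continuous_on, rule ballI)
      fix s :: "nat \<Rightarrow> real"
      have coord: "((\<lambda>t. t j) \<longlongrightarrow> s j) (at s)" for j
      proof -
        have "continuous_on UNIV (\<lambda>t :: nat \<Rightarrow> real. t j)" by (rule continuous_on_product_coordinates)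
        then show ?thesis by (simp add: continuous_on_def)
      qed
      have "((\<lambda>t. \<bar>C\<bar> * (\<Sum>j<?d. \<bar>t j - s j\<bar> * nn (g m j))) \<longlongrightarrow> \<bar>C\<bar> * (\<Sum>j<?d. \<bar>s j - s j\<bar> * nn (g m j))) (at s)"
        by (intro tendsto_intros coord)
      then have lim0: "((\<lambda>t. \<bar>C\<bar> * (\<Sum>j<?d. \<bar>t j - s j\<bar> * nn (g m j))) \<longlongrightarrow> 0) (at s)" by simp
      have le: "norm (\<psi> t - \<psi> s) \<le> \<bar>C\<bar> * (\<Sum>j<?d. \<bar>t j - s j\<bar> * nn (g m j))" for t
      proof -
        have "norm (\<psi> t - \<psi> s) \<le> C * nn (\<lambda>x. (\<Sum>j<?d. t j * g m j x) - (\<Sum>j<?d. s j * g m j x))"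
          unfolding \<psi>_def real_norm_def by (rule lip[OF in_V in_V])
        also have "\<dots> \<le> \<bar>C\<bar> * nn (\<lambda>x. (\<Sum>j<?d. t j * g m j x) - (\<Sum>j<?d. s j * g m j x))"
          by (intro mult_right_mono) auto
        also have "nn (\<lambda>x. (\<Sum>j<?d. t j * g m j x) - (\<Sum>j<?d. s j * g m j x)) = nn (\<lambda>x. \<Sum>j<?d. (t j - s j) * g m j x)"
          by (simp add: left_diff_distrib sum_subtractf)
        also have "\<bar>C\<bar> * \<dots> \<le> \<bar>C\<bar> * (\<Sum>j<?d. \<bar>t j - s j\<bar> * nn (g m j))"
          by (intro mult_left_mono nn_comb_le g_V) auto
        finally show ?thesis .
      qed
      have "((\<lambda>t. \<psi> t - \<psi> s) \<longlongrightarrow> 0) (at s)"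
        by (rule Lim_null_comparison[OF always_eventually lim0]) (use le in blast)
      then show "isCont \<psi> s" unfolding isCont_def by (rule LIM_zero_cancel)
    qed
  next
    fix a :: "nat \<Rightarrow> real"
    define F where "F v = (\<Sum>j<?d. a j * e j v)" for v
    have F_b: "F \<in> bounded_measurable \<nu>" unfolding F_def[abs_def] by (rule e_comb_bounded)
    have F_m [measurable]: "F \<in> borel_measurable BV" unfolding F_def[abs_def] by measurable
    have ind: "P.indep_vars (\<lambda>_. borel) (\<lambda>k \<omega>. F (Y k \<omega>)) UNIV"
      by (rule P.indep_vars_compose2[OF Y_indep]) simp
    have dist: "distr P borel (\<lambda>\<omega>. F (Y k \<omega>)) = distr \<nu> borel F" for k
      unfolding Y_distr[of k, symmetric] by (subst distr_distr) (auto simp: o_def)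
    have sq_\<nu>: "integrable \<nu> (\<lambda>v. (F v)\<^sup>2)"
      unfolding power2_eq_square by (intro \<nu>.bounded_measurable_integrable bounded_measurable_mult F_b)
    have sq: "integrable P (\<lambda>\<omega>. (F (Y 0 \<omega>))\<^sup>2)"
      using sq_\<nu> unfolding Y_distr[of 0, symmetric] by (subst (asm) integrable_distr_eq) auto
    have sq_eq: "P.expectation (\<lambda>\<omega>. (F (Y 0 \<omega>))\<^sup>2) = (\<integral>v. (F v)\<^sup>2 \<partial>\<nu>)"
      unfolding Y_distr[of 0, symmetric] by (subst integral_distr) auto
    have "(\<integral>v. F v \<partial>\<nu>) = (\<Sum>j<?d. (\<integral>v. a j * e j v \<partial>\<nu>))"
      unfolding F_def by (intro Bochner_Integration.integral_sum integrable_mult_right \<nu>.bounded_measurable_integrable e_bounded)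
    also have "\<dots> = 0" by (simp add: e_mean)
    finally have mean: "P.expectation (\<lambda>\<omega>. F (Y 0 \<omega>)) = 0"
      unfolding Y_distr[of 0, symmetric] by (subst (asm) integral_distr) auto
    have "(\<lambda>n. CLINT \<omega>|P. iexp ((\<Sum>k<n. F (Y k \<omega>)) / sqrt (real n))) \<longlonglongrightarrow>
        complex_of_real (exp (- P.expectation (\<lambda>\<omega>. (F (Y 0 \<omega>))\<^sup>2) / 2))"
      by (rule P.CLT_iexp[OF ind _ sq mean]) (simp add: dist)
    moreover have "(\<Sum>k<n. F (Y k \<omega>)) / sqrt (real n) = (\<Sum>j<?d. a j * T' n j \<omega>)" for n \<omega>
    proof -
      have "(\<Sum>k<n. F (Y k \<omega>)) = (\<Sum>j<?d. a j * (\<Sum>k<n. e j (Y k \<omega>)))"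
        unfolding F_def by (subst sum.swap) (simp add: sum_distrib_left)
      then show ?thesis by (simp add: T'_def T_def sum_divide_distrib[of _ "{..<D m}"])
    qed
    moreover have "(CLINT \<omega>|P. iexp (\<Sum>j<?d. a j * W' j \<omega>)) = complex_of_real (exp (- (\<integral>v. (F v)\<^sup>2 \<partial>\<nu>) / 2))"
      unfolding F_def W_char[symmetric] by (simp add: W'_def)
    ultimately show "(\<lambda>n. CLINT \<omega>|P. iexp (\<Sum>j<?d. a j * T' n j \<omega>)) \<longlonglongrightarrow> (CLINT \<omega>|P. iexp (\<Sum>j<?d. a j * W' j \<omega>))"
      by (simp add: sq_eq)
  next
    fix \<epsilon> :: real assume \<epsilon>: "0 < \<epsilon>"
    obtain K1 :: real where K1: "1 \<le> K1"
      "\<And>(Y' :: nat \<Rightarrow> 'w \<Rightarrow> (nat \<Rightarrow> 'a) \<Rightarrow> real) B \<nu>' H n. \<lbrakk>P.indep_vars (\<lambda>_. B) Y' UNIV; \<And>k. distr P B (Y' k) = \<nu>'; H \<in> borel_measurable B;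
        Lnorm \<nu>' q (\<lambda>v. ennreal \<bar>H v\<bar>) < \<top>; (\<integral>v. H v \<partial>\<nu>') = (0::real)\<rbrakk> \<Longrightarrow>
      Lnorm P q (\<lambda>\<omega>. ennreal \<bar>(\<Sum>k<n. H (Y' k \<omega>)) / sqrt (real n)\<bar>) \<le> ennreal K1 * Lnorm \<nu>' q (\<lambda>v. ennreal \<bar>H v\<bar>)"
      using P.normalized_sum_Lnorm_bound[OF q, where 'v = "(nat \<Rightarrow> 'a) \<Rightarrow> real"] by blast
    let ?N = "Lnorm std_normal_distribution q (\<lambda>x. ennreal \<bar>x\<bar>)"
    have e_fin: "Lnorm \<nu> q (\<lambda>v. ennreal \<bar>e j v\<bar>) < \<top>" for j
    proof -
      obtain B where B: "\<And>v. \<bar>e j v\<bar> \<le> B" using e_bounded[of j] by (auto simp: bounded_measurable_def)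
      have "Lnorm \<nu> q (\<lambda>v. ennreal \<bar>e j v\<bar>) \<le> Lnorm \<nu> q (\<lambda>v. ennreal B)"
        using B q0 by (intro Lnorm_mono ennreal_leI)
      also have "\<dots> < \<top>" by (simp add: Lnorm_def \<nu>.emeasure_space_1)
      finally show ?thesis .
    qed
    define R where "R = (\<Sum>j<?d. (ennreal K1 + ?N) * Lnorm \<nu> q (\<lambda>v. ennreal \<bar>e j v\<bar>))"
    have "R < \<top>" unfolding R_def using e_fin std_normal_abs_moment_finite[OF q0] by (auto simp: ennreal_mult_less_top)
    then obtain r where r: "R = ennreal r" "0 \<le> r" by (cases R rule: ennreal_cases) auto
    have R_ge: "(ennreal K1 + ?N) * Lnorm \<nu> q (\<lambda>v. ennreal \<bar>e j v\<bar>) \<le> R" if "j < ?d" for j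
      unfolding R_def using that by (intro member_le_sum) auto
    have T_le: "Lnorm P q (\<lambda>\<omega>. ennreal \<bar>T' n j \<omega>\<bar>) \<le> ennreal r" if j: "j < ?d" for n j
    proof -
      have "Lnorm P q (\<lambda>\<omega>. ennreal \<bar>T' n j \<omega>\<bar>) \<le> ennreal K1 * Lnorm \<nu> q (\<lambda>v. ennreal \<bar>e j v\<bar>)"
        using K1(2)[OF Y_indep Y_distr e_measurable e_fin e_mean, of j n] j by (simp add: T'_def T_def)
      also have "\<dots> \<le> (ennreal K1 + ?N) * Lnorm \<nu> q (\<lambda>v. ennreal \<bar>e j v\<bar>)" by (intro mult_right_mono) auto
      also have "\<dots> \<le> ennreal r" using R_ge[OF j] by (simp add: r)
      finally show ?thesis .
    qed
    have W_le: "Lnorm P q (\<lambda>\<omega>. ennreal \<bar>W' j \<omega>\<bar>) \<le> ennreal r" if j: "j < ?d" for j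
    proof -
      have "Lnorm P q (\<lambda>\<omega>. ennreal \<bar>W' j \<omega>\<bar>) \<le> ?N * Lnorm \<nu> q (\<lambda>v. ennreal \<bar>e j v\<bar>)"
        using Lnorm_W_comb_le[where d = "Suc j" and c = "\<lambda>i. if i = j then 1 else 0"] j
        by (simp add: W'_def if_distrib[of "\<lambda>x. x * _"] cong: if_cong)
      also have "\<dots> \<le> (ennreal K1 + ?N) * Lnorm \<nu> q (\<lambda>v. ennreal \<bar>e j v\<bar>)" by (intro mult_right_mono) auto
      also have "\<dots> \<le> ennreal r" using R_ge[OF j] by (simp add: r)
      finally show ?thesis .
    qed
    \<comment> \<open>The limit (\<open>None\<close>) and all members of the sequence
      (\<open>Some n\<close>) form one family, so a single \<open>L\<close> serves them
      together.\<close>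
    define U where "U i = (case i of None \<Rightarrow> W' | Some n \<Rightarrow> T' n)" for i
    have "\<exists>L>0. \<forall>i. P.prob {\<omega> \<in> space P. \<exists>j<?d. L < \<bar>U i j \<omega>\<bar>} \<le> \<epsilon>"
    proof (rule P.tight_of_Lnorm[OF q1 _ _ r(2) \<epsilon>])
      show "U i j \<in> borel_measurable P" for i j by (cases i) (auto simp: U_def)
      show "Lnorm P q (\<lambda>\<omega>. ennreal \<bar>U i j \<omega>\<bar>) \<le> ennreal r" if "j < ?d" for i j
        using that T_le W_le by (cases i) (auto simp: U_def)
    qed
    then obtain L where "0 < L" and L: "\<And>i. P.prob {\<omega> \<in> space P. \<exists>j<?d. L < \<bar>U i j \<omega>\<bar>} \<le> \<epsilon>" by blast
    then show "\<exists>L>0. (\<forall>n. P.prob {\<omega> \<in> space P. \<exists>j<?d. L < \<bar>T' n j \<omega>\<bar>} \<le> \<epsilon>) \<and>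
        P.prob {\<omega> \<in> space P. \<exists>j<?d. L < \<bar>W' j \<omega>\<bar>} \<le> \<epsilon>"
      using L[of None] L[of "Some _"] unfolding U_def by (intro exI[of _ L]) simp
  qed
  moreover have "\<psi> (\<lambda>j. T' n j \<omega>) = \<phi> (Sm m n \<omega>)" "\<psi> (\<lambda>j. W' j \<omega>) = \<phi> (G m \<omega>)" for n \<omega>
    unfolding \<psi>_def T'_def W'_def Sm_def[abs_def] G_def[abs_def] by (auto intro!: arg_cong[where f = \<phi>] ext sum.cong)
  ultimately show ?thesis by simp
qed

text \<open>A three-part comparison for Lipschitz \<open>\<phi>\<close>: original sums with
  finite-rank sums, finite-rank sums with their Gaussian limit, and that limit with
  \<open>S\<close>. The precision \<open>m\<close> is fixed first, which is possible because the
  first error is uniform in \<open>n\<close>; only then is \<open>n\<close> made large.\<close>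

theorem weak_limit:
  "\<exists>S \<in> measurable P BV. \<forall>\<phi> K. continuous_map (seminorm_topology V nn) euclideanreal \<phi> \<longrightarrow> (\<forall>f\<in>V. \<bar>\<phi> f\<bar> \<le> K) \<longrightarrow>
      (\<lambda>n. P.expectation (\<lambda>\<omega>. \<phi> (normalized_sum Y n \<omega>))) \<longlonglongrightarrow> P.expectation (\<lambda>\<omega>. \<phi> (S \<omega>))"
proof -
  obtain S C0 where S: "S \<in> measurable P BV" and C0: "0 \<le> C0"
    "\<And>m. (\<integral>\<^sup>+ \<omega>. ennreal (nn (\<lambda>x. S \<omega> x - G m \<omega> x)) \<partial>P) \<le> ennreal (C0 * (1/2) ^ m)"
    by (rule limit_exists) (rule that)
  obtain K0 where K0: "0 \<le> K0"
    "\<And>n m. (\<integral>\<^sup>+ \<omega>. ennreal (nn (\<lambda>x. normalized_sum Y n \<omega> x - Sm m n \<omega> x)) \<partial>P) \<le> ennreal (K0 * (1/2) ^ m)"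
    by (rule partial_sums_close) (rule that)
  have lip_conv: "(\<lambda>n. P.expectation (\<lambda>\<omega>. \<phi> (normalized_sum Y n \<omega>))) \<longlonglongrightarrow> P.expectation (\<lambda>\<omega>. \<phi> (S \<omega>))"
    if lip: "\<And>f h. f \<in> V \<Longrightarrow> h \<in> V \<Longrightarrow> \<bar>\<phi> f - \<phi> h\<bar> \<le> C * nn (\<lambda>x. f x - h x)" and K: "\<And>f. f \<in> V \<Longrightarrow> \<bar>\<phi> f\<bar> \<le> K" for \<phi> C K
  proof (rule LIMSEQ_I)
    fix r :: real assume r: "0 < r"
    have \<phi>_m [measurable]: "\<phi> \<in> borel_measurable BV"
      using lip by (intro continuous_map_measurable lipschitz_continuous_map)
    have int: "integrable P (\<lambda>\<omega>. \<phi> (U \<omega>))" if U [measurable]: "U \<in> measurable P BV" for U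
      using K measurable_space[OF U] by (intro P.integrable_const_bound[where B = K] AE_I2) (auto simp: space_BV)
    have diff: "\<bar>P.expectation (\<lambda>\<omega>. \<phi> (U \<omega>)) - P.expectation (\<lambda>\<omega>. \<phi> (U' \<omega>))\<bar> \<le> (\<bar>C\<bar> + 1) * \<beta>"
      if U: "U \<in> measurable P BV" "U' \<in> measurable P BV" and \<beta>: "0 \<le> \<beta>" "(\<integral>\<^sup>+ \<omega>. ennreal (nn (\<lambda>x. U \<omega> x - U' \<omega> x)) \<partial>P) \<le> ennreal \<beta>" for U U' \<beta>
      using int[OF U(1)] int[OF U(2)] \<beta>
      by (rule integral_diff_le_of_lipschitz) (use lip measurable_space[OF U(1)] measurable_space[OF U(2)] in \<open>auto simp: space_BV\<close>)
    define \<beta> where "\<beta> = (\<bar>C\<bar> + 1) * (K0 + C0)"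
    have \<beta>: "0 \<le> \<beta>" using K0 C0 by (simp add: \<beta>_def)
    have "(\<lambda>m. \<beta> * (1/2) ^ m) \<longlonglongrightarrow> \<beta> * 0" by (intro tendsto_intros LIMSEQ_realpow_zero) auto
    from order_tendstoD(2)[OF this, of "r / 2"] r obtain m where m: "\<beta> * (1/2) ^ m < r / 2"
      by (auto simp: eventually_sequentially)
    have "(\<lambda>n. P.expectation (\<lambda>\<omega>. \<phi> (Sm m n \<omega>))) \<longlonglongrightarrow> P.expectation (\<lambda>\<omega>. \<phi> (G m \<omega>))"
      using lip K by (rule finite_dimensional_convergence)
    from LIMSEQ_D[OF this, of "r / 2"] r obtain n0 where
      n0: "\<And>n. n0 \<le> n \<Longrightarrow> norm (P.expectation (\<lambda>\<omega>. \<phi> (Sm m n \<omega>)) - P.expectation (\<lambda>\<omega>. \<phi> (G m \<omega>))) < r / 2" by auto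
    have "norm (P.expectation (\<lambda>\<omega>. \<phi> (normalized_sum Y n \<omega>)) - P.expectation (\<lambda>\<omega>. \<phi> (S \<omega>))) < r" if n: "n0 \<le> n" for n
    proof -
      have 1: "\<bar>P.expectation (\<lambda>\<omega>. \<phi> (normalized_sum Y n \<omega>)) - P.expectation (\<lambda>\<omega>. \<phi> (Sm m n \<omega>))\<bar> \<le> (\<bar>C\<bar> + 1) * (K0 * (1/2) ^ m)"
        using K0 by (intro diff normalized_sum_measurable measurable_BV_Sm) auto
      have 2: "\<bar>P.expectation (\<lambda>\<omega>. \<phi> (S \<omega>)) - P.expectation (\<lambda>\<omega>. \<phi> (G m \<omega>))\<bar> \<le> (\<bar>C\<bar> + 1) * (C0 * (1/2) ^ m)"
        using C0 by (intro diff S measurable_BV_G) auto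
      have "(\<bar>C\<bar> + 1) * (K0 * (1/2) ^ m) + (\<bar>C\<bar> + 1) * (C0 * (1/2) ^ m) = \<beta> * (1/2) ^ m"
        by (simp add: \<beta>_def algebra_simps)
      then show ?thesis using 1 2 n0[OF n] m unfolding real_norm_def by linarith
    qed
    then show "\<exists>n0. \<forall>n\<ge>n0. norm (P.expectation (\<lambda>\<omega>. \<phi> (normalized_sum Y n \<omega>)) - P.expectation (\<lambda>\<omega>. \<phi> (S \<omega>))) < r"
      by blast
  qed
  show ?thesis
  proof (intro bexI[OF _ S] allI impI)
    fix \<phi> K
    assume \<phi>: "continuous_map (seminorm_topology V nn) euclideanreal \<phi>" and K: "\<forall>f\<in>V. \<bar>\<phi> f\<bar> \<le> K"
    show "(\<lambda>n. P.expectation (\<lambda>\<omega>. \<phi> (normalized_sum Y n \<omega>))) \<longlonglongrightarrow> P.expectation (\<lambda>\<omega>. \<phi> (S \<omega>))"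
      by (rule expectation_tendsto_of_lipschitz[OF P.prob_space_axioms normalized_sum_measurable S lip_conv \<phi> K[rule_format]])
  qed
qed

text \<open>On the finite-rank field \<open>Z m\<close> the functional becomes a finite combination
  of the centered \<open>e j\<close> and has mean \<open>0\<close>. The mean distance of
  \<open>v\<close> to \<open>Z m v\<close> tends to \<open>0\<close>, so the mean of the Lipschitz
  functional \<open>b\<close> vanishes as well.\<close>

lemma dual_mean_0:
  assumes b: "b \<in> dual_space V nn" shows "(\<integral>v. b v \<partial>\<nu>) = 0"
proof -
  obtain C where C: "\<And>f h. f \<in> V \<Longrightarrow> h \<in> V \<Longrightarrow> \<bar>b f - b h\<bar> \<le> C * nn (\<lambda>x. f x - h x)"
    using dual_bound[OF b] by metis
  note dual_measurable[OF b, measurable]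
  have bi: "integrable \<nu> b"
    by (rule \<nu>.square_integrable_imp_integrable[OF _ dual_square_integrable[OF b]]) measurable
  have le: "\<bar>\<integral>v. b v \<partial>\<nu>\<bar> \<le> (\<bar>C\<bar> + 1) * (1/2) ^ m" for m
  proof -
    have bZ: "b (Z m v) = (\<Sum>j<D m. e j v * b (g m j))" for v
      unfolding Z_def[abs_def] by (rule dual_sum[OF b g_V])
    have ei: "integrable \<nu> (\<lambda>v. e j v * b (g m j))" for j by (intro integrable_mult_left \<nu>.bounded_measurable_integrable e_bounded)
    have bZi: "integrable \<nu> (\<lambda>v. b (Z m v))" unfolding bZ by (intro Bochner_Integration.integrable_sum ei)
    have "(\<integral>v. b (Z m v) \<partial>\<nu>) = (\<Sum>j<D m. (\<integral>v. e j v * b (g m j) \<partial>\<nu>))" unfolding bZ by (intro Bochner_Integration.integral_sum ei)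
    also have "\<dots> = 0" by (simp add: e_mean)
    finally have bZ0: "(\<integral>v. b (Z m v) \<partial>\<nu>) = 0" .
    have "(\<integral>\<^sup>+ v. ennreal (nn (\<lambda>x. v x - Z m v x)) \<partial>\<nu>) = (\<integral>\<^sup>+ v. N (\<lambda>x. ennreal \<bar>\<Phi> v x - Z m v x\<bar>) \<partial>\<nu>)"
    proof (rule nn_integral_cong)
      fix v assume "v \<in> space \<nu>"
      then have v: "v \<in> V" by (simp add: space_\<nu>)
      have "N (\<lambda>x. ennreal \<bar>v x - Z m v x\<bar>) = N (\<lambda>x. ennreal \<bar>\<Phi> v x - Z m v x\<bar>)"
        using V_measurable[OF v] V_measurable[OF \<Phi>_in_V[OF v]] V_measurable[OF Z_V[of m v]] \<Phi>_version[OF v]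
        by (intro N_cong_AE) (auto elim: eventually_mono)
      then show "ennreal (nn (\<lambda>x. v x - Z m v x)) = N (\<lambda>x. ennreal \<bar>\<Phi> v x - Z m v x\<bar>)"
        using ennreal_nn[OF V_diff[OF v Z_V[of m v]]] by simp
    qed
    also have "\<dots> \<le> field_norm \<nu> q (\<lambda>v x. \<Phi> v x - Z m v x)"
      by (rule nn_integral_N_le_field_norm[OF prob_space_\<nu> q1 p_le_q]) measurable
    also have "\<dots> \<le> ennreal ((1/2) ^ m)" by (rule field_norm_\<Phi>_Z)
    finally have "(\<integral>\<^sup>+ v. ennreal (nn (\<lambda>x. v x - Z m v x)) \<partial>\<nu>) \<le> ennreal ((1/2) ^ m)" .
    from integral_diff_le_of_lipschitz[OF bi bZi _ this, of C] C Z_V bZ0 show ?thesis by (simp add: space_\<nu>)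
  qed
  have "(\<lambda>m. (\<bar>C\<bar> + 1) * (1/2) ^ m) \<longlonglongrightarrow> (\<bar>C\<bar> + 1) * 0" by (intro tendsto_intros LIMSEQ_realpow_zero) auto
  then have "\<bar>\<integral>v. b v \<partial>\<nu>\<bar> \<le> (\<bar>C\<bar> + 1) * 0" by (rule LIMSEQ_le_const) (intro exI allI impI le)
  then show ?thesis by simp
qed

text \<open>The law of \<open>b (S \<omega>)\<close> is found through weak convergence: cosine and
  sine of \<open>b\<close> are bounded and Lipschitz, so the characteristic function is the limit of
  those of the normalized sums of \<open>b (Y k)\<close>, which \<open>CLT_iexp\<close> computes.
  Limits are unique.\<close>

theorem CLT: "satisfies_CLT P V nn Y"
proof -
  obtain S where S [measurable]: "S \<in> measurable P BV"
    and lim: "\<And>\<phi> K. continuous_map (seminorm_topology V nn) euclideanreal \<phi> \<Longrightarrow> \<forall>f\<in>V. \<bar>\<phi> f\<bar> \<le> K \<Longrightarrow>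
      (\<lambda>n. P.expectation (\<lambda>\<omega>. \<phi> (normalized_sum Y n \<omega>))) \<longlonglongrightarrow> P.expectation (\<lambda>\<omega>. \<phi> (S \<omega>))"
    using weak_limit by blast
  have copies: "independent_copies P BV (Y 0) Y"
    using Y_indep Y_distr by (simp add: independent_copies_def)
  have dual: "integrable P (\<lambda>\<omega>. b (Y 0 \<omega>)) \<and> (\<integral>\<omega>. b (Y 0 \<omega>) \<partial>P) = 0 \<and> integrable P (\<lambda>\<omega>. (b (Y 0 \<omega>))\<^sup>2)"
    if b: "b \<in> dual_space V nn" for b
  proof -
    note dual_measurable[OF b, measurable]
    have sq: "integrable P (\<lambda>\<omega>. (b (Y 0 \<omega>))\<^sup>2)"
      using dual_square_integrable[OF b] unfolding Y_distr[of 0, symmetric] by (subst (asm) integrable_distr_eq) auto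
    have "integrable P (\<lambda>\<omega>. b (Y 0 \<omega>))" by (rule P.square_integrable_imp_integrable[OF _ sq]) measurable
    moreover have "(\<integral>\<omega>. b (Y 0 \<omega>) \<partial>P) = 0"
      using dual_mean_0[OF b] unfolding Y_distr[of 0, symmetric] by (subst (asm) integral_distr) auto
    ultimately show ?thesis using sq by simp
  qed
  have char: "(CLINT \<omega>|P. exp (\<i> * complex_of_real (b (S \<omega>)))) = complex_of_real (exp (- (\<integral>\<omega>. (b (Y 0 \<omega>))\<^sup>2 \<partial>P) / 2))"
    if b: "b \<in> dual_space V nn" for b
  proof -
    note dual_measurable[OF b, measurable]
    obtain C where C: "\<And>f h. f \<in> V \<Longrightarrow> h \<in> V \<Longrightarrow> \<bar>b f - b h\<bar> \<le> C * nn (\<lambda>x. f x - h x)"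
      using dual_bound[OF b] by metis
    have cos_lip: "continuous_map (seminorm_topology V nn) euclideanreal (\<lambda>f. cos (b f))"
      by (rule lipschitz_continuous_map[where C = C]) (use C abs_cos_diff_le in \<open>blast intro: order_trans\<close>)
    have sin_lip: "continuous_map (seminorm_topology V nn) euclideanreal (\<lambda>f. sin (b f))"
      by (rule lipschitz_continuous_map[where C = C]) (use C abs_sin_diff_le in \<open>blast intro: order_trans\<close>)
    have iexp_eq: "(CLINT \<omega>|P. iexp (b (U \<omega>))) = Complex (P.expectation (\<lambda>\<omega>. cos (b (U \<omega>)))) (P.expectation (\<lambda>\<omega>. sin (b (U \<omega>))))"
      if [measurable]: "U \<in> measurable P BV" for U
      by (rule P.iexp_integral_eq) measurable
    have "(\<lambda>n. CLINT \<omega>|P. iexp (b (normalized_sum Y n \<omega>))) \<longlonglongrightarrow> (CLINT \<omega>|P. iexp (b (S \<omega>)))"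
      unfolding iexp_eq[OF normalized_sum_measurable] iexp_eq[OF S]
      by (intro tendsto_Complex lim[OF cos_lip, of 1] lim[OF sin_lip, of 1]) auto
    moreover have "(CLINT \<omega>|P. iexp (b (normalized_sum Y n \<omega>))) = (CLINT \<omega>|P. iexp ((\<Sum>k<n. b (Y k \<omega>)) / sqrt (real n)))" for n
      by (intro Bochner_Integration.integral_cong refl) (simp add: dual_normalized_sum[OF b])
    moreover have "(\<lambda>n. CLINT \<omega>|P. iexp ((\<Sum>k<n. b (Y k \<omega>)) / sqrt (real n))) \<longlonglongrightarrow>
        complex_of_real (exp (- P.expectation (\<lambda>\<omega>. (b (Y 0 \<omega>))\<^sup>2) / 2))"
    proof (rule P.CLT_iexp)
      show "P.indep_vars (\<lambda>_. borel) (\<lambda>k \<omega>. b (Y k \<omega>)) UNIV" by (rule P.indep_vars_compose2[OF Y_indep]) simp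
      have "distr P borel (\<lambda>\<omega>. b (Y k \<omega>)) = distr \<nu> borel b" for k
        unfolding Y_distr[of k, symmetric] by (subst distr_distr) (auto simp: o_def)
      then show "distr P borel (\<lambda>\<omega>. b (Y k \<omega>)) = distr P borel (\<lambda>\<omega>. b (Y 0 \<omega>))" for k by simp
    qed (use dual[OF b] in auto)
    ultimately show ?thesis using LIMSEQ_unique by auto
  qed
  have "converges_weakly V nn (\<lambda>n. distr P BV (normalized_sum Y n)) (distr P BV S)"
    unfolding converges_weakly_def
  proof (intro allI impI)
    fix \<phi> assume \<phi>: "continuous_map (seminorm_topology V nn) euclideanreal \<phi> \<and> bounded (\<phi> ` V)"
    then obtain K where K: "\<And>f. f \<in> V \<Longrightarrow> \<bar>\<phi> f\<bar> \<le> K" unfolding bounded_iff by auto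
    have m: "\<phi> \<in> borel_measurable BV" using \<phi> by (intro continuous_map_measurable) simp
    show "(\<lambda>n. \<integral>f. \<phi> f \<partial>distr P BV (normalized_sum Y n)) \<longlonglongrightarrow> (\<integral>f. \<phi> f \<partial>distr P BV S)"
      unfolding integral_distr[OF normalized_sum_measurable m] integral_distr[OF S m]
      using \<phi> K by (intro lim) auto
  qed
  then show ?thesis unfolding satisfies_CLT_def using copies dual char S by blast
qed

end

section \<open>From the approximation scheme and the law on the space back to random fields\<close>

theorem (in clt_field) CLT: "satisfies_CLT P V nn Y"
proof -
  obtain e :: "nat \<Rightarrow> ((nat \<Rightarrow> 'a) \<Rightarrow> real) \<Rightarrow> real" and D g where
    e: "\<And>j. e j \<in> bounded_measurable \<nu>" "\<And>j. (\<integral>v. e j v \<partial>\<nu>) = 0" and g: "\<And>m j. g m j \<in> V"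
    "\<And>m j. D m \<le> j \<Longrightarrow> g m j = (\<lambda>x. 0)"
    "\<And>m. field_norm \<nu> q (\<lambda>v x. \<Phi> v x - (\<Sum>j<D m. e j v * g m j x)) < ennreal ((1/2) ^ m)"
    by (rule approximating_fields[OF prob_space_\<nu> q1 \<Phi>_meas_\<nu> \<Phi>_finite \<Phi>_centered]) (rule that)
  obtain W :: "nat \<Rightarrow> 'w \<Rightarrow> real" where W: "\<And>j. W j \<in> borel_measurable P"
    "\<And>d c. (CLINT \<omega>|P. iexp (\<Sum>j<d. c j * W j \<omega>)) = complex_of_real (exp (- (\<integral>v. (\<Sum>j<d. c j * e j v)\<^sup>2 \<partial>\<nu>) / 2))"
    by (rule P.gaussian_family[OF Y_indep Y_distr e]) (rule that)
  interpret clt_approx M p l P q Y \<nu> \<Phi> e D g W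
    by unfold_locales (fact e g W)+
  show ?thesis by (rule CLT)
qed

text \<open>For almost every \<open>\<omega>\<close> the version \<open>\<Phi>\<close> recovers the
  path of \<open>F\<close> almost everywhere. Exchanging the null sets by Fubini, at almost every
  \<open>x\<close> the variables \<open>\<Phi> (E \<omega>) x\<close> and
  \<open>F \<omega> x\<close> agree almost surely, so the moments and means of \<open>F\<close>
  under \<open>P\<close> are those of \<open>\<Phi>\<close> under the law of
  \<open>E\<close>.\<close>

lemma (in separable_mixed_space) field_CLT:
  assumes P: "prob_space P" and q: "2 \<le> q" "\<And>k. k \<in> {1..l} \<Longrightarrow> p k \<le> q"
    and F: "(\<lambda>z. F (fst z) (snd z)) \<in> borel_measurable (P \<Otimes>\<^sub>M X)"
    and mean: "AE x in X. (\<integral>\<omega>. F \<omega> x \<partial>P) = 0" and fin: "field_norm P q F < \<top>"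
    and Y: "prob_space.indep_vars P (\<lambda>_. BV) Y UNIV" "\<And>k. distr P BV (Y k) = distr P BV (Lp_element M p l F)"
  shows "satisfies_CLT P V nn Y"
proof -
  interpret P: prob_space P by fact
  interpret X: sigma_finite_measure X by (rule sigma_finite_X)
  interpret PX: pair_sigma_finite P X ..
  note F [measurable]
  obtain \<Phi> where \<Phi>: "(\<lambda>(v, x). \<Phi> v x) \<in> borel_measurable (BV \<Otimes>\<^sub>M X)"
    and version: "\<And>v. v \<in> V \<Longrightarrow> AE x in X. \<Phi> v x = v x"
    by (rule jointly_measurable_version) (rule that)
  define E where "E = Lp_element M p l F"
  define \<nu> where "\<nu> = distr P BV E"
  have E [measurable]: "E \<in> measurable P BV" unfolding E_def by (rule measurable_Lp_element[OF F])
  have \<nu>: "prob_space \<nu>" unfolding \<nu>_def by (rule P.prob_space_distr[OF E])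
  have \<Phi>' [measurable]: "(\<lambda>z. \<Phi> (fst z) (snd z)) \<in> borel_measurable (BV \<Otimes>\<^sub>M X)" using \<Phi> by (simp add: split_beta')
  have \<Phi>\<nu>: "(\<lambda>z. \<Phi> (fst z) (snd z)) \<in> borel_measurable (\<nu> \<Otimes>\<^sub>M X)"
    unfolding measurable_cong_sets[OF sets_pair_measure_cong[OF sets_distr refl] refl] \<nu>_def by (rule \<Phi>')
  have [measurable]: "(\<lambda>\<omega>. N (\<lambda>x. ennreal \<bar>F \<omega> x\<bar>)) \<in> borel_measurable P"
    by (rule measurable_N_param) (simp add: split_beta')
  have "Lnorm P q (\<lambda>\<omega>. N (\<lambda>x. ennreal \<bar>F \<omega> x\<bar>)) < \<top>"
    using Lnorm_N_le_field_norm[OF P q(2) F] fin by (rule le_less_trans)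
  then have "AE \<omega> in P. N (\<lambda>x. ennreal \<bar>F \<omega> x\<bar>) < \<top>"
    using q by (intro Lnorm_finite_AE[where r = q]) auto
  then have "AE \<omega> in P. AE x in X. \<Phi> (E \<omega>) x = F \<omega> x"
    using AE_space
  proof eventually_elim
    case (elim \<omega>)
    have "F \<omega> \<in> V"
      using measurable_compose[OF measurable_Pair1'[OF elim(2)] F] elim(1) by (simp add: V_iff)
    then show ?case using version[of "F \<omega>"] by (simp add: E_def Lp_element_def)
  qed
  moreover have \<Phi>E [measurable]: "(\<lambda>z. \<Phi> (E (fst z)) (snd z)) \<in> borel_measurable (P \<Otimes>\<^sub>M X)"
  proof -
    have "(\<lambda>z. (E (fst z), snd z)) \<in> measurable (P \<Otimes>\<^sub>M X) (BV \<Otimes>\<^sub>M X)" by measurable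
    from measurable_compose[OF this \<Phi>'] show ?thesis by simp
  qed
  ultimately have ae: "AE x in X. AE \<omega> in P. \<Phi> (E \<omega>) x = F \<omega> x"
    by (subst (asm) PX.AE_commute) measurable
  have \<Phi>x: "(\<lambda>v. \<Phi> v x) \<in> borel_measurable BV" if "x \<in> space X" for x
    using measurable_compose[OF measurable_Pair2'[OF that] \<Phi>'] by simp
  have Fx: "(\<lambda>\<omega>. F \<omega> x) \<in> borel_measurable P" if "x \<in> space X" for x
    using measurable_compose[OF measurable_Pair2'[OF that] F] by simp
  have norm: "field_norm \<nu> q \<Phi> = field_norm P q F"
    unfolding field_norm_def
  proof (rule N_cong_AE)
    show "(\<lambda>x. Lnorm \<nu> q (\<lambda>v. ennreal \<bar>\<Phi> v x\<bar>)) \<in> borel_measurable X"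
      by (rule measurable_Lnorm_field[OF \<nu> \<Phi>\<nu>])
    show "(\<lambda>x. Lnorm P q (\<lambda>\<omega>. ennreal \<bar>F \<omega> x\<bar>)) \<in> borel_measurable X"
      by (rule measurable_Lnorm_field[OF P F])
    show "AE x in X. Lnorm \<nu> q (\<lambda>v. ennreal \<bar>\<Phi> v x\<bar>) = Lnorm P q (\<lambda>\<omega>. ennreal \<bar>F \<omega> x\<bar>)"
      using ae AE_space
    proof eventually_elim
      case (elim x)
      note [measurable] = \<Phi>x[OF elim(2)]
      have "Lnorm \<nu> q (\<lambda>v. ennreal \<bar>\<Phi> v x\<bar>) = Lnorm P q (\<lambda>\<omega>. ennreal \<bar>\<Phi> (E \<omega>) x\<bar>)"
        unfolding Lnorm_def \<nu>_def by (subst nn_integral_distr) measurable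
      also have "\<dots> = Lnorm P q (\<lambda>\<omega>. ennreal \<bar>F \<omega> x\<bar>)"
        by (rule Lnorm_cong_AE) (use elim(1) in eventually_elim, simp)
      finally show ?case .
    qed
  qed
  have centered: "AE x in X. (\<integral>v. \<Phi> v x \<partial>\<nu>) = 0"
    using ae mean AE_space
  proof eventually_elim
    case (elim x)
    note [measurable] = \<Phi>x[OF elim(3)] Fx[OF elim(3)]
    have "(\<integral>v. \<Phi> v x \<partial>\<nu>) = (\<integral>\<omega>. \<Phi> (E \<omega>) x \<partial>P)"
      unfolding \<nu>_def by (subst integral_distr) auto
    also have "\<dots> = (\<integral>\<omega>. F \<omega> x \<partial>P)" by (rule integral_cong_AE) (use elim(1) in auto)
    finally show ?case using elim(2) by simp
  qed
  interpret clt_field M p l P q Y \<nu> \<Phi>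
  proof
    show "2 \<le> q" "P.indep_vars (\<lambda>_. BV) Y UNIV" by fact+
    show "p k \<le> q" if "k \<in> {1..l}" for k using q(2)[OF that] .
    show "distr P BV (Y k) = \<nu>" for k using Y(2) unfolding \<nu>_def E_def .
    show "(\<lambda>(v, x). \<Phi> v x) \<in> borel_measurable (BV \<Otimes>\<^sub>M X)" by (rule \<Phi>)
    show "AE x in X. \<Phi> v x = v x" if "v \<in> V" for v using version[OF that] .
    show "field_norm \<nu> q \<Phi> < \<top>" using norm fin by simp
    show "AE x in X. (\<integral>v. \<Phi> v x \<partial>\<nu>) = 0" by (rule centered)
  qed
  show ?thesis by (rule CLT)
qed

theorem theorem3p1:
  fixes P :: "'w measure"
    and M :: "nat \<Rightarrow> 'a measure"
    and p :: "nat \<Rightarrow> real"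
    and l :: nat
    and \<xi> :: "'w \<Rightarrow> (nat \<Rightarrow> 'a) \<Rightarrow> real"
    and \<xi>s :: "nat \<Rightarrow> 'w \<Rightarrow> (nat \<Rightarrow> 'a) \<Rightarrow> real"
    and pbar :: real
  defines "pbar \<equiv> Max (p ` {1..l})"
  assumes "prob_space P"
    and "2 \<le> l"
    and "\<And>k. k \<in> {1..l} \<Longrightarrow> sigma_finite_measure (M k)"
    and "\<And>k. k \<in> {1..l} \<Longrightarrow> separable_measure (M k)"
    and "\<And>k. k \<in> {1..l} \<Longrightarrow> emeasure (M k) (space (M k)) \<noteq> 0"
    and "\<And>k. k \<in> {1..l} \<Longrightarrow> 1 \<le> p k"
    and "2 \<le> pbar"
    and "jointly_measurable_field P M l \<xi>"
    and "centered_field P M l \<xi>"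
    and "\<And>k. jointly_measurable_field P M l (\<xi>s k)"
    and "\<And>k. AE \<omega> in P. \<xi>s k \<omega> \<in> mixed_Lp M p l"
    and "independent_copies P (seminorm_borel (mixed_Lp M p l) (mixed_Lp_norm M p l))
           (Lp_element M p l \<xi>) (\<lambda>k. Lp_element M p l (\<xi>s k))"
    and "mixed_norm M p l
           (\<lambda>x. ennreal_powr (\<integral>\<^sup>+ \<omega>. ennreal (\<bar>\<xi> \<omega> x\<bar> powr pbar) \<partial>P) (1 / pbar)) < \<infinity>"
  shows "satisfies_CLT P (mixed_Lp M p l) (mixed_Lp_norm M p l)
           (\<lambda>k. Lp_element M p l (\<xi>s k))"
proof -
  have p_le: "p k \<le> pbar" if "k \<in> {1..l}" for k
    unfolding pbar_def using that by (intro Max_ge) auto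
  interpret separable_mixed_space M p l
  proof (rule separable_mixed_space.intro[OF mixed_space.intro separable_mixed_space_axioms.intro])
    show "1 \<le> l" using \<open>2 \<le> l\<close> by simp
  qed fact+
  have F: "(\<lambda>z. \<xi> (fst z) (snd z)) \<in> borel_measurable (P \<Otimes>\<^sub>M X)"
    using \<open>jointly_measurable_field P M l \<xi>\<close> by (simp add: jointly_measurable_field_def split_beta')
  have mean: "AE x in X. (\<integral>\<omega>. \<xi> \<omega> x \<partial>P) = 0"
    using \<open>centered_field P M l \<xi>\<close> unfolding centered_field_def by eventually_elim simp
  have fin: "field_norm P pbar \<xi> < \<top>"
    using \<open>mixed_norm M p l _ < \<infinity>\<close> unfolding field_norm_def Lnorm_def by simp
  note copies = \<open>independent_copies P _ _ _\<close>[unfolded independent_copies_def]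
  show ?thesis
    by (rule field_CLT[OF \<open>prob_space P\<close> \<open>2 \<le> pbar\<close> p_le F mean fin conjunct1[OF copies]])
      (assumption, rule conjunct2[OF copies, rule_format])
qed

end
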